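(* Let $n\ge 1$ and let $V\subset(\mathbb{C}^\times)^{2n}$ be an algebraic variety of (complex) dimension $n$. Then the amoeba $\mathcal{A}=\operatorname{Log}(V)$ is covered by the map $\operatorname{Log}|_V:V\to\mathbb{R}^{2n}$ at most $\beta(V)$ times, while the rolled coamoeba $\mathcal{B}_\pi=\operatorname{Arg}_\pi(V)$ is covered by the map $\operatorname{Arg}_\pi|_V:V\to(\mathbb{R}/\pi\mathbb{Z})^{2n}$ at most $\alpha(V)$ times. Furthermore, $$\operatorname{Vol}(\mathcal{A})\le\frac{\pi^{2n}}{2}\,\alpha(V).$$
   Context: $\operatorname{Log}:(\mathbb{C}^\times)^{2n}\to\mathbb{R}^{2n}$ is $\operatorname{Log}(z_1,\dots,z_{2n})=(\log|z_1|,\dots,\log|z_{2n}|)$. For $z\in\mathbb{C}^\times$, $\arg_\pi(z)\in\mathbb{R}/\pi\mathbb{Z}$ is the argument of $z$ taken mod $\pi$, and $\operatorname{Arg}_\pi:(\mathbb{C}^\times)^{2n}\to(\mathbb{R}/\pi\mathbb{Z})^{2n}$ is $\operatorname{Arg}_\pi(z_1,\dots,z_{2n})=(\arg_\pi(z_1),\dots,\arg_\pi(z_{2n}))$. $\operatorname{Vol}$ is Lebesgue measure on $\mathbb{R}^{2n}$. Define antiholomorphic involutions of $(\mathbb{C}^\times)^{2n}$ by $\operatorname{conj}(z_1,\dots,z_{2n})=(\bar z_1,\dots,\bar z_{2n})$ and $\operatorname{conj}'(z_1,\dots,z_{2n})=(1/\bar z_1,\dots,1/\bar z_{2n})$. If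 $A,B\subset(\mathbb{C}^\times)^{2n}$ are complex algebraic subvarieties of complementary dimensions, then for $\epsilon$ in an open dense subset of $(\mathbb{C}^\times)^{2n}$ all points of $A\cap\epsilon B$ are transverse intersection points and their number does not depend on $\epsilon$, where $\epsilon B$ is the translate of $B$ by coordinatewise multiplication by $\epsilon$. The toric intersection number $A.B\in\mathbb{Z}_{\ge0}$ is this number of points (counted with the multiplicities of the components of $A$ and $B$ if these are not reduced). Put $\alpha(V)=V.\operatorname{conj}(V)$ (the $\operatorname{conj}$-degree) and $\beta(V)=V.\operatorname{conj}'(V)$ (the $\operatorname{conj}'$-degree). "Covers at most $m$ times": let $A$ be a (possibly singular) real or complex algebraic variety, stratified into smooth manifolds, let $B$ be a smooth manifold with $\dim_{\mathbb{R}}A=\dim_{\mathbb{R}}B$, and let $f:A\to B$ be a map whose restriction to each stratum is smooth. Then $f$ covers its image at most $m$ times if for every $p\in B$ the inverse image $f^{-1}(p)$ consists of at most $m$ points, unless $p$ is a critical value of $f|_\Sigma$ for some stratum $\Sigma$ of the stratification (a point of $f(\Sigma)$ is a critical value of $f|_\Sigma$ if it is the image of a point of $\Sigma$ where the differential of $f|_\Sigma$ is not surjective onto the tangent space of $B$). *)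

theory Defs
  imports "HOL-Analysis.Analysis"
begin

definition torus :: "(complex ^ 'm) set" where
  "torus = {z. \<forall>i. z $ i \<noteq> 0}"

definition laurent_polynomial :: "(complex ^ 'm \<Rightarrow> complex) \<Rightarrow> bool" where
  "laurent_polynomial f \<longleftrightarrow>
     (\<exists>(E :: ('m \<Rightarrow> int) set) c. finite E \<and>
        f = (\<lambda>z. \<Sum>e\<in>E. c e * (\<Prod>i\<in>UNIV. z $ i powi e i)))"

text \<open>Varieties are closed in the torus, reduced, and possibly reducible.\<close>

definition algebraic_variety :: "(complex ^ 'm) set \<Rightarrow> bool" where
  "algebraic_variety V \<longleftrightarrow>
     (\<exists>P. finite P \<and> (\<forall>f\<in>P. laurent_polynomial f) \<and>
          V = {z \<in> torus. \<forall>f\<in>P. f z = 0})"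

definition holomorphic_map_on ::
    "(complex ^ 'm) set \<Rightarrow> (complex ^ 'm \<Rightarrow> complex ^ 'm) \<Rightarrow> bool" where
  "holomorphic_map_on U f \<longleftrightarrow>
     (\<forall>z\<in>U. \<exists>D. (f has_derivative D) (at z) \<and> (\<forall>c v. D (c *s v) = c *s D v))"

definition biholomorphic_on ::
    "(complex ^ 'm) set \<Rightarrow> (complex ^ 'm \<Rightarrow> complex ^ 'm) \<Rightarrow> bool" where
  "biholomorphic_on U \<phi> \<longleftrightarrow> open U \<and> open (\<phi> ` U) \<and> inj_on \<phi> U \<and>
     holomorphic_map_on U \<phi> \<and> holomorphic_map_on (\<phi> ` U) (inv_into U \<phi>)"

text \<open>Near the point \<open>z\<close>, the set \<open>V\<close> is a complex submanifold of complex dimension \<open>d\<close>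
  (\<open>vec.subspace\<close> and \<open>vec.dim\<close> refer to complex scalars).\<close>

definition complex_submanifold_at :: "(complex ^ 'm) set \<Rightarrow> nat \<Rightarrow> complex ^ 'm \<Rightarrow> bool" where
  "complex_submanifold_at V d z \<longleftrightarrow> z \<in> V \<and>
     (\<exists>U \<phi> L. z \<in> U \<and> biholomorphic_on U \<phi> \<and> vec.subspace L \<and> vec.dim L = d \<and>
        \<phi> ` (V \<inter> U) = \<phi> ` U \<inter> L)"

text \<open>The dimension of a complex variety is the largest dimension of its regular locus at a
  regular point; varieties with components of different dimensions are allowed.\<close>

definition has_complex_dimension :: "(complex ^ 'm) set \<Rightarrow> nat \<Rightarrow> bool" where
  "has_complex_dimension V d \<longleftrightarrow> (\<exists>z. complex_submanifold_at V d z) \<and>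
     (\<forall>e z. complex_submanifold_at V e z \<longrightarrow> e \<le> d)"

text \<open>Velocities at \<open>0\<close> of curves in \<open>S\<close>. Only differentiability at \<open>0\<close> is asked for, so
  curves may be taken to be defined on the whole line. This is used only at points near which
  \<open>S\<close> is a submanifold, where it is the usual tangent space.\<close>

definition tangent_space :: "'a::real_normed_vector set \<Rightarrow> 'a \<Rightarrow> 'a set" where
  "tangent_space S z =
     {v. \<exists>\<gamma>::real \<Rightarrow> 'a. \<gamma> 0 = z \<and> range \<gamma> \<subseteq> S \<and> (\<gamma> has_vector_derivative v) (at 0)}"

definition transverse_at ::
    "(complex ^ 'm) set \<Rightarrow> (complex ^ 'm) set \<Rightarrow> complex ^ 'm \<Rightarrow> bool" where
  "transverse_at A B z \<longleftrightarrow>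
     (\<exists>d. complex_submanifold_at A d z) \<and> (\<exists>e. complex_submanifold_at B e z) \<and>
     {v + w | v w. v \<in> tangent_space A z \<and> w \<in> tangent_space B z} = UNIV"

definition translate :: "complex ^ 'm \<Rightarrow> (complex ^ 'm) set \<Rightarrow> (complex ^ 'm) set" where
  "translate \<epsilon> B = (\<lambda>z. \<chi> i. \<epsilon> $ i * z $ i) ` B"

text \<open>At most one \<open>k\<close> qualifies, because two open dense sets meet.\<close>

definition toric_intersection_number ::
    "(complex ^ 'm) set \<Rightarrow> (complex ^ 'm) set \<Rightarrow> nat" where
  "toric_intersection_number A B =
     (THE k. \<exists>U. open U \<and> U \<subseteq> torus \<and> torus \<subseteq> closure U \<and>
        (\<forall>\<epsilon>\<in>U. (\<forall>z \<in> A \<inter> translate \<epsilon> B. transverse_at A (translate \<epsilon> B) z) \<and>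
             finite (A \<inter> translate \<epsilon> B) \<and> card (A \<inter> translate \<epsilon> B) = k))"

definition conj_map :: "complex ^ 'm \<Rightarrow> complex ^ 'm" where
  "conj_map z = (\<chi> i. cnj (z $ i))"

definition conj'_map :: "complex ^ 'm \<Rightarrow> complex ^ 'm" where
  "conj'_map z = (\<chi> i. 1 / cnj (z $ i))"

definition conj_degree :: "(complex ^ 'm) set \<Rightarrow> nat" where
  "conj_degree V = toric_intersection_number V (conj_map ` V)"

definition conj'_degree :: "(complex ^ 'm) set \<Rightarrow> nat" where
  "conj'_degree V = toric_intersection_number V (conj'_map ` V)"

primrec Ck_on :: "nat \<Rightarrow> 'a::real_normed_vector set \<Rightarrow> ('a \<Rightarrow> 'b::real_normed_vector) \<Rightarrow> bool" where
  "Ck_on 0 U f \<longleftrightarrow> continuous_on U f"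
| "Ck_on (Suc k) U f \<longleftrightarrow> (\<forall>x\<in>U. f differentiable (at x)) \<and>
     (\<forall>v. Ck_on k U (\<lambda>x. frechet_derivative f (at x) v))"

definition smooth_on :: "'a::real_normed_vector set \<Rightarrow> ('a \<Rightarrow> 'b::real_normed_vector) \<Rightarrow> bool" where
  "smooth_on U f \<longleftrightarrow> (\<forall>k. Ck_on k U f)"

definition diffeomorphic_on :: "'a::euclidean_space set \<Rightarrow> ('a \<Rightarrow> 'a) \<Rightarrow> bool" where
  "diffeomorphic_on U \<phi> \<longleftrightarrow> open U \<and> open (\<phi> ` U) \<and> inj_on \<phi> U \<and>
     smooth_on U \<phi> \<and> smooth_on (\<phi> ` U) (inv_into U \<phi>)"

definition smooth_submanifold :: "'a::euclidean_space set \<Rightarrow> bool" where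
  "smooth_submanifold S \<longleftrightarrow>
     (\<exists>d. \<forall>z\<in>S. \<exists>U \<phi> L. z \<in> U \<and> diffeomorphic_on U \<phi> \<and> subspace L \<and> dim L = d \<and>
        \<phi> ` (S \<inter> U) = \<phi> ` U \<inter> L)"

text \<open>No frontier condition is imposed and strata need not be algebraic, so a statement about
  all stratifications in this sense includes those in any more restrictive sense.\<close>

definition stratification :: "'a::euclidean_space set set \<Rightarrow> 'a set \<Rightarrow> bool" where
  "stratification \<S> A \<longleftrightarrow>
     finite \<S> \<and> disjoint \<S> \<and> \<Union>\<S> = A \<and> (\<forall>S\<in>\<S>. smooth_submanifold S)"

text \<open>The target manifold is presented by a surjective local diffeomorphism \<open>q\<close> from a
  Euclidean space: the identity for Euclidean space itself, the quotient map for a torus.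
  The differential of \<open>f\<close> restricted to \<open>S\<close> is that of a lift of \<open>f\<close> along \<open>q\<close>; away from
  \<open>z\<close> the lift may be discontinuous. On the tangent space of \<open>S\<close> at \<open>z\<close>, it is determined
  by \<open>f\<close>.\<close>

definition differential_at ::
    "('c::euclidean_space \<Rightarrow> 'b) \<Rightarrow> 'a::euclidean_space set \<Rightarrow> ('a \<Rightarrow> 'b) \<Rightarrow> 'a \<Rightarrow> ('a \<Rightarrow> 'c) \<Rightarrow> bool" where
  "differential_at q S f z D \<longleftrightarrow>
     (\<exists>g. (\<forall>w\<in>S. q (g w) = f w) \<and> (g has_derivative D) (at z within S))"

definition critical_value ::
    "('c::euclidean_space \<Rightarrow> 'b) \<Rightarrow> 'a::euclidean_space set \<Rightarrow> ('a \<Rightarrow> 'b) \<Rightarrow> 'b \<Rightarrow> bool" where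
  "critical_value q S f p \<longleftrightarrow>
     (\<exists>z\<in>S. f z = p \<and> (\<exists>D. differential_at q S f z D \<and> D ` tangent_space S z \<noteq> UNIV))"

definition covers_at_most ::
    "('c::euclidean_space \<Rightarrow> 'b) \<Rightarrow> 'a::euclidean_space set set \<Rightarrow> 'a set \<Rightarrow> ('a \<Rightarrow> 'b) \<Rightarrow> nat \<Rightarrow> bool" where
  "covers_at_most q \<S> A f m \<longleftrightarrow>
     (\<forall>p. (\<forall>S\<in>\<S>. \<not> critical_value q S f p) \<longrightarrow>
          finite {z \<in> A. f z = p} \<and> card {z \<in> A. f z = p} \<le> m)"

definition Log_map :: "complex ^ 'm \<Rightarrow> real ^ 'm" where
  "Log_map z = (\<chi> i. ln (cmod (z $ i)))"

quotient_type real_mod_pi = real / "\<lambda>x y. \<exists>k::int. x - y = of_int k * pi"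
proof (rule equivpI)
  show "reflp (\<lambda>x y. \<exists>k::int. x - y = of_int k * pi)"
    by (rule reflpI) (auto intro: exI[of _ 0])
  show "symp (\<lambda>x y. \<exists>k::int. x - y = of_int k * pi)"
  proof (rule sympI)
    fix x y :: real
    assume "\<exists>k::int. x - y = of_int k * pi"
    then obtain k :: int where "x - y = of_int k * pi" ..
    then have "y - x = of_int (- k) * pi" by simp
    then show "\<exists>k::int. y - x = of_int k * pi" ..
  qed
  show "transp (\<lambda>x y. \<exists>k::int. x - y = of_int k * pi)"
  proof (rule transpI)
    fix x y z :: real
    assume "\<exists>k::int. x - y = of_int k * pi" "\<exists>k::int. y - z = of_int k * pi"
    then obtain k l :: int where "x - y = of_int k * pi" "y - z = of_int l * pi" by blast
    then have "x - z = of_int (k + l) * pi" by (simp add: distrib_right)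
    then show "\<exists>k::int. x - z = of_int k * pi" ..
  qed
qed

definition mod_pi :: "real ^ 'm \<Rightarrow> real_mod_pi ^ 'm" where
  "mod_pi x = (\<chi> i. abs_real_mod_pi (x $ i))"

definition arg_pi :: "complex \<Rightarrow> real_mod_pi" where
  "arg_pi z = abs_real_mod_pi (Arg z)"

definition Arg_pi_map :: "complex ^ 'm \<Rightarrow> real_mod_pi ^ 'm" where
  "Arg_pi_map z = (\<chi> i. arg_pi (z $ i))"

end

(* The points of V over a value p of Log are the fixed points on V of the reflection
   z -> exp(2 p) / cnj z, hence they lie in the intersection of V with a translate of conj'(V);
   likewise a fibre of Arg lies in the intersection of V with a translate of conj(V). These translates
   form a real slice of the torus, and a polynomial vanishing on a non-negligible part of such a slice
   is zero. So for almost every p the intersection is finite and transverse, and its cardinality is the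
   degree. A point of a fibre outside the critical values persists over nearby, hence over generic,
   values; this bounds every noncritical fibre.

   At the fixed points transversality makes Log and Arg, the real and imaginary parts of a holomorphic
   map, immersions of V. Multiplication by i identifies their Jacobians up to sign, so Log and a branch
   of Arg map small pieces of V to sets of equal volume. The images under Arg cover the torus
   (R / pi Z)^(2n) at most alpha(V) times almost everywhere. Since the reflection permutes the
   intersection, a generic fibre of Log has the parity of beta(V). The volume is finite, so some generic
   fibre is empty and beta(V) is even; thus the nonempty generic fibres have at least two points, which
   gives the factor 1/2.

   Generic transversality is elementary: the incidence variety is cut into finitely many cells, in each
   of which some coordinates are free and the others are simple roots of polynomials in their
   predecessors. Cells of too small dimension miss almost every translation parameter; the others are
   local sections over the parameter, and differentiating a section shows transversality. *)

theory Submission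
  imports Defs "HOL-Computational_Algebra.Fundamental_Theorem_Algebra"
begin

section \<open>Constructible sets\<close>

text \<open>The translation parameters that govern the fibres of \<open>Log_map\<close> and
  \<open>Arg_pi_map\<close> form sets of measure zero in the torus. That almost every translate
  behaves well therefore says nothing about them: the bad parameters have to lie in the zero set of
  a nonzero polynomial. Constructible sets bridge this gap. Of a constructible set and its
  complement, one contains a nonempty Zariski open set; so a negligible constructible set lies in a
  proper algebraic subset. Elimination of variables shows that the relevant sets of parameters are
  constructible, and crude counts of real dimension, with differentiable images of subspaces, show
  that the bad ones are negligible. The same dichotomy, applied to the parameters with at least
  \<open>k\<close> intersection points, yields the generic number of points without any degree
  theory. Constructibility survives complex conjugation, so the antiholomorphic images of
  \<open>V\<close> are treated on the same footing as \<open>V\<close>.\<close>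

inductive_set polyf :: "'v set \<Rightarrow> (('v \<Rightarrow> complex) \<Rightarrow> complex) set" for A where
  polyf_const: "(\<lambda>x. c) \<in> polyf A"
| polyf_var: "i \<in> A \<Longrightarrow> (\<lambda>x. x i) \<in> polyf A"
| polyf_add: "f \<in> polyf A \<Longrightarrow> g \<in> polyf A \<Longrightarrow> (\<lambda>x. f x + g x) \<in> polyf A"
| polyf_mult: "f \<in> polyf A \<Longrightarrow> g \<in> polyf A \<Longrightarrow> (\<lambda>x. f x * g x) \<in> polyf A"

lemma polyf_sum: "(\<And>i. i \<in> I \<Longrightarrow> f i \<in> polyf A) \<Longrightarrow> (\<lambda>x. \<Sum>i\<in>I. f i x) \<in> polyf A"
  by (induction I rule: infinite_finite_induct) (auto intro: polyf_const polyf_add)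

lemma polyf_prod: "(\<And>i. i \<in> I \<Longrightarrow> f i \<in> polyf A) \<Longrightarrow> (\<lambda>x. \<Prod>i\<in>I. f i x) \<in> polyf A"
  by (induction I rule: infinite_finite_induct) (auto intro: polyf_const polyf_mult)

lemma polyf_power: "f \<in> polyf A \<Longrightarrow> (\<lambda>x. f x ^ k) \<in> polyf A"
  by (induction k) (auto intro: polyf_const polyf_mult)

lemma polyf_cong: "f \<in> polyf A \<Longrightarrow> (\<And>i. i \<in> A \<Longrightarrow> x i = y i) \<Longrightarrow> f x = f y"
  by (induction rule: polyf.induct) auto

lemma polyf_subst:
  "f \<in> polyf A \<Longrightarrow> (\<And>i. i \<in> A \<Longrightarrow> h i \<in> polyf B) \<Longrightarrow> (\<lambda>x. f (\<lambda>i. h i x)) \<in> polyf B"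
  by (induction rule: polyf.induct) (auto intro: polyf.intros)

lemma polyf_mono: "f \<in> polyf A \<Longrightarrow> A \<subseteq> B \<Longrightarrow> f \<in> polyf B"
  by (induction rule: polyf.induct) (auto intro: polyf.intros)

lemma polyf_line:
  assumes "f \<in> polyf A"
  shows "\<exists>p. \<forall>t. f (\<lambda>i. a i + t * b i) = poly p t"
  using assms
proof (induction rule: polyf.induct)
  case (polyf_const c)
  show ?case by (rule exI[of _ "[:c:]"]) simp
next
  case (polyf_var i)
  show ?case by (rule exI[of _ "[:a i, b i:]"]) simp
next
  case (polyf_add f g)
  then show ?case by (metis poly_add)
next
  case (polyf_mult f g)
  then show ?case by (metis poly_mult)
qed

text \<open>On the complex line through \<open>a\<close> and \<open>b\<close> both functions become
  nonzero polynomials in one variable, and then so does their product.\<close>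

lemma polyf_mult_nonzero:
  assumes "f \<in> polyf A" "g \<in> polyf A" "f a \<noteq> 0" "g b \<noteq> 0"
  obtains x where "f x * g x \<noteq> 0"
proof -
  obtain p where p: "\<And>t. f (\<lambda>i. a i + t * (b i - a i)) = poly p t"
    using polyf_line[OF assms(1), of a "\<lambda>i. b i - a i"] by metis
  obtain q where q: "\<And>t. g (\<lambda>i. a i + t * (b i - a i)) = poly q t"
    using polyf_line[OF assms(2), of a "\<lambda>i. b i - a i"] by metis
  have "poly p 0 \<noteq> 0" "poly q 1 \<noteq> 0"
    using p[of 0] q[of 1] assms(3,4) by auto
  then have "p * q \<noteq> 0" by auto
  then obtain t where "poly (p * q) t \<noteq> 0"
    using poly_all_0_iff_0 by blast
  with p q that show ?thesis by (metis poly_mult)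
qed

lemma polyf_prod_nonzero:
  assumes "finite I" "\<And>i. i \<in> I \<Longrightarrow> f i \<in> polyf A" "\<And>i. i \<in> I \<Longrightarrow> \<exists>x. f i x \<noteq> 0"
  shows "\<exists>x. (\<Prod>i\<in>I. f i x) \<noteq> 0"
  using assms
proof (induction I rule: finite_induct)
  case (insert i I)
  then obtain a where "f i a \<noteq> 0" by blast
  moreover obtain b where "(\<Prod>i\<in>I. f i b) \<noteq> 0" using insert by blast
  ultimately obtain x where "f i x * (\<Prod>i\<in>I. f i x) \<noteq> 0"
    using polyf_mult_nonzero[of "f i" A "\<lambda>x. \<Prod>i\<in>I. f i x" a b] polyf_prod[of I f A] insert by auto
  with insert show ?case by auto
qed auto

text \<open>Since \<open>inverse 0 = 0\<close>, the function \<open>1 - f * inverse f\<close> vanishes exactly where \<open>f\<close> does not. So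
  the zero sets of these functions are closed under complement: they are the constructible sets.\<close>

inductive_set ratf :: "'v set \<Rightarrow> (('v \<Rightarrow> complex) \<Rightarrow> complex) set" for A where
  ratf_const: "(\<lambda>x. c) \<in> ratf A"
| ratf_var: "i \<in> A \<Longrightarrow> (\<lambda>x. x i) \<in> ratf A"
| ratf_add: "f \<in> ratf A \<Longrightarrow> g \<in> ratf A \<Longrightarrow> (\<lambda>x. f x + g x) \<in> ratf A"
| ratf_mult: "f \<in> ratf A \<Longrightarrow> g \<in> ratf A \<Longrightarrow> (\<lambda>x. f x * g x) \<in> ratf A"
| ratf_inverse: "f \<in> ratf A \<Longrightarrow> (\<lambda>x. inverse (f x)) \<in> ratf A"

lemma ratf_uminus: "f \<in> ratf A \<Longrightarrow> (\<lambda>x. - f x) \<in> ratf A"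
  using ratf_mult[OF ratf_const[of "-1"], of f A] by simp

lemma ratf_diff: "f \<in> ratf A \<Longrightarrow> g \<in> ratf A \<Longrightarrow> (\<lambda>x. f x - g x) \<in> ratf A"
  using ratf_add[OF _ ratf_uminus, of f A g] by simp

lemma ratf_divide: "f \<in> ratf A \<Longrightarrow> g \<in> ratf A \<Longrightarrow> (\<lambda>x. f x / g x) \<in> ratf A"
  by (simp add: divide_inverse ratf_mult ratf_inverse)

lemma ratf_sum: "(\<And>i. i \<in> I \<Longrightarrow> f i \<in> ratf A) \<Longrightarrow> (\<lambda>x. \<Sum>i\<in>I. f i x) \<in> ratf A"
  by (induction I rule: infinite_finite_induct) (auto intro: ratf_const ratf_add)

lemma ratf_prod: "(\<And>i. i \<in> I \<Longrightarrow> f i \<in> ratf A) \<Longrightarrow> (\<lambda>x. \<Prod>i\<in>I. f i x) \<in> ratf A"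
  by (induction I rule: infinite_finite_induct) (auto intro: ratf_const ratf_mult)

lemma ratf_subst:
  "f \<in> ratf A \<Longrightarrow> (\<And>i. i \<in> A \<Longrightarrow> h i \<in> ratf B) \<Longrightarrow> (\<lambda>x. f (\<lambda>i. h i x)) \<in> ratf B"
  by (induction rule: ratf.induct) (auto intro: ratf.intros)

lemma ratf_mono: "f \<in> ratf A \<Longrightarrow> A \<subseteq> B \<Longrightarrow> f \<in> ratf B"
  by (induction rule: ratf.induct) (auto intro: ratf.intros)

lemma ratf_cong: "f \<in> ratf A \<Longrightarrow> (\<And>i. i \<in> A \<Longrightarrow> x i = y i) \<Longrightarrow> f x = f y"
  by (induction rule: ratf.induct) auto

lemma polyf_imp_ratf: "f \<in> polyf A \<Longrightarrow> f \<in> ratf A"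
  by (induction rule: polyf.induct) (auto intro: ratf.intros)

definition dset :: "'v set \<Rightarrow> ('v \<Rightarrow> complex) set \<Rightarrow> bool" where
  "dset A X \<longleftrightarrow> (\<exists>f\<in>ratf A. X = {x. f x = 0})"

lemma dset_zero: "f \<in> ratf A \<Longrightarrow> dset A {x. f x = 0}"
  by (auto simp: dset_def)

lemma dset_Compl:
  assumes "dset A X" shows "dset A (- X)"
proof -
  obtain f where f: "f \<in> ratf A" "X = {x. f x = 0}" using assms by (auto simp: dset_def)
  have "(\<lambda>x. 1 - f x / f x) \<in> ratf A"
    by (intro ratf_diff ratf_divide ratf_const f)
  then have "dset A {x. 1 - f x / f x = 0}" by (rule dset_zero)
  moreover have "- X = {x. 1 - f x / f x = 0}" using f by auto
  ultimately show ?thesis by simp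
qed

lemma dset_Un:
  assumes "dset A X" "dset A Y" shows "dset A (X \<union> Y)"
proof -
  obtain f g where fg: "f \<in> ratf A" "X = {x. f x = 0}" "g \<in> ratf A" "Y = {x. g x = 0}"
    using assms by (auto simp: dset_def)
  then have "X \<union> Y = {x. f x * g x = 0}" by auto
  with dset_zero[OF ratf_mult[OF fg(1,3)]] show ?thesis by simp
qed

lemma dset_Int: "dset A X \<Longrightarrow> dset A Y \<Longrightarrow> dset A (X \<inter> Y)"
  using dset_Compl[OF dset_Un[OF dset_Compl dset_Compl], of A X Y] by simp

lemma dset_Diff: "dset A X \<Longrightarrow> dset A Y \<Longrightarrow> dset A (X - Y)"
  by (simp add: Diff_eq dset_Int dset_Compl)

lemma dset_empty: "dset A {}"
  using dset_zero[OF ratf_const[of 1]] by simp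

lemma dset_UNIV: "dset A UNIV"
  using dset_zero[OF ratf_const[of 0]] by simp

lemma dset_neq: "f \<in> ratf A \<Longrightarrow> dset A {x. f x \<noteq> 0}"
  using dset_Compl[OF dset_zero] by (simp add: Collect_neg_eq)

lemma dset_conj: "dset A {x. P x} \<Longrightarrow> dset A {x. Q x} \<Longrightarrow> dset A {x. P x \<and> Q x}"
  using dset_Int[of A "{x. P x}" "{x. Q x}"] by (simp add: Collect_conj_eq)

lemma dset_disj: "dset A {x. P x} \<Longrightarrow> dset A {x. Q x} \<Longrightarrow> dset A {x. P x \<or> Q x}"
  using dset_Un[of A "{x. P x}" "{x. Q x}"] by (simp add: Collect_disj_eq)

lemma dset_not: "dset A {x. P x} \<Longrightarrow> dset A {x. \<not> P x}"
  using dset_Compl[of A "{x. P x}"] by (simp add: Collect_neg_eq)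

lemma dset_ball: "finite I \<Longrightarrow> (\<And>i. i \<in> I \<Longrightarrow> dset A {x. P i x}) \<Longrightarrow> dset A {x. \<forall>i\<in>I. P i x}"
  by (induction I rule: finite_induct) (auto simp: dset_UNIV intro: dset_conj)

lemma dset_bex: "finite I \<Longrightarrow> (\<And>i. i \<in> I \<Longrightarrow> dset A {x. P i x}) \<Longrightarrow> dset A {x. \<exists>i\<in>I. P i x}"
  by (induction I rule: finite_induct) (auto simp: dset_empty intro: dset_disj)

lemma dset_subst:
  assumes "dset A X" "\<And>i. i \<in> A \<Longrightarrow> h i \<in> ratf B"
  shows "dset B {x. (\<lambda>i. h i x) \<in> X}"
proof -
  obtain f where f: "f \<in> ratf A" "X = {x. f x = 0}" using assms by (auto simp: dset_def)
  show ?thesis using dset_zero[OF ratf_subst[OF f(1) assms(2)]] f(2) by simp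
qed

lemma dset_mono: "dset A X \<Longrightarrow> A \<subseteq> B \<Longrightarrow> dset B X"
  unfolding dset_def using ratf_mono by blast

lemma dset_cong: "dset A X \<Longrightarrow> (\<And>i. i \<in> A \<Longrightarrow> x i = y i) \<Longrightarrow> x \<in> X \<longleftrightarrow> y \<in> X"
  unfolding dset_def by (metis mem_Collect_eq ratf_cong)

lemma ratf_if:
  assumes "dset A {x. P x}" "f \<in> ratf A" "g \<in> ratf A"
  shows "(\<lambda>x. if P x then f x else g x) \<in> ratf A"
proof -
  obtain h where h: "h \<in> ratf A" "{x. P x} = {x. h x = 0}" using assms by (auto simp: dset_def)
  then have P: "P x \<longleftrightarrow> h x = 0" for x by auto
  \<comment> \<open>The quotient \<open>h x / h x\<close> is the indicator of
    \<open>h x \<noteq> 0\<close>, because \<open>0 / 0 = 0\<close>.\<close>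
  have "(\<lambda>x. g x * (h x / h x) + f x * (1 - h x / h x)) \<in> ratf A"
    by (intro ratf_add ratf_mult ratf_diff ratf_divide ratf_const h assms)
  moreover have "(\<lambda>x. g x * (h x / h x) + f x * (1 - h x / h x)) = (\<lambda>x. if P x then f x else g x)"
    by (auto simp: P fun_eq_iff)
  ultimately show ?thesis by simp
qed

text \<open>One-variable polynomials depending on a parameter \<open>x\<close>. The uniform degree
  bound makes every case distinction on the degree finite, hence constructible.\<close>

definition pfam :: "'v set \<Rightarrow> (('v \<Rightarrow> complex) \<Rightarrow> complex poly) \<Rightarrow> bool" where
  "pfam A p \<longleftrightarrow> (\<exists>d. \<forall>x. degree (p x) \<le> d) \<and> (\<forall>i. (\<lambda>x. coeff (p x) i) \<in> ratf A)"

lemma pfam_coeff: "pfam A p \<Longrightarrow> (\<lambda>x. coeff (p x) i) \<in> ratf A"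
  by (auto simp: pfam_def)

lemma pfam_const: "pfam A (\<lambda>x. c)"
  by (auto simp: pfam_def intro: ratf_const)

lemma pfam_if:
  assumes "dset A {x. P x}" "pfam A p" "pfam A q"
  shows "pfam A (\<lambda>x. if P x then p x else q x)"
proof -
  obtain d e where "\<forall>x. degree (p x) \<le> d" "\<forall>x. degree (q x) \<le> e"
    using assms by (auto simp: pfam_def)
  then have "\<forall>x. degree (if P x then p x else q x) \<le> max d e" by (auto simp: le_max_iff_disj)
  then have "\<exists>d. \<forall>x. degree (if P x then p x else q x) \<le> d" by blast
  moreover have "(\<lambda>x. coeff (if P x then p x else q x) i) \<in> ratf A" for i
    using ratf_if[OF assms(1) pfam_coeff[OF assms(2)] pfam_coeff[OF assms(3)]]
    by (simp add: if_distrib if_distribR)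
  ultimately show ?thesis unfolding pfam_def by blast
qed

lemma pfam_add:
  assumes "pfam A p" "pfam A q" shows "pfam A (\<lambda>x. p x + q x)"
proof -
  obtain d e where "\<forall>x. degree (p x) \<le> d" "\<forall>x. degree (q x) \<le> e"
    using assms by (auto simp: pfam_def)
  then have "\<forall>x. degree (p x + q x) \<le> max d e" by (meson degree_add_le max.coboundedI1 max.coboundedI2)
  then show ?thesis using assms by (auto simp: pfam_def intro!: ratf_add)
qed

lemma pfam_mult:
  assumes "pfam A p" "pfam A q" shows "pfam A (\<lambda>x. p x * q x)"
proof -
  obtain d e where "\<forall>x. degree (p x) \<le> d" "\<forall>x. degree (q x) \<le> e"
    using assms by (auto simp: pfam_def)
  then have "\<forall>x. degree (p x * q x) \<le> d + e" by (meson degree_mult_le add_mono order_trans)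
  then show ?thesis using assms
    by (auto simp: pfam_def coeff_mult intro!: ratf_sum ratf_mult)
qed

lemma pfam_diff: "pfam A p \<Longrightarrow> pfam A q \<Longrightarrow> pfam A (\<lambda>x. p x - q x)"
  using pfam_add[OF _ pfam_mult[OF pfam_const[of A "[:-1:]"]], of p q] by simp

lemma pfam_pderiv:
  assumes "pfam A p" shows "pfam A (\<lambda>x. pderiv (p x))"
proof -
  obtain d where "\<forall>x. degree (p x) \<le> d" using assms by (auto simp: pfam_def)
  then have "\<forall>x. degree (pderiv (p x)) \<le> d" by (metis degree_pderiv diff_le_self order_trans)
  moreover have "(\<lambda>x. coeff (pderiv (p x)) i) \<in> ratf A" for i
    unfolding coeff_pderiv by (intro ratf_mult ratf_const pfam_coeff assms)
  ultimately show ?thesis by (auto simp: pfam_def)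
qed

lemma dset_degree_le:
  assumes "pfam A p" shows "dset A {x. degree (p x) \<le> k}"
proof -
  obtain d where d: "\<forall>x. degree (p x) \<le> d" using assms by (auto simp: pfam_def)
  have "degree (p x) \<le> k \<longleftrightarrow> (\<forall>i\<in>{k<..d}. coeff (p x) i = 0)" for x
  proof
    assume *: "\<forall>i\<in>{k<..d}. coeff (p x) i = 0"
    show "degree (p x) \<le> k"
      by (rule degree_le) (metis * coeff_eq_0 d greaterThanAtMost_iff le_less_trans not_le)
  qed (auto simp: coeff_eq_0)
  moreover have "dset A {x. \<forall>i\<in>{k<..d}. coeff (p x) i = 0}"
    by (intro dset_ball dset_zero pfam_coeff assms) auto
  ultimately show ?thesis by simp
qed

lemma dset_degree_eq:
  assumes "pfam A p" shows "dset A {x. degree (p x) = k}"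
proof (cases k)
  case 0
  then show ?thesis using dset_degree_le[OF assms, of 0] by simp
next
  case (Suc j)
  have "degree (p x) = k \<longleftrightarrow> degree (p x) \<le> k \<and> \<not> degree (p x) \<le> j" for x using Suc by auto
  then show ?thesis using dset_conj[OF dset_degree_le[OF assms] dset_not[OF dset_degree_le[OF assms]]]
    by simp
qed

lemma dset_pfam_eq_0:
  assumes "pfam A p" shows "dset A {x. p x = 0}"
proof -
  have "p x = 0 \<longleftrightarrow> degree (p x) = 0 \<and> coeff (p x) 0 = 0" for x
    by (metis coeff_0 degree_0 leading_coeff_0_iff)
  then show ?thesis
    using dset_conj[OF dset_degree_eq[OF assms] dset_zero[OF pfam_coeff[OF assms]]] by simp
qed

lemma ratf_cases:
  fixes c :: "('v \<Rightarrow> complex) \<Rightarrow> nat"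
  assumes "\<And>x. c x \<le> N" "\<And>k. dset A {x. c x = k}" "\<And>k. k \<le> N \<Longrightarrow> F k \<in> ratf A"
  shows "(\<lambda>x. F (c x) x) \<in> ratf A"
proof -
  have "(\<lambda>x. \<Sum>k\<le>N. if c x = k then F k x else 0) \<in> ratf A"
    by (intro ratf_sum ratf_if assms ratf_const) auto
  moreover have "(\<Sum>k\<le>N. if c x = k then F k x else 0) = F (c x) x" for x
    using assms(1)[of x] by (simp add: sum.delta)
  ultimately show ?thesis by simp
qed

lemma ratf_lead_coeff:
  assumes "pfam A p" shows "(\<lambda>x. lead_coeff (p x)) \<in> ratf A"
proof -
  obtain d where d: "\<And>x. degree (p x) \<le> d" using assms by (auto simp: pfam_def)
  show ?thesis
    using ratf_cases[of "\<lambda>x. degree (p x)" d A "\<lambda>k x. coeff (p x) k"] d dset_degree_eq[OF assms]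
      pfam_coeff[OF assms] by simp
qed

lemma pfam_monom:
  fixes c :: "('v \<Rightarrow> complex) \<Rightarrow> nat"
  assumes "\<And>x. c x \<le> N" "\<And>k. dset A {x. c x = k}" "f \<in> ratf A"
  shows "pfam A (\<lambda>x. monom (f x) (c x))"
proof -
  have "(\<lambda>x. coeff (monom (f x) (c x)) i) \<in> ratf A" for i
    unfolding coeff_monom by (intro ratf_if assms ratf_const)
  moreover have "\<forall>x. degree (monom (f x) (c x)) \<le> N"
    by (meson assms(1) degree_monom_le order_trans)
  ultimately show ?thesis by (auto simp: pfam_def)
qed

text \<open>Long division for all parameters at once, one leading term per induction step, with
  \<open>e\<close> bounding the degree of the dividend.\<close>

lemma pfam_divmod_aux:
  assumes q: "pfam A q"
  shows "pfam A p \<Longrightarrow> (\<And>x. p x = 0 \<or> degree (p x) < e) \<Longrightarrow>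
     pfam A (\<lambda>x. p x div q x) \<and> pfam A (\<lambda>x. p x mod q x)"
proof (induction e arbitrary: p)
  case 0
  then have "p = (\<lambda>x. 0)" by auto
  then show ?case by (simp add: pfam_const)
next
  case (Suc e p)
  \<comment> \<open>The parameters at which a term of the quotient may still have to be removed;
    elsewhere the quotient is 0 and the remainder is \<open>p x\<close>, also where
    \<open>q x = 0\<close>.\<close>
  define P where "P x \<longleftrightarrow> q x \<noteq> 0 \<and> degree (q x) \<le> e" for x
  have P: "dset A {x. P x}"
    unfolding P_def by (intro dset_conj dset_not dset_pfam_eq_0 dset_degree_le q)
  define c where "c x = coeff (p x) e / lead_coeff (q x)" for x
  define m where "m x = monom (c x) (e - degree (q x))" for x
  have m: "pfam A m"
    unfolding m_def
  proof (rule pfam_monom[where N = e])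
    show "c \<in> ratf A" unfolding c_def
      by (intro ratf_divide pfam_coeff Suc.prems ratf_lead_coeff q)
    fix k
    obtain d where "\<And>x. degree (q x) \<le> d" using q by (auto simp: pfam_def)
    then have "{x. e - degree (q x) = k} = {x. \<exists>j\<in>{j. j \<le> d \<and> e - j = k}. degree (q x) = j}"
      by auto
    moreover have "dset A {x. \<exists>j\<in>{j. j \<le> d \<and> e - j = k}. degree (q x) = j}"
      by (intro dset_bex dset_degree_eq q) auto
    ultimately show "dset A {x. e - degree (q x) = k}" by (simp only:)
  qed auto
  define p1 where "p1 x = (if P x then p x - m x * q x else 0)" for x
  have p1: "pfam A p1"
    unfolding p1_def by (intro pfam_if P pfam_diff pfam_mult m q Suc.prems pfam_const)
  have "p1 x = 0 \<or> degree (p1 x) < e" for x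
  proof (cases "P x")
    case True
    then have qx: "q x \<noteq> 0" "degree (q x) \<le> e" by (auto simp: P_def)
    have 1: "degree (p x) \<le> e" using Suc.prems(2)[of x] by auto
    have 2: "degree (m x * q x) \<le> e"
      using degree_mult_le[of "m x" "q x"] degree_monom_le[of "c x" "e - degree (q x)"] qx
      unfolding m_def by linarith
    have 3: "degree (p1 x) \<le> e" using True 1 2 by (simp add: p1_def degree_diff_le)
    have 4: "coeff (p1 x) e = 0"
      using True qx by (simp add: p1_def m_def coeff_monom_mult c_def)
    show ?thesis
      using 3 4 by (metis le_neq_implies_less leading_coeff_0_iff)
  qed (simp add: p1_def)
  from Suc.IH[OF p1 this] have IH: "pfam A (\<lambda>x. p1 x div q x)" "pfam A (\<lambda>x. p1 x mod q x)" by auto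
  have eq: "p x = p1 x + m x * q x" if "P x" for x using that by (simp add: p1_def)
  have small: "p x div q x = 0 \<and> p x mod q x = p x" if "\<not> P x" for x
  proof (cases "q x = 0")
    case False
    then have "p x = 0 \<or> degree (p x) < degree (q x)"
      using that Suc.prems(2)[of x] by (auto simp: P_def)
    then show ?thesis by (auto simp: div_poly_less mod_poly_less)
  qed auto
  have "p x mod q x = (if P x then p1 x mod q x else p x)" for x
    using eq[of x] small[of x] by auto
  moreover have "p x div q x = (if P x then m x + p1 x div q x else 0)" for x
    using eq[of x] small[of x] by (auto simp: P_def div_mult_self1 add.commute)
  ultimately show ?case
    by (auto intro!: pfam_if P IH Suc.prems pfam_add m pfam_const)
qed

lemma
  assumes p: "pfam A p" and q: "pfam A q"
  shows pfam_div: "pfam A (\<lambda>x. p x div q x)" and pfam_mod: "pfam A (\<lambda>x. p x mod q x)"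
proof -
  obtain d where "\<And>x. degree (p x) \<le> d" using p by (auto simp: pfam_def)
  then have "p x = 0 \<or> degree (p x) < Suc d" for x by (simp add: le_imp_less_Suc)
  from pfam_divmod_aux[OF q p this] show "pfam A (\<lambda>x. p x div q x)" "pfam A (\<lambda>x. p x mod q x)"
    by auto
qed

text \<open>Euclid's algorithm for all parameters at once: the degree bound \<open>e\<close> falls
  by one in each round, and parameters at which the remainder is already 0 are left as they
  are.\<close>

lemma pfam_gcd_aux:
  assumes "pfam A p" "pfam A q" "\<And>x. q x = 0 \<or> degree (q x) < e"
  shows "\<exists>g. pfam A g \<and> (\<forall>x. g x dvd p x \<and> g x dvd q x \<and> (\<exists>a b. g x = a * p x + b * q x))"
  using assms
proof (induction e arbitrary: p q)
  case 0
  then have "q x = 0" for x by auto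
  then show ?case using 0(1) by (intro exI[of _ p]) (auto intro: exI[of _ 1])
next
  case (Suc e p q)
  define p' where "p' x = (if q x = 0 then p x else q x)" for x
  define q' where "q' x = (if q x = 0 then 0 else p x mod q x)" for x
  have "pfam A p'" "pfam A q'"
    unfolding p'_def q'_def
    by (intro pfam_if dset_pfam_eq_0 pfam_mod pfam_const Suc.prems)+
  moreover have "q' x = 0 \<or> degree (q' x) < e" for x
    using Suc.prems(3)[of x] degree_mod_less[of "q x" "p x"] by (auto simp: q'_def)
  ultimately obtain g where g: "pfam A g"
    "\<And>x. g x dvd p' x \<and> g x dvd q' x \<and> (\<exists>a b. g x = a * p' x + b * q' x)"
    using Suc.IH by blast
  have "g x dvd p x \<and> g x dvd q x \<and> (\<exists>a b. g x = a * p x + b * q x)" for x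
  proof (cases "q x = 0")
    case True
    then show ?thesis using g(2)[of x] by (simp add: p'_def q'_def)
  next
    case False
    then obtain a b where *: "g x = a * q x + b * (p x mod q x)" "g x dvd q x" "g x dvd p x mod q x"
      using g(2)[of x] by (auto simp: p'_def q'_def)
    have "g x = b * p x + (a - b * (p x div q x)) * q x"
      using *(1) by (simp add: algebra_simps minus_div_mult_eq_mod[symmetric])
    then show ?thesis using * dvd_mod_imp_dvd by blast
  qed
  then show ?case using g(1) by blast
qed

lemma pfam_gcd:
  assumes p: "pfam A p" and q: "pfam A q"
  obtains g where "pfam A g" "\<And>x. g x dvd p x" "\<And>x. g x dvd q x"
    "\<And>x. \<exists>a b. g x = a * p x + b * q x"
proof -
  obtain d where "\<And>x. degree (q x) \<le> d" using q by (auto simp: pfam_def)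
  then have "q x = 0 \<or> degree (q x) < Suc d" for x by (simp add: le_imp_less_Suc)
  from pfam_gcd_aux[OF p q this] show ?thesis using that by metis
qed

text \<open>Division by the gcd with the derivative keeps the roots and makes them simple.\<close>

lemma pfam_squarefree:
  assumes p: "pfam A p" and nz: "\<And>x. p x \<noteq> 0"
  obtains q where "pfam A q" "\<And>x. q x \<noteq> 0" "\<And>x y. poly (q x) y = 0 \<longleftrightarrow> poly (p x) y = 0"
    "\<And>x y. poly (q x) y = 0 \<Longrightarrow> poly (pderiv (q x)) y \<noteq> 0"
proof -
  obtain g where g: "pfam A g" "\<And>x. g x dvd p x" "\<And>x. g x dvd pderiv (p x)"
    "\<And>x. \<exists>a b. g x = a * p x + b * pderiv (p x)"
    using pfam_gcd[OF p pfam_pderiv[OF p]] by blast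
  \<comment> \<open>A nonzero constant has derivative 0, which the decomposition below does not
    admit; having no roots, it may be replaced by 1.\<close>
  define q where "q x = (if degree (p x) \<le> 0 then 1 else p x div g x)" for x
  have "pfam A q"
    unfolding q_def by (intro pfam_if dset_degree_le pfam_div p g pfam_const)
  moreover have "q x \<noteq> 0 \<and> (poly (q x) y = 0 \<longleftrightarrow> poly (p x) y = 0) \<and>
      (poly (q x) y = 0 \<longrightarrow> poly (pderiv (q x)) y \<noteq> 0)" for x y
  proof (cases "degree (p x) = 0")
    case True
    then show ?thesis using nz[of x] by (auto simp: q_def elim: degree_eq_zeroE)
  next
    case False
    then have pd: "pderiv (p x) \<noteq> 0" by (auto simp: pderiv_eq_0_iff)
    obtain a b where ab: "g x = a * p x + b * pderiv (p x)" using g(4) by blast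
    have 1: "p x = q x * g x" using g(2)[of x] False by (simp add: q_def)
    obtain e where e: "pderiv (p x) = e * g x" using g(3)[of x] by (metis dvd_div_mult_self)
    have r: "rsquarefree (q x) \<and> (\<forall>a. poly (q x) a = 0 \<longleftrightarrow> poly (p x) a = 0)"
      by (rule poly_squarefree_decomp[OF pd 1 e ab])
    then show ?thesis using rsquarefree_roots[of "q x"] by (auto simp: rsquarefree_def)
  qed
  ultimately show ?thesis using that by blast
qed

section \<open>Elimination and triangular cells\<close>

text \<open>These turn out to be the sets described by \<open>dset\<close>. Generating them from
  polynomial equations by Boolean operations provides an induction principle.\<close>

inductive_set constr :: "'v set \<Rightarrow> ('v \<Rightarrow> complex) set set" for A where
  constr_zero: "f \<in> polyf A \<Longrightarrow> {x. f x = 0} \<in> constr A"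
| constr_Compl: "X \<in> constr A \<Longrightarrow> - X \<in> constr A"
| constr_Int: "X \<in> constr A \<Longrightarrow> Y \<in> constr A \<Longrightarrow> X \<inter> Y \<in> constr A"

lemma constr_Un: "X \<in> constr A \<Longrightarrow> Y \<in> constr A \<Longrightarrow> X \<union> Y \<in> constr A"
  using constr_Compl[OF constr_Int[OF constr_Compl constr_Compl], of X A Y] by simp

lemma constr_UNIV: "UNIV \<in> constr A"
  using constr_zero[OF polyf_const[of 0]] by simp

lemma constr_Union: "finite F \<Longrightarrow> F \<subseteq> constr A \<Longrightarrow> \<Union>F \<in> constr A"
  by (induction F rule: finite_induct) (use constr_Compl[OF constr_UNIV] in \<open>auto intro: constr_Un\<close>)

lemma constr_imp_dset: "X \<in> constr A \<Longrightarrow> dset A X"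
  by (induction rule: constr.induct) (auto intro: dset_zero dset_Compl dset_Int polyf_imp_ratf)

text \<open>Records case distinctions on the vanishing of functions: \<open>P\<close> holds on each
  piece of a finite constructible cover.\<close>

definition covered :: "'v set \<Rightarrow> (('v \<Rightarrow> complex) set \<Rightarrow> bool) \<Rightarrow> bool" where
  "covered A P \<longleftrightarrow> (\<exists>F. finite F \<and> F \<subseteq> constr A \<and> \<Union>F = UNIV \<and> (\<forall>X\<in>F. P X))"

lemma covered_UNIV: "P UNIV \<Longrightarrow> covered A P"
  unfolding covered_def by (rule exI[of _ "{UNIV}"]) (simp add: constr_UNIV)

lemma covered_mono: "covered A P \<Longrightarrow> (\<And>X. P X \<Longrightarrow> R X) \<Longrightarrow> covered A R"
  unfolding covered_def by meson

lemma covered_refine: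
  assumes "covered A P" "covered A Q" "\<And>X Y. P X \<Longrightarrow> Q Y \<Longrightarrow> R (X \<inter> Y)"
  shows "covered A R"
proof -
  obtain F where F: "finite F" "F \<subseteq> constr A" "\<Union>F = UNIV" "\<forall>X\<in>F. P X"
    using assms by (auto simp: covered_def)
  obtain G where G: "finite G" "G \<subseteq> constr A" "\<Union>G = UNIV" "\<forall>X\<in>G. Q X"
    using assms by (auto simp: covered_def)
  let ?H = "(\<lambda>(X, Y). X \<inter> Y) ` (F \<times> G)"
  have "\<Union>?H = \<Union>F \<inter> \<Union>G" by auto
  moreover have "?H \<subseteq> constr A" using F(2) G(2) by (auto intro!: constr_Int)
  moreover have "\<forall>X\<in>?H. R X" using F(4) G(4) assms(3) by auto
  ultimately show ?thesis
    unfolding covered_def using F(1,3) G(1,3) by (intro exI[of _ ?H]) simp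
qed

lemma covered_bind:
  assumes "covered A P" "\<And>X. P X \<Longrightarrow> \<exists>Y\<in>constr A. R (X \<inter> Y) \<and> R (X \<inter> - Y)"
  shows "covered A R"
proof -
  obtain F where F: "finite F" "F \<subseteq> constr A" "\<Union>F = UNIV" "\<forall>X\<in>F. P X"
    using assms by (auto simp: covered_def)
  obtain Y where Y: "\<And>X. X \<in> F \<Longrightarrow> Y X \<in> constr A \<and> R (X \<inter> Y X) \<and> R (X \<inter> - Y X)"
    using assms(2) F(4) by metis
  let ?H = "(\<lambda>X. X \<inter> Y X) ` F \<union> (\<lambda>X. X \<inter> - Y X) ` F"
  have "\<Union>?H = \<Union>F" by auto
  moreover have "?H \<subseteq> constr A" using F(2) Y by (auto intro!: constr_Int constr_Compl)
  moreover have "\<forall>X\<in>?H. R X" using Y by auto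
  ultimately show ?thesis
    unfolding covered_def using F(1,3) by (intro exI[of _ ?H]) simp
qed

lemma covered_ball:
  assumes "finite I" "\<And>i. i \<in> I \<Longrightarrow> covered A (P i)" "\<And>i X Y. P i X \<Longrightarrow> Y \<subseteq> X \<Longrightarrow> P i Y"
  shows "covered A (\<lambda>X. \<forall>i\<in>I. P i X)"
  using assms(1,2)
proof (induction I rule: finite_induct)
  case empty
  show ?case by (rule covered_UNIV) simp
next
  case (insert i I)
  show ?case
  proof (rule covered_refine)
    show "covered A (P i)" "covered A (\<lambda>X. \<forall>i\<in>I. P i X)" using insert by auto
  qed (auto intro: assms(3))
qed

text \<open>Sums and products are computed as fractions on a common refinement of two covers. An
  inverse splits each piece according to whether the numerator vanishes.\<close>

lemma ratf_piecewise:
  assumes "f \<in> ratf A"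
  shows "covered A (\<lambda>X. \<exists>a\<in>polyf A. \<exists>b\<in>polyf A. \<forall>x\<in>X. b x \<noteq> 0 \<and> f x = a x / b x)"
  using assms
proof (induction rule: ratf.induct)
  case (ratf_const c)
  show ?case
    by (intro covered_UNIV bexI[OF _ polyf_const[of c]] bexI[OF _ polyf_const[of 1]]) simp
next
  case (ratf_var i)
  show ?case
    by (intro covered_UNIV bexI[OF _ polyf_var[OF ratf_var]] bexI[OF _ polyf_const[of 1]]) simp
next
  case (ratf_add f g)
  show ?case
  proof (rule covered_refine[OF ratf_add.IH])
    fix X Y
    assume "\<exists>a\<in>polyf A. \<exists>b\<in>polyf A. \<forall>x\<in>X. b x \<noteq> 0 \<and> f x = a x / b x"
      "\<exists>a\<in>polyf A. \<exists>b\<in>polyf A. \<forall>x\<in>Y. b x \<noteq> 0 \<and> g x = a x / b x"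
    then obtain a b c d where *: "a \<in> polyf A" "b \<in> polyf A" "c \<in> polyf A" "d \<in> polyf A"
      "\<forall>x\<in>X. b x \<noteq> 0 \<and> f x = a x / b x" "\<forall>x\<in>Y. d x \<noteq> 0 \<and> g x = c x / d x" by blast
    show "\<exists>a\<in>polyf A. \<exists>b\<in>polyf A. \<forall>x\<in>X \<inter> Y. b x \<noteq> 0 \<and> f x + g x = a x / b x"
    proof (rule bexI, rule bexI)
      show "\<forall>x\<in>X \<inter> Y. b x * d x \<noteq> 0 \<and> f x + g x = (a x * d x + c x * b x) / (b x * d x)"
        using * by (auto simp: add_frac_eq)
      show "(\<lambda>x. a x * d x + c x * b x) \<in> polyf A" "(\<lambda>x. b x * d x) \<in> polyf A"
        by (intro polyf_add polyf_mult *)+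
    qed
  qed
next
  case (ratf_mult f g)
  show ?case
  proof (rule covered_refine[OF ratf_mult.IH])
    fix X Y
    assume "\<exists>a\<in>polyf A. \<exists>b\<in>polyf A. \<forall>x\<in>X. b x \<noteq> 0 \<and> f x = a x / b x"
      "\<exists>a\<in>polyf A. \<exists>b\<in>polyf A. \<forall>x\<in>Y. b x \<noteq> 0 \<and> g x = a x / b x"
    then obtain a b c d where *: "a \<in> polyf A" "b \<in> polyf A" "c \<in> polyf A" "d \<in> polyf A"
      "\<forall>x\<in>X. b x \<noteq> 0 \<and> f x = a x / b x" "\<forall>x\<in>Y. d x \<noteq> 0 \<and> g x = c x / d x" by blast
    show "\<exists>a\<in>polyf A. \<exists>b\<in>polyf A. \<forall>x\<in>X \<inter> Y. b x \<noteq> 0 \<and> f x * g x = a x / b x"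
    proof (rule bexI, rule bexI)
      show "\<forall>x\<in>X \<inter> Y. b x * d x \<noteq> 0 \<and> f x * g x = (a x * c x) / (b x * d x)"
        using * by auto
      show "(\<lambda>x. a x * c x) \<in> polyf A" "(\<lambda>x. b x * d x) \<in> polyf A"
        by (intro polyf_mult *)+
    qed
  qed
next
  case (ratf_inverse f)
  show ?case
  proof (rule covered_bind[OF ratf_inverse.IH])
    fix X
    assume "\<exists>a\<in>polyf A. \<exists>b\<in>polyf A. \<forall>x\<in>X. b x \<noteq> 0 \<and> f x = a x / b x"
    then obtain a b where *: "a \<in> polyf A" "b \<in> polyf A" "\<forall>x\<in>X. b x \<noteq> 0 \<and> f x = a x / b x" by blast
    let ?R = "\<lambda>X. \<exists>a\<in>polyf A. \<exists>b\<in>polyf A. \<forall>x\<in>X. b x \<noteq> 0 \<and> inverse (f x) = a x / b x"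
    have "?R (X \<inter> {x. a x = 0})"
      by (intro bexI[OF _ polyf_const[of 0]] bexI[OF _ polyf_const[of 1]]) (use * in auto)
    moreover have "?R (X \<inter> - {x. a x = 0})"
      by (rule bexI[of _ b], rule bexI[of _ a]) (use * in auto)
    ultimately show "\<exists>Y\<in>constr A. ?R (X \<inter> Y) \<and> ?R (X \<inter> - Y)"
      using constr_zero[OF *(1)] by blast
  qed
qed

lemma dset_imp_constr:
  assumes "dset A X" shows "X \<in> constr A"
proof -
  obtain f where f: "f \<in> ratf A" "X = {x. f x = 0}" using assms by (auto simp: dset_def)
  from ratf_piecewise[OF f(1)] obtain F where F: "finite F" "F \<subseteq> constr A" "\<Union>F = UNIV"
    "\<forall>X\<in>F. \<exists>a\<in>polyf A. \<exists>b\<in>polyf A. \<forall>x\<in>X. b x \<noteq> 0 \<and> f x = a x / b x"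
    by (auto simp: covered_def)
  from F(4) obtain a where a: "\<And>Y. Y \<in> F \<Longrightarrow> a Y \<in> polyf A" "\<And>Y x. Y \<in> F \<Longrightarrow> x \<in> Y \<Longrightarrow> f x = 0 \<longleftrightarrow> a Y x = 0"
    by (metis divide_eq_0_iff)
  let ?H = "(\<lambda>Y. Y \<inter> {x. a Y x = 0}) ` F"
  have "Y \<inter> {x. a Y x = 0} \<in> constr A" if "Y \<in> F" for Y
    by (rule constr_Int[OF _ constr_zero[OF a(1)[OF that]]]) (use F(2) that in blast)
  then have "?H \<subseteq> constr A" by (rule image_subsetI)
  with F(1) have "\<Union>?H \<in> constr A" by (intro constr_Union finite_imageI)
  moreover have "\<Union>?H = X"
  proof (rule set_eqI)
    fix x
    from F(3) have "x \<in> \<Union>F" by simp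
    then obtain Y where "Y \<in> F" "x \<in> Y" by (rule UnionE)
    have "x \<in> \<Union>?H \<longleftrightarrow> (\<exists>Y\<in>F. x \<in> Y \<and> a Y x = 0)" by auto
    also have "\<dots> \<longleftrightarrow> (\<exists>Y\<in>F. x \<in> Y \<and> f x = 0)" using a(2) by meson
    also have "\<dots> \<longleftrightarrow> x \<in> X" using \<open>Y \<in> F\<close> \<open>x \<in> Y\<close> by (auto simp: f(2))
    finally show "x \<in> \<Union>?H \<longleftrightarrow> x \<in> X" .
  qed
  ultimately show ?thesis by simp
qed

text \<open>\<open>X\<close> contains a nonempty Zariski open set. A polynomial witness is asked for
  because it can still be tested on real slices of measure zero.\<close>

definition generic :: "'v set \<Rightarrow> ('v \<Rightarrow> complex) set \<Rightarrow> bool" where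
  "generic A X \<longleftrightarrow> (\<exists>Q\<in>polyf A. (\<exists>x. Q x \<noteq> 0) \<and> (\<forall>x. Q x \<noteq> 0 \<longrightarrow> x \<in> X))"

lemma generic_mono: "generic A X \<Longrightarrow> X \<subseteq> Y \<Longrightarrow> generic A Y"
  unfolding generic_def by blast

lemma generic_Int:
  assumes "generic A X" "generic A Y" shows "generic A (X \<inter> Y)"
proof -
  obtain P Q a b where PQ: "P \<in> polyf A" "P a \<noteq> 0" "\<forall>x. P x \<noteq> 0 \<longrightarrow> x \<in> X"
    "Q \<in> polyf A" "Q b \<noteq> 0" "\<forall>x. Q x \<noteq> 0 \<longrightarrow> x \<in> Y"
    using assms by (auto simp: generic_def)
  obtain x where "P x * Q x \<noteq> 0"
    using polyf_mult_nonzero[of P A Q a b] PQ by metis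
  then have "(\<exists>x. P x * Q x \<noteq> 0) \<and> (\<forall>x. P x * Q x \<noteq> 0 \<longrightarrow> x \<in> X \<inter> Y)"
    using PQ by auto
  moreover have "(\<lambda>x. P x * Q x) \<in> polyf A" by (rule polyf_mult[OF PQ(1,4)])
  ultimately show ?thesis unfolding generic_def by (metis (mono_tags, lifting))
qed

lemma generic_UNIV: "generic A UNIV"
  unfolding generic_def by (rule bexI[OF _ polyf_const[of 1]]) simp

lemma generic_INT:
  "finite I \<Longrightarrow> (\<And>i. i \<in> I \<Longrightarrow> generic A (X i)) \<Longrightarrow> generic A (\<Inter>i\<in>I. X i)"
proof (induction I rule: finite_induct)
  case (insert i I)
  then have "generic A (X i)" "generic A (\<Inter>i\<in>I. X i)" by auto
  from generic_Int[OF this] show ?case by simp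
qed (simp add: generic_UNIV)

lemma generic_nonempty: "generic A X \<Longrightarrow> X \<noteq> {}"
  unfolding generic_def by auto

lemma generic_neq: "Q \<in> polyf A \<Longrightarrow> Q a \<noteq> 0 \<Longrightarrow> generic A {x. Q x \<noteq> 0}"
  unfolding generic_def by (rule bexI) auto

text \<open>Affine space is irreducible: nonempty Zariski open sets meet, so genericity passes to
  intersections and the dichotomy survives Boolean operations.\<close>

lemma dset_dichotomy:
  assumes "dset A X" shows "generic A X \<or> generic A (- X)"
  using dset_imp_constr[OF assms]
proof (induction rule: constr.induct)
  case (constr_zero f)
  show ?case
  proof (cases "\<exists>x. f x \<noteq> 0")
    case True
    then have "generic A {x. f x \<noteq> 0}" using generic_neq[OF constr_zero] by blast
    then show ?thesis by (simp add: Collect_neg_eq)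
  next
    case False
    then have "{x. f x = 0} = UNIV" by auto
    then show ?thesis using generic_UNIV by metis
  qed
next
  case (constr_Int X Y)
  then show ?case using generic_Int[of A X Y] generic_mono[of A _ "- (X \<inter> Y)"] by blast
qed auto

text \<open>If no piece were generic then all complements would be, and finitely many generic sets
  have a common point.\<close>

lemma covered_generic:
  assumes "covered A P" obtains X where "generic A X" "P X"
proof -
  obtain F where F: "finite F" "F \<subseteq> constr A" "\<Union>F = UNIV" "\<forall>X\<in>F. P X"
    using assms by (auto simp: covered_def)
  have "\<exists>X\<in>F. generic A X"
  proof (rule ccontr)
    assume "\<not> ?thesis"
    then have "generic A (- X)" if "X \<in> F" for X
      using dset_dichotomy[OF constr_imp_dset] F(2) that by blast
    then have "generic A (\<Inter>X\<in>F. - X)" by (intro generic_INT F)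
    moreover have "(\<Inter>X\<in>F. - X) = {}" using F(3) by auto
    ultimately show False using generic_nonempty by auto
  qed
  with F(4) that show ?thesis by blast
qed

lemma polyf_family:
  assumes "f \<in> polyf (insert v A)" "v \<notin> A"
  shows "\<exists>p. (\<exists>d. \<forall>x. degree (p x) \<le> d) \<and> (\<forall>i. (\<lambda>x. coeff (p x) i) \<in> polyf A) \<and>
    (\<forall>x y. f (x(v := y)) = poly (p x) y)"
  using assms(1)
proof (induction rule: polyf.induct)
  case (polyf_const c)
  have "(\<lambda>x. coeff [:c:] i) \<in> polyf A" for i by (rule polyf.polyf_const)
  then show ?case by (intro exI[of _ "\<lambda>x. [:c:]"]) auto
next
  case (polyf_var i)
  show ?case
  proof (cases "i = v")
    case True
    have "(\<lambda>x. coeff [:0, 1:] j) \<in> polyf A" for j by (rule polyf.polyf_const)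
    then show ?thesis using True by (intro exI[of _ "\<lambda>x. [:0, 1:]"]) auto
  next
    case False
    have "(\<lambda>x. coeff [:x i:] j) \<in> polyf A" for j
      using polyf_var False by (cases j) (auto intro: polyf.polyf_var polyf.polyf_const)
    then show ?thesis using False by (intro exI[of _ "\<lambda>x. [:x i:]"]) (auto intro: exI[of _ 0])
  qed
next
  case (polyf_add f g)
  from polyf_add.IH(1) obtain p d where p: "\<And>x. degree (p x) \<le> d" "\<And>i. (\<lambda>x. coeff (p x) i) \<in> polyf A"
    "\<And>x y. f (x(v := y)) = poly (p x) y" by metis
  from polyf_add.IH(2) obtain q e where q: "\<And>x. degree (q x) \<le> e" "\<And>i. (\<lambda>x. coeff (q x) i) \<in> polyf A"
    "\<And>x y. g (x(v := y)) = poly (q x) y" by metis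
  note * = p q
  have "degree (p x + q x) \<le> max d e" for x
    using *(1,4) by (meson degree_add_le max.coboundedI1 max.coboundedI2)
  moreover have "(\<lambda>x. coeff (p x + q x) i) \<in> polyf A" for i
    unfolding coeff_add by (intro polyf.polyf_add *)
  ultimately show ?case using * by (intro exI[of _ "\<lambda>x. p x + q x"]) (auto simp del: fun_upd_apply)
next
  case (polyf_mult f g)
  from polyf_mult.IH(1) obtain p d where p: "\<And>x. degree (p x) \<le> d" "\<And>i. (\<lambda>x. coeff (p x) i) \<in> polyf A"
    "\<And>x y. f (x(v := y)) = poly (p x) y" by metis
  from polyf_mult.IH(2) obtain q e where q: "\<And>x. degree (q x) \<le> e" "\<And>i. (\<lambda>x. coeff (q x) i) \<in> polyf A"
    "\<And>x y. g (x(v := y)) = poly (q x) y" by metis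
  note * = p q
  have "degree (p x * q x) \<le> d + e" for x
    using *(1,4) by (meson degree_mult_le add_mono order_trans)
  moreover have "(\<lambda>x. coeff (p x * q x) i) \<in> polyf A" for i
    unfolding coeff_mult by (intro polyf_sum polyf.polyf_mult *)
  ultimately show ?case using * by (intro exI[of _ "\<lambda>x. p x * q x"]) (auto simp del: fun_upd_apply)
qed

text \<open>Every fibre in the direction of \<open>v\<close> is finite or cofinite. The roots of
  \<open>p\<close> are its exceptional points, and \<open>B\<close> tells over which parameters they
  are the fibre rather than its complement.\<close>

definition fibred :: "'v \<Rightarrow> 'v set \<Rightarrow> ('v \<Rightarrow> complex) set \<Rightarrow> bool" where
  "fibred v A C \<longleftrightarrow> (\<exists>p B. pfam A p \<and> dset A B \<and> (\<forall>x. p x \<noteq> 0) \<and>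
     (\<forall>x y. x(v := y) \<in> C \<longleftrightarrow> (if x \<in> B then poly (p x) y = 0 else poly (p x) y \<noteq> 0)))"

lemma pfam_common_roots:
  assumes "pfam A p" "pfam A q" "\<And>x. p x \<noteq> 0"
  shows "\<exists>r. pfam A r \<and> (\<forall>x. r x \<noteq> 0) \<and>
    (\<forall>x y. poly (r x) y = 0 \<longleftrightarrow> poly (p x) y = 0 \<and> poly (q x) y = 0)"
proof -
  obtain g where g: "pfam A g" "\<And>x. g x dvd p x" "\<And>x. g x dvd q x"
    "\<And>x. \<exists>a b. g x = a * p x + b * q x" using pfam_gcd[OF assms(1,2)] by blast
  have "poly (g x) y = 0 \<longleftrightarrow> poly (p x) y = 0 \<and> poly (q x) y = 0" for x y
  proof
    assume "poly (g x) y = 0"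
    then show "poly (p x) y = 0 \<and> poly (q x) y = 0"
      using g(2,3)[of x] by (auto simp: dvd_def)
  next
    assume *: "poly (p x) y = 0 \<and> poly (q x) y = 0"
    obtain a b where "g x = a * p x + b * q x" using g(4) by blast
    with * show "poly (g x) y = 0" by simp
  qed
  moreover have "g x \<noteq> 0" for x using g(2)[of x] assms(3)[of x] by auto
  ultimately show ?thesis using g(1) by blast
qed

text \<open>Once the roots of \<open>p\<close> are simple, division by the gcd with \<open>q\<close>
  removes each shared root completely.\<close>

lemma pfam_root_diff:
  assumes "pfam A p" "pfam A q" "\<And>x. p x \<noteq> 0"
  shows "\<exists>r. pfam A r \<and> (\<forall>x. r x \<noteq> 0) \<and>
    (\<forall>x y. poly (r x) y = 0 \<longleftrightarrow> poly (p x) y = 0 \<and> poly (q x) y \<noteq> 0)"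
proof -
  obtain s where s: "pfam A s" "\<And>x. s x \<noteq> 0" "\<And>x y. poly (s x) y = 0 \<longleftrightarrow> poly (p x) y = 0"
    "\<And>x y. poly (s x) y = 0 \<Longrightarrow> poly (pderiv (s x)) y \<noteq> 0"
    using pfam_squarefree[OF assms(1,3)] by blast
  obtain g where g: "pfam A g" "\<And>x. g x dvd s x" "\<And>x. g x dvd q x"
    "\<And>x. \<exists>a b. g x = a * s x + b * q x" using pfam_gcd[OF s(1) assms(2)] by blast
  have eq: "s x = (s x div g x) * g x" for x using g(2)[of x] by simp
  have nz: "s x div g x \<noteq> 0" for x using eq[of x] s(2)[of x] by auto
  have "poly (s x div g x) y = 0 \<longleftrightarrow> poly (p x) y = 0 \<and> poly (q x) y \<noteq> 0" for x y
  proof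
    assume r: "poly (s x div g x) y = 0"
    then have sy: "poly (s x) y = 0" by (subst eq) simp
    obtain a b where ab: "g x = a * s x + b * q x" using g(4) by blast
    have "poly (g x) y \<noteq> 0"
    proof
      assume "poly (g x) y = 0"
      with r have "poly (pderiv (s x)) y = 0"
        by (subst eq) (simp only: pderiv_mult poly_add poly_mult, simp)
      with s(4)[OF sy] show False by simp
    qed
    with ab sy have "poly (q x) y \<noteq> 0" by auto
    with sy s(3) show "poly (p x) y = 0 \<and> poly (q x) y \<noteq> 0" by auto
  next
    assume *: "poly (p x) y = 0 \<and> poly (q x) y \<noteq> 0"
    then have "poly ((s x div g x) * g x) y = 0" using s(3) eq by metis
    moreover have "poly (g x) y \<noteq> 0" using * g(3)[of x] by (auto simp: dvd_def)
    ultimately show "poly (s x div g x) y = 0" by simp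
  qed
  then show ?thesis using nz pfam_div[OF s(1) g(1)] by blast
qed

lemma fibred_Compl: "fibred v A C \<Longrightarrow> fibred v A (- C)"
  unfolding fibred_def
proof (elim exE conjE)
  fix p B assume *: "pfam A p" "dset A B" "\<forall>x. p x \<noteq> 0"
     "\<forall>x y. (x(v := y) \<in> C) = (if x \<in> B then poly (p x) y = 0 else poly (p x) y \<noteq> 0)"
  show "\<exists>p B. pfam A p \<and> dset A B \<and> (\<forall>x. p x \<noteq> 0) \<and>
     (\<forall>x y. (x(v := y) \<in> - C) = (if x \<in> B then poly (p x) y = 0 else poly (p x) y \<noteq> 0))"
    by (rule exI[of _ p], rule exI[of _ "- B"]) (use * dset_Compl in auto)
qed

lemma fibred_Int:
  assumes "fibred v A C" "fibred v A D" shows "fibred v A (C \<inter> D)"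
proof -
  obtain p B where p: "pfam A p" "dset A B" "\<And>x. p x \<noteq> 0"
    "\<And>x y. x(v := y) \<in> C \<longleftrightarrow> (if x \<in> B then poly (p x) y = 0 else poly (p x) y \<noteq> 0)"
    using assms(1) by (auto simp: fibred_def)
  obtain q E where q: "pfam A q" "dset A E" "\<And>x. q x \<noteq> 0"
    "\<And>x y. x(v := y) \<in> D \<longleftrightarrow> (if x \<in> E then poly (q x) y = 0 else poly (q x) y \<noteq> 0)"
    using assms(2) by (auto simp: fibred_def)
  obtain r where r: "pfam A r" "\<And>x. r x \<noteq> 0"
    "\<And>x y. poly (r x) y = 0 \<longleftrightarrow> poly (p x) y = 0 \<and> poly (q x) y = 0"
    using pfam_common_roots[OF p(1) q(1) p(3)] by blast
  obtain s where s: "pfam A s" "\<And>x. s x \<noteq> 0"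
    "\<And>x y. poly (s x) y = 0 \<longleftrightarrow> poly (p x) y = 0 \<and> poly (q x) y \<noteq> 0"
    using pfam_root_diff[OF p(1) q(1) p(3)] by blast
  obtain t where t: "pfam A t" "\<And>x. t x \<noteq> 0"
    "\<And>x y. poly (t x) y = 0 \<longleftrightarrow> poly (q x) y = 0 \<and> poly (p x) y \<noteq> 0"
    using pfam_root_diff[OF q(1) p(1) q(3)] by blast
  \<comment> \<open>Two finite fibres meet in the common roots, a finite and a cofinite one in a
    difference of root sets, and two cofinite ones omit the roots of the product.\<close>
  define u where "u x = (if x \<in> B then if x \<in> E then r x else s x
    else if x \<in> E then t x else p x * q x)" for x
  have "pfam A u" unfolding u_def using p(2) q(2)
    by (intro pfam_if pfam_mult p q r s t) auto
  moreover have "dset A (B \<union> E)" using p(2) q(2) by (rule dset_Un)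
  moreover have "u x \<noteq> 0" for x using p(3) q(3) r(2) s(2) t(2) by (auto simp: u_def)
  moreover have "x(v := y) \<in> C \<inter> D \<longleftrightarrow>
      (if x \<in> B \<union> E then poly (u x) y = 0 else poly (u x) y \<noteq> 0)" for x y
    using p(4) q(4) r(3) s(3) t(3) by (auto simp: u_def)
  ultimately show ?thesis unfolding fibred_def by blast
qed

lemma dset_fibred:
  assumes "dset (insert v A) C" "v \<notin> A" shows "fibred v A C"
  using dset_imp_constr[OF assms(1)]
proof (induction rule: constr.induct)
  case (constr_zero f)
  obtain p d where p: "\<And>x. degree (p x) \<le> d" "\<And>i. (\<lambda>x. coeff (p x) i) \<in> polyf A"
    "\<And>x y. f (x(v := y)) = poly (p x) y"
    using polyf_family[OF constr_zero assms(2)] by blast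
  have pf: "pfam A p" using p(1,2) by (auto simp: pfam_def intro: polyf_imp_ratf)
  \<comment> \<open>Where \<open>p x\<close> is the zero polynomial the fibre is the whole line; it
    is described as cofinite with nothing omitted.\<close>
  define q where "q x = (if p x = 0 then 1 else p x)" for x
  have "pfam A q" unfolding q_def by (intro pfam_if dset_pfam_eq_0 pf pfam_const)
  moreover have "dset A {x. p x \<noteq> 0}" by (intro dset_not dset_pfam_eq_0 pf)
  moreover have "x(v := y) \<in> {x. f x = 0} \<longleftrightarrow>
      (if x \<in> {x. p x \<noteq> 0} then poly (q x) y = 0 else poly (q x) y \<noteq> 0)" for x y
    using p(3) by (auto simp: q_def)
  moreover have "q x \<noteq> 0" for x by (auto simp: q_def)
  ultimately show ?case unfolding fibred_def by blast
qed (auto intro: fibred_Compl fibred_Int)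

text \<open>Elimination of one variable. By the fundamental theorem of algebra a root set is
  nonempty unless the polynomial is constant, and a cofinite fibre is never empty.\<close>

lemma fibred_project:
  assumes "fibred v A C" shows "dset A {x. \<exists>y. x(v := y) \<in> C}"
proof -
  obtain p B where p: "pfam A p" "dset A B" "\<And>x. p x \<noteq> 0"
    "\<And>x y. x(v := y) \<in> C \<longleftrightarrow> (if x \<in> B then poly (p x) y = 0 else poly (p x) y \<noteq> 0)"
    using assms by (auto simp: fibred_def)
  have "(\<exists>y. x(v := y) \<in> C) \<longleftrightarrow> x \<notin> B \<or> degree (p x) \<noteq> 0" for x
  proof (cases "x \<in> B")
    case True
    have "(\<exists>y. poly (p x) y = 0) \<longleftrightarrow> degree (p x) \<noteq> 0"
    proof
      assume "\<exists>y. poly (p x) y = 0"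
      then show "degree (p x) \<noteq> 0" using p(3)[of x]
        by (metis degree_eq_zeroE pCons_0_0 poly_const_conv)
    next
      assume "degree (p x) \<noteq> 0"
      then show "\<exists>y. poly (p x) y = 0"
        using fundamental_theorem_of_algebra[of "p x"] by (simp add: constant_degree)
    qed
    then show ?thesis using p(4)[of x] True by auto
  next
    case False
    have "\<exists>y. poly (p x) y \<noteq> 0" using p(3)[of x] poly_all_0_iff_0 by blast
    then show ?thesis using p(4)[of x] False by auto
  qed
  moreover have "dset A {x. x \<notin> B \<or> degree (p x) \<noteq> 0}"
    using p(2) by (intro dset_disj dset_not dset_degree_eq p) auto
  ultimately show ?thesis by simp
qed

lemma dset_project:
  assumes "finite W" "dset (W \<union> A) C" "W \<inter> A = {}"
  shows "dset A {x. \<exists>y. (\<forall>i. i \<notin> W \<longrightarrow> y i = x i) \<and> y \<in> C}"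
  using assms
proof (induction W arbitrary: C rule: finite_induct)
  case empty
  have "{x. \<exists>y. (\<forall>i. i \<notin> {} \<longrightarrow> y i = x i) \<and> y \<in> C} = C"
    by (auto simp: fun_eq_iff[symmetric])
  with empty show ?case by simp
next
  case (insert v W)
  have "dset (insert v (W \<union> A)) C" "v \<notin> W \<union> A" using insert by auto
  then have "dset (W \<union> A) {x. \<exists>y. x(v := y) \<in> C}" by (intro fibred_project dset_fibred)
  from insert.IH[OF this] insert.prems
  have "dset A {x. \<exists>y. (\<forall>i. i \<notin> W \<longrightarrow> y i = x i) \<and> (\<exists>z. y(v := z) \<in> C)}" by auto
  moreover have "(\<exists>y. (\<forall>i. i \<notin> W \<longrightarrow> y i = x i) \<and> (\<exists>z. y(v := z) \<in> C)) \<longleftrightarrow>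
      (\<exists>y. (\<forall>i. i \<notin> insert v W \<longrightarrow> y i = x i) \<and> y \<in> C)" for x
  proof
    assume "\<exists>y. (\<forall>i. i \<notin> W \<longrightarrow> y i = x i) \<and> (\<exists>z. y(v := z) \<in> C)"
    then obtain y z where "\<forall>i. i \<notin> W \<longrightarrow> y i = x i" "y(v := z) \<in> C" by blast
    then show "\<exists>y. (\<forall>i. i \<notin> insert v W \<longrightarrow> y i = x i) \<and> y \<in> C"
      by (intro exI[of _ "y(v := z)"]) auto
  next
    assume "\<exists>y. (\<forall>i. i \<notin> insert v W \<longrightarrow> y i = x i) \<and> y \<in> C"
    then obtain y where y: "\<forall>i. i \<notin> insert v W \<longrightarrow> y i = x i" "y \<in> C" by blast
    have "(y(v := x v))(v := y v) = y" by auto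
    with y show "\<exists>y. (\<forall>i. i \<notin> W \<longrightarrow> y i = x i) \<and> (\<exists>z. y(v := z) \<in> C)"
      using insert.hyps(2) by (intro exI[of _ "y(v := x v)"]) (auto intro: exI[of _ "y v"])
  qed
  ultimately show ?case by simp
qed

section \<open>Decomposition of constructible sets into triangular cells\<close>

definition simple_root :: "(('v \<Rightarrow> complex) \<Rightarrow> complex) \<Rightarrow> 'v \<Rightarrow> ('v \<Rightarrow> complex) \<Rightarrow> bool" where
  "simple_root f v x \<longleftrightarrow> f x = 0 \<and>
     (\<exists>D. D \<noteq> 0 \<and> ((\<lambda>y. f (x(v := y))) has_field_derivative D) (at (x v)))"

text \<open>On each piece of a finite cover the coefficients are fractions of polynomials;
  \<open>b\<close> is the product of all their denominators.\<close>

lemma pfam_clear_denominators: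
  assumes "pfam A p" "v \<notin> A"
  shows "covered A (\<lambda>X. \<exists>f\<in>polyf (insert v A). \<exists>b\<in>polyf A.
    \<forall>x\<in>X. b x \<noteq> 0 \<and> (\<forall>y. f (x(v := y)) = b x * poly (p x) y))"
proof -
  obtain d where d: "\<And>x. degree (p x) \<le> d" using assms by (auto simp: pfam_def)
  have "covered A (\<lambda>X. \<forall>i\<in>{..d}. \<exists>a\<in>polyf A. \<exists>b\<in>polyf A. \<forall>x\<in>X. b x \<noteq> 0 \<and> coeff (p x) i = a x / b x)"
  proof (rule covered_ball)
    show "covered A (\<lambda>X. \<exists>a\<in>polyf A. \<exists>b\<in>polyf A. \<forall>x\<in>X. b x \<noteq> 0 \<and> coeff (p x) i = a x / b x)" for i
      by (rule ratf_piecewise[OF pfam_coeff[OF assms(1)]])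
  qed auto
  moreover have "\<exists>f\<in>polyf (insert v A). \<exists>b\<in>polyf A.
      \<forall>x\<in>X. b x \<noteq> 0 \<and> (\<forall>y. f (x(v := y)) = b x * poly (p x) y)"
    if "\<forall>i\<in>{..d}. \<exists>a\<in>polyf A. \<exists>b\<in>polyf A. \<forall>x\<in>X. b x \<noteq> 0 \<and> coeff (p x) i = a x / b x" for X
  proof -
    from that obtain a b where ab: "\<And>i. i \<le> d \<Longrightarrow> a i \<in> polyf A" "\<And>i. i \<le> d \<Longrightarrow> b i \<in> polyf A"
      "\<And>i x. i \<le> d \<Longrightarrow> x \<in> X \<Longrightarrow> b i x \<noteq> 0 \<and> coeff (p x) i = a i x / b i x"
      by (metis atMost_iff)
    define c where "c i x = a i x * (\<Prod>j\<in>{..d} - {i}. b j x)" for i x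
    have c: "c i \<in> polyf A" if "i \<le> d" for i
      unfolding c_def by (intro polyf_mult polyf_prod ab) (use that in auto)
    define f where "f x = (\<Sum>i\<le>d. c i x * x v ^ i)" for x
    have 1: "f \<in> polyf (insert v A)" unfolding f_def
      by (intro polyf_sum polyf_mult polyf_power polyf_var) (auto intro: polyf_mono[OF c])
    have 2: "(\<lambda>x. \<Prod>j\<le>d. b j x) \<in> polyf A" by (intro polyf_prod ab) auto
    have "(\<Prod>j\<le>d. b j x) \<noteq> 0 \<and> (\<forall>y. f (x(v := y)) = (\<Prod>j\<le>d. b j x) * poly (p x) y)"
      if x: "x \<in> X" for x
    proof (intro conjI allI)
      show "(\<Prod>j\<le>d. b j x) \<noteq> 0" using ab(3) x by auto
      fix y
      have ci: "c i x = (\<Prod>j\<le>d. b j x) * coeff (p x) i" if "i \<le> d" for i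
        using ab(3)[OF that x] that by (simp add: c_def prod.remove[of "{..d}" i])
      have "c i (x(v := y)) = c i x" if "i \<le> d" for i
        by (rule polyf_cong[OF c[OF that]]) (use assms(2) in auto)
      then have "f (x(v := y)) = (\<Sum>i\<le>d. c i x * y ^ i)" by (simp add: f_def)
      also have "\<dots> = (\<Prod>j\<le>d. b j x) * (\<Sum>i\<le>d. coeff (p x) i * y ^ i)"
        by (simp add: ci sum_distrib_left mult.assoc)
      also have "(\<Sum>i\<le>d. coeff (p x) i * y ^ i) = poly (p x) y"
        using d[of x] poly_altdef[of "p x" y]
          sum.mono_neutral_left[of "{..d}" "{..degree (p x)}" "\<lambda>i. coeff (p x) i * y ^ i"]
        by (auto simp: coeff_eq_0)
      finally show "f (x(v := y)) = (\<Prod>j\<le>d. b j x) * poly (p x) y" .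
    qed
    then have "\<forall>x\<in>X. (\<Prod>j\<le>d. b j x) \<noteq> 0 \<and> (\<forall>y. f (x(v := y)) = (\<Prod>j\<le>d. b j x) * poly (p x) y)"
      by simp
    then have "\<exists>b\<in>polyf A. \<forall>x\<in>X. b x \<noteq> 0 \<and> (\<forall>y. f (x(v := y)) = b x * poly (p x) y)"
      by (rule bexI[where x = "\<lambda>x. \<Prod>j\<le>d. b j x"]) (rule 2)
    then show ?thesis by (rule bexI[where x = f]) (rule 1)
  qed
  ultimately show ?thesis by (rule covered_mono)
qed

text \<open>Cells over the variables listed in \<open>vs\<close>: those in \<open>J\<close> range over nonempty Zariski open sets,
  the others are simple roots of polynomials in their predecessors.\<close>

inductive tri :: "'v list \<Rightarrow> 'v set \<Rightarrow> ('v \<Rightarrow> complex) set \<Rightarrow> bool" where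
  tri_Nil: "tri [] {} UNIV"
| tri_free: "tri vs J C \<Longrightarrow> v \<notin> set vs \<Longrightarrow> g \<in> polyf (insert v (set vs)) \<Longrightarrow>
    tri (vs @ [v]) (insert v J) (C \<inter> {x. g x \<noteq> 0})"
| tri_root: "tri vs J C \<Longrightarrow> v \<notin> set vs \<Longrightarrow> f \<in> polyf (insert v (set vs)) \<Longrightarrow>
    (\<And>x. x \<in> C \<Longrightarrow> f x = 0 \<Longrightarrow> simple_root f v x) \<Longrightarrow>
    tri (vs @ [v]) J (C \<inter> {x. f x = 0})"

definition cellular :: "'v list \<Rightarrow> ('v \<Rightarrow> complex) set \<Rightarrow> bool" where
  "cellular vs X \<longleftrightarrow> (\<exists>F. finite F \<and> (\<forall>C\<in>F. \<exists>J. tri vs J C) \<and> X = \<Union>F)"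

lemma cellular_UN:
  assumes "finite I" "\<And>i. i \<in> I \<Longrightarrow> cellular vs (X i)"
  shows "cellular vs (\<Union>i\<in>I. X i)"
proof -
  obtain F where "\<And>i. i \<in> I \<Longrightarrow> finite (F i) \<and> (\<forall>C\<in>F i. \<exists>J. tri vs J C) \<and> X i = \<Union>(F i)"
    using assms(2) unfolding cellular_def by metis
  then have "finite (\<Union>i\<in>I. F i) \<and> (\<forall>C\<in>(\<Union>i\<in>I. F i). \<exists>J. tri vs J C) \<and>
      (\<Union>i\<in>I. X i) = \<Union>(\<Union>i\<in>I. F i)" using assms(1) by auto
  then show ?thesis unfolding cellular_def by (rule exI)
qed

text \<open>Induction on the last variable: finite fibres give root cells, cofinite ones give free
  cells. The squarefree part is taken so that the roots are simple.\<close>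

lemma dset_cellular:
  "distinct vs \<Longrightarrow> dset (set vs) X \<Longrightarrow> cellular vs X"
proof (induction vs arbitrary: X rule: rev_induct)
  case Nil
  have "x \<in> X \<longleftrightarrow> y \<in> X" for x y using dset_cong[of "{}" X x y] Nil by simp
  then have "X = {} \<or> X = UNIV" by auto
  then show ?case
  proof
    assume "X = {}"
    then show ?thesis unfolding cellular_def by (intro exI[of _ "{}"]) simp
  next
    assume "X = UNIV"
    then show ?thesis unfolding cellular_def
      by (intro exI[of _ "{UNIV}"]) (auto intro: tri_Nil)
  qed
next
  case (snoc v vs)
  let ?A = "set vs"
  have v: "v \<notin> ?A" and d: "dset (insert v ?A) X" using snoc.prems by auto
  obtain p0 B where p0: "pfam ?A p0" "dset ?A B" "\<And>x. p0 x \<noteq> 0"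
    "\<And>x y. x(v := y) \<in> X \<longleftrightarrow> (if x \<in> B then poly (p0 x) y = 0 else poly (p0 x) y \<noteq> 0)"
    using dset_fibred[OF d v] by (auto simp: fibred_def)
  obtain p where p: "pfam ?A p" "\<And>x. p x \<noteq> 0" "\<And>x y. poly (p x) y = 0 \<longleftrightarrow> poly (p0 x) y = 0"
    "\<And>x y. poly (p x) y = 0 \<Longrightarrow> poly (pderiv (p x)) y \<noteq> 0"
    using pfam_squarefree[OF p0(1,3)] by blast
  from pfam_clear_denominators[OF p(1) v]
  obtain F where F: "finite F" "F \<subseteq> constr ?A" "\<Union>F = UNIV"
    "\<forall>Y\<in>F. \<exists>f\<in>polyf (insert v ?A). \<exists>b\<in>polyf ?A.
       \<forall>x\<in>Y. b x \<noteq> 0 \<and> (\<forall>y. f (x(v := y)) = b x * poly (p x) y)" by (auto simp: covered_def)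
  have X: "x \<in> X \<longleftrightarrow> (if x \<in> B then poly (p x) (x v) = 0 else poly (p x) (x v) \<noteq> 0)" for x
    using p0(4)[of x "x v"] p(3) by simp
  have "cellular (vs @ [v]) (X \<inter> Y)" if Y: "Y \<in> F" for Y
  proof -
    obtain f where f: "f \<in> polyf (insert v ?A)" and
      "\<exists>b\<in>polyf ?A. \<forall>x\<in>Y. b x \<noteq> 0 \<and> (\<forall>y. f (x(v := y)) = b x * poly (p x) y)"
      using bspec[OF F(4) Y] by (rule bexE)
    from this(2) obtain b where
      b: "\<forall>x\<in>Y. b x \<noteq> 0 \<and> (\<forall>y. f (x(v := y)) = b x * poly (p x) y)" by (rule bexE)
    have fb: "b x \<noteq> 0 \<and> f (x(v := y)) = b x * poly (p x) y" if "x \<in> Y" for x y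
      using b that by simp
    have f0: "f x = 0 \<longleftrightarrow> poly (p x) (x v) = 0" if "x \<in> Y" for x
      using fb[OF that, of "x v"] by simp
    have simple: "simple_root f v x" if "x \<in> Y" "f x = 0" for x
      unfolding simple_root_def
    proof (intro conjI exI that)
      have "f (x(v := y)) = b x * poly (p x) y" for y using fb[OF that(1)] by blast
      moreover have "((\<lambda>y. b x * poly (p x) y) has_field_derivative b x * poly (pderiv (p x)) (x v)) (at (x v))"
        by (auto intro!: derivative_eq_intros)
      ultimately show "((\<lambda>y. f (x(v := y))) has_field_derivative b x * poly (pderiv (p x)) (x v)) (at (x v))"
        by simp
      show "b x * poly (pderiv (p x)) (x v) \<noteq> 0"
        using p(4)[of x "x v"] f0[OF that(1)] that(2) fb[OF that(1)] by simp
    qed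
    have dY: "dset ?A Y" using F(2) Y by (intro constr_imp_dset) (rule subsetD)
    have "distinct vs" using snoc.prems by simp
    obtain G where G: "finite G" "\<And>C. C \<in> G \<Longrightarrow> \<exists>J. tri vs J C" "Y \<inter> B = \<Union>G"
      using snoc.IH[OF \<open>distinct vs\<close> dset_Int[OF dY p0(2)]] by (auto simp: cellular_def)
    obtain H where H: "finite H" "\<And>C. C \<in> H \<Longrightarrow> \<exists>J. tri vs J C" "Y - B = \<Union>H"
      using snoc.IH[OF \<open>distinct vs\<close> dset_Diff[OF dY p0(2)]] by (auto simp: cellular_def)
    have 1: "\<exists>J. tri (vs @ [v]) J (C \<inter> {x. f x = 0})" if C: "C \<in> G" for C
    proof -
      obtain J where "tri vs J C" using G(2)[OF C] ..
      moreover have "C \<subseteq> Y" using C G(3) by blast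
      ultimately have "tri (vs @ [v]) J (C \<inter> {x. f x = 0})"
        by (intro tri_root[OF _ v f] simple) auto
      then show ?thesis ..
    qed
    have 2: "\<exists>J. tri (vs @ [v]) J (C \<inter> {x. f x \<noteq> 0})" if C: "C \<in> H" for C
    proof -
      obtain J where "tri vs J C" using H(2)[OF C] ..
      from tri_free[OF this v f] show ?thesis ..
    qed
    let ?F = "(\<lambda>C. C \<inter> {x. f x = 0}) ` G \<union> (\<lambda>C. C \<inter> {x. f x \<noteq> 0}) ` H"
    have "X \<inter> Y = ((Y \<inter> B) \<inter> {x. f x = 0}) \<union> ((Y - B) \<inter> {x. f x \<noteq> 0})"
    proof (rule set_eqI)
      show "x \<in> X \<inter> Y \<longleftrightarrow> x \<in> ((Y \<inter> B) \<inter> {x. f x = 0}) \<union> ((Y - B) \<inter> {x. f x \<noteq> 0})" for x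
        using X[of x] f0[of x] by (cases "x \<in> B") auto
    qed
    also have "\<dots> = \<Union>?F" unfolding G(3) H(3) by auto
    finally have "finite ?F \<and> (\<forall>C\<in>?F. \<exists>J. tri (vs @ [v]) J C) \<and> X \<inter> Y = \<Union>?F"
      using G(1) H(1) 1 2 by (intro conjI) auto
    then show ?thesis unfolding cellular_def by (rule exI)
  qed
  then have "cellular (vs @ [v]) (\<Union>Y\<in>F. X \<inter> Y)" by (intro cellular_UN F)
  moreover have "(\<Union>Y\<in>F. X \<inter> Y) = X" using F(3) by auto
  ultimately show ?case by simp
qed

text \<open>Take the squarefree part of \<open>P\<close> as a polynomial in \<open>v\<close> and
  clear denominators on the generic piece of the resulting cover. It replaces an algebraic relation
  by one to which the inverse function theorem applies.\<close>

lemma simple_root_cover: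
  assumes P: "P \<in> polyf (insert v A)" and v: "v \<notin> A" and nz: "P a \<noteq> 0"
  obtains Q R where "Q \<in> polyf A" "\<exists>x. Q x \<noteq> 0" "R \<in> polyf (insert v A)"
    "\<And>x. Q x \<noteq> 0 \<Longrightarrow> P x = 0 \<Longrightarrow> simple_root R v x"
proof -
  obtain p d where p: "\<And>x. degree (p x) \<le> d" "\<And>i. (\<lambda>x. coeff (p x) i) \<in> polyf A"
    "\<And>x y. P (x(v := y)) = poly (p x) y" using polyf_family[OF P v] by blast
  have pf: "pfam A p" using p(1,2) by (auto simp: pfam_def intro: polyf_imp_ratf)
  have "p a \<noteq> 0" using p(3)[of a "a v"] nz by auto
  then obtain i where i: "coeff (p a) i \<noteq> 0" by (metis coeff_0 poly_eqI)
  define q where "q x = (if p x = 0 then 1 else p x)" for x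
  have "pfam A q" unfolding q_def by (intro pfam_if dset_pfam_eq_0 pf pfam_const)
  moreover have "q x \<noteq> 0" for x by (auto simp: q_def)
  ultimately obtain s where s: "pfam A s" "\<And>x y. poly (s x) y = 0 \<longleftrightarrow> poly (q x) y = 0"
    "\<And>x y. poly (s x) y = 0 \<Longrightarrow> poly (pderiv (s x)) y \<noteq> 0"
    using pfam_squarefree by metis
  obtain X where X: "generic A X" "\<exists>f\<in>polyf (insert v A). \<exists>b\<in>polyf A.
       \<forall>x\<in>X. b x \<noteq> 0 \<and> (\<forall>y. f (x(v := y)) = b x * poly (s x) y)"
    by (rule covered_generic[OF pfam_clear_denominators[OF s(1) v]])
  from X(2) obtain f where f0: "f \<in> polyf (insert v A)" and
    "\<exists>b\<in>polyf A. \<forall>x\<in>X. b x \<noteq> 0 \<and> (\<forall>y. f (x(v := y)) = b x * poly (s x) y)" by (rule bexE)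
  from this(2) obtain b where
    b: "\<forall>x\<in>X. b x \<noteq> 0 \<and> (\<forall>y. f (x(v := y)) = b x * poly (s x) y)" by (rule bexE)
  have f: "f \<in> polyf (insert v A)" "\<And>x y. x \<in> X \<Longrightarrow> b x \<noteq> 0 \<and> f (x(v := y)) = b x * poly (s x) y"
    using f0 b by simp_all
  \<comment> \<open>A nonvanishing coefficient ensures that \<open>p x\<close> is not the zero
    polynomial, so that \<open>q x\<close> is \<open>p x\<close>.\<close>
  have "generic A (X \<inter> {x. coeff (p x) i \<noteq> 0})"
    using generic_neq[OF p(2)[of i], of a] i X(1) by (intro generic_Int) auto
  then obtain Q where Q: "Q \<in> polyf A" "\<exists>x. Q x \<noteq> 0"
    "\<And>x. Q x \<noteq> 0 \<Longrightarrow> x \<in> X \<and> coeff (p x) i \<noteq> 0" by (auto simp: generic_def)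
  have "simple_root f v x" if "Q x \<noteq> 0" "P x = 0" for x
  proof -
    have x: "x \<in> X" "p x \<noteq> 0" using Q(3)[OF that(1)] by auto
    have "poly (q x) (x v) = 0" using p(3)[of x "x v"] that x by (simp add: q_def)
    then have 1: "poly (s x) (x v) = 0" by (simp add: s)
    have fy: "f (x(v := y)) = b x * poly (s x) y" for y using f(2) x by blast
    have "((\<lambda>y. b x * poly (s x) y) has_field_derivative b x * poly (pderiv (s x)) (x v)) (at (x v))"
      by (auto intro!: derivative_eq_intros)
    moreover have "b x * poly (pderiv (s x)) (x v) \<noteq> 0" using s(3)[OF 1] f(2) x by auto
    moreover have "f x = 0" using fy[of "x v"] 1 by simp
    ultimately show ?thesis unfolding simple_root_def fy by blast
  qed
  then show ?thesis using that[OF Q(1,2) f(1)] by blast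
qed

section \<open>Etale charts\<close>

lemma has_derivative_vec_lambda:
  fixes f :: "'k::finite \<Rightarrow> 'a::real_normed_vector \<Rightarrow> 'b::euclidean_space"
  assumes "\<And>i. (f i has_derivative D i) (at x within S)"
  shows "((\<lambda>x. \<chi> i. f i x) has_derivative (\<lambda>u. \<chi> i. D i u)) (at x within S)"
proof -
  have "((\<lambda>x. (\<chi> i. f i x) \<bullet> b) has_derivative (\<lambda>u. (\<chi> i. D i u) \<bullet> b)) (at x within S)"
    if b: "b \<in> Basis" for b :: "'b ^ 'k"
  proof -
    obtain i c where "b = axis i c" using b by (auto simp: Basis_vec_def)
    then show ?thesis using has_derivative_inner_left[OF assms[of i], of c] by (simp add: inner_axis)
  qed
  then show ?thesis using has_derivative_componentwise_within[of "\<lambda>x. \<chi> i. f i x"] by blast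
qed

section \<open>Partial derivatives of polynomials\<close>

definition pd :: "(('v \<Rightarrow> complex) \<Rightarrow> complex) \<Rightarrow> 'v \<Rightarrow> ('v \<Rightarrow> complex) \<Rightarrow> complex" where
  "pd f i x = deriv (\<lambda>y. f (x(i := y))) (x i)"

lemma polyf_derivative_exists:
  fixes A :: "'k::finite set"
  assumes "f \<in> polyf A"
  shows "\<exists>d. (\<forall>i. d i \<in> polyf A) \<and>
    (\<forall>z. ((\<lambda>z. f (vec_nth z)) has_derivative (\<lambda>u. \<Sum>i\<in>UNIV. d i (vec_nth z) * u $ i)) (at z))"
  using assms
proof (induction rule: polyf.induct)
  case (polyf_const c)
  show ?case by (intro exI[of _ "\<lambda>i x. 0"]) (auto intro: polyf.polyf_const)
next
  case (polyf_var i)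
  have "(\<lambda>x::'k \<Rightarrow> complex. if j = i then 1 else 0) \<in> polyf A" for j by (rule polyf.polyf_const)
  moreover have "((\<lambda>z::complex^'k. z $ i) has_derivative
      (\<lambda>u. \<Sum>j\<in>UNIV. (if j = i then 1 else 0) * u $ j)) (at z)" for z
    by (simp add: if_distrib[of "\<lambda>x. x * _"] bounded_linear_vec_nth bounded_linear_imp_has_derivative
        cong: if_cong)
  ultimately show ?case by (intro exI[of _ "\<lambda>j x. if j = i then 1 else 0"]) auto
next
  case (polyf_add f g)
  then obtain d e where *: "\<And>i. d i \<in> polyf A" "\<And>i. e i \<in> polyf A"
    "\<And>z. ((\<lambda>z. f (vec_nth z)) has_derivative (\<lambda>u. \<Sum>i\<in>UNIV. d i (vec_nth z) * u $ i)) (at z)"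
    "\<And>z. ((\<lambda>z. g (vec_nth z)) has_derivative (\<lambda>u. \<Sum>i\<in>UNIV. e i (vec_nth z) * u $ i)) (at z)"
    by auto
  have "((\<lambda>z. f (vec_nth z) + g (vec_nth z)) has_derivative
      (\<lambda>u. \<Sum>i\<in>UNIV. (d i (vec_nth z) + e i (vec_nth z)) * u $ i)) (at z)" for z
    using has_derivative_add[OF *(3,4)] by (simp add: ring_distribs sum.distrib)
  then show ?case using * by (intro exI[of _ "\<lambda>i x. d i x + e i x"]) (auto intro: polyf.polyf_add)
next
  case (polyf_mult f g)
  then obtain d e where *: "\<And>i. d i \<in> polyf A" "\<And>i. e i \<in> polyf A"
    "\<And>z. ((\<lambda>z. f (vec_nth z)) has_derivative (\<lambda>u. \<Sum>i\<in>UNIV. d i (vec_nth z) * u $ i)) (at z)"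
    "\<And>z. ((\<lambda>z. g (vec_nth z)) has_derivative (\<lambda>u. \<Sum>i\<in>UNIV. e i (vec_nth z) * u $ i)) (at z)"
    by auto
  have "((\<lambda>z. f (vec_nth z) * g (vec_nth z)) has_derivative
      (\<lambda>u. \<Sum>i\<in>UNIV. (f (vec_nth z) * e i (vec_nth z) + d i (vec_nth z) * g (vec_nth z)) * u $ i)) (at z)" for z
    using has_derivative_mult[OF *(3,4)]
    by (simp add: ring_distribs sum.distrib sum_distrib_left sum_distrib_right mult_ac)
  moreover have "(\<lambda>x. f x * e i x + d i x * g x) \<in> polyf A" for i
    by (intro polyf.polyf_add polyf.polyf_mult * polyf_mult.hyps)
  ultimately show ?case by (intro exI[of _ "\<lambda>i x. f x * e i x + d i x * g x"]) auto
qed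

lemma fun_upd_vec: "vec_nth (z + axis i t) = (vec_nth z)(i := z $ i + t)" for z :: "complex^'k::finite"
  by (auto simp: axis_def fun_eq_iff)

lemma
  fixes A :: "'k::finite set"
  assumes "f \<in> polyf A"
  shows pd_polyf: "pd f i \<in> polyf A"
    and polyf_has_derivative: "((\<lambda>z. f (vec_nth z)) has_derivative
      (\<lambda>u. \<Sum>i\<in>UNIV. pd f i (vec_nth z) * u $ i)) (at z)"
    and polyf_has_field_derivative:
      "((\<lambda>y. f (x(i := y))) has_field_derivative pd f i x) (at (x i))"
proof -
  obtain d where d: "\<And>i. d i \<in> polyf A"
    "\<And>z. ((\<lambda>z. f (vec_nth z)) has_derivative (\<lambda>u. \<Sum>i\<in>UNIV. d i (vec_nth z) * u $ i)) (at z)"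
    using polyf_derivative_exists[OF assms] by blast
  have *: "((\<lambda>y. f (x(i := y))) has_field_derivative d i x) (at (x i))" for i and x :: "'k \<Rightarrow> complex"
  proof -
    define z :: "complex^'k" where "z = (\<chi> j. x j)"
    have x: "vec_nth z = x" by (auto simp: z_def)
    have 1: "((\<lambda>y. z + axis i (y - x i)) has_derivative (\<lambda>t. axis i t)) (at (x i))"
    proof -
      have "((\<lambda>y. \<chi> j. if j = i then y else z $ j) has_derivative (\<lambda>t. \<chi> j. if j = i then t else 0)) (at (x i))"
      proof (rule has_derivative_vec_lambda)
        show "((\<lambda>y. if j = i then y else z $ j) has_derivative (\<lambda>t. if j = i then t else 0)) (at (x i))" for j
          by (cases "j = i") simp_all
      qed
      moreover have "(\<lambda>y. \<chi> j. if j = i then y else z $ j) = (\<lambda>y. z + axis i (y - x i))"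
        by (auto simp: axis_def vec_eq_iff x)
      ultimately show ?thesis by (simp add: axis_def)
    qed
    from has_derivative_compose[OF 1 d(2)]
    have "((\<lambda>y. f (vec_nth (z + axis i (y - x i)))) has_derivative
        (\<lambda>t. \<Sum>j\<in>UNIV. d j (vec_nth (z + axis i (x i - x i))) * axis i t $ j)) (at (x i))" .
    moreover have "z + axis i (x i - x i) = z" by (simp add: axis_def vec_eq_iff)
    ultimately have "((\<lambda>y. f (vec_nth (z + axis i (y - x i)))) has_derivative
        (\<lambda>t. \<Sum>j\<in>UNIV. d j x * axis i t $ j)) (at (x i))"
      by (simp only: x)
    moreover have "(\<lambda>t. \<Sum>j\<in>UNIV. d j x * axis i t $ j) = (\<lambda>t. d i x * t)"
      by (auto simp: axis_def if_distrib cong: if_cong)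
    moreover have "vec_nth (z + axis i (y - x i)) = x(i := y)" for y
      unfolding fun_upd_vec x by simp
    ultimately show ?thesis by (simp add: has_field_derivative_def)
  qed
  then have pd: "pd f i = d i" for i unfolding pd_def by (intro ext DERIV_imp_deriv)
  show "pd f i \<in> polyf A" by (simp add: pd d)
  show "((\<lambda>z. f (vec_nth z)) has_derivative (\<lambda>u. \<Sum>i\<in>UNIV. pd f i (vec_nth z) * u $ i)) (at z)"
    using d(2) by (simp add: pd)
  show "((\<lambda>y. f (x(i := y))) has_field_derivative pd f i x) (at (x i))"
    unfolding pd by (rule *)
qed

lemma pd_eq_0:
  assumes "f \<in> polyf A" "i \<notin> A" shows "pd f i x = 0"
proof -
  have "f (x(i := y)) = f x" for y by (rule polyf_cong[OF assms(1)]) (use assms(2) in auto)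
  then show ?thesis by (simp add: pd_def)
qed

lemma simple_root_pd: "simple_root f v x \<Longrightarrow> f x = 0 \<and> pd f v x \<noteq> 0"
  unfolding simple_root_def pd_def using DERIV_imp_deriv by blast

lemma polyf_continuous:
  fixes A :: "'k::finite set"
  assumes "f \<in> polyf A" shows "continuous_on S (\<lambda>z. f (vec_nth z))"
  using polyf_has_derivative[OF assms] has_derivative_continuous continuous_at_imp_continuous_on
  by blast

lemma open_polyf_neq_0:
  fixes A :: "'k::finite set"
  shows "f \<in> polyf A \<Longrightarrow> open {z. f (vec_nth z) \<noteq> 0}"
  using polyf_continuous[of f A UNIV] by (intro open_Collect_neq) auto

text \<open>Straightens the common zero set of the \<open>F k\<close> with \<open>k\<close> outside
  \<open>J\<close> to the coordinate subspace \<open>Lsub J\<close>; the coordinates in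
  \<open>J\<close> are the local parameters.\<close>

definition chart :: "'k::finite set \<Rightarrow> ('k \<Rightarrow> ('k \<Rightarrow> complex) \<Rightarrow> complex) \<Rightarrow> complex^'k \<Rightarrow> complex^'k" where
  "chart J F z = (\<chi> k. if k \<in> J then z $ k else F k (vec_nth z))"

definition dchart :: "'k::finite set \<Rightarrow> ('k \<Rightarrow> ('k \<Rightarrow> complex) \<Rightarrow> complex) \<Rightarrow> complex^'k \<Rightarrow> complex^'k \<Rightarrow> complex^'k" where
  "dchart J F z u = (\<chi> k. if k \<in> J then u $ k else \<Sum>i\<in>UNIV. pd (F k) i (vec_nth z) * u $ i)"

lemma chart_has_derivative:
  assumes "\<And>k. F k \<in> polyf UNIV"
  shows "(chart J F has_derivative dchart J F z) (at z)"
proof -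
  have "((\<lambda>z. if k \<in> J then z $ k else F k (vec_nth z)) has_derivative
      (\<lambda>u. if k \<in> J then u $ k else \<Sum>i\<in>UNIV. pd (F k) i (vec_nth z) * u $ i)) (at z)" for k
    using polyf_has_derivative[OF assms[of k], of z] bounded_linear_vec_nth[of k]
    by (cases "k \<in> J") (auto intro: bounded_linear_imp_has_derivative)
  from has_derivative_vec_lambda[OF this] show ?thesis
    unfolding chart_def[abs_def] dchart_def[abs_def] .
qed

lemma dchart_linear: "linear (dchart J F z)"
  by (rule linearI) (auto simp: dchart_def vec_eq_iff ring_distribs sum.distrib scaleR_sum_right)

lemma dchart_scale: "dchart J F z (c *s u) = c *s dchart J F z u"
  by (auto simp: dchart_def vec_eq_iff sum_distrib_left mult_ac)

lemma dchart_continuous: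
  assumes F: "\<And>k. F k \<in> polyf UNIV"
  shows "continuous_on N (\<lambda>w. dchart J F w u)"
proof -
  have "continuous_on N (\<lambda>w. if k \<in> J then u $ k else \<Sum>i\<in>UNIV. pd (F k) i (vec_nth w) * u $ i)" for k
    by (cases "k \<in> J") (auto intro!: continuous_intros polyf_continuous[OF pd_polyf[OF F]])
  then show ?thesis unfolding dchart_def by (rule continuous_on_vec_lambda)
qed

text \<open>The name refers to the projection of the common zero set to the coordinates in
  \<open>J\<close>, which is then a local isomorphism at \<open>z\<close>.\<close>

definition etale :: "'k::finite set \<Rightarrow> ('k \<Rightarrow> ('k \<Rightarrow> complex) \<Rightarrow> complex) \<Rightarrow> complex^'k \<Rightarrow> bool" where
  "etale J F z \<longleftrightarrow> (\<forall>k. F k \<in> polyf UNIV) \<and> (\<forall>k. k \<notin> J \<longrightarrow> F k (vec_nth z) = 0) \<and>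
     (\<forall>u. dchart J F z u = 0 \<longrightarrow> u = 0)"

definition local_inverse where
  "local_inverse J F U W \<Psi> \<Psi>' \<longleftrightarrow> open U \<and> open W \<and> chart J F ` U = W \<and>
     (\<forall>w\<in>U. \<Psi> (chart J F w) = w) \<and> (\<forall>y\<in>W. \<Psi> y \<in> U \<and> chart J F (\<Psi> y) = y) \<and>
     (\<forall>y\<in>W. (\<Psi> has_derivative \<Psi>' y) (at y) \<and>
        (\<forall>v. dchart J F (\<Psi> y) (\<Psi>' y v) = v \<and> \<Psi>' y (dchart J F (\<Psi> y) v) = v))"

lemma local_inverseD:
  assumes "local_inverse J F U W \<Psi> \<Psi>'"
  shows "open U" "open W" "chart J F ` U = W"
    "\<And>w. w \<in> U \<Longrightarrow> \<Psi> (chart J F w) = w" "\<And>y. y \<in> W \<Longrightarrow> \<Psi> y \<in> U \<and> chart J F (\<Psi> y) = y"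
    "\<And>y. y \<in> W \<Longrightarrow> (\<Psi> has_derivative \<Psi>' y) (at y)"
    "\<And>y v. y \<in> W \<Longrightarrow> dchart J F (\<Psi> y) (\<Psi>' y v) = v"
    "\<And>y v. y \<in> W \<Longrightarrow> \<Psi>' y (dchart J F (\<Psi> y) v) = v"
  using assms unfolding local_inverse_def by auto

lemma etale_chart:
  fixes J :: "'k::finite set"
  assumes et: "etale J F z" and N: "open N" "z \<in> N"
  obtains U W \<Psi> \<Psi>' where "local_inverse J F U W \<Psi> \<Psi>'" "z \<in> U" "U \<subseteq> N"
proof -
  have F: "\<And>k. F k \<in> polyf UNIV" and inj: "\<And>u. dchart J F z u = 0 \<Longrightarrow> u = 0"
    using et by (auto simp: etale_def)
  define D where "D w = Blinfun (dchart J F w)" for w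
  have D: "blinfun_apply (D w) = dchart J F w" for w
    unfolding D_def by (rule bounded_linear_Blinfun_apply)
      (rule linear_conv_bounded_linear[THEN iffD1, OF dchart_linear])
  have "inj (dchart J F z)"
    using inj by (simp add: linear_injective_0[OF dchart_linear])
  then obtain h where h: "linear h" "h \<circ> dchart J F z = id"
    using linear_injective_left_inverse[OF dchart_linear] by blast
  have inv: "Blinfun h o\<^sub>L D z = id_blinfun"
    using h by (auto simp: blinfun_eqI D bounded_linear_Blinfun_apply linear_conv_bounded_linear
        fun_eq_iff intro!: blinfun_eqI)
  have cont: "continuous_on N D"
    by (rule continuous_on_blinfun_componentwise) (simp add: D dchart_continuous[OF F])
  have der: "\<And>w. w \<in> N \<Longrightarrow> (chart J F has_derivative blinfun_apply (D w)) (at w)"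
    unfolding D by (rule chart_has_derivative[OF F])
  show thesis
  proof (rule inverse_function_theorem[OF N(1) der cont N(2) inv])
    fix U W \<Psi> \<Psi>'
    assume *: "open U" "U \<subseteq> N" "z \<in> U" "open W" "chart J F z \<in> W"
      "homeomorphism U W (chart J F) \<Psi>" "\<And>y. y \<in> W \<Longrightarrow> (\<Psi> has_derivative \<Psi>' y) (at y)"
      "\<And>y. y \<in> W \<Longrightarrow> \<Psi>' y = inv (blinfun_apply (D (\<Psi> y)))"
      "\<And>y. y \<in> W \<Longrightarrow> bij (blinfun_apply (D (\<Psi> y)))"
    have "dchart J F (\<Psi> y) (\<Psi>' y v) = v" "\<Psi>' y (dchart J F (\<Psi> y) v) = v" if "y \<in> W" for y v
      using *(8,9)[OF that] by (simp_all add: D bij_is_surj surj_f_inv_f bij_is_inj inv_f_f)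
    then have "local_inverse J F U W \<Psi> \<Psi>'"
      using * unfolding local_inverse_def homeomorphism_def by auto
    then show thesis using that * by blast
  qed auto
qed

section \<open>Coordinate subspaces and sets of bounded real dimension\<close>

definition Lsub :: "'k::finite set \<Rightarrow> (complex^'k) set" where
  "Lsub J = {w. \<forall>k. k \<notin> J \<longrightarrow> w $ k = 0}"

lemma chart_in_Lsub: "chart J F z \<in> Lsub J \<longleftrightarrow> (\<forall>k. k \<notin> J \<longrightarrow> F k (vec_nth z) = 0)"
  by (auto simp: Lsub_def chart_def)

lemma subspace_Lsub: "subspace (Lsub J)"
  by (auto simp: Lsub_def subspace_def)

lemma vec_subspace_Lsub: "vec.subspace (Lsub J)"
  by (auto simp: Lsub_def vec.subspace_def)

lemma vec_dim_Lsub: "vec.dim (Lsub J) = card J"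
  unfolding Lsub_def by (rule dim_substandard_cart)

lemma dim_Lsub: "dim (Lsub J) \<le> 2 * card J"
proof -
  let ?B = "(\<lambda>j. axis j 1) ` J \<union> (\<lambda>j. axis j \<i>) ` J :: (complex^'a) set"
  have "Lsub J \<subseteq> span ?B"
  proof
    fix w :: "complex^'a" assume w: "w \<in> Lsub J"
    have "w = (\<Sum>j\<in>J. Re (w $ j) *\<^sub>R axis j 1 + Im (w $ j) *\<^sub>R axis j \<i>)"
    proof -
      have "Re c *\<^sub>R axis j 1 + Im c *\<^sub>R axis j \<i> = (axis j c :: complex^'a)" for j c
        by (auto simp: vec_eq_iff axis_def complex_eq_iff)
      moreover have "w = (\<Sum>j\<in>J. axis j (w $ j))"
        using w by (auto simp: vec_eq_iff axis_def Lsub_def)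
      ultimately show ?thesis by simp
    qed
    also have "\<dots> \<in> span ?B"
      by (intro span_sum span_add span_scale span_base) auto
    finally show "w \<in> span ?B" .
  qed
  then have "dim (Lsub J) \<le> card ?B" by (intro dim_le_card) auto
  also have "\<dots> \<le> card J + card J"
    by (rule order_trans[OF card_Un_le]) (intro add_mono card_image_le; simp)
  finally show ?thesis by simp
qed

text \<open>A map together with a domain inside a subspace of dimension at most \<open>r\<close>.
  Plain differentiability suffices for images to be negligible in spaces of larger
  dimension.\<close>

definition piece :: "nat \<Rightarrow> ('a::euclidean_space \<Rightarrow> 'a) \<times> 'a set \<Rightarrow> bool" where
  "piece r p \<longleftrightarrow> fst p differentiable_on snd p \<and> (\<exists>T. subspace T \<and> dim T \<le> r \<and> snd p \<subseteq> T)"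

definition piece_image :: "('a \<Rightarrow> 'a) \<times> 'a set \<Rightarrow> 'a set" where
  "piece_image p = fst p ` snd p"

text \<open>This stands in for having real dimension at most \<open>r\<close>.\<close>

definition small :: "'a::euclidean_space set \<Rightarrow> nat \<Rightarrow> bool" where
  "small X r \<longleftrightarrow> (\<exists>G. countable G \<and> (\<forall>p\<in>G. piece r p) \<and> X \<subseteq> (\<Union>p\<in>G. piece_image p))"

lemma small_subset: "small X r \<Longrightarrow> Y \<subseteq> X \<Longrightarrow> small Y r"
  unfolding small_def by (meson subset_trans)

lemma small_mono: "small X r \<Longrightarrow> r \<le> s \<Longrightarrow> small X s"
  unfolding small_def piece_def by (meson order_trans)

lemma small_UN:
  fixes X :: "'i \<Rightarrow> 'a::euclidean_space set"
  assumes "countable I" "\<And>i. i \<in> I \<Longrightarrow> small (X i) r"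
  shows "small (\<Union>i\<in>I. X i) r"
proof -
  obtain G where G: "\<And>i. i \<in> I \<Longrightarrow> countable (G i)" "\<And>i p. i \<in> I \<Longrightarrow> p \<in> G i \<Longrightarrow> piece r p"
    "\<And>i. i \<in> I \<Longrightarrow> X i \<subseteq> (\<Union>p\<in>G i. piece_image p)"
    using assms(2) unfolding small_def by metis
  have "countable (\<Union>i\<in>I. G i)" using assms(1) G(1) by (rule countable_UN)
  moreover have "\<forall>p\<in>(\<Union>i\<in>I. G i). piece r p" using G(2) by auto
  moreover have "(\<Union>i\<in>I. X i) \<subseteq> (\<Union>p\<in>(\<Union>i\<in>I. G i). piece_image p)"
  proof
    fix x assume "x \<in> (\<Union>i\<in>I. X i)"
    then obtain i where i: "i \<in> I" "x \<in> X i" by (rule UN_E)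
    moreover obtain p where "p \<in> G i" "x \<in> piece_image p"
      using subsetD[OF G(3)[OF i(1)] i(2)] by auto
    ultimately show "x \<in> (\<Union>p\<in>(\<Union>i\<in>I. G i). piece_image p)" by auto
  qed
  ultimately show ?thesis unfolding small_def by metis
qed

lemma small_in_subspace:
  assumes "X \<subseteq> T" "subspace T" "dim T \<le> r" shows "small X r"
proof -
  have "piece r (\<lambda>x. x, X)" using assms by (auto simp: piece_def)
  moreover have "X \<subseteq> piece_image (\<lambda>x. x, X)" by (simp add: piece_image_def)
  ultimately show ?thesis unfolding small_def by (intro exI[of _ "{(\<lambda>x. x, X)}"]) simp
qed

text \<open>By Lindelof's theorem countably many of the neighbourhoods suffice.\<close>

lemma small_local:
  assumes "\<And>z. z \<in> X \<Longrightarrow> \<exists>U. open U \<and> z \<in> U \<and> small (X \<inter> U) r"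
  shows "small X r"
proof -
  obtain U where U: "\<And>z. z \<in> X \<Longrightarrow> open (U z) \<and> z \<in> U z \<and> small (X \<inter> U z) r"
    using assms by metis
  obtain F where F: "F \<subseteq> U ` X" "countable F" "\<Union>F = \<Union>(U ` X)"
    using Lindelof[of "U ` X"] U by (metis imageE)
  have "small (\<Union>S\<in>F. X \<inter> S) r" using F(2)
    by (rule small_UN) (use F(1) U in auto)
  moreover have "X \<subseteq> \<Union>F" unfolding F(3) using U by auto
  ultimately show ?thesis by (auto elim!: small_subset)
qed

lemma differentiable_comp_on:
  assumes "g differentiable_on S" "h differentiable_on X" "g ` S \<subseteq> X"
  shows "(\<lambda>x. h (g x)) differentiable_on S"
  by (rule differentiable_on_compose[OF assms(1) differentiable_on_subset[OF assms(2,3)]])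

lemma small_image:
  fixes h :: "'a::euclidean_space \<Rightarrow> 'a"
  assumes "small X r" "h differentiable_on X"
  shows "small (h ` X) r"
proof -
  obtain G where G: "countable G" "\<And>p. p \<in> G \<Longrightarrow> piece r p" "X \<subseteq> (\<Union>p\<in>G. piece_image p)"
    using assms(1) unfolding small_def by metis
  \<comment> \<open>The domain is cut down to the preimage of \<open>X\<close>, because
    \<open>h\<close> is differentiable on \<open>X\<close> only.\<close>
  define q where "q p = (\<lambda>x. h (fst p x), snd p \<inter> fst p -` X)" for p :: "('a \<Rightarrow> 'a) \<times> 'a set"
  have "piece r (q p)" if "p \<in> G" for p
  proof -
    have "(\<lambda>x. h (fst p x)) differentiable_on (snd p \<inter> fst p -` X)"
      by (rule differentiable_comp_on[OF differentiable_on_subset assms(2)])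
        (use G(2)[OF that] in \<open>auto simp: piece_def\<close>)
    then show ?thesis using G(2)[OF that] by (auto simp: piece_def q_def)
  qed
  moreover have "h ` X \<subseteq> (\<Union>p\<in>q ` G. piece_image p)"
  proof
    fix y assume "y \<in> h ` X"
    then obtain x where x: "x \<in> X" "y = h x" by auto
    then obtain p where "p \<in> G" "x \<in> piece_image p" using G(3) by auto
    then show "y \<in> (\<Union>p\<in>q ` G. piece_image p)" using x by (auto simp: piece_image_def q_def)
  qed
  ultimately show ?thesis using G(1) unfolding small_def by (intro exI[of _ "q ` G"]) auto
qed

text \<open>Allows a domain of low dimension to be parametrized by a hyperplane of the target space,
  which is negligible there.\<close>

lemma linear_image_of_hyperplane:
  fixes T :: "'a::euclidean_space set" and b :: "'b::euclidean_space"
  assumes "subspace T" "dim T < DIM('b)" "b \<noteq> 0"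
  obtains A :: "'b \<Rightarrow> 'a" where "linear A" "T \<subseteq> A ` {x. b \<bullet> x = 0}"
proof -
  have H: "subspace {x. b \<bullet> x = 0}" by (rule subspace_hyperplane)
  have "dim T \<le> dim {x. b \<bullet> x = 0}" using assms by (simp add: dim_hyperplane)
  then obtain K where K: "subspace K" "K \<subseteq> span {x. b \<bullet> x = 0}" "dim K = dim T"
    by (rule choose_subspace_of_subspace)
  obtain A :: "'b \<Rightarrow> 'a" where A: "linear A" "A ` K = T"
    using subspace_isomorphism[OF K(1) assms(1) K(3)] by blast
  have "K \<subseteq> {x. b \<bullet> x = 0}" using K(2) span_eq_iff[THEN iffD2, OF H] by simp
  then have "T \<subseteq> A ` {x. b \<bullet> x = 0}" using A(2) by blast
  with A(1) that show ?thesis by blast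
qed

text \<open>Each piece is reparametrized from a hyperplane of the target space, and differentiable
  maps of that space to itself preserve negligible sets.\<close>

lemma small_negligible:
  fixes X :: "'a::euclidean_space set" and h :: "'a \<Rightarrow> 'b::euclidean_space"
  assumes "small X r" "h differentiable_on X" "r < DIM('b)"
  shows "negligible (h ` X)"
proof -
  obtain G where G: "countable G" "\<And>p. p \<in> G \<Longrightarrow> piece r p" "X \<subseteq> (\<Union>p\<in>G. piece_image p)"
    using assms(1) unfolding small_def by metis
  obtain b :: 'b where b: "b \<in> Basis" using nonempty_Basis by blast
  define I where "I p = (\<lambda>x. h (fst p x)) ` (snd p \<inter> fst p -` X)" for p :: "('a \<Rightarrow> 'a) \<times> 'a set"
  have "negligible (I p)" if p: "p \<in> G" for p
  proof -
    obtain T where T: "subspace T" "dim T \<le> r" "snd p \<subseteq> T"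
      using G(2)[OF p] by (auto simp: piece_def)
    have dT: "dim T < DIM('b)" using T(2) assms(3) by simp
    obtain A :: "'b \<Rightarrow> 'a" where A: "linear A" "T \<subseteq> A ` {x. b \<bullet> x = 0}"
      by (rule linear_image_of_hyperplane[OF T(1) dT nonzero_Basis[OF b]])
    define N where "N = {x. b \<bullet> x = 0} \<inter> A -` (snd p \<inter> fst p -` X)"
    have "negligible N" unfolding N_def
      by (rule negligible_subset[OF negligible_hyperplane[of b 0]]) (use b nonzero_Basis in auto)
    moreover have "(\<lambda>x. h (fst p (A x))) differentiable_on N"
    proof (rule differentiable_comp_on[OF linear_imp_differentiable_on[OF A(1)]])
      show "(\<lambda>x. h (fst p x)) differentiable_on (snd p \<inter> fst p -` X)"
        by (rule differentiable_comp_on[OF differentiable_on_subset assms(2)])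
          (use G(2)[OF p] in \<open>auto simp: piece_def\<close>)
    qed (auto simp: N_def)
    ultimately have "negligible ((\<lambda>x. h (fst p (A x))) ` N)"
      by (intro negligible_differentiable_image_negligible) auto
    moreover have "I p \<subseteq> (\<lambda>x. h (fst p (A x))) ` N"
    proof
      fix y assume "y \<in> I p"
      then obtain x where x: "x \<in> snd p" "fst p x \<in> X" "y = h (fst p x)" by (auto simp: I_def)
      then obtain a where "b \<bullet> a = 0" "x = A a" using A(2) T(3) by blast
      then show "y \<in> (\<lambda>x. h (fst p (A x))) ` N"
        using x by (auto simp: N_def)
    qed
    ultimately show ?thesis by (rule negligible_subset)
  qed
  then have "negligible (\<Union>p\<in>G. I p)"
    using G(1) by (intro negligible_countable_Union) auto
  moreover have "h ` X \<subseteq> (\<Union>p\<in>G. I p)"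
  proof
    fix y assume "y \<in> h ` X"
    then obtain x where x: "x \<in> X" "y = h x" by auto
    then obtain p where "p \<in> G" "x \<in> piece_image p" using G(3) by auto
    then show "y \<in> (\<Union>p\<in>G. I p)" using x by (auto simp: piece_image_def I_def)
  qed
  ultimately show ?thesis by (rule negligible_subset)
qed

lemma small_Times:
  assumes "small X r" "small Y s" shows "small (X \<times> Y) (r + s)"
proof -
  obtain G where G: "countable G" "\<And>p. p \<in> G \<Longrightarrow> piece r p" "X \<subseteq> (\<Union>p\<in>G. piece_image p)"
    using assms(1) unfolding small_def by metis
  obtain H where H: "countable H" "\<And>p. p \<in> H \<Longrightarrow> piece s p" "Y \<subseteq> (\<Union>p\<in>H. piece_image p)"
    using assms(2) unfolding small_def by metis
  define k where "k = (\<lambda>(p :: ('a \<Rightarrow> 'a) \<times> 'a set, q :: ('b \<Rightarrow> 'b) \<times> 'b set). (\<lambda>z. (fst p (fst z), fst q (snd z)), snd p \<times> snd q))"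
  have "piece (r + s) (k (p, q))" if p: "p \<in> G" and q: "q \<in> H" for p :: "('a \<Rightarrow> 'a) \<times> 'a set" and q :: "('b \<Rightarrow> 'b) \<times> 'b set"
  proof -
    have "(\<lambda>z. (fst p (fst z), fst q (snd z))) differentiable_on snd p \<times> snd q"
      unfolding differentiable_on_def
    proof
      fix z assume z: "z \<in> snd p \<times> snd q"
      have "fst p differentiable_on snd p" "fst q differentiable_on snd q"
        using G(2)[OF p] H(2)[OF q] by (auto simp: piece_def)
      then obtain g' h' where g': "(fst p has_derivative g') (at (fst z) within snd p)"
        and h': "(fst q has_derivative h') (at (snd z) within snd q)"
        using z unfolding differentiable_on_def differentiable_def by fastforce
      have "fst ` (snd p \<times> snd q) \<subseteq> snd p" "snd ` (snd p \<times> snd q) \<subseteq> snd q" by auto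
      then have "((\<lambda>z. fst p (fst z)) has_derivative (\<lambda>u. g' (fst u))) (at z within snd p \<times> snd q)"
        "((\<lambda>z. fst q (snd z)) has_derivative (\<lambda>u. h' (snd u))) (at z within snd p \<times> snd q)"
        using has_derivative_in_compose[OF has_derivative_fst[OF has_derivative_ident] has_derivative_subset[OF g']]
          has_derivative_in_compose[OF has_derivative_snd[OF has_derivative_ident] has_derivative_subset[OF h']]
        by auto
      from has_derivative_Pair[OF this]
      show "(\<lambda>z. (fst p (fst z), fst q (snd z))) differentiable (at z within snd p \<times> snd q)"
        by (auto simp: differentiable_def)
    qed
    moreover obtain V where V: "subspace V" "dim V \<le> r" "snd p \<subseteq> V"
      using G(2)[OF p] by (auto simp: piece_def)
    moreover obtain V' where V': "subspace V'" "dim V' \<le> s" "snd q \<subseteq> V'"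
      using H(2)[OF q] by (auto simp: piece_def)
    moreover have "subspace (V \<times> V')" "dim (V \<times> V') \<le> r + s" "snd p \<times> snd q \<subseteq> V \<times> V'"
      using V V' by (auto simp: subspace_Times dim_Times)
    ultimately show ?thesis unfolding piece_def k_def by auto
  qed
  moreover have "X \<times> Y \<subseteq> (\<Union>p\<in>k ` (G \<times> H). piece_image p)"
  proof
    fix z assume "z \<in> X \<times> Y"
    then obtain x y where z: "z = (x, y)" "x \<in> X" "y \<in> Y" by auto
    obtain p a where p: "p \<in> G" "a \<in> snd p" "x = fst p a"
      using z(2) G(3) by (auto simp: piece_image_def)
    obtain q b where q: "q \<in> H" "b \<in> snd q" "y = fst q b"
      using z(3) H(3) by (auto simp: piece_image_def)
    have "z \<in> piece_image (k (p, q))"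
      unfolding piece_image_def k_def using z p q by (auto intro!: image_eqI[of _ _ "(a, b)"])
    then show "z \<in> (\<Union>p\<in>k ` (G \<times> H). piece_image p)" using p(1) q(1) by blast
  qed
  ultimately show ?thesis using G(1) H(1) unfolding small_def
    by (intro exI[of _ "k ` (G \<times> H)"]) auto
qed

section \<open>Regular points\<close>

lemma tri_basic: "tri vs J C \<Longrightarrow> J \<subseteq> set vs \<and> dset (set vs) C"
proof (induction rule: tri.induct)
  case tri_Nil
  show ?case by (simp add: dset_UNIV)
next
  case (tri_free vs J C v g)
  have "dset (insert v (set vs)) {x. g x \<noteq> 0}" by (intro dset_neq polyf_imp_ratf tri_free)
  moreover have "dset (insert v (set vs)) C" using tri_free.IH by (auto intro: dset_mono)
  ultimately show ?case using tri_free.IH by (auto intro: dset_Int)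
next
  case (tri_root vs J C v f)
  have "dset (insert v (set vs)) {x. f x = 0}" by (intro dset_zero polyf_imp_ratf tri_root)
  moreover have "dset (insert v (set vs)) C" using tri_root.IH by (auto intro: dset_mono)
  ultimately show ?case using tri_root.IH by (auto intro: dset_Int)
qed

definition infinitesimally_rigid ::
    "'v set \<Rightarrow> 'v set \<Rightarrow> ('v \<Rightarrow> ('v \<Rightarrow> complex) \<Rightarrow> complex) \<Rightarrow> ('v \<Rightarrow> complex) \<Rightarrow> bool" where
  "infinitesimally_rigid A J F x \<longleftrightarrow> (\<forall>u. (\<forall>j\<in>J. u j = 0) \<longrightarrow>
     (\<forall>k\<in>A - J. (\<Sum>i\<in>A. pd (F k) i x * u i) = 0) \<longrightarrow> (\<forall>i\<in>A. u i = 0))"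

definition presents where
  "presents A J C g F \<longleftrightarrow> g \<in> polyf A \<and> (\<forall>k\<in>A - J. F k \<in> polyf A) \<and>
     C = {x. g x \<noteq> 0 \<and> (\<forall>k\<in>A - J. F k x = 0)} \<and> (\<forall>x\<in>C. infinitesimally_rigid A J F x)"

lemma presentsI:
  "g \<in> polyf A \<Longrightarrow> (\<And>k. k \<in> A - J \<Longrightarrow> F k \<in> polyf A) \<Longrightarrow>
   C = {x. g x \<noteq> 0 \<and> (\<forall>k\<in>A - J. F k x = 0)} \<Longrightarrow>
   (\<And>x. x \<in> C \<Longrightarrow> infinitesimally_rigid A J F x) \<Longrightarrow> presents A J C g F"
  by (simp add: presents_def)

lemma presentsD:
  assumes "presents A J C g F"
  shows "g \<in> polyf A" "\<And>k. k \<in> A - J \<Longrightarrow> F k \<in> polyf A"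
    "C = {x. g x \<noteq> 0 \<and> (\<forall>k\<in>A - J. F k x = 0)}" "\<And>x. x \<in> C \<Longrightarrow> infinitesimally_rigid A J F x"
  using assms by (simp_all add: presents_def)

text \<open>In the variables outside \<open>J\<close> the Jacobian of the equations is triangular,
  with the nonzero derivatives at simple roots on the diagonal; this gives the rigidity.\<close>

lemma tri_explicit: "tri vs J C \<Longrightarrow> \<exists>g F. presents (set vs) J C g F"
proof (induction rule: tri.induct)
  case tri_Nil
  show ?case
    by (intro exI[of _ "\<lambda>x. 1"] exI[of _ "\<lambda>k x. 0"] presentsI)
      (auto intro: polyf_const simp: infinitesimally_rigid_def)
next
  case (tri_free vs J C v g)
  obtain g0 F where "presents (set vs) J C g0 F" using tri_free.IH by blast
  note * = presentsD[OF this]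
  have A: "set (vs @ [v]) - insert v J = set vs - J" using tri_free.hyps(2) by auto
  have 1: "(\<lambda>x. g0 x * g x) \<in> polyf (set (vs @ [v]))"
    using polyf_mult[OF polyf_mono[OF *(1)] tri_free.hyps(3)] by auto
  have 2: "F k \<in> polyf (set (vs @ [v]))" if "k \<in> set (vs @ [v]) - insert v J" for k
    using that unfolding A by (rule polyf_mono[OF *(2)]) auto
  have 3: "C \<inter> {x. g x \<noteq> 0} =
      {x. g0 x * g x \<noteq> 0 \<and> (\<forall>k\<in>set (vs @ [v]) - insert v J. F k x = 0)}"
    unfolding A *(3) by auto
  have 4: "infinitesimally_rigid (set (vs @ [v])) (insert v J) F x" if x: "x \<in> C \<inter> {x. g x \<noteq> 0}" for x
    unfolding infinitesimally_rigid_def A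
  proof (intro allI impI)
    fix u
    assume u: "\<forall>j\<in>insert v J. u j = 0"
      and 0: "\<forall>k\<in>set vs - J. (\<Sum>i\<in>set (vs @ [v]). pd (F k) i x * u i) = 0"
    have "(\<Sum>i\<in>set (vs @ [v]). pd (F k) i x * u i) = (\<Sum>i\<in>set vs. pd (F k) i x * u i)" for k
      using u tri_free.hyps(2) by simp
    then show "\<forall>i\<in>set (vs @ [v]). u i = 0"
      using u 0 *(4)[of x] x by (auto simp: infinitesimally_rigid_def)
  qed
  have "presents (set (vs @ [v])) (insert v J) (C \<inter> {x. g x \<noteq> 0}) (\<lambda>x. g0 x * g x) F"
    by (rule presentsI[OF 1 2 3 4])
  then show ?case by (intro exI)
next
  case (tri_root vs J C v f)
  obtain g0 F where "presents (set vs) J C g0 F" using tri_root.IH by blast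
  note * = presentsD[OF this]
  have vJ: "v \<notin> J" using tri_basic[OF tri_root.hyps(1)] tri_root.hyps(2) by auto
  have A: "set (vs @ [v]) - J = insert v (set vs - J)" using vJ by auto
  have ne: "k \<noteq> v" if "k \<in> set vs - J" for k using that tri_root.hyps(2) by auto
  have 1: "g0 \<in> polyf (set (vs @ [v]))" by (rule polyf_mono[OF *(1)]) auto
  have 2: "(F(v := f)) k \<in> polyf (set (vs @ [v]))" if "k \<in> set (vs @ [v]) - J" for k
    using that polyf_mono[OF *(2)[of k], of "set (vs @ [v])"] tri_root.hyps(3) unfolding A by auto
  have 3: "C \<inter> {x. f x = 0} =
      {x. g0 x \<noteq> 0 \<and> (\<forall>k\<in>set (vs @ [v]) - J. (F(v := f)) k x = 0)}"
    unfolding A *(3) using ne by auto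
  have 4: "infinitesimally_rigid (set (vs @ [v])) J (F(v := f)) x"
    if x: "x \<in> C \<inter> {x. f x = 0}" for x
    unfolding infinitesimally_rigid_def A
  proof (intro allI impI)
    fix u
    assume u: "\<forall>j\<in>J. u j = 0"
      and 0: "\<forall>k\<in>insert v (set vs - J). (\<Sum>i\<in>set (vs @ [v]). pd ((F(v := f)) k) i x * u i) = 0"
    have "(\<Sum>i\<in>set vs. pd (F k) i x * u i) = 0" if k: "k \<in> set vs - J" for k
    proof -
      have "(\<Sum>i\<in>set (vs @ [v]). pd (F k) i x * u i) = 0"
        using bspec[OF 0, of k] k ne[OF k] by simp
      then show ?thesis using pd_eq_0[OF *(2)[OF k] tri_root.hyps(2)] tri_root.hyps(2) by simp
    qed
    then have u0: "\<forall>i\<in>set vs. u i = 0"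
      using u *(4)[of x] x by (auto simp: infinitesimally_rigid_def)
    have "(\<Sum>i\<in>set (vs @ [v]). pd f i x * u i) = 0" using 0 by auto
    then have "pd f v x * u v = 0" using u0 tri_root.hyps(2) by simp
    moreover have "pd f v x \<noteq> 0" using simple_root_pd[OF tri_root.hyps(4)[of x]] x by simp
    ultimately show "\<forall>i\<in>set (vs @ [v]). u i = 0" using u0 by auto
  qed
  have "presents (set (vs @ [v])) J (C \<inter> {x. f x = 0}) g0 (F(v := f))"
    by (rule presentsI[OF 1 2 3 4])
  then show ?case by (intro exI)
qed

lemma tri_etale:
  fixes C :: "('k::finite \<Rightarrow> complex) set"
  assumes "tri vs J C" "set vs = UNIV"
  obtains g F where "g \<in> polyf UNIV"
    "C = {x. g x \<noteq> 0 \<and> (\<forall>k. k \<notin> J \<longrightarrow> F k x = 0)}" "\<forall>z. vec_nth z \<in> C \<longrightarrow> etale J F z"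
proof -
  obtain g F where "presents UNIV J C g F"
    using tri_explicit[OF assms(1)] unfolding assms(2) by blast
  note p = presentsD[OF this]
  have *: "g \<in> polyf UNIV" "\<And>k. k \<notin> J \<Longrightarrow> F k \<in> polyf UNIV"
    "C = {x. g x \<noteq> 0 \<and> (\<forall>k. k \<notin> J \<longrightarrow> F k x = 0)}" "\<And>x. x \<in> C \<Longrightarrow> infinitesimally_rigid UNIV J F x"
    using p(1,2,4) by (simp, simp, subst p(3), auto)
  define F' where "F' k = (if k \<in> J then (\<lambda>x. 0) else F k)" for k
  have F': "F' k \<in> polyf UNIV" for k using *(2) by (auto simp: F'_def intro: polyf_const)
  have "etale J F' z" if z: "vec_nth z \<in> C" for z
    unfolding etale_def
  proof (intro conjI allI impI F')
    show "F' k (vec_nth z) = 0" if "k \<notin> J" for k using z that by (simp add: *(3) F'_def)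
    fix u assume d: "dchart J F' z u = 0"
    have "\<forall>j\<in>J. u $ j = 0"
    proof
      fix j assume "j \<in> J"
      moreover have "dchart J F' z u $ j = 0" using d by simp
      ultimately show "u $ j = 0" by (simp add: dchart_def)
    qed
    moreover have "\<forall>k\<in>UNIV - J. (\<Sum>i\<in>UNIV. pd (F k) i (vec_nth z) * u $ i) = 0"
    proof
      fix k assume "k \<in> UNIV - J"
      moreover have "dchart J F' z u $ k = 0" using d by simp
      ultimately show "(\<Sum>i\<in>UNIV. pd (F k) i (vec_nth z) * u $ i) = 0" by (simp add: dchart_def F'_def)
    qed
    ultimately have "\<forall>i\<in>UNIV. u $ i = 0"
      using *(4)[OF z] unfolding infinitesimally_rigid_def by blast
    then show "u = 0" by (simp add: vec_eq_iff)
  qed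
  moreover have "C = {x. g x \<noteq> 0 \<and> (\<forall>k. k \<notin> J \<longrightarrow> F' k x = 0)}" using *(3) by (auto simp: F'_def)
  ultimately show ?thesis using that[OF *(1)] by blast
qed

lemma open_vec_nbhd:
  fixes y0 :: "complex ^ 'k::finite"
  assumes "open W" "y0 \<in> W"
  obtains \<delta> where "\<delta> > 0" "\<And>y. (\<And>i. dist (y $ i) (y0 $ i) < \<delta>) \<Longrightarrow> y \<in> W"
proof -
  obtain A where A: "\<And>i. open (A i) \<and> y0 $ i \<in> A i" "\<And>y. (\<And>i. y $ i \<in> A i) \<Longrightarrow> y \<in> W"
    using assms unfolding open_vec_def by metis
  have "\<exists>e>0. \<forall>y. dist y (y0 $ i) < e \<longrightarrow> y \<in> A i" for i
    using A(1)[of i] by (meson open_dist)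
  then obtain e where e: "\<And>i. e i > 0" "\<And>i y. dist y (y0 $ i) < e i \<Longrightarrow> y \<in> A i" by metis
  show ?thesis
  proof (rule that[of "Min (range e)"])
    show "Min (range e) > 0" using e(1) by auto
    fix y assume "\<And>i. dist (y $ i) (y0 $ i) < Min (range e)"
    then show "y \<in> W" by (intro A(2) e(2)) (meson Min_le finite_class.finite finite_imageI less_le_trans rangeI)
  qed
qed

lemma etale_section:
  assumes et: "etale J F z" and N: "open N" "z \<in> N"
  obtains \<delta> where "\<delta> > 0"
    "\<And>x. (\<And>j. j \<in> J \<Longrightarrow> dist (x j) (z $ j) < \<delta>) \<Longrightarrow>
       \<exists>w\<in>N. (\<forall>j\<in>J. w $ j = x j) \<and> (\<forall>k. k \<notin> J \<longrightarrow> F k (vec_nth w) = 0)"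
proof -
  obtain U W \<Psi> \<Psi>' where li: "local_inverse J F U W \<Psi> \<Psi>'" and zU: "z \<in> U" "U \<subseteq> N"
    by (rule etale_chart[OF assms])
  note * = local_inverseD(1)[OF li] zU local_inverseD(2-)[OF li]
  have "chart J F z \<in> W" using * by blast
  then obtain \<delta> where \<delta>: "\<delta> > 0" "\<And>y. (\<And>i. dist (y $ i) (chart J F z $ i) < \<delta>) \<Longrightarrow> y \<in> W"
    by (rule open_vec_nbhd[OF *(4)]) blast
  show ?thesis
  proof (rule that[OF \<delta>(1)])
    fix x assume x: "\<And>j. j \<in> J \<Longrightarrow> dist (x j) (z $ j) < \<delta>"
    define y :: "complex ^ 'a" where "y = (\<chi> k. if k \<in> J then x k else 0)"
    have "y \<in> W"
    proof (rule \<delta>(2))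
      show "dist (y $ i) (chart J F z $ i) < \<delta>" for i
        using x et \<delta>(1) by (auto simp: y_def chart_def etale_def)
    qed
    then have w: "\<Psi> y \<in> U" "chart J F (\<Psi> y) = y" using *(7) by auto
    have "\<Psi> y $ j = x j" if "j \<in> J" for j
      using arg_cong[OF w(2), of "\<lambda>v. v $ j"] that by (simp add: y_def chart_def)
    moreover have "F k (vec_nth (\<Psi> y)) = 0" if "k \<notin> J" for k
      using arg_cong[OF w(2), of "\<lambda>v. v $ k"] that by (simp add: y_def chart_def)
    ultimately show "\<exists>w\<in>N. (\<forall>j\<in>J. w $ j = x j) \<and> (\<forall>k. k \<notin> J \<longrightarrow> F k (vec_nth w) = 0)"
      using w(1) *(3) by blast
  qed
qed

text \<open>A cell is open over its free coordinates. Contradictions about dimension are obtained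
  from this below.\<close>

lemma cell_section:
  fixes C :: "('k::finite \<Rightarrow> complex) set"
  assumes C: "tri vs J C" "set vs = UNIV" and z: "vec_nth z \<in> C" and N: "open N" "z \<in> N"
  obtains \<delta> where "\<delta> > 0"
    "\<And>x. (\<And>j. j \<in> J \<Longrightarrow> dist (x j) (z $ j) < \<delta>) \<Longrightarrow> \<exists>w\<in>N. vec_nth w \<in> C \<and> (\<forall>j\<in>J. w $ j = x j)"
proof -
  obtain g F where g: "g \<in> polyf UNIV"
    and CF: "C = {x. g x \<noteq> 0 \<and> (\<forall>k. k \<notin> J \<longrightarrow> F k x = 0)}"
    and et: "\<forall>z. vec_nth z \<in> C \<longrightarrow> etale J F z" by (rule tri_etale[OF C])
  have etz: "etale J F z" using et z by blast
  let ?N = "N \<inter> {z. g (vec_nth z) \<noteq> 0}"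
  have N': "open ?N" using N(1) open_polyf_neq_0[OF g] by (rule open_Int)
  have z': "z \<in> ?N" using N(2) z CF by auto
  obtain \<delta> where \<delta>: "\<delta> > 0"
    "\<And>x. (\<And>j. j \<in> J \<Longrightarrow> dist (x j) (z $ j) < \<delta>) \<Longrightarrow>
       \<exists>w\<in>?N. (\<forall>j\<in>J. w $ j = x j) \<and> (\<forall>k. k \<notin> J \<longrightarrow> F k (vec_nth w) = 0)"
    by (rule etale_section[OF etz N' z']) blast
  show ?thesis
  proof (rule that[OF \<delta>(1)])
    fix x assume "\<And>j. j \<in> J \<Longrightarrow> dist (x j) (z $ j) < \<delta>"
    from \<delta>(2)[OF this] show "\<exists>w\<in>N. vec_nth w \<in> C \<and> (\<forall>j\<in>J. w $ j = x j)"
      unfolding CF by auto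
  qed
qed

text \<open>The condition \<open>P\<close> concerns the coordinates in \<open>J\<close> only; the
  chart leaves these unchanged and so carries \<open>P\<close> over to
  \<open>Lsub J\<close>.\<close>

lemma etale_small:
  assumes et: "etale J F z" and sm: "small {w \<in> Lsub J. P w} r"
    and P: "\<And>w w'. (\<forall>j\<in>J. w $ j = w' $ j) \<Longrightarrow> P w \<longleftrightarrow> P w'"
  obtains U where "open U" "z \<in> U" "small {w \<in> U. (\<forall>k. k \<notin> J \<longrightarrow> F k (vec_nth w) = 0) \<and> P w} r"
proof -
  obtain U W \<Psi> \<Psi>' where li: "local_inverse J F U W \<Psi> \<Psi>'" and zU: "z \<in> U" "U \<subseteq> UNIV"
    by (rule etale_chart[OF et open_UNIV UNIV_I])
  note * = local_inverseD(1)[OF li] zU local_inverseD(2-)[OF li]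
  have "\<Psi> differentiable_on W \<inter> {w \<in> Lsub J. P w}"
    unfolding differentiable_on_def differentiable_def using *(8) has_derivative_at_withinI by blast
  then have "small (\<Psi> ` (W \<inter> {w \<in> Lsub J. P w})) r"
    by (rule small_image[OF small_subset[OF sm Int_lower2]])
  moreover have "{w \<in> U. (\<forall>k. k \<notin> J \<longrightarrow> F k (vec_nth w) = 0) \<and> P w} \<subseteq> \<Psi> ` (W \<inter> {w \<in> Lsub J. P w})"
  proof
    fix w assume "w \<in> {w \<in> U. (\<forall>k. k \<notin> J \<longrightarrow> F k (vec_nth w) = 0) \<and> P w}"
    then have w: "w \<in> U" "\<forall>k. k \<notin> J \<longrightarrow> F k (vec_nth w) = 0" "P w" by auto
    have "chart J F w \<in> W" using w(1) *(5) by blast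
    moreover have "chart J F w \<in> Lsub J" using w(2) by (simp add: chart_in_Lsub)
    moreover have "P (chart J F w)" using w(3) P[of w "chart J F w"] by (simp add: chart_def)
    ultimately show "w \<in> \<Psi> ` (W \<inter> {w \<in> Lsub J. P w})"
      using *(6)[OF w(1)] by (intro image_eqI[of _ _ "chart J F w"]) auto
  qed
  ultimately show ?thesis using that *(1,2) small_subset by blast
qed

lemma cell_small:
  fixes C :: "('k::finite \<Rightarrow> complex) set"
  assumes C: "tri vs J C" "set vs = UNIV"
    and sm: "small {w \<in> Lsub J. P w} r"
    and P: "\<And>w w'. (\<forall>j\<in>J. w $ j = w' $ j) \<Longrightarrow> P w \<longleftrightarrow> P w'"
  shows "small {z. vec_nth z \<in> C \<and> P z} r"
proof (rule small_local)
  fix z assume "z \<in> {z. vec_nth z \<in> C \<and> P z}"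
  then have z: "vec_nth z \<in> C" by auto
  obtain g F where g: "g \<in> polyf UNIV"
    and CF: "C = {x. g x \<noteq> 0 \<and> (\<forall>k. k \<notin> J \<longrightarrow> F k x = 0)}"
    and et: "\<forall>z. vec_nth z \<in> C \<longrightarrow> etale J F z" by (rule tri_etale[OF C])
  have etz: "etale J F z" using et z by blast
  obtain U where U: "open U" "z \<in> U" "small {w \<in> U. (\<forall>k. k \<notin> J \<longrightarrow> F k (vec_nth w) = 0) \<and> P w} r"
    by (rule etale_small[OF etz sm P])
  have "{z. vec_nth z \<in> C \<and> P z} \<inter> U \<subseteq> {w \<in> U. (\<forall>k. k \<notin> J \<longrightarrow> F k (vec_nth w) = 0) \<and> P w}"
    using CF by auto
  then show "\<exists>U. open U \<and> z \<in> U \<and> small ({z. vec_nth z \<in> C \<and> P z} \<inter> U) r"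
    using U small_subset by blast
qed

lemma cell_small_dim:
  fixes C :: "('k::finite \<Rightarrow> complex) set"
  assumes C: "tri vs J C" "set vs = UNIV"
  shows "small (vec_nth -` C) (2 * card J)"
proof -
  have "small {w \<in> Lsub J. True} (2 * card J)"
    by (rule small_in_subspace[OF _ subspace_Lsub dim_Lsub]) auto
  from cell_small[OF C this] show ?thesis by (simp add: vimage_def)
qed

text \<open>On the line from \<open>z\<close> to \<open>a\<close> the polynomial vanishes at all
  small real times, which are infinitely many.\<close>

lemma polyf_open_zero:
  assumes Q: "Q \<in> polyf J" and J: "finite J" and \<delta>: "\<delta> > 0"
    and 0: "\<And>x. (\<And>j. j \<in> J \<Longrightarrow> dist (x j) (z j) < \<delta>) \<Longrightarrow> Q x = 0"
  shows "Q a = 0"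
proof -
  obtain p where p: "\<And>t. Q (\<lambda>i. z i + t * (a i - z i)) = poly p t"
    using polyf_line[OF Q, of z "\<lambda>i. a i - z i"] by metis
  \<comment> \<open>The summand 1 keeps \<open>M\<close> positive when \<open>a\<close> and
    \<open>z\<close> agree on \<open>J\<close>.\<close>
  define M where "M = (\<Sum>j\<in>J. cmod (a j - z j)) + 1"
  have M: "M > 0" unfolding M_def by (intro add_nonneg_pos sum_nonneg) auto
  have "poly p t = 0" if t: "t \<in> complex_of_real ` {0..<\<delta> / M}" for t
  proof -
    obtain s where s: "t = of_real s" "0 \<le> s" "s < \<delta> / M" using t by auto
    have "dist (z j + t * (a j - z j)) (z j) < \<delta>" if j: "j \<in> J" for j
    proof -
      have "cmod (a j - z j) \<le> (\<Sum>j\<in>J. cmod (a j - z j))"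
        by (rule member_le_sum[OF j]) (use J in auto)
      then have "cmod (a j - z j) \<le> M" by (simp add: M_def)
      then have "s * cmod (a j - z j) \<le> s * M" using s(2) by (rule mult_left_mono)
      also have "\<dots> < \<delta>" using s(3) M by (simp add: pos_less_divide_eq)
      finally show ?thesis using s(1,2) by (simp add: dist_norm norm_mult)
    qed
    then have "Q (\<lambda>i. z i + t * (a i - z i)) = 0" by (intro 0)
    then show ?thesis by (simp add: p)
  qed
  moreover have "infinite (complex_of_real ` {0..<\<delta> / M})"
    using \<delta> M by (subst finite_image_iff) (auto simp: inj_on_def)
  ultimately have "p = 0" using poly_roots_finite[of p] finite_subset by (metis (mono_tags, lifting) mem_Collect_eq subsetI)
  then show ?thesis using p[of 1] by simp
qed

text \<open>Decompose the zero set into cells. Their free variables lie in \<open>J\<close>, and if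
  all of \<open>J\<close> were free then \<open>Q\<close> would vanish on an open set. So one
  complex variable is lost, and with it two real dimensions.\<close>

lemma polyf_zero_small:
  fixes Q :: "('k::finite \<Rightarrow> complex) \<Rightarrow> complex"
  assumes Q: "Q \<in> polyf J" and a: "Q a \<noteq> 0"
  shows "small {w \<in> Lsub J. Q (vec_nth w) = 0} (2 * card J - 2)"
proof -
  let ?X = "{x. (\<forall>k\<in>- J. x k = 0) \<and> Q x = 0}"
  have d: "dset UNIV ?X"
    by (intro dset_conj dset_ball dset_zero ratf_var polyf_imp_ratf polyf_mono[OF Q]) auto
  obtain vs :: "'k list" where vs: "set vs = UNIV" "distinct vs"
    using finite_distinct_list[of "UNIV :: 'k set"] by auto
  obtain F where F: "finite F" "\<And>C. C \<in> F \<Longrightarrow> \<exists>I. tri vs I C" "?X = \<Union>F"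
    using dset_cellular[OF vs(2), of ?X] d vs(1) unfolding cellular_def by auto
  have "small (vec_nth -` C) (2 * card J - 2)" if C: "C \<in> F" for C
  proof (cases "C = {}")
    case True
    then show ?thesis using small_in_subspace[of "{}" "{0 :: complex ^ 'k}" "2 * card J - 2"]
      by (simp add: subspace_0)
  next
    case False
    then obtain x where "x \<in> C" by auto
    define z :: "complex ^ 'k" where "z = (\<chi> i. x i)"
    have z: "vec_nth z \<in> C" using \<open>x \<in> C\<close> by (simp add: z_def vec_lambda_inverse)
    obtain I where I: "tri vs I C" using F(2)[OF C] ..
    have CX: "(\<forall>k\<in>- J. y k = 0) \<and> Q y = 0" if "y \<in> C" for y using that C F(3) by blast
    obtain \<delta> where \<delta>: "\<delta> > 0"
      "\<And>x. (\<And>j. j \<in> I \<Longrightarrow> dist (x j) (z $ j) < \<delta>) \<Longrightarrow> \<exists>w\<in>UNIV. vec_nth w \<in> C \<and> (\<forall>j\<in>I. w $ j = x j)"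
      by (rule cell_section[OF I vs(1) z open_UNIV UNIV_I]) blast
    have "I \<subseteq> J"
    proof
      fix k assume k: "k \<in> I"
      show "k \<in> J"
      proof (rule ccontr)
        assume "k \<notin> J"
        \<comment> \<open>Moving the free coordinate \<open>k\<close> by \<open>\<delta> / 2\<close>
          stays within reach of the cell, although coordinate \<open>k\<close> vanishes on all of
          it.\<close>
        define y where "y = (vec_nth z)(k := z $ k + of_real (\<delta> / 2))"
        have "dist (y j) (z $ j) < \<delta>" for j using \<delta>(1) by (auto simp: y_def dist_norm)
        then obtain w where w: "vec_nth w \<in> C" "\<forall>j\<in>I. w $ j = y j" using \<delta>(2)[of y] by blast
        have "w $ k = 0" "z $ k = 0" using CX[OF w(1)] CX[OF z] \<open>k \<notin> J\<close> by auto
        then show False using w(2) k \<delta>(1) by (auto simp: y_def)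
      qed
    qed
    moreover have "I \<noteq> J"
    proof
      assume IJ: "I = J"
      have "Q x = 0" if x: "\<And>j. j \<in> J \<Longrightarrow> dist (x j) (z $ j) < \<delta>" for x
      proof -
        obtain w where w: "vec_nth w \<in> C" "\<forall>j\<in>I. w $ j = x j" using \<delta>(2)[of x] x IJ by blast
        have "Q x = Q (vec_nth w)" by (rule polyf_cong[OF Q]) (use w IJ in auto)
        then show ?thesis using CX[OF w(1)] by simp
      qed
      from polyf_open_zero[OF Q _ \<delta>(1), of "vec_nth z", OF _ this] have "Q a = 0" by simp
      with a show False by simp
    qed
    ultimately have "card I < card J" by (intro psubset_card_mono) auto
    then show ?thesis by (intro small_mono[OF cell_small_dim[OF I vs(1)]]) simp
  qed
  then have s: "small (\<Union>C\<in>F. vec_nth -` C) (2 * card J - 2)"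
    using F(1) by (intro small_UN countable_finite)
  moreover have "{w \<in> Lsub J. Q (vec_nth w) = 0} \<subseteq> vec_nth -` ?X" by (auto simp: Lsub_def)
  moreover have "vec_nth -` ?X = (\<Union>C\<in>F. vec_nth -` C)" unfolding F(3) by auto
  ultimately show ?thesis by (intro small_subset[OF s]) simp
qed

lemma polyf_zero_negligible:
  fixes Q :: "('k::finite \<Rightarrow> complex) \<Rightarrow> complex"
  assumes Q: "Q \<in> polyf A" and a: "Q a \<noteq> 0"
  shows "negligible {z. Q (vec_nth z) = 0}"
proof -
  have "small {w \<in> Lsub UNIV. Q (vec_nth w) = 0} (2 * CARD('k) - 2)"
    by (rule polyf_zero_small[OF polyf_mono[OF Q subset_UNIV] a])
  moreover have "2 * CARD('k) - 2 < DIM(complex ^ 'k)"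
    using zero_less_card_finite[where 'a = 'k] by (simp add: mult.commute)
  ultimately have "negligible ((\<lambda>z. z) ` {w \<in> Lsub UNIV. Q (vec_nth w) = 0})"
    by (intro small_negligible) auto
  then show ?thesis by (simp add: Lsub_def)
qed

lemma generic_not_negligible:
  fixes X :: "('k::finite \<Rightarrow> complex) set"
  assumes "generic A X" shows "\<not> negligible (vec_nth -` X)"
proof
  assume n: "negligible (vec_nth -` X)"
  obtain Q a where Q: "Q \<in> polyf A" "Q a \<noteq> 0" "\<And>x. Q x \<noteq> 0 \<Longrightarrow> x \<in> X"
    using assms unfolding generic_def by blast
  have "negligible ({z. Q (vec_nth z) = 0} \<union> vec_nth -` X)"
    by (rule negligible_Un[OF polyf_zero_negligible[OF Q(1,2)] n])
  moreover have "{z. Q (vec_nth z) = 0} \<union> vec_nth -` X = UNIV" using Q(3) by auto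
  ultimately have "negligible (UNIV :: (complex ^ 'k) set)" by simp
  then show False using open_not_negligible[OF open_UNIV] by auto
qed

text \<open>Generic sets are not negligible, so by the dichotomy a statement about measure decides
  one about the Zariski topology.\<close>

lemma negligible_generic_Compl:
  fixes X :: "('k::finite \<Rightarrow> complex) set"
  assumes "dset A X" "negligible (vec_nth -` X)" shows "generic A (- X)"
  using dset_dichotomy[OF assms(1)] generic_not_negligible assms(2) by blast

text \<open>The projection of \<open>X\<close> to the coordinates in \<open>K\<close> is
  constructible by elimination, and negligible because the real dimension of \<open>X\<close> is
  below \<open>2 * card K\<close>. So a nonzero polynomial vanishes on it.\<close>

lemma algebraic_dependence:
  fixes X :: "('k::finite \<Rightarrow> complex) set"
  assumes X: "dset UNIV X" and sm: "small (vec_nth -` X) r" and r: "r < 2 * card K"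
  obtains P a where "P \<in> polyf K" "P a \<noteq> 0" "\<And>x. x \<in> X \<Longrightarrow> P x = 0"
proof -
  define Y where "Y = {x. \<exists>y. (\<forall>i. i \<notin> - K \<longrightarrow> y i = x i) \<and> y \<in> X}"
  have Y: "dset K Y" unfolding Y_def by (rule dset_project) (use X in \<open>auto simp: Un_commute\<close>)
  \<comment> \<open>The second argument supplies the coordinates outside \<open>K\<close>; this
    exhibits the cylinder over the projection as a differentiable image.\<close>
  define h :: "(complex ^ 'k) \<times> (complex ^ 'k) \<Rightarrow> complex ^ 'k" where
    "h p = (\<chi> k. if k \<in> K then fst p $ k else snd p $ k)" for p
  have "linear h" by (rule linearI) (auto simp: h_def vec_eq_iff)
  then have "h differentiable_on (vec_nth -` X \<times> Lsub (- K))" by (rule linear_imp_differentiable_on)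
  moreover have "small (vec_nth -` X \<times> Lsub (- K)) (r + 2 * card (- K))"
    by (intro small_Times sm small_in_subspace[OF subset_refl subspace_Lsub dim_Lsub])
  moreover have "r + 2 * card (- K) < DIM(complex ^ 'k)"
    using r card_mono[of UNIV K] by (simp add: card_Diff_subset Compl_eq_Diff_UNIV algebra_simps)
  ultimately have "negligible (h ` (vec_nth -` X \<times> Lsub (- K)))"
    by (intro small_negligible)
  moreover have "vec_nth -` Y \<subseteq> h ` (vec_nth -` X \<times> Lsub (- K))"
  proof
    fix z assume "z \<in> vec_nth -` Y"
    then obtain y where y: "\<forall>i. i \<in> K \<longrightarrow> y i = z $ i" "y \<in> X" by (auto simp: Y_def)
    have "z = h (\<chi> i. y i, \<chi> i. if i \<in> K then 0 else z $ i)"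
      using y(1) by (auto simp: h_def vec_eq_iff)
    moreover have "(\<chi> i. y i) \<in> vec_nth -` X" using y(2) by (simp add: vec_lambda_inverse)
    moreover have "(\<chi> i. if i \<in> K then 0 else z $ i) \<in> Lsub (- K)" by (simp add: Lsub_def)
    ultimately show "z \<in> h ` (vec_nth -` X \<times> Lsub (- K))" by blast
  qed
  ultimately have "negligible (vec_nth -` Y)" by (rule negligible_subset)
  then have "generic K (- Y)" by (rule negligible_generic_Compl[OF Y])
  then obtain P a where P: "P \<in> polyf K" "P a \<noteq> 0" "\<And>x. P x \<noteq> 0 \<Longrightarrow> x \<notin> Y"
    unfolding generic_def by blast
  have "P x = 0" if "x \<in> X" for x
  proof -
    have "x \<in> Y" using that unfolding Y_def by blast
    then show ?thesis using P(3) by blast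
  qed
  with P(1,2) that show ?thesis by blast
qed

text \<open>A regular point together with a choice of local parameters and with polynomial
  equations, as many as the codimension.\<close>

definition etale_at :: "(complex ^ 'k::finite) set \<Rightarrow> 'k set \<Rightarrow> complex ^ 'k \<Rightarrow> bool" where
  "etale_at V J z \<longleftrightarrow> z \<in> V \<and> (\<exists>F U. etale J F z \<and> open U \<and> z \<in> U \<and>
     V \<inter> U = {w \<in> U. \<forall>k. k \<notin> J \<longrightarrow> F k (vec_nth w) = 0})"

lemma etale_at_complex_submanifold:
  assumes "etale_at V J z" shows "complex_submanifold_at V (card J) z"
proof -
  obtain F N where F: "etale J F z" "open N" "z \<in> N" "z \<in> V"
    "V \<inter> N = {w \<in> N. \<forall>k. k \<notin> J \<longrightarrow> F k (vec_nth w) = 0}"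
    using assms unfolding etale_at_def by blast
  obtain U W \<Psi> \<Psi>' where li: "local_inverse J F U W \<Psi> \<Psi>'" and zU: "z \<in> U" "U \<subseteq> N"
    by (rule etale_chart[OF F(1-3)])
  note * = local_inverseD(1)[OF li] zU local_inverseD(2-)[OF li]
  have inj: "inj_on (chart J F) U" using *(6) by (rule inj_on_inverseI)
  have inv: "inv_into U (chart J F) y = \<Psi> y" if "y \<in> W" for y
    using inv_into_f_eq[OF inj] *(7)[OF that] by blast
  have FU: "\<And>k. F k \<in> polyf UNIV" using F(1) by (simp add: etale_def)
  have "holomorphic_map_on U (chart J F)"
    unfolding holomorphic_map_on_def
  proof
    show "\<exists>D. (chart J F has_derivative D) (at w) \<and> (\<forall>c v. D (c *s v) = c *s D v)" for w
      using chart_has_derivative[of F J w, OF FU] dchart_scale[of J F w] by metis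
  qed
  moreover have "holomorphic_map_on W (inv_into U (chart J F))"
    unfolding holomorphic_map_on_def
  proof
    fix y assume y: "y \<in> W"
    have "(inv_into U (chart J F) has_derivative \<Psi>' y) (at y)"
      by (rule has_derivative_transform_within_open[OF *(8)[OF y] *(4) y]) (simp add: inv)
    moreover have "\<Psi>' y (c *s v) = c *s \<Psi>' y v" for c v
      using *(10)[OF y, of "c *s \<Psi>' y v"] by (simp add: dchart_scale *(9)[OF y])
    ultimately show "\<exists>D. (inv_into U (chart J F) has_derivative D) (at y) \<and> (\<forall>c v. D (c *s v) = c *s D v)"
      by blast
  qed
  ultimately have "biholomorphic_on U (chart J F)"
    unfolding biholomorphic_on_def using *(1,4,5) inj by simp
  moreover have "chart J F ` (V \<inter> U) = chart J F ` U \<inter> Lsub J"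
  proof -
    have "V \<inter> U = {w \<in> U. chart J F w \<in> Lsub J}"
      using F(5) *(3) by (auto simp: chart_in_Lsub)
    then show ?thesis by auto
  qed
  ultimately show ?thesis unfolding complex_submanifold_at_def
    using F(4) *(2) vec_subspace_Lsub vec_dim_Lsub by blast
qed

lemma ratf_power: "f \<in> ratf A \<Longrightarrow> (\<lambda>x. f x ^ k) \<in> ratf A"
  by (induction k) (auto intro: ratf_const ratf_mult)

lemma ratf_power_int: "f \<in> ratf A \<Longrightarrow> (\<lambda>x. f x powi k) \<in> ratf A"
  by (cases "k \<ge> 0") (simp_all add: power_int_def ratf_power ratf_inverse)

definition pts :: "(complex ^ 'k) set \<Rightarrow> ('k \<Rightarrow> complex) set" where
  "pts V = {x. vec_lambda x \<in> V}"

lemma vec_nth_in_pts [simp]: "vec_nth z \<in> pts V \<longleftrightarrow> z \<in> V"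
  by (simp add: pts_def)

lemma vimage_pts [simp]: "vec_nth -` pts V = V"
  by auto

lemma laurent_polynomial_ratf:
  fixes f :: "complex ^ 'k::finite \<Rightarrow> complex"
  assumes "laurent_polynomial f" shows "(\<lambda>x. f (vec_lambda x)) \<in> ratf UNIV"
proof -
  obtain E :: "('k \<Rightarrow> int) set" and c where "f = (\<lambda>z. \<Sum>e\<in>E. c e * (\<Prod>i\<in>UNIV. z $ i powi e i))"
    using assms unfolding laurent_polynomial_def by blast
  then have "(\<lambda>x. f (vec_lambda x)) = (\<lambda>x. \<Sum>e\<in>E. c e * (\<Prod>i\<in>UNIV. x i powi e i))" by simp
  also have "\<dots> \<in> ratf UNIV"
    by (intro ratf_sum ratf_mult ratf_const ratf_prod ratf_power_int ratf_var UNIV_I)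
  finally show ?thesis .
qed

lemma dset_variety:
  fixes V :: "(complex ^ 'k::finite) set"
  assumes "algebraic_variety V" shows "dset UNIV (pts V)"
proof -
  obtain P where P0: "finite P \<and> (\<forall>f\<in>P. laurent_polynomial f) \<and> V = {z \<in> torus. \<forall>f\<in>P. f z = 0}"
    using assms unfolding algebraic_variety_def by (rule exE)
  then have P: "finite P" "\<And>f. f \<in> P \<Longrightarrow> laurent_polynomial f"
    "V = {z \<in> torus. \<forall>f\<in>P. f z = 0}" by simp_all
  have "pts V = {x. (\<forall>i\<in>UNIV. x i \<noteq> 0) \<and> (\<forall>f\<in>P. f (vec_lambda x) = 0)}"
    by (auto simp: pts_def P(3) torus_def)
  also have "dset UNIV \<dots>"
    by (intro dset_conj dset_ball finite P(1) dset_neq dset_zero ratf_var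
        laurent_polynomial_ratf P(2) UNIV_I)
  finally show ?thesis .
qed

lemma cell_generic_point:
  fixes C :: "('k::finite \<Rightarrow> complex) set"
  assumes C: "tri vs J C" "set vs = UNIV" and x: "x \<in> C" and Q: "Q \<in> polyf J" "Q a \<noteq> 0"
  obtains z where "vec_nth z \<in> C" "Q (vec_nth z) \<noteq> 0"
proof (rule ccontr)
  assume contra: "\<not> thesis"
  note witness = that
  have 0: "Q (vec_nth z) = 0" if "vec_nth z \<in> C" for z using witness[OF that] contra by blast
  define z :: "complex ^ 'k" where "z = (\<chi> i. x i)"
  have z: "vec_nth z \<in> C" using x by (simp add: z_def vec_lambda_inverse)
  obtain \<delta> where \<delta>: "\<delta> > 0"
    "\<And>x. (\<And>j. j \<in> J \<Longrightarrow> dist (x j) (z $ j) < \<delta>) \<Longrightarrow> \<exists>w\<in>UNIV. vec_nth w \<in> C \<and> (\<forall>j\<in>J. w $ j = x j)"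
    by (rule cell_section[OF C z open_UNIV UNIV_I]) blast
  have "Q x = 0" if x: "\<And>j. j \<in> J \<Longrightarrow> dist (x j) (z $ j) < \<delta>" for x
  proof -
    obtain w where w: "vec_nth w \<in> C" "\<forall>j\<in>J. w $ j = x j" using \<delta>(2)[of x] x by blast
    have "Q x = Q (vec_nth w)" by (rule polyf_cong[OF Q(1)]) (use w in auto)
    then show ?thesis using 0 w(1) by simp
  qed
  from polyf_open_zero[OF Q(1) _ \<delta>(1), of "vec_nth z", OF _ this] have "Q a = 0" by simp
  with Q(2) show False by simp
qed

text \<open>Generically over the coordinates in \<open>J\<close> of a cell \<open>C\<close> of maximal dimension, each other
  coordinate of a point of \<open>X\<close> is a simple root, so \<open>X\<close> coincides with \<open>C\<close> near such points of \<open>C\<close>.\<close>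

lemma top_cell_etale_at:
  fixes X :: "('k::finite \<Rightarrow> complex) set"
  assumes X: "dset UNIV X" and sm: "small (vec_nth -` X) (2 * N)"
    and C: "tri vs J C" "set vs = UNIV" "C \<subseteq> X" "card J = N"
  obtains Q a where "Q \<in> polyf J" "Q a \<noteq> 0"
    "\<And>z. vec_nth z \<in> C \<Longrightarrow> Q (vec_nth z) \<noteq> 0 \<Longrightarrow> etale_at (vec_nth -` X) J z"
proof -
  define G where "G k Q R \<longleftrightarrow> Q \<in> polyf J \<and> (\<exists>x. Q x \<noteq> 0) \<and> R \<in> polyf (insert k J) \<and>
      (\<forall>x\<in>X. Q x \<noteq> 0 \<longrightarrow> simple_root R k x)" for k Q R
  have "\<exists>Q R. G k Q R" if k: "k \<notin> J" for k
  proof -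
    \<comment> \<open>One coordinate more than the dimension of \<open>X\<close> allows to be
      independent.\<close>
    have "2 * N < 2 * card (insert k J)" using k C(4) by simp
    then obtain P a where P: "P \<in> polyf (insert k J)" "P a \<noteq> 0" "\<And>x. x \<in> X \<Longrightarrow> P x = 0"
      using algebraic_dependence[OF X sm] by metis
    obtain Q R where QR: "Q \<in> polyf J" "\<exists>x. Q x \<noteq> 0" "R \<in> polyf (insert k J)"
      "\<And>x. Q x \<noteq> 0 \<Longrightarrow> P x = 0 \<Longrightarrow> simple_root R k x"
      using simple_root_cover[OF P(1) k P(2)] by metis
    then have "G k Q R" unfolding G_def using P(3) by simp
    then show ?thesis by blast
  qed
  then obtain Q R where "\<And>k. k \<notin> J \<Longrightarrow> G k (Q k) (R k)" by metis
  then have QR: "\<And>k. k \<notin> J \<Longrightarrow> Q k \<in> polyf J" "\<And>k. k \<notin> J \<Longrightarrow> \<exists>x. Q k x \<noteq> 0"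
    "\<And>k. k \<notin> J \<Longrightarrow> R k \<in> polyf (insert k J)"
    "\<And>k x. k \<notin> J \<Longrightarrow> x \<in> X \<Longrightarrow> Q k x \<noteq> 0 \<Longrightarrow> simple_root (R k) k x"
    unfolding G_def by auto
  define q where "q x = (\<Prod>k\<in>- J. Q k x)" for x
  define F where "F k = (if k \<in> J then (\<lambda>x. 0) else R k)" for k
  have F: "F k \<in> polyf UNIV" for k
    unfolding F_def using polyf_mono[OF QR(3)] by (auto intro: polyf_const)
  have q: "q \<in> polyf J" unfolding q_def by (intro polyf_prod QR(1)) auto
  have "\<exists>a. q a \<noteq> 0" unfolding q_def by (rule polyf_prod_nonzero[of "- J" Q J]) (use QR(1,2) in auto)
  then obtain a where a: "q a \<noteq> 0" ..
  have simple: "F k (vec_nth z) = 0 \<and> pd (F k) k (vec_nth z) \<noteq> 0"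
    if "vec_nth z \<in> X" "q (vec_nth z) \<noteq> 0" "k \<notin> J" for z k
  proof -
    have "Q k (vec_nth z) \<noteq> 0" using that(2,3) by (auto simp: q_def)
    from simple_root_pd[OF QR(4)[OF that(3,1) this]] show ?thesis using that(3) by (simp add: F_def)
  qed
  have et: "etale J F z" if z: "vec_nth z \<in> X" "q (vec_nth z) \<noteq> 0" for z
    unfolding etale_def
  proof (intro conjI allI impI F)
    show "F k (vec_nth z) = 0" if "k \<notin> J" for k using simple[OF z that] by simp
    fix u assume d: "dchart J F z u = 0"
    have uJ: "u $ j = 0" if "j \<in> J" for j
      using arg_cong[OF d, of "\<lambda>v. v $ j"] that by (simp add: dchart_def)
    have "u $ k = 0" if k: "k \<notin> J" for k
    proof -
      have 0: "(\<Sum>i\<in>UNIV. pd (F k) i (vec_nth z) * u $ i) = 0"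
        using arg_cong[OF d, of "\<lambda>v. v $ k"] k by (simp add: dchart_def)
      \<comment> \<open>\<open>F k\<close> involves only \<open>k\<close> and the coordinates in
        \<open>J\<close>, where \<open>u\<close> vanishes; so the linear system is diagonal.\<close>
      have eq: "pd (F k) i (vec_nth z) * u $ i = (if i = k then pd (F k) k (vec_nth z) * u $ k else 0)" for i
        using pd_eq_0[OF QR(3)[OF k], of i] uJ[of i] k by (auto simp: F_def)
      have "(\<Sum>i\<in>UNIV. pd (F k) i (vec_nth z) * u $ i) =
          (\<Sum>i\<in>UNIV. if i = k then pd (F k) k (vec_nth z) * u $ k else 0)"
        by (rule sum.cong[OF refl]) (rule eq)
      then have "pd (F k) k (vec_nth z) * u $ k = 0" using 0 by simp
      then show ?thesis using simple[OF z k] by simp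
    qed
    with uJ show "u = 0" by (metis vec_eq_iff zero_index)
  qed
  have "etale_at (vec_nth -` X) J z" if z: "vec_nth z \<in> C" "q (vec_nth z) \<noteq> 0" for z
  proof -
    have zX: "vec_nth z \<in> X" using z(1) C(3) by auto
    let ?N = "{w. q (vec_nth w) \<noteq> 0}"
    have N: "open ?N" "z \<in> ?N" using open_polyf_neq_0[OF q] z(2) by auto
    obtain U W \<Psi> \<Psi>' where li: "local_inverse J F U W \<Psi> \<Psi>'" and zU: "z \<in> U" "U \<subseteq> ?N"
      by (rule etale_chart[OF et[OF zX z(2)] N])
    obtain \<delta> where \<delta>: "\<delta> > 0"
      "\<And>x. (\<And>j. j \<in> J \<Longrightarrow> dist (x j) (z $ j) < \<delta>) \<Longrightarrow> \<exists>w\<in>U. vec_nth w \<in> C \<and> (\<forall>j\<in>J. w $ j = x j)"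
      by (rule cell_section[OF C(1,2) z(1) local_inverseD(1)[OF li] zU(1)]) blast
    let ?U = "U \<inter> {w. \<forall>j\<in>J. dist (w $ j) (z $ j) < \<delta>}"
    have "open (\<Inter>j\<in>J. {w :: complex ^ 'k. dist (w $ j) (z $ j) < \<delta>})"
      by (intro open_INT finite ballI open_Collect_less continuous_intros)
    also have "(\<Inter>j\<in>J. {w :: complex ^ 'k. dist (w $ j) (z $ j) < \<delta>}) =
        {w. \<forall>j\<in>J. dist (w $ j) (z $ j) < \<delta>}" by auto
    finally have "open ?U" using local_inverseD(1)[OF li] by (simp add: open_Int)
    moreover have "z \<in> ?U" using zU \<delta>(1) by simp
    moreover have "vec_nth -` X \<inter> ?U = {w \<in> ?U. \<forall>k. k \<notin> J \<longrightarrow> F k (vec_nth w) = 0}"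
    proof (intro set_eqI iffI)
      fix w assume "w \<in> vec_nth -` X \<inter> ?U"
      then show "w \<in> {w \<in> ?U. \<forall>k. k \<notin> J \<longrightarrow> F k (vec_nth w) = 0}" using simple zU(2) by blast
    next
      fix w assume w: "w \<in> {w \<in> ?U. \<forall>k. k \<notin> J \<longrightarrow> F k (vec_nth w) = 0}"
      \<comment> \<open>The section of \<open>C\<close> over the same coordinates in
        \<open>J\<close> satisfies the same equations, and the chart is injective, so it passes
        through \<open>w\<close> itself.\<close>
      then obtain w' where w': "w' \<in> U" "vec_nth w' \<in> C" "\<forall>j\<in>J. w' $ j = w $ j"
        using \<delta>(2)[of "vec_nth w"] by auto
      have "F k (vec_nth w') = 0" if "k \<notin> J" for k
        using simple[of w' k] w'(1,2) zU(2) C(3) that by blast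
      then have "chart J F w = chart J F w'" using w w'(3) by (auto simp: chart_def vec_eq_iff)
      then have "w = w'" using local_inverseD(4)[OF li, of w] local_inverseD(4)[OF li, of w'] w w'(1) by auto
      then show "w \<in> vec_nth -` X \<inter> ?U" using w w'(2) C(3) by auto
    qed
    ultimately show ?thesis unfolding etale_at_def using et[OF zX z(2)] zX by blast
  qed
  with q a that show ?thesis by blast
qed

text \<open>The exceptional set \<open>B\<close> consists of the cells of dimension below
  \<open>n\<close> and of the zeros of the polynomials that \<open>top_cell_etale_at\<close>
  attaches to the others. No cell has dimension above \<open>n\<close>, since a largest cell
  contains regular points of \<open>V\<close> of its own dimension.\<close>

lemma variety_structure:
  fixes V :: "(complex ^ 'k::finite) set"
  assumes "algebraic_variety V" "has_complex_dimension V n"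
  obtains B where "dset UNIV B" "B \<subseteq> pts V" "small (vec_nth -` B) (2 * n - 2)" "small V (2 * n)"
    "\<forall>z\<in>V. vec_nth z \<notin> B \<longrightarrow> (\<exists>J. card J = n \<and> etale_at V J z)"
proof -
  have V: "dset UNIV (pts V)" by (rule dset_variety[OF assms(1)])
  obtain vs :: "'k list" where vs: "set vs = UNIV" "distinct vs"
    using finite_distinct_list[of "UNIV :: 'k set"] by auto
  obtain F0 where F0: "finite F0" "\<And>C. C \<in> F0 \<Longrightarrow> \<exists>I. tri vs I C" "pts V = \<Union>F0"
    using dset_cellular[OF vs(2), of "pts V"] V vs(1) unfolding cellular_def by auto
  \<comment> \<open>Empty cells are dropped: the size of their \<open>J\<close> says nothing about
    \<open>V\<close>.\<close>
  define F where "F = F0 - {{}}"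
  have F: "finite F" "pts V = \<Union>F" using F0 by (auto simp: F_def)
  obtain J where J: "\<And>C. C \<in> F \<Longrightarrow> tri vs (J C) C" using F0(2) unfolding F_def by (metis DiffD1)
  have bound: "card (J C) \<le> n" if C: "C \<in> F" for C
  proof -
    define N where "N = Max ((\<lambda>C. card (J C)) ` F)"
    have "N \<in> (\<lambda>C. card (J C)) ` F" unfolding N_def using F(1) C by (intro Max_in) auto
    then obtain D where D: "D \<in> F" "card (J D) = N" by auto
    have le: "card (J C) \<le> N" if "C \<in> F" for C unfolding N_def using F(1) that by simp
    have "small (\<Union>C\<in>F. vec_nth -` C) (2 * N)"
      by (intro small_UN countable_finite F small_mono[OF cell_small_dim[OF J vs(1)]]) (use le in auto)
    then have "small (vec_nth -` pts V) (2 * N)" unfolding F(2) by (simp add: vimage_Union)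
    then obtain Q a where Q: "Q \<in> polyf (J D)" "Q a \<noteq> 0"
      "\<And>z. vec_nth z \<in> D \<Longrightarrow> Q (vec_nth z) \<noteq> 0 \<Longrightarrow> etale_at (vec_nth -` pts V) (J D) z"
      using top_cell_etale_at[OF V _ J[OF D(1)] vs(1) _ D(2)] F(2) D(1) by (metis Union_upper)
    obtain x where "x \<in> D" using D(1) by (auto simp: F_def)
    then obtain z where "vec_nth z \<in> D" "Q (vec_nth z) \<noteq> 0"
      using cell_generic_point[OF J[OF D(1)] vs(1) _ Q(1,2)] by metis
    then have "etale_at V (J D) z" using Q(3) by simp
    then have "complex_submanifold_at V N z" using etale_at_complex_submanifold D(2) by metis
    then have "N \<le> n" using assms(2) unfolding has_complex_dimension_def by blast
    with le[OF C] show ?thesis by simp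
  qed
  have smV: "small V (2 * n)"
  proof -
    have "small (\<Union>C\<in>F. vec_nth -` C) (2 * n)"
      by (intro small_UN countable_finite F small_mono[OF cell_small_dim[OF J vs(1)]]) (use bound in auto)
    then have "small (vec_nth -` pts V) (2 * n)" unfolding F(2) by (simp add: vimage_Union)
    then show ?thesis by simp
  qed
  define G where "G C Q \<longleftrightarrow> Q \<in> polyf (J C) \<and> (\<exists>a. Q a \<noteq> 0) \<and>
      (\<forall>z. vec_nth z \<in> C \<longrightarrow> Q (vec_nth z) \<noteq> 0 \<longrightarrow> etale_at V (J C) z)" for C Q
  have "\<exists>Q. G C Q"
    if C: "C \<in> F" "card (J C) = n" for C
  proof -
    have "small (vec_nth -` pts V) (2 * n)" using smV by simp
    then obtain Q a where "Q \<in> polyf (J C)" "Q a \<noteq> 0"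
      "\<And>z. vec_nth z \<in> C \<Longrightarrow> Q (vec_nth z) \<noteq> 0 \<Longrightarrow> etale_at (vec_nth -` pts V) (J C) z"
      using top_cell_etale_at[OF V _ J[OF C(1)] vs(1) _ C(2)] F(2) C(1) by (metis Union_upper)
    then have "G C Q" unfolding G_def by auto
    then show ?thesis by blast
  qed
  then obtain Q where "\<And>C. C \<in> F \<Longrightarrow> card (J C) = n \<Longrightarrow> G C (Q C)" by metis
  then have Q: "\<And>C. C \<in> F \<Longrightarrow> card (J C) = n \<Longrightarrow> Q C \<in> polyf (J C)"
    "\<And>C. C \<in> F \<Longrightarrow> card (J C) = n \<Longrightarrow> \<exists>a. Q C a \<noteq> 0"
    "\<And>C z. C \<in> F \<Longrightarrow> card (J C) = n \<Longrightarrow> vec_nth z \<in> C \<Longrightarrow> Q C (vec_nth z) \<noteq> 0 \<Longrightarrow> etale_at V (J C) z"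
    unfolding G_def by auto
  define D where "D C = (if card (J C) = n then C \<inter> {x. Q C x = 0} else C)" for C
  define B where "B = {x. \<exists>C\<in>F. x \<in> D C}"
  have B: "dset UNIV B" unfolding B_def
  proof (rule dset_bex[OF F(1)])
    fix C assume C: "C \<in> F"
    have "dset UNIV C" using tri_basic[OF J[OF C]] vs(1) by simp
    moreover have "dset UNIV {x. Q C x = 0}" if "card (J C) = n"
      by (rule dset_zero[OF polyf_imp_ratf[OF polyf_mono[OF Q(1)[OF C that] subset_UNIV]]])
    ultimately show "dset UNIV {x. x \<in> D C}" by (auto simp: D_def intro: dset_Int)
  qed
  have BV: "B \<subseteq> pts V" unfolding B_def F(2) D_def by (auto split: if_splits)
  have smB: "small (vec_nth -` B) (2 * n - 2)"
  proof -
    have "small (vec_nth -` D C) (2 * n - 2)" if C: "C \<in> F" for C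
    proof (cases "card (J C) = n")
      case True
      obtain a where "Q C a \<noteq> 0" using Q(2)[OF C True] ..
      then have "small {w \<in> Lsub (J C). Q C (vec_nth w) = 0} (2 * n - 2)"
        using polyf_zero_small[OF Q(1)[OF C True]] True by simp
      then have "small {z. vec_nth z \<in> C \<and> Q C (vec_nth z) = 0} (2 * n - 2)"
      proof (rule cell_small[OF J[OF C] vs(1)])
        fix w w' :: "complex ^ 'k" assume "\<forall>j\<in>J C. w $ j = w' $ j"
        then have "Q C (vec_nth w) = Q C (vec_nth w')" by (intro polyf_cong[OF Q(1)[OF C True]]) auto
        then show "Q C (vec_nth w) = 0 \<longleftrightarrow> Q C (vec_nth w') = 0" by simp
      qed
      moreover have "vec_nth -` D C = {z. vec_nth z \<in> C \<and> Q C (vec_nth z) = 0}"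
        using True by (auto simp: D_def)
      ultimately show ?thesis by simp
    next
      case False
      then have "card (J C) < n" using bound[OF C] by simp
      then show ?thesis using False
        by (simp add: D_def small_mono[OF cell_small_dim[OF J[OF C] vs(1)]])
    qed
    then have "small (\<Union>C\<in>F. vec_nth -` D C) (2 * n - 2)"
      by (intro small_UN countable_finite F)
    moreover have "vec_nth -` B = (\<Union>C\<in>F. vec_nth -` D C)" by (auto simp: B_def)
    ultimately show ?thesis by simp
  qed
  have "\<forall>z\<in>V. vec_nth z \<notin> B \<longrightarrow> (\<exists>J. card J = n \<and> etale_at V J z)"
  proof (intro ballI impI)
    fix z assume z: "z \<in> V" "vec_nth z \<notin> B"
    then have "vec_nth z \<in> pts V" by simp
    then have "vec_nth z \<in> \<Union>F" by (simp only: F(2))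
    then obtain C where C: "C \<in> F" "vec_nth z \<in> C" by (rule UnionE)
    have "vec_nth z \<notin> D C" using z(2) C(1) by (auto simp: B_def)
    then have "card (J C) = n" "Q C (vec_nth z) \<noteq> 0" using C(2) by (auto simp: D_def split: if_splits)
    then show "\<exists>J. card J = n \<and> etale_at V J z" using Q(3)[OF C(1) _ C(2)] by blast
  qed
  then show ?thesis by (rule that[OF B BV smB smV])
qed

section \<open>Intersection with a generic translate\<close>

text \<open>The index type \<open>'q\<close> may be infinite, as in \<open>dset_card_ge\<close>;
  membership in \<open>G\<close> depends on the finitely many variables in \<open>S\<close> and the
  parameters.\<close>

lemma dset_exists:
  fixes G :: "('p + 'q \<Rightarrow> complex) set"
  assumes S: "finite S" and G: "dset (range Inl \<union> Inr ` S) G"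
  shows "dset UNIV {e. \<exists>z. case_sum e z \<in> G}"
proof -
  have "dset (Inr ` S \<union> range Inl) G" using G by (simp add: Un_commute)
  then have "dset (range Inl) {x. \<exists>y. (\<forall>i. i \<notin> Inr ` S \<longrightarrow> y i = x i) \<and> y \<in> G}"
    by (rule dset_project[rotated]) (use S in auto)
  then have "dset UNIV {e. (\<lambda>s. case_sum (\<lambda>i. e i) (\<lambda>j. 0) s) \<in>
      {x. \<exists>y. (\<forall>i. i \<notin> Inr ` S \<longrightarrow> y i = x i) \<and> y \<in> G}}"
    by (rule dset_subst) (auto intro: ratf_var[OF UNIV_I] ratf_const)
  moreover have "(\<lambda>s. case_sum (\<lambda>i. e i) (\<lambda>j. 0) s) \<in>
      {x. \<exists>y. (\<forall>i. i \<notin> Inr ` S \<longrightarrow> y i = x i) \<and> y \<in> G} \<longleftrightarrow> (\<exists>z. case_sum e z \<in> G)" for e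
  proof
    assume "(\<lambda>s. case_sum (\<lambda>i. e i) (\<lambda>j. 0) s) \<in> {x. \<exists>y. (\<forall>i. i \<notin> Inr ` S \<longrightarrow> y i = x i) \<and> y \<in> G}"
    then obtain y where y: "\<forall>i. i \<notin> Inr ` S \<longrightarrow> y i = case_sum e (\<lambda>j. 0) i" "y \<in> G" by auto
    have "case_sum e (\<lambda>j. y (Inr j)) = y"
    proof
      show "case_sum e (\<lambda>j. y (Inr j)) s = y s" for s using y(1)[rule_format, of s] by (cases s) (auto simp: image_iff)
    qed
    then show "\<exists>z. case_sum e z \<in> G" using y(2) by metis
  next
    assume "\<exists>z. case_sum e z \<in> G"
    then obtain z where z: "case_sum e z \<in> G" ..
    define y where "y = case_sum e (\<lambda>j. if j \<in> S then z j else 0)"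
    have "y \<in> G \<longleftrightarrow> case_sum e z \<in> G" by (rule dset_cong[OF G]) (auto simp: y_def)
    moreover have "\<forall>i. i \<notin> Inr ` S \<longrightarrow> y i = case_sum e (\<lambda>j. 0) i"
    proof (intro allI impI)
      show "y i = case_sum e (\<lambda>j. 0) i" if "i \<notin> Inr ` S" for i using that by (cases i) (auto simp: y_def)
    qed
    ultimately show "(\<lambda>s. case_sum (\<lambda>i. e i) (\<lambda>j. 0) s) \<in> {x. \<exists>y. (\<forall>i. i \<notin> Inr ` S \<longrightarrow> y i = x i) \<and> y \<in> G}"
      using z by auto
  qed
  ultimately show ?thesis by simp
qed

text \<open>The equation attached to a variable that is not free has a simple root on the nonempty
  cell, hence is not the zero polynomial. It involves no variable after \<open>v\<close>.\<close>

lemma tri_dependent: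
  "tri vs J C \<Longrightarrow> vs = us @ ws \<Longrightarrow> v \<in> set us \<Longrightarrow> v \<notin> J \<Longrightarrow> C \<noteq> {} \<Longrightarrow>
     \<exists>f\<in>polyf (set us). (\<exists>a. f a \<noteq> 0) \<and> (\<forall>x\<in>C. f x = 0)"
proof (induction arbitrary: us ws rule: tri.induct)
  case (tri_free vs J C v' g)
  have ne: "C \<noteq> {}" using tri_free.prems by auto
  show ?case
  proof (cases ws rule: rev_cases)
    case Nil
    then have us: "us = vs @ [v']" using tri_free.prems by simp
    then have "v \<in> set vs" "v \<notin> J" using tri_free.prems by auto
    then obtain f where "f \<in> polyf (set vs)" "\<exists>a. f a \<noteq> 0" "\<forall>x\<in>C. f x = 0"
      using tri_free.IH[of vs "[]"] ne by auto
    then show ?thesis using polyf_mono[of f "set vs" "set us"] us by auto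
  next
    case (snoc ws' w)
    then have "vs = us @ ws'" using tri_free.prems by simp
    then show ?thesis using tri_free.IH[of us ws'] tri_free.prems ne by auto
  qed
next
  case (tri_root vs J C v' f)
  have ne: "C \<noteq> {}" using tri_root.prems by auto
  show ?case
  proof (cases ws rule: rev_cases)
    case Nil
    then have us: "us = vs @ [v']" using tri_root.prems by simp
    show ?thesis
    proof (cases "v = v'")
      case True
      obtain x where x: "x \<in> C" "f x = 0" using tri_root.prems by auto
      then have pd: "pd f v' x \<noteq> 0" using simple_root_pd tri_root.hyps(4) by metis
      have "\<exists>a. f a \<noteq> 0"
      proof (rule ccontr)
        assume "\<not> (\<exists>a. f a \<noteq> 0)"
        then have "f = (\<lambda>x. 0)" by auto
        then show False using pd by (simp add: pd_def)
      qed
      then show ?thesis using tri_root.hyps(3) us by auto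
    next
      case False
      then have "v \<in> set vs" "v \<notin> J" using tri_root.prems us by auto
      then obtain f' where "f' \<in> polyf (set vs)" "\<exists>a. f' a \<noteq> 0" "\<forall>x\<in>C. f' x = 0"
        using tri_root.IH[of vs "[]"] ne by auto
      then show ?thesis using polyf_mono[of f' "set vs" "set us"] us by auto
    qed
  next
    case (snoc ws' w)
    then have "vs = us @ ws'" using tri_root.prems by simp
    then show ?thesis using tri_root.IH[of us ws'] tri_root.prems ne by auto
  qed
qed simp

lemma card_UN_bound:
  assumes "finite T" "\<And>t. t \<in> T \<Longrightarrow> finite (S t) \<and> card (S t) \<le> d"
  shows "finite (\<Union>t\<in>T. S t) \<and> card (\<Union>t\<in>T. S t) \<le> card T * d"
proof
  show "finite (\<Union>t\<in>T. S t)" using assms by blast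
  have "card (\<Union>t\<in>T. S t) \<le> (\<Sum>t\<in>T. card (S t))" by (rule card_UN_le[OF assms(1)])
  also have "\<dots> \<le> (\<Sum>t\<in>T. d)" by (rule sum_mono) (use assms in auto)
  finally show "card (\<Union>t\<in>T. S t) \<le> card T * d" by simp
qed

text \<open>With the free coordinates fixed, each root step multiplies the number of points at most
  by the degree of its equation.\<close>

lemma tri_finite_fibres:
  "tri vs J C \<Longrightarrow> \<exists>b. \<forall>x. finite {y \<in> C. \<forall>i. i \<notin> set vs - J \<longrightarrow> y i = x i} \<and>
     card {y \<in> C. \<forall>i. i \<notin> set vs - J \<longrightarrow> y i = x i} \<le> b"
proof (induction rule: tri.induct)
  case tri_Nil
  have "{y \<in> UNIV. \<forall>i. i \<notin> set [] - {} \<longrightarrow> y i = x i} = {x}" for x :: "'a \<Rightarrow> complex"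
    by (auto simp: fun_eq_iff)
  then show ?case by (intro exI[of _ 1]) simp
next
  case (tri_free vs J C v g)
  then obtain b where b: "\<And>x. finite {y \<in> C. \<forall>i. i \<notin> set vs - J \<longrightarrow> y i = x i} \<and>
     card {y \<in> C. \<forall>i. i \<notin> set vs - J \<longrightarrow> y i = x i} \<le> b" by auto
  have A: "set (vs @ [v]) - insert v J = set vs - J" using tri_free.hyps(2) by auto
  have "{y \<in> C \<inter> {x. g x \<noteq> 0}. \<forall>i. i \<notin> set vs - J \<longrightarrow> y i = x i} \<subseteq>
      {y \<in> C. \<forall>i. i \<notin> set vs - J \<longrightarrow> y i = x i}" for x by auto
  then show ?case unfolding A using b by (meson card_mono finite_subset order_trans)
next
  case (tri_root vs J C v f)
  define K where "K x = {y \<in> C. \<forall>i. i \<notin> set vs - J \<longrightarrow> y i = x i}" for x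
  obtain b where b: "\<And>x. finite (K x) \<and> card (K x) \<le> b" using tri_root.IH unfolding K_def by auto
  obtain p d where p: "\<And>x. degree (p x) \<le> d" "\<And>x y. f (x(v := y)) = poly (p x) y"
    using polyf_family[OF tri_root.hyps(3,2)] by metis
  have vJ: "v \<notin> J" using tri_basic[OF tri_root.hyps(1)] tri_root.hyps(2) by auto
  have A: "set (vs @ [v]) - J = insert v (set vs - J)" using vJ by auto
  define R where "R t = (\<lambda>c. t(v := c)) ` {c. t(v := c) \<in> C \<and> f (t(v := c)) = 0}" for t
  have R: "finite (R t) \<and> card (R t) \<le> d" for t
  proof (cases "p t = 0")
    \<comment> \<open>The zero polynomial has no simple roots, so no point of the cell lies
      here.\<close>
    case True
    have "R t = {}"
    proof (rule ccontr)
      assume "R t \<noteq> {}"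
      then obtain c where c: "t(v := c) \<in> C" "f (t(v := c)) = 0" by (auto simp: R_def)
      then have "pd f v (t(v := c)) \<noteq> 0" using simple_root_pd tri_root.hyps(4) by metis
      moreover have "(\<lambda>y. f ((t(v := c))(v := y))) = (\<lambda>y. 0)" using p(2) True by auto
      ultimately show False by (simp add: pd_def)
    qed
    then show ?thesis by simp
  next
    case False
    have "R t \<subseteq> (\<lambda>c. t(v := c)) ` {c. poly (p t) c = 0}" by (auto simp: R_def p(2))
    moreover have "finite {c. poly (p t) c = 0}" by (rule poly_roots_finite[OF False])
    moreover have "card {c. poly (p t) c = 0} \<le> d"
      using card_poly_roots_bound[OF False] p(1)[of t] by (rule order_trans)
    ultimately show ?thesis
      by (meson card_image_le card_mono finite_imageI finite_subset order_trans)
  qed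
  have "{y \<in> C \<inter> {x. f x = 0}. \<forall>i. i \<notin> set (vs @ [v]) - J \<longrightarrow> y i = x i} \<subseteq> (\<Union>t\<in>K x. R t)" for x
  proof
    fix y assume "y \<in> {y \<in> C \<inter> {x. f x = 0}. \<forall>i. i \<notin> set (vs @ [v]) - J \<longrightarrow> y i = x i}"
    then have y: "y \<in> C" "f y = 0" "\<forall>i. i \<notin> insert v (set vs - J) \<longrightarrow> y i = x i" unfolding A by auto
    have "y(v := x v) \<in> C \<longleftrightarrow> y \<in> C"
      by (rule dset_cong[of "set vs"]) (use tri_basic[OF tri_root.hyps(1)] tri_root.hyps(2) in auto)
    then have "y(v := x v) \<in> K x" using y by (auto simp: K_def)
    moreover have "y \<in> R (y(v := x v))"
      unfolding R_def by (rule image_eqI[of _ _ "y v"]) (use y in auto)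
    ultimately show "y \<in> (\<Union>t\<in>K x. R t)" by blast
  qed
  moreover have "finite (\<Union>t\<in>K x. R t) \<and> card (\<Union>t\<in>K x. R t) \<le> b * d" for x
  proof -
    have "finite (\<Union>t\<in>K x. R t) \<and> card (\<Union>t\<in>K x. R t) \<le> card (K x) * d"
      using b R by (intro card_UN_bound) auto
    then show ?thesis using b[of x] by (meson mult_le_mono1 order_trans)
  qed
  ultimately show ?case by (meson card_mono finite_subset order_trans)
qed

section \<open>Quotients of torus points and the incidence variety\<close>

definition cdiv :: "complex ^ 'k::finite \<Rightarrow> complex ^ 'k \<Rightarrow> complex ^ 'k" where
  "cdiv z e = (\<chi> i. z $ i / e $ i)"

lemma in_translate: "e \<in> torus \<Longrightarrow> z \<in> translate e W \<longleftrightarrow> cdiv z e \<in> W"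
proof
  assume e: "e \<in> torus" and "z \<in> translate e W"
  then obtain w where w: "w \<in> W" "z = (\<chi> i. e $ i * w $ i)" by (auto simp: translate_def)
  have "cdiv z e = w" using e by (auto simp: cdiv_def w(2) vec_eq_iff torus_def)
  with w(1) show "cdiv z e \<in> W" by simp
next
  assume e: "e \<in> torus" and "cdiv z e \<in> W"
  moreover have "z = (\<chi> i. e $ i * cdiv z e $ i)" using e by (auto simp: cdiv_def vec_eq_iff torus_def)
  ultimately show "z \<in> translate e W" unfolding translate_def by blast
qed

lemma differentiable_vec_lambda:
  fixes f :: "'k::finite \<Rightarrow> 'a::real_normed_vector \<Rightarrow> 'b::euclidean_space"
  assumes "\<And>i. f i differentiable (at x within S)"
  shows "(\<lambda>x. \<chi> i. f i x) differentiable (at x within S)"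
proof -
  obtain D where "\<And>i. (f i has_derivative D i) (at x within S)"
    using assms unfolding differentiable_def by metis
  from has_derivative_vec_lambda[of f D x S, OF this] show ?thesis unfolding differentiable_def by blast
qed

lemma cdiv_differentiable_on:
  assumes "S \<subseteq> UNIV \<times> torus"
  shows "(\<lambda>p. cdiv (fst p) (snd p)) differentiable_on S"
  unfolding differentiable_on_def cdiv_def
proof (intro ballI differentiable_vec_lambda)
  fix p i assume "p \<in> S"
  then have nz: "snd p $ i \<noteq> 0" using assms by (auto simp: torus_def)
  have "bounded_linear (\<lambda>p :: (complex ^ 'a) \<times> (complex ^ 'a). fst p $ i)"
    "bounded_linear (\<lambda>p :: (complex ^ 'a) \<times> (complex ^ 'a). snd p $ i)"
    using bounded_linear_compose[OF bounded_linear_vec_nth bounded_linear_fst]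
      bounded_linear_compose[OF bounded_linear_vec_nth bounded_linear_snd] by auto
  then show "(\<lambda>p. fst p $ i / snd p $ i) differentiable (at p within S)"
    by (intro differentiable_divide bounded_linear_imp_differentiable nz)
qed

lemma tangent_spaceI:
  assumes \<delta>: "\<delta> > 0" and s: "\<And>t. \<bar>t\<bar> < \<delta> \<Longrightarrow> s t \<in> S" and z: "s 0 = z"
    and d: "(s has_vector_derivative v) (at 0)"
  shows "v \<in> tangent_space S z"
proof -
  \<comment> \<open>Away from 0 the curve rests at \<open>z\<close>, because
    \<open>tangent_space\<close> asks for curves on the whole line.\<close>
  define \<gamma> where "\<gamma> t = (if \<bar>t\<bar> < \<delta> then s t else z)" for t
  have "z \<in> S" using s[of 0] \<delta> z by simp
  then have "range \<gamma> \<subseteq> S" using s by (auto simp: \<gamma>_def)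
  moreover have "(\<gamma> has_vector_derivative v) (at 0)"
    by (rule has_vector_derivative_transform_within_open[OF d, of "{-\<delta><..<\<delta>}"])
      (use \<delta> in \<open>auto simp: \<gamma>_def\<close>)
  moreover have "\<gamma> 0 = z" using \<delta> z by (simp add: \<gamma>_def)
  ultimately show ?thesis unfolding tangent_space_def by blast
qed

text \<open>The linear part of transversality, split off from the requirement that both sets are
  submanifolds at \<open>z\<close>.\<close>

definition spanning where
  "spanning A B z \<longleftrightarrow> {v + w | v w. v \<in> tangent_space A z \<and> w \<in> tangent_space B z} = UNIV"

text \<open>Coordinates \<open>Inl i\<close> are those of the translation parameter \<open>\<epsilon>\<close>, coordinates \<open>Inr i\<close> those of a
  point of \<open>V \<inter> \<epsilon>W\<close>.\<close>

definition incidence :: "(complex ^ 'm::finite) set \<Rightarrow> (complex ^ 'm) set \<Rightarrow> ('m + 'm \<Rightarrow> complex) set" where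
  "incidence V W = {x. (\<forall>i\<in>UNIV. x (Inl i) \<noteq> 0) \<and> (\<lambda>i. x (Inr i)) \<in> pts V \<and>
     (\<lambda>i. x (Inr i) / x (Inl i)) \<in> pts W}"

lemma in_incidence:
  "x \<in> incidence V W \<longleftrightarrow> (\<chi> i. x (Inl i)) \<in> torus \<and>
     (\<chi> i. x (Inr i)) \<in> V \<inter> translate (\<chi> i. x (Inl i)) W"
  by (auto simp: incidence_def in_translate torus_def pts_def cdiv_def)

lemma dset_incidence:
  assumes "dset UNIV (pts V)" "dset UNIV (pts W)"
  shows "dset UNIV (incidence V W)"
  unfolding incidence_def
proof (intro dset_conj dset_ball)
  show "dset UNIV {x. (\<lambda>i. x (Inr i)) \<in> pts V}"
    by (rule dset_subst[OF assms(1)]) (auto intro: ratf_var)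
  show "dset UNIV {x. (\<lambda>i. x (Inr i) / x (Inl i)) \<in> pts W}"
    by (rule dset_subst[OF assms(2)]) (intro ratf_var ratf_divide UNIV_I)
qed (intro finite dset_neq ratf_var UNIV_I)+

text \<open>A cell over which the translation parameter is free and nothing else is gives local sections
  of the incidence variety; differentiating them yields transversality.\<close>

lemma section_spanning:
  fixes V W :: "(complex ^ 'm::finite) set"
  assumes VW: "V \<subseteq> torus" and C: "tri vs (range Inl) C" "set vs = UNIV" "C \<subseteq> incidence V W"
    and x: "case_sum (vec_nth e) (vec_nth z) \<in> C"
  shows "spanning V (translate e W) z"
proof -
  let ?J = "range Inl :: ('m + 'm) set"
  define p :: "complex ^ ('m + 'm)" where "p = (\<chi> s. case_sum (vec_nth e) (vec_nth z) s)"
  have p: "vec_nth p \<in> C" using x by (simp add: p_def vec_lambda_inverse)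
  obtain g F where g: "g \<in> polyf UNIV"
    and CF: "C = {x. g x \<noteq> 0 \<and> (\<forall>k. k \<notin> ?J \<longrightarrow> F k x = 0)}"
    and et: "\<forall>z. vec_nth z \<in> C \<longrightarrow> etale ?J F z" by (rule tri_etale[OF C(1,2)])
  have etp: "etale ?J F p" using et p by blast
  have N: "open {z. g (vec_nth z) \<noteq> 0}" "p \<in> {z. g (vec_nth z) \<noteq> 0}"
    using open_polyf_neq_0[OF g] p CF by auto
  obtain U Y \<Psi> \<Psi>' where li: "local_inverse ?J F U Y \<Psi> \<Psi>'" and U: "p \<in> U" "U \<subseteq> {z. g (vec_nth z) \<noteq> 0}"
    by (rule etale_chart[OF etp N])
  have eT: "e \<in> torus" "z \<in> V" using x C(3) by (auto simp: in_incidence)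
  have zT: "z \<in> torus" using eT VW by auto
  have p0: "chart ?J F p \<in> Y" using local_inverseD(3)[OF li] U by blast
  have "u \<in> {v + w | v w. v \<in> tangent_space V z \<and> w \<in> tangent_space (translate e W) z}" for u
  proof -
    \<comment> \<open>The velocity of the parameter. When the parameter moves with velocity
      \<open>\<eta>\<close> and the point with velocity \<open>v1\<close>, their quotient, scaled
      back by \<open>e\<close>, moves with velocity \<open>v1 - u\<close>.\<close>
    define \<eta> where "\<eta> = (\<chi> i. e $ i * u $ i / z $ i)"
    define \<eta>' :: "complex ^ ('m + 'm)" where "\<eta>' = (\<chi> s. case_sum (vec_nth \<eta>) (\<lambda>_. 0) s)"
    define c where "c t = chart ?J F p + t *\<^sub>R \<eta>'" for t
    have "open (c -` Y)"
      by (rule open_vimage[OF local_inverseD(2)[OF li]]) (auto simp: c_def[abs_def] intro!: continuous_intros)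
    moreover have "0 \<in> c -` Y" using p0 by (simp add: c_def)
    ultimately obtain \<delta> where "\<delta> > 0" and sub: "ball 0 \<delta> \<subseteq> c -` Y" by (rule openE)
    then have \<delta>: "\<delta> > 0" "\<And>t. \<bar>t\<bar> < \<delta> \<Longrightarrow> c t \<in> Y" by (auto simp: ball_def)
    define P where "P t = \<Psi> (c t)" for t
    define s :: "real \<Rightarrow> complex ^ 'm" where "s t = (\<chi> i. P t $ Inr i)" for t
    have c_comp: "c t $ Inl i = e $ i + of_real t * \<eta> $ i" "k \<notin> ?J \<Longrightarrow> c t $ k = 0" for t i k
      using etp scaleR_conv_of_real[of t "\<eta> $ i"]
      by (auto simp: c_def chart_def \<eta>'_def p_def etale_def split: sum.splits)
    have P: "P t \<in> U" "chart ?J F (P t) = c t" if "\<bar>t\<bar> < \<delta>" for t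
      using local_inverseD(5)[OF li \<delta>(2)[OF that]] by (auto simp: P_def)
    have PI: "P t $ Inl i = e $ i + of_real t * \<eta> $ i" if "\<bar>t\<bar> < \<delta>" for t i
      using arg_cong[OF P(2)[OF that], of "\<lambda>v. v $ Inl i"] by (simp add: chart_def c_comp)
    have PC: "vec_nth (P t) \<in> C" if "\<bar>t\<bar> < \<delta>" for t
      unfolding CF
    proof (intro CollectI conjI allI impI)
      show "g (vec_nth (P t)) \<noteq> 0" using P(1)[OF that] U(2) by auto
      show "F k (vec_nth (P t)) = 0" if "k \<notin> ?J" for k
        using arg_cong[OF P(2)[OF \<open>\<bar>t\<bar> < \<delta>\<close>], of "\<lambda>v. v $ k"] that by (simp add: chart_def c_comp)
    qed
    define E :: "real \<Rightarrow> complex ^ 'm" where "E t = (\<chi> i. e $ i + of_real t * \<eta> $ i)" for t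
    have inc: "E t \<in> torus" "s t \<in> V" "s t \<in> translate (E t) W" if "\<bar>t\<bar> < \<delta>" for t
      using PC[OF that] C(3) PI[OF that] by (auto simp: in_incidence E_def s_def)
    have P0: "P 0 = p" using local_inverseD(4)[OF li U(1)] by (simp add: P_def c_def)
    have s0: "s 0 = z" by (simp add: s_def P0 p_def)
    have dP: "(P has_derivative (\<lambda>t. \<Psi>' (c 0) (t *\<^sub>R \<eta>'))) (at 0)"
    proof -
      have 1: "(c has_derivative (\<lambda>t. t *\<^sub>R \<eta>')) (at 0)"
        unfolding c_def by (auto intro!: derivative_eq_intros)
      have 2: "(\<Psi> has_derivative \<Psi>' (c 0)) (at (c 0))"
        using local_inverseD(6)[OF li p0] by (simp add: c_def)
      show ?thesis unfolding P_def by (rule has_derivative_compose[OF 1 2])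
    qed
    then obtain v where dv: "(P has_vector_derivative v) (at 0)"
      using vector_derivative_works differentiableI by blast
    have Pi: "((\<lambda>t. P t $ k) has_vector_derivative v $ k) (at 0)" for k
      using bounded_linear.has_vector_derivative[OF bounded_linear_vec_nth dv] .
    have vec: "((\<lambda>t. \<chi> i. h i t) has_vector_derivative (\<chi> i. h' i)) (at 0)"
      if "\<And>i. (h i has_vector_derivative h' i) (at 0)" for h :: "'m \<Rightarrow> real \<Rightarrow> complex" and h'
    proof -
      have "((\<lambda>t. \<chi> i. h i t) has_derivative (\<lambda>t. \<chi> i. t *\<^sub>R h' i)) (at 0)"
        using that by (intro has_derivative_vec_lambda) (simp add: has_vector_derivative_def)
      moreover have "(\<lambda>t. \<chi> i. t *\<^sub>R h' i) = (\<lambda>t. t *\<^sub>R (\<chi> i. h' i))" by (simp add: vec_eq_iff fun_eq_iff)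
      ultimately show ?thesis by (simp add: has_vector_derivative_def)
    qed
    define v1 where "v1 = (\<chi> i. v $ Inr i)"
    have ds: "(s has_vector_derivative v1) (at 0)"
      unfolding s_def v1_def by (rule vec) (rule Pi)
    have 1: "v1 \<in> tangent_space V z"
      by (rule tangent_spaceI[OF \<delta>(1) inc(2) s0 ds])
    \<comment> \<open>The quotients of point by parameter lie in \<open>W\<close>. Reversing time
      changes the velocity to \<open>u - v1\<close>, which complements \<open>v1\<close> to
      \<open>u\<close>.\<close>
    define r where "r t = (\<chi> i. e $ i * (s (- t) $ i / E (- t) $ i))" for t
    have "r t \<in> translate e W" if "\<bar>t\<bar> < \<delta>" for t
    proof -
      have "\<bar>- t\<bar> < \<delta>" using that by simp
      from inc(1,3)[OF this] have "cdiv (s (- t)) (E (- t)) \<in> W" by (simp add: in_translate)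
      then have "(\<chi> i. e $ i * cdiv (s (- t)) (E (- t)) $ i) \<in> translate e W"
        unfolding translate_def by blast
      then show ?thesis by (simp add: r_def cdiv_def)
    qed
    moreover have "r 0 = z" using eT(1) by (simp add: r_def s0 E_def vec_eq_iff torus_def)
    moreover have "(r has_vector_derivative (\<chi> i. u $ i - v1 $ i)) (at 0)"
      unfolding r_def
    proof (rule vec)
      fix i
      have ei: "e $ i \<noteq> 0" "z $ i \<noteq> 0" using eT(1) zT by (auto simp: torus_def)
      have d1: "((\<lambda>t. s (- t) $ i) has_vector_derivative - (v1 $ i)) (at 0)"
      proof -
        have "((\<lambda>t. P t $ Inr i) has_vector_derivative v $ Inr i) (at (- 0))" using Pi by simp
        from vector_diff_chain_at[of uminus "-1" 0, OF _ this]
        have "((\<lambda>t. P t $ Inr i) \<circ> uminus has_vector_derivative (- 1) *\<^sub>R (v $ Inr i)) (at 0)"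
          by (auto intro!: derivative_eq_intros simp: has_vector_derivative_def)
        then show ?thesis by (simp add: s_def v1_def o_def)
      qed
      have d2: "((\<lambda>t. E (- t) $ i) has_vector_derivative - (\<eta> $ i)) (at 0)"
        unfolding E_def by (auto intro!: derivative_eq_intros simp: has_vector_derivative_def scaleR_conv_of_real)
      have "((\<lambda>t. e $ i * (s (- t) $ i / E (- t) $ i)) has_derivative
          (\<lambda>t. e $ i * ((t *\<^sub>R (- (v1 $ i)) * E 0 $ i - s 0 $ i * (t *\<^sub>R (- (\<eta> $ i)))) / (E 0 $ i * E 0 $ i)))) (at 0)"
        using has_derivative_mult_right[OF has_derivative_divide'[OF d1[unfolded has_vector_derivative_def] d2[unfolded has_vector_derivative_def]], of "e $ i"] ei
        by (simp add: E_def)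
      moreover have "e $ i * ((t *\<^sub>R (- (v1 $ i)) * E 0 $ i - s 0 $ i * (t *\<^sub>R (- (\<eta> $ i)))) / (E 0 $ i * E 0 $ i)) =
          t *\<^sub>R (u $ i - v1 $ i)" for t
        using ei by (simp add: E_def s0 \<eta>_def scaleR_conv_of_real field_simps)
      ultimately show "((\<lambda>t. e $ i * (s (- t) $ i / E (- t) $ i)) has_vector_derivative u $ i - v1 $ i) (at 0)"
        by (simp add: has_vector_derivative_def)
    qed
    ultimately have "(\<chi> i. u $ i - v1 $ i) \<in> tangent_space (translate e W) z"
      by (intro tangent_spaceI[OF \<delta>(1), of r])
    moreover have "u = v1 + (\<chi> i. u $ i - v1 $ i)" by (simp add: vec_eq_iff)
    ultimately show ?thesis using 1 by blast
  qed
  then show ?thesis unfolding spanning_def by blast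
qed

lemma cdiv_cdiv: "z \<in> torus \<Longrightarrow> e \<in> torus \<Longrightarrow> cdiv z (cdiv z e) = e"
  by (auto simp: cdiv_def vec_eq_iff torus_def)

text \<open>The incidence variety is parametrized by the pairs in \<open>V \<times> W\<close>, of
  real dimension at most \<open>2 * CARD('m)\<close>. A free coordinate beyond the parameters would
  make an image of these pairs contain an open set of real dimension
  \<open>2 * CARD('m) + 2\<close>.\<close>

lemma incidence_cell_bound:
  fixes V W :: "(complex ^ 'm::finite) set"
  assumes VW: "V \<subseteq> torus" "W \<subseteq> torus" "small V CARD('m)" "small W CARD('m)"
    and C: "tri vs J C" "set vs = UNIV" "C \<subseteq> incidence V W" and J: "range Inl \<subseteq> J" "Inr j \<in> J"
  shows "C = {}"
proof (rule ccontr)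
  assume "C \<noteq> {}"
  then obtain x where x: "x \<in> C" by auto
  define p :: "complex ^ ('m + 'm)" where "p = (\<chi> s. x s)"
  have p: "vec_nth p \<in> C" using x by (simp add: p_def vec_lambda_inverse)
  obtain \<delta> where \<delta>: "\<delta> > 0"
    "\<And>x. (\<And>j. j \<in> J \<Longrightarrow> dist (x j) (p $ j) < \<delta>) \<Longrightarrow> \<exists>w\<in>UNIV. vec_nth w \<in> C \<and> (\<forall>j\<in>J. w $ j = x j)"
    by (rule cell_section[OF C(1,2) p open_UNIV UNIV_I]) blast
  \<comment> \<open>From the two points recover the translation parameter, their quotient, and the
    additional free coordinate.\<close>
  define h :: "(complex ^ 'm) \<times> (complex ^ 'm) \<Rightarrow> (complex ^ 'm) \<times> complex" where
    "h q = (cdiv (fst q) (snd q), fst q $ j)" for q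
  have "(\<lambda>q. fst q $ j) differentiable_on (V \<times> W)"
    by (intro bounded_linear_imp_differentiable_on bounded_linear_compose[OF bounded_linear_vec_nth bounded_linear_fst])
  then have "h differentiable_on (V \<times> W)"
    unfolding h_def differentiable_on_def
    using cdiv_differentiable_on[of "V \<times> W"] VW(2)
    by (auto simp: differentiable_on_def intro!: differentiable_Pair)
  moreover have "small (V \<times> W) (CARD('m) + CARD('m))" by (rule small_Times[OF VW(3,4)])
  ultimately have "negligible (h ` (V \<times> W))" by (intro small_negligible) auto
  moreover define O' where "O' = {e :: complex ^ 'm. \<forall>i. dist (e $ i) (p $ Inl i) < \<delta>} \<times> ball (p $ Inr j) \<delta>"
  have "O' \<subseteq> h ` (V \<times> W)"
  proof
    fix q assume "q \<in> O'"
    then obtain e c where q: "q = (e, c)" "\<And>i. dist (e $ i) (p $ Inl i) < \<delta>" "dist c (p $ Inr j) < \<delta>"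
      unfolding O'_def by (cases q) (auto simp: dist_commute)
    define y where "y = case_sum (vec_nth e) (\<lambda>i. if i = j then c else p $ Inr i)"
    have "dist (y s) (p $ s) < \<delta>" for s using q \<delta>(1) by (cases s) (auto simp: y_def)
    then obtain w where w: "vec_nth w \<in> C" "\<forall>s\<in>J. w $ s = y s" using \<delta>(2)[of y] by blast
    define v where "v = (\<chi> i. w $ Inr i)"
    have "w $ Inl i = e $ i" for i using bspec[OF w(2), of "Inl i"] J(1) by (auto simp: y_def)
    then have we: "(\<chi> i. w $ Inl i) = e" by (simp add: vec_eq_iff)
    have "vec_nth w \<in> incidence V W" using w(1) C(3) by blast
    then have e: "e \<in> torus" "v \<in> V" "cdiv v e \<in> W"
      using in_translate[of e] by (auto simp: in_incidence we v_def)
    have "v $ j = c" using w(2) J(2) by (simp add: v_def y_def)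
    moreover have "cdiv v (cdiv v e) = e" using e VW by (intro cdiv_cdiv) auto
    ultimately have "q = h (v, cdiv v e)" by (simp add: h_def q)
    then show "q \<in> h ` (V \<times> W)" using e by blast
  qed
  ultimately have "negligible O'" by (rule negligible_subset)
  moreover have "open O'"
  proof -
    have "open (\<Inter>i. {e :: complex ^ 'm. dist (e $ i) (p $ Inl i) < \<delta>})"
      by (intro open_INT finite ballI open_Collect_less continuous_intros)
    also have "(\<Inter>i. {e :: complex ^ 'm. dist (e $ i) (p $ Inl i) < \<delta>}) =
        {e. \<forall>i. dist (e $ i) (p $ Inl i) < \<delta>}" by auto
    finally show ?thesis unfolding O'_def by (intro open_Times open_ball)
  qed
  moreover have "((\<chi> i. p $ Inl i), p $ Inr j) \<in> O'" using \<delta>(1) by (simp add: O'_def)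
  ultimately show False using open_not_negligible by blast
qed

lemma dset_exists_UNIV:
  fixes G :: "('m::finite + 'm \<Rightarrow> complex) set"
  assumes "dset UNIV G" shows "dset UNIV {e. \<exists>z. case_sum e z \<in> G}"
  using dset_exists[of "UNIV :: 'm set" G] assms by (simp add: UNIV_sum)

text \<open>A bad parameter is the quotient of a point of \<open>A\<close> by a point of
  \<open>B\<close>. Such quotients are negligible, as \<open>r + s\<close> is below the real
  dimension of the torus.\<close>

lemma generic_avoids:
  fixes V W :: "(complex ^ 'm::finite) set"
  assumes V: "V \<subseteq> torus" and W: "W \<subseteq> torus" and d: "dset UNIV (pts V)" "dset UNIV (pts W)"
    and A: "dset UNIV A" "A \<subseteq> pts V" "small (vec_nth -` A) r"
    and B: "dset UNIV B" "B \<subseteq> pts W" "small (vec_nth -` B) s" and rs: "r + s < 2 * CARD('m)"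
  shows "generic UNIV {e. \<forall>z. case_sum e z \<in> incidence V W \<longrightarrow>
    \<not> ((\<lambda>i. z i) \<in> A \<and> (\<lambda>i. z i / e i) \<in> B)}"
proof -
  let ?G = "incidence V W \<inter> ({x. (\<lambda>i. x (Inr i)) \<in> A} \<inter> {x. (\<lambda>i. x (Inr i) / x (Inl i)) \<in> B})"
  have "dset UNIV ?G"
  proof (intro dset_Int dset_incidence d)
    show "dset UNIV {x. (\<lambda>i. x (Inr i)) \<in> A}"
      by (rule dset_subst[OF A(1)]) (intro ratf_var UNIV_I)
    show "dset UNIV {x. (\<lambda>i. x (Inr i) / x (Inl i)) \<in> B}"
      by (rule dset_subst[OF B(1)]) (intro ratf_var ratf_divide UNIV_I)
  qed
  then have dE: "dset UNIV {e. \<exists>z. case_sum e z \<in> ?G}" by (rule dset_exists_UNIV)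
  let ?h = "\<lambda>p. cdiv (fst p) (snd p)"
  have "vec_nth -` B \<subseteq> torus"
  proof
    fix w assume "w \<in> vec_nth -` B"
    then have "vec_nth w \<in> pts W" using B(2) by auto
    then show "w \<in> torus" using W by auto
  qed
  then have "?h differentiable_on (vec_nth -` A \<times> vec_nth -` B)"
    by (intro cdiv_differentiable_on) auto
  then have "negligible (?h ` (vec_nth -` A \<times> vec_nth -` B))"
    using rs by (intro small_negligible[OF small_Times[OF A(3) B(3)]]) auto
  moreover have "vec_nth -` {e. \<exists>z. case_sum e z \<in> ?G} \<subseteq> ?h ` (vec_nth -` A \<times> vec_nth -` B)"
  proof
    fix e assume "e \<in> vec_nth -` {e. \<exists>z. case_sum e z \<in> ?G}"
    then obtain z where z: "case_sum (vec_nth e) z \<in> incidence V W" "(\<lambda>i. z i) \<in> A"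
      "(\<lambda>i. z i / e $ i) \<in> B" by auto
    define v where "v = (\<chi> i. z i)"
    have "e \<in> torus" "v \<in> torus" using z(1) V by (auto simp: in_incidence v_def)
    then have "e = ?h (v, cdiv v e)" by (simp add: cdiv_cdiv)
    moreover have "vec_nth v \<in> A" "vec_nth (cdiv v e) \<in> B"
      using z(2,3) by (simp_all add: v_def cdiv_def vec_lambda_inverse)
    ultimately show "e \<in> ?h ` (vec_nth -` A \<times> vec_nth -` B)" by blast
  qed
  ultimately have "negligible (vec_nth -` {e. \<exists>z. case_sum e z \<in> ?G})" by (rule negligible_subset)
  from negligible_generic_Compl[OF dE this] show ?thesis
    by (rule generic_mono) auto
qed

lemma generic_rename:
  fixes f :: "('m + 'm \<Rightarrow> complex) \<Rightarrow> complex"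
  assumes f: "f \<in> polyf (range Inl)" and a: "f a \<noteq> 0"
  shows "generic UNIV {e. \<forall>z. f (case_sum e z) \<noteq> 0}"
proof -
  define P where "P e = f (\<lambda>s. case_sum (\<lambda>i. e i) (\<lambda>j. 0) s)" for e
  have P: "P \<in> polyf UNIV" unfolding P_def
    by (rule polyf_subst[OF f]) (auto intro: polyf_var[OF UNIV_I])
  have eq: "f (case_sum e z) = P e" for e z
    unfolding P_def by (rule polyf_cong[OF f]) auto
  have "f a = f (case_sum (\<lambda>i. a (Inl i)) (\<lambda>i. a (Inr i)))"
    by (rule polyf_cong[OF f]) auto
  then have "P (\<lambda>i. a (Inl i)) \<noteq> 0" using a eq by simp
  from generic_neq[OF P this] show ?thesis by (simp add: eq)
qed

lemma generic_forall_cells: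
  assumes "finite F" "\<And>C. C \<in> F \<Longrightarrow> generic A {e. P C e}"
  shows "generic A {e. \<forall>C\<in>F. P C e}"
proof -
  have "generic A (\<Inter>C\<in>F. {e. P C e})" by (rule generic_INT[OF assms])
  moreover have "(\<Inter>C\<in>F. {e. P C e}) = {e. \<forall>C\<in>F. P C e}" by auto
  ultimately show ?thesis by simp
qed

lemma generic_torus: "generic UNIV {e :: 'm::finite \<Rightarrow> complex. vec_lambda e \<in> torus}"
proof -
  have "generic UNIV {e :: 'm \<Rightarrow> complex. \<forall>i\<in>UNIV. e i \<noteq> 0}"
    by (rule generic_forall_cells[OF finite])
      (rule generic_neq[OF polyf_var[OF UNIV_I], where a = "\<lambda>_. 1"], simp)
  then show ?thesis by (simp add: torus_def)
qed

text \<open>In a nonempty cell either the free variables are exactly the parameters, or the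
  parameters satisfy a nonzero polynomial equation. Cells of the second kind do not lie over generic
  parameters.\<close>

lemma incidence_generic:
  fixes V W :: "(complex ^ 'm::finite) set"
  assumes VW: "V \<subseteq> torus" "W \<subseteq> torus" "small V CARD('m)" "small W CARD('m)"
    and d: "dset UNIV (pts V)" "dset UNIV (pts W)"
  obtains b where "generic UNIV {e. \<forall>z. case_sum e z \<in> incidence V W \<longrightarrow>
      spanning V (translate (vec_lambda e) W) (vec_lambda z)}"
    "generic UNIV {e. finite {z. case_sum e z \<in> incidence V W} \<and> card {z. case_sum e z \<in> incidence V W} \<le> b}"
proof -
  let ?G = "incidence V W"
  obtain xs :: "'m list" where xs: "set xs = UNIV" "distinct xs"
    using finite_distinct_list[of "UNIV :: 'm set"] by auto
  \<comment> \<open>The parameters come first, so that a parameter that is not free satisfies an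
    equation in parameters alone.\<close>
  define vs :: "('m + 'm) list" where "vs = map Inl xs @ map Inr xs"
  have vs: "set vs = UNIV" "distinct vs"
    using xs by (auto simp: vs_def UNIV_sum distinct_map inj_on_def)
  obtain F where F: "finite F" "\<And>C. C \<in> F \<Longrightarrow> \<exists>I. tri vs I C" "?G = \<Union>F"
    using dset_cellular[OF vs(2), of ?G] dset_incidence[OF d] vs(1) unfolding cellular_def by auto
  obtain J where J: "\<And>C. C \<in> F \<Longrightarrow> tri vs (J C) C" using F(2) by metis
  have sub: "C \<subseteq> ?G" if "C \<in> F" for C unfolding F(3) using that by (rule Union_upper)
  have gen: "generic UNIV {e. \<forall>z. case_sum e z \<in> C \<longrightarrow> J C = range Inl}" if C: "C \<in> F" for C
  proof (cases "C = {} \<or> J C = range Inl")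
    case True
    then have "{e. \<forall>z. case_sum e z \<in> C \<longrightarrow> J C = range Inl} = UNIV" by auto
    then show ?thesis by (simp add: generic_UNIV)
  next
    case False
    have "\<not> range Inl \<subseteq> J C"
    proof
      assume *: "range Inl \<subseteq> J C"
      with False obtain s where "s \<in> J C" "s \<notin> range Inl" by auto
      then obtain j where "Inr j \<in> J C" by (cases s) auto
      from incidence_cell_bound[OF VW J[OF C] vs(1) sub[OF C] * this] False show False by simp
    qed
    then obtain i where i: "Inl i \<notin> J C" by auto
    have "Inl i \<in> set (map Inl xs)" using xs by auto
    then obtain f a where f: "f \<in> polyf (set (map Inl xs))" "f a \<noteq> 0" "\<forall>x\<in>C. f x = 0"
      using tri_dependent[OF J[OF C] vs_def _ i] False by metis
    have "f \<in> polyf (range Inl)" using f(1) xs by simp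
    from generic_rename[OF this f(2)] show ?thesis
      by (rule generic_mono) (use f(3) in auto)
  qed
  have gen': "generic UNIV {e. \<forall>C\<in>F. \<forall>z. case_sum e z \<in> C \<longrightarrow> J C = range Inl}"
    by (rule generic_forall_cells[OF F(1) gen])
  have 1: "generic UNIV {e. \<forall>z. case_sum e z \<in> ?G \<longrightarrow> spanning V (translate (vec_lambda e) W) (vec_lambda z)}"
  proof (rule generic_mono[OF gen'], intro subsetI CollectI allI impI)
    fix e z assume e: "e \<in> {e. \<forall>C\<in>F. \<forall>z. case_sum e z \<in> C \<longrightarrow> J C = range Inl}"
      and "case_sum e z \<in> ?G"
    then obtain C where C: "C \<in> F" "case_sum e z \<in> C" unfolding F(3) by (elim UnionE)
    then have "J C = range Inl" using e by blast
    then have "tri vs (range Inl) C" using J[OF C(1)] by simp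
    from section_spanning[OF VW(1) this vs(1) sub[OF C(1)], of "vec_lambda e" "vec_lambda z"] C(2)
    show "spanning V (translate (vec_lambda e) W) (vec_lambda z)" by (simp add: vec_lambda_inverse)
  qed
  define fb where "fb C b \<longleftrightarrow> (\<forall>x. finite {y \<in> C. \<forall>i. i \<notin> set vs - J C \<longrightarrow> y i = x i} \<and>
     card {y \<in> C. \<forall>i. i \<notin> set vs - J C \<longrightarrow> y i = x i} \<le> b)" for C b
  have "\<exists>b. fb C b" if "C \<in> F" for C
    unfolding fb_def by (rule tri_finite_fibres[OF J[OF that]])
  then obtain b where fb: "\<And>C. C \<in> F \<Longrightarrow> fb C (b C)" by metis
  have b: "\<And>C x. C \<in> F \<Longrightarrow> finite {y \<in> C. \<forall>i. i \<notin> UNIV - J C \<longrightarrow> y i = x i} \<and>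
     card {y \<in> C. \<forall>i. i \<notin> UNIV - J C \<longrightarrow> y i = x i} \<le> b C" using fb unfolding fb_def vs(1) by blast
  have 2: "generic UNIV {e. finite {z. case_sum e z \<in> ?G} \<and> card {z. case_sum e z \<in> ?G} \<le> (\<Sum>C\<in>F. b C)}"
  proof (rule generic_mono[OF gen'], intro subsetI CollectI)
    fix e assume e: "e \<in> {e. \<forall>C\<in>F. \<forall>z. case_sum e z \<in> C \<longrightarrow> J C = range Inl}"
    have fib: "finite {z. case_sum e z \<in> C} \<and> card {z. case_sum e z \<in> C} \<le> b C" if C: "C \<in> F" for C
    proof (cases "{z. case_sum e z \<in> C} = {}")
      case False
      then have JC: "J C = range Inl" using e C by auto
      let ?Y = "{y \<in> C. \<forall>i. i \<notin> UNIV - J C \<longrightarrow> y i = case_sum e (\<lambda>_. 0) i}"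
      have "(\<lambda>z. case_sum e z) ` {z. case_sum e z \<in> C} \<subseteq> ?Y" by (auto simp: JC)
      moreover have "inj_on (\<lambda>z. case_sum e z) {z. case_sum e z \<in> C}"
      proof (rule inj_onI)
        fix z z' assume "case_sum e z = case_sum e z'"
        then have "case_sum e z (Inr i) = case_sum e z' (Inr i)" for i by simp
        then show "z = z'" by (simp add: fun_eq_iff)
      qed
      ultimately show ?thesis using b[OF C, of "case_sum e (\<lambda>_. 0)"]
        by (meson card_inj_on_le finite_subset inj_on_finite order_trans)
    qed simp
    have eq: "{z. case_sum e z \<in> ?G} = (\<Union>C\<in>F. {z. case_sum e z \<in> C})" unfolding F(3) by auto
    show "finite {z. case_sum e z \<in> ?G} \<and> card {z. case_sum e z \<in> ?G} \<le> (\<Sum>C\<in>F. b C)"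
    proof
      show "finite {z. case_sum e z \<in> ?G}" unfolding eq using F(1) fib by blast
      have "card (\<Union>C\<in>F. {z. case_sum e z \<in> C}) \<le> (\<Sum>C\<in>F. card {z. case_sum e z \<in> C})"
        by (rule card_UN_le[OF F(1)])
      also have "\<dots> \<le> (\<Sum>C\<in>F. b C)" by (rule sum_mono) (use fib in auto)
      finally show "card {z. case_sum e z \<in> ?G} \<le> (\<Sum>C\<in>F. b C)" unfolding eq .
    qed
  qed
  from 1 2 show ?thesis by (rule that)
qed

text \<open>Encodes \<open>k\<close> distinct points over \<open>e\<close> as \<open>k\<close>
  further blocks of variables, all eliminated together.\<close>

lemma dset_card_ge:
  fixes G :: "('m::finite + 'm \<Rightarrow> complex) set"
  assumes G: "dset UNIV G"
  shows "dset UNIV {e. \<exists>T. finite T \<and> card T = k \<and> (\<forall>z\<in>T. case_sum e z \<in> G)}"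
proof -
  let ?S = "{..<k} \<times> (UNIV :: 'm set)"
  let ?A = "range Inl \<union> Inr ` ?S :: ('m + nat \<times> 'm) set"
  let ?H = "{x. (\<forall>i\<in>{..<k}. (\<lambda>s. case_sum (\<lambda>m. x (Inl m)) (\<lambda>m. x (Inr (i, m))) s) \<in> G) \<and>
    (\<forall>i\<in>{..<k}. \<forall>j\<in>{..<i}. \<exists>m\<in>UNIV. x (Inr (i, m)) - x (Inr (j, m)) \<noteq> 0)}"
  have "dset ?A ?H"
  proof (intro dset_conj dset_ball dset_bex dset_neq ratf_diff ratf_var finite_lessThan finite)
    fix i assume "i \<in> {..<k}"
    then show "dset ?A {x. (\<lambda>s. case_sum (\<lambda>m. x (Inl m)) (\<lambda>m. x (Inr (i, m))) s) \<in> G}"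
    proof (intro dset_subst[OF G])
      show "(\<lambda>x. case_sum (\<lambda>m. x (Inl m)) (\<lambda>m. x (Inr (i, m))) s) \<in> ratf ?A" for s
        using \<open>i \<in> {..<k}\<close> by (cases s) (auto intro!: ratf_var)
    qed
  qed auto
  then have "dset UNIV {e. \<exists>z. case_sum e z \<in> ?H}" by (intro dset_exists) auto
  moreover have "(\<exists>z. case_sum e z \<in> ?H) \<longleftrightarrow> (\<exists>T. finite T \<and> card T = k \<and> (\<forall>z\<in>T. case_sum e z \<in> G))" for e
  proof
    assume "\<exists>z. case_sum e z \<in> ?H"
    then obtain z where z: "\<And>i. i < k \<Longrightarrow> case_sum e (\<lambda>m. z (i, m)) \<in> G"
      "\<And>i j. i < k \<Longrightarrow> j < i \<Longrightarrow> \<exists>m. z (i, m) \<noteq> z (j, m)" by (fastforce cong: sum.case_cong)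
    have "inj_on (\<lambda>i m. z (i, m)) {..<k}"
    proof (rule inj_onI, rule ccontr)
      fix i j assume ij: "i \<in> {..<k}" "j \<in> {..<k}" "(\<lambda>m. z (i, m)) = (\<lambda>m. z (j, m))" "i \<noteq> j"
      then have "z (i, m) = z (j, m)" for m by meson
      then show False using z(2)[of i j] z(2)[of j i] ij by (metis lessThan_iff linorder_neqE_nat)
    qed
    then have "card ((\<lambda>i m. z (i, m)) ` {..<k}) = k" by (simp add: card_image)
    then show "\<exists>T. finite T \<and> card T = k \<and> (\<forall>z\<in>T. case_sum e z \<in> G)"
      using z(1) by (intro exI[of _ "(\<lambda>i m. z (i, m)) ` {..<k}"]) auto
  next
    assume "\<exists>T. finite T \<and> card T = k \<and> (\<forall>z\<in>T. case_sum e z \<in> G)"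
    then obtain T where T: "finite T" "card T = k" "\<forall>z\<in>T. case_sum e z \<in> G" by blast
    obtain h where h: "bij_betw h {0..<k} T" using ex_bij_betw_nat_finite[OF T(1)] T(2) by auto
    have hT: "h i \<in> T" if "i < k" for i using h that by (auto simp: bij_betw_def)
    have hne: "\<exists>m. h i m \<noteq> h j m" if ij: "i < k" "j < i" for i j
    proof -
      have "h i \<noteq> h j"
        using inj_onD[OF bij_betw_imp_inj_on[OF h], of i j] ij by auto
      then show ?thesis by (simp add: fun_eq_iff)
    qed
    have "case_sum e (\<lambda>(i, m). h i m) \<in> ?H"
      using T(3) hT hne by (auto cong: sum.case_cong)
    then show "\<exists>z. case_sum e z \<in> ?H" by blast
  qed
  ultimately show ?thesis by simp
qed

text \<open>Having at least \<open>k\<close> intersection points is a constructible condition on the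
  parameter, so it holds generically or fails generically. The generic number of points is the
  largest \<open>k\<close> for which it holds.\<close>

theorem generic_intersection:
  fixes V W :: "(complex ^ 'm::finite) set"
  assumes VW: "V \<subseteq> torus" "W \<subseteq> torus" "small V CARD('m)" "small W CARD('m)"
    and d: "dset UNIV (pts V)" "dset UNIV (pts W)"
    and A: "dset UNIV A" "A \<subseteq> pts V" "small (vec_nth -` A) (CARD('m) - 1)"
    and B: "dset UNIV B" "B \<subseteq> pts W" "small (vec_nth -` B) (CARD('m) - 1)"
  obtains k Q a where "Q \<in> polyf UNIV" "Q a \<noteq> 0"
    "\<forall>e. Q (vec_nth e) \<noteq> 0 \<longrightarrow> e \<in> torus \<and> finite (V \<inter> translate e W) \<and> card (V \<inter> translate e W) = k \<and>
       (\<forall>z \<in> V \<inter> translate e W. vec_nth z \<notin> A \<and> vec_nth (cdiv z e) \<notin> B \<and> spanning V (translate e W) z)"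
proof -
  let ?G = "incidence V W"
  let ?S = "\<lambda>e. {z. case_sum e z \<in> ?G}"
  obtain b where b: "generic UNIV {e. \<forall>z. case_sum e z \<in> ?G \<longrightarrow>
      spanning V (translate (vec_lambda e) W) (vec_lambda z)}"
    "generic UNIV {e. finite (?S e) \<and> card (?S e) \<le> b}"
    by (rule incidence_generic[OF VW d])
  have card: "CARD('m) > 0" by simp
  have gA: "generic UNIV {e. \<forall>z. case_sum e z \<in> ?G \<longrightarrow> \<not> ((\<lambda>i. z i) \<in> A \<and> (\<lambda>i. z i / e i) \<in> pts W)}"
    by (rule generic_avoids[OF VW(1,2) d A d(2) subset_refl, of "CARD('m)"]) (use VW(4) card in \<open>auto simp del: zero_less_card_finite\<close>)
  have gB: "generic UNIV {e. \<forall>z. case_sum e z \<in> ?G \<longrightarrow> \<not> ((\<lambda>i. z i) \<in> pts V \<and> (\<lambda>i. z i / e i) \<in> B)}"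
    by (rule generic_avoids[OF VW(1,2) d d(1) subset_refl _ B, of "CARD('m)"]) (use VW(3) card in \<open>auto simp del: zero_less_card_finite\<close>)
  define N where "N k = {e. \<exists>T. finite T \<and> card T = k \<and> (\<forall>z\<in>T. case_sum e z \<in> ?G)}" for k
  have N: "dset UNIV (N k)" for k unfolding N_def by (rule dset_card_ge[OF dset_incidence[OF d]])
  have Nk: "e \<in> N k \<longleftrightarrow> k \<le> card (?S e)" if "finite (?S e)" for e k
  proof
    assume "e \<in> N k"
    then obtain T where T: "finite T" "card T = k" "\<forall>z\<in>T. case_sum e z \<in> ?G" by (auto simp: N_def)
    then have "T \<subseteq> ?S e" by auto
    then show "k \<le> card (?S e)" using card_mono[OF that] T(2) by blast
  next
    assume "k \<le> card (?S e)"
    then obtain T where "T \<subseteq> ?S e" "card T = k" "finite T" by (rule obtain_subset_with_card_n)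
    then show "e \<in> N k" by (auto simp: N_def)
  qed
  have "N 0 = UNIV" by (auto simp: N_def intro: exI[of _ "{}"])
  then have N0: "generic UNIV (N 0)" by (simp add: generic_UNIV)
  have bound: "k \<le> b" if g: "generic UNIV (N k)" for k
  proof -
    obtain e where "e \<in> N k" "finite (?S e)" "card (?S e) \<le> b"
      using generic_nonempty[OF generic_Int[OF g b(2)]] by blast
    then show ?thesis using Nk by fastforce
  qed
  define k where "k = (GREATEST k. generic UNIV (N k))"
  have k: "generic UNIV (N k)" unfolding k_def by (rule GreatestI_nat[of "\<lambda>k. generic UNIV (N k)", OF N0 bound])
  have "\<not> generic UNIV (N (Suc k))"
  proof
    assume "generic UNIV (N (Suc k))"
    from Greatest_le_nat[of "\<lambda>k. generic UNIV (N k)", OF this bound] show False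
      unfolding k_def by simp
  qed
  then have k': "generic UNIV (- N (Suc k))" using dset_dichotomy[OF N] by blast
  have "generic UNIV ({e. vec_lambda e \<in> torus} \<inter> ({e. \<forall>z. case_sum e z \<in> ?G \<longrightarrow>
      spanning V (translate (vec_lambda e) W) (vec_lambda z)} \<inter> ({e. finite (?S e) \<and> card (?S e) \<le> b} \<inter>
      ({e. \<forall>z. case_sum e z \<in> ?G \<longrightarrow> \<not> ((\<lambda>i. z i) \<in> A \<and> (\<lambda>i. z i / e i) \<in> pts W)} \<inter>
      ({e. \<forall>z. case_sum e z \<in> ?G \<longrightarrow> \<not> ((\<lambda>i. z i) \<in> pts V \<and> (\<lambda>i. z i / e i) \<in> B)} \<inter> (N k \<inter> - N (Suc k)))))))"
    (is "generic UNIV ?X")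
    by (intro generic_Int generic_torus b gA gB k k')
  then obtain Q a where Q: "Q \<in> polyf UNIV" "Q a \<noteq> 0" "\<And>e. Q e \<noteq> 0 \<Longrightarrow> e \<in> ?X"
    unfolding generic_def by blast
  have good: "e \<in> torus \<and> finite (V \<inter> translate e W) \<and> card (V \<inter> translate e W) = k \<and>
       (\<forall>z \<in> V \<inter> translate e W. vec_nth z \<notin> A \<and> vec_nth (cdiv z e) \<notin> B \<and> spanning V (translate e W) z)"
    if "Q (vec_nth e) \<noteq> 0" for e
  proof -
    have X: "vec_nth e \<in> ?X" by (rule Q(3)[OF that])
    then have eT: "e \<in> torus" by simp
    have mem: "z \<in> V \<inter> translate e W \<longleftrightarrow> case_sum (vec_nth e) (vec_nth z) \<in> ?G" for z
      using eT by (simp add: in_incidence)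
    have fin: "finite (?S (vec_nth e))" using X by blast
    have img: "vec_nth ` (V \<inter> translate e W) = ?S (vec_nth e)"
    proof (intro set_eqI iffI)
      fix z assume "z \<in> ?S (vec_nth e)"
      then have "vec_lambda z \<in> V \<inter> translate e W" using mem[of "vec_lambda z"] by (simp add: vec_lambda_inverse)
      then have "vec_nth (vec_lambda z) \<in> vec_nth ` (V \<inter> translate e W)" by (rule imageI)
      then show "z \<in> vec_nth ` (V \<inter> translate e W)" by (simp add: vec_lambda_inverse)
    qed (use mem in auto)
    have inj: "inj_on vec_nth (V \<inter> translate e W)" by (rule inj_onI) (simp add: vec_nth_inject)
    have "card (V \<inter> translate e W) = card (?S (vec_nth e))" using card_image[OF inj] img by simp
    moreover have "card (?S (vec_nth e)) = k" using X Nk[OF fin, of k] Nk[OF fin, of "Suc k"] by auto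
    moreover have "finite (V \<inter> translate e W)" using inj img fin by (metis finite_image_iff)
    moreover have "vec_nth z \<notin> A \<and> vec_nth (cdiv z e) \<notin> B \<and> spanning V (translate e W) z"
      if z: "z \<in> V \<inter> translate e W" for z
    proof -
      have zG: "case_sum (vec_nth e) (vec_nth z) \<in> ?G" using z mem by blast
      have c: "vec_nth (cdiv z e) = (\<lambda>i. z $ i / e $ i)" by (simp add: cdiv_def vec_lambda_inverse)
      have "vec_nth (cdiv z e) \<in> pts W" using z in_translate[OF eT, of z W] by simp
      then have zV: "vec_nth z \<in> pts V" "(\<lambda>i. z $ i / e $ i) \<in> pts W"
        using z by (simp_all add: c)
      have "\<not> ((\<lambda>i. z $ i) \<in> A \<and> (\<lambda>i. z $ i / e $ i) \<in> pts W)"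
        "\<not> ((\<lambda>i. z $ i) \<in> pts V \<and> (\<lambda>i. z $ i / e $ i) \<in> B)"
        "spanning V (translate (vec_lambda (vec_nth e)) W) (vec_lambda (vec_nth z))"
        using X zG by blast+
      then show ?thesis using zV by (simp add: c)
    qed
    ultimately show ?thesis using eT by simp
  qed
  show ?thesis by (rule that[OF Q(1,2)]) (use good in blast)
qed

section \<open>Reflections of the torus\<close>

lemma open_torus: "open (torus :: (complex ^ 'm::finite) set)"
proof -
  have "torus = (\<Inter>i. {z :: complex ^ 'm. z $ i \<noteq> 0})" by (auto simp: torus_def)
  moreover have "open (\<Inter>i. {z :: complex ^ 'm. z $ i \<noteq> 0})"
    by (intro open_INT finite ballI open_Collect_neq continuous_intros)
  ultimately show ?thesis by simp
qed

lemma torus_nonempty: "(\<chi> i. 1) \<in> torus"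
  by (simp add: torus_def)

lemma polyf_dense:
  fixes Q :: "('m::finite \<Rightarrow> complex) \<Rightarrow> complex"
  assumes Q: "Q \<in> polyf A" and a: "Q a \<noteq> 0"
  shows "closure {e. Q (vec_nth e) \<noteq> 0} = UNIV"
proof (rule ccontr)
  let ?U = "{e. Q (vec_nth e) \<noteq> 0}"
  assume "closure ?U \<noteq> UNIV"
  then have ne: "- closure ?U \<noteq> {}" by auto
  have "- closure ?U \<subseteq> {z. Q (vec_nth z) = 0}" using closure_subset[of ?U] by auto
  then have "negligible (- closure ?U)" by (rule negligible_subset[OF polyf_zero_negligible[OF Q a]])
  moreover have "open (- closure ?U)" by (rule open_Compl[OF closed_closure])
  ultimately show False using open_not_negligible ne by blast
qed

lemma toric_intersection_number_eqI:
  fixes A B :: "(complex ^ 'm::finite) set"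
  assumes U: "open U" "U \<subseteq> torus" "torus \<subseteq> closure U"
    and k: "\<And>e. e \<in> U \<Longrightarrow> (\<forall>z \<in> A \<inter> translate e B. transverse_at A (translate e B) z) \<and>
             finite (A \<inter> translate e B) \<and> card (A \<inter> translate e B) = k"
  shows "toric_intersection_number A B = k"
  unfolding toric_intersection_number_def
proof (rule the_equality)
  show "\<exists>U. open U \<and> U \<subseteq> torus \<and> torus \<subseteq> closure U \<and>
        (\<forall>\<epsilon>\<in>U. (\<forall>z \<in> A \<inter> translate \<epsilon> B. transverse_at A (translate \<epsilon> B) z) \<and>
             finite (A \<inter> translate \<epsilon> B) \<and> card (A \<inter> translate \<epsilon> B) = k)"
    by (rule exI[of _ U]) (use U k in simp)
  fix k'
  assume "\<exists>U. open U \<and> U \<subseteq> torus \<and> torus \<subseteq> closure U \<and>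
        (\<forall>\<epsilon>\<in>U. (\<forall>z \<in> A \<inter> translate \<epsilon> B. transverse_at A (translate \<epsilon> B) z) \<and>
             finite (A \<inter> translate \<epsilon> B) \<and> card (A \<inter> translate \<epsilon> B) = k')"
  then obtain U' where U': "open U'" "U' \<subseteq> torus" "torus \<subseteq> closure U'"
    "\<forall>\<epsilon>\<in>U'. card (A \<inter> translate \<epsilon> B) = k'" by (elim exE conjE) simp
  have "U \<noteq> {}" using U(3) torus_nonempty by auto
  then have "U \<inter> closure U' \<noteq> {}" using U(2) U'(3) by blast
  then have "U \<inter> U' \<noteq> {}" using open_Int_closure_eq_empty[OF U(1), of U'] by simp
  then obtain e where "e \<in> U" "e \<in> U'" by blast
  then show "k' = k" using k U'(4) by auto
qed

text \<open>Conjugation before and after \<open>f\<close> merely conjugates its constants; this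
  makes constructibility stable under antiholomorphic involutions.\<close>

lemma ratf_conj: "f \<in> ratf A \<Longrightarrow> (\<lambda>x. cnj (f (\<lambda>i. cnj (x i)))) \<in> ratf A"
  by (induction rule: ratf.induct) (auto intro: ratf.intros)

lemma dset_conj_preimage: "dset A X \<Longrightarrow> dset A {x. (\<lambda>i. cnj (x i)) \<in> X}"
proof -
  assume "dset A X"
  then obtain f where f: "f \<in> ratf A" "X = {x. f x = 0}" by (auto simp: dset_def)
  have "{x. (\<lambda>i. cnj (x i)) \<in> X} = {x. cnj (f (\<lambda>i. cnj (x i))) = 0}" by (simp add: f(2))
  then show ?thesis using dset_zero[OF ratf_conj[OF f(1)]] by simp
qed

lemma conj_map_linear: "linear conj_map"
  by (rule linearI) (auto simp: conj_map_def vec_eq_iff)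

lemma conj_map_has_derivative: "(conj_map has_derivative conj_map) (at z within S)"
  by (simp add: linear_imp_has_derivative conj_map_linear)

lemma conj_map_scale: "conj_map (c *s v) = cnj c *s conj_map v"
  by (simp add: conj_map_def vec_eq_iff)

lemma conj_map_involution [simp]: "conj_map (conj_map z) = z"
  by (simp add: conj_map_def vec_eq_iff)

definition antilinear_derivative where
  "antilinear_derivative f z \<longleftrightarrow> (\<exists>D. (f has_derivative D) (at z) \<and> (\<forall>c v. D (c *s v) = cnj c *s D v))"

text \<open>Two antiholomorphic maps compose to a holomorphic one, so a chart \<open>\<phi>0\<close>
  of \<open>V\<close> yields the chart \<open>\<lambda>x. conj_map (\<phi>0 (s x))\<close> of the
  image.\<close>

lemma antilinear_submanifold:
  fixes V :: "(complex ^ 'm::finite) set" and t s :: "complex ^ 'm \<Rightarrow> complex ^ 'm"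
  assumes V: "V \<subseteq> torus" and sub: "complex_submanifold_at V d w"
    and t: "\<And>z. z \<in> torus \<Longrightarrow> t z \<in> torus \<and> s (t z) = z \<and> antilinear_derivative t z"
    and s: "\<And>z. z \<in> torus \<Longrightarrow> s z \<in> torus \<and> t (s z) = z \<and> antilinear_derivative s z"
  shows "\<exists>d. complex_submanifold_at (t ` V) d (t w)"
proof -
  obtain U0 \<phi>0 L where U0: "w \<in> V" "w \<in> U0" "biholomorphic_on U0 \<phi>0" "vec.subspace L"
    "\<phi>0 ` (V \<inter> U0) = \<phi>0 ` U0 \<inter> L" using sub unfolding complex_submanifold_at_def by blast
  note bi = U0(3)[unfolded biholomorphic_on_def]
  define \<psi>0 where "\<psi>0 = inv_into U0 \<phi>0"
  have inj0: "inj_on \<phi>0 U0" and \<psi>\<phi>: "\<And>x. x \<in> U0 \<Longrightarrow> \<psi>0 (\<phi>0 x) = x"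
    using bi by (auto simp: \<psi>0_def)
  define U where "U = t ` (U0 \<inter> torus)"
  define \<phi> where "\<phi> x = conj_map (\<phi>0 (s x))" for x
  define \<psi> where "\<psi> y = t (\<psi>0 (conj_map y))" for y
  have ts: "x \<in> torus \<and> s x \<in> U0 \<and> s x \<in> torus" if "x \<in> U" for x using that t by (auto simp: U_def)
  have Ueq: "U = {x \<in> torus. s x \<in> U0}" using t s by (force simp: U_def)
  have dt: "continuous_on torus t" "continuous_on torus s"
    using t s unfolding antilinear_derivative_def
    by (metis continuous_at_imp_continuous_on has_derivative_continuous)+
  have oU: "open U"
  proof -
    have "U = torus \<inter> s -` U0" unfolding Ueq by auto
    then show ?thesis using continuous_open_preimage[OF dt(2) open_torus] bi by simp
  qed
  have c\<psi>0: "continuous_on (\<phi>0 ` U0) \<psi>0"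
    using bi unfolding holomorphic_map_on_def \<psi>0_def
    by (metis continuous_at_imp_continuous_on has_derivative_continuous)
  have im: "\<phi>0 ` (U0 \<inter> torus) = \<phi>0 ` U0 \<inter> \<psi>0 -` torus" using \<psi>\<phi> by auto
  have o0: "open (\<phi>0 ` (U0 \<inter> torus))"
    unfolding im by (rule continuous_open_preimage[OF c\<psi>0 _ open_torus]) (use bi in simp)
  have \<phi>U: "\<phi> ` U = conj_map -` (\<phi>0 ` (U0 \<inter> torus))"
  proof (intro set_eqI iffI)
    fix y assume "y \<in> \<phi> ` U"
    then show "y \<in> conj_map -` (\<phi>0 ` (U0 \<inter> torus))" using ts by (auto simp: \<phi>_def)
  next
    fix y assume "y \<in> conj_map -` (\<phi>0 ` (U0 \<inter> torus))"
    then obtain x where x: "conj_map y = \<phi>0 x" "x \<in> U0" "x \<in> torus" by auto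
    have "\<phi> (t x) = y" using t[OF x(3)] arg_cong[OF x(1), of conj_map] by (simp add: \<phi>_def)
    moreover have "t x \<in> U" using x by (auto simp: U_def)
    ultimately show "y \<in> \<phi> ` U" by blast
  qed
  have o\<phi>: "open (\<phi> ` U)"
    unfolding \<phi>U by (rule open_vimage[OF o0]) (simp add: linear_continuous_on linear_conv_bounded_linear[symmetric] conj_map_linear)
  have \<psi>\<phi>': "\<psi> (\<phi> x) = x" if "x \<in> U" for x
    using ts[OF that] s \<psi>\<phi> by (auto simp: \<psi>_def \<phi>_def)
  then have inj: "inj_on \<phi> U" by (rule inj_on_inverseI)
  have hol: "holomorphic_map_on U \<phi>"
    unfolding holomorphic_map_on_def
  proof
    fix x assume x: "x \<in> U"
    obtain D where D: "(s has_derivative D) (at x)" "\<And>c v. D (c *s v) = cnj c *s D v"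
      using s ts[OF x] unfolding antilinear_derivative_def by blast
    obtain D0 where D0: "(\<phi>0 has_derivative D0) (at (s x))" "\<And>c v. D0 (c *s v) = c *s D0 v"
      using bi ts[OF x] unfolding holomorphic_map_on_def by blast
    have "(\<phi> has_derivative (\<lambda>v. conj_map (D0 (D v)))) (at x)"
      unfolding \<phi>_def by (rule has_derivative_compose[OF has_derivative_compose[OF D(1) D0(1)] conj_map_has_derivative])
    moreover have "conj_map (D0 (D (c *s v))) = c *s conj_map (D0 (D v))" for c v
      by (simp add: D(2) D0(2) conj_map_scale)
    ultimately show "\<exists>D. (\<phi> has_derivative D) (at x) \<and> (\<forall>c v. D (c *s v) = c *s D v)" by blast
  qed
  have hol': "holomorphic_map_on (\<phi> ` U) (inv_into U \<phi>)"
    unfolding holomorphic_map_on_def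
  proof
    fix y assume y: "y \<in> \<phi> ` U"
    then have cy: "conj_map y \<in> \<phi>0 ` U0" "\<psi>0 (conj_map y) \<in> torus"
      using \<phi>U im by auto
    obtain D where D: "(t has_derivative D) (at (\<psi>0 (conj_map y)))" "\<And>c v. D (c *s v) = cnj c *s D v"
      using t[OF cy(2)] unfolding antilinear_derivative_def by blast
    obtain D0 where D0: "(\<psi>0 has_derivative D0) (at (conj_map y))" "\<And>c v. D0 (c *s v) = c *s D0 v"
      using bi cy(1) unfolding holomorphic_map_on_def \<psi>0_def by blast
    have 1: "(\<psi> has_derivative (\<lambda>v. D (D0 (conj_map v)))) (at y)"
      unfolding \<psi>_def by (rule has_derivative_compose[OF has_derivative_compose[OF conj_map_has_derivative D0(1)] D(1)])
    have "(inv_into U \<phi> has_derivative (\<lambda>v. D (D0 (conj_map v)))) (at y)"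
    proof (rule has_derivative_transform_within_open[OF 1 o\<phi> y])
      show "\<psi> y' = inv_into U \<phi> y'" if "y' \<in> \<phi> ` U" for y'
        using that \<psi>\<phi>' inv_into_f_f[OF inj] by auto
    qed
    moreover have "D (D0 (conj_map (c *s v))) = c *s D (D0 (conj_map v))" for c v
      by (simp add: D(2) D0(2) conj_map_scale)
    ultimately show "\<exists>D. (inv_into U \<phi> has_derivative D) (at y) \<and> (\<forall>c v. D (c *s v) = c *s D v)" by blast
  qed
  have "biholomorphic_on U \<phi>"
    unfolding biholomorphic_on_def using oU o\<phi> inj hol hol' by blast
  moreover have "vec.subspace (conj_map ` L)"
    unfolding vec.subspace_def
  proof (intro conjI ballI allI)
    show "0 \<in> conj_map ` L"
      using vec.subspace_0[OF U0(4)] linear_0[OF conj_map_linear] by (metis image_eqI)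
    fix x assume x: "x \<in> conj_map ` L"
    show "c *s x \<in> conj_map ` L" for c
    proof -
      obtain l where "l \<in> L" "x = conj_map l" using x by blast
      then have "c *s x = conj_map (cnj c *s l)" "cnj c *s l \<in> L"
        using vec.subspace_scale[OF U0(4)] by (auto simp: conj_map_scale)
      then show ?thesis by blast
    qed
    fix y assume y: "y \<in> conj_map ` L"
    obtain l l' where "l \<in> L" "x = conj_map l" "l' \<in> L" "y = conj_map l'" using x y by blast
    then have "x + y = conj_map (l + l')" "l + l' \<in> L"
      using vec.subspace_add[OF U0(4)] by (simp_all add: linear_add[OF conj_map_linear])
    then show "x + y \<in> conj_map ` L" by blast
  qed
  moreover have "\<phi> ` (t ` V \<inter> U) = \<phi> ` U \<inter> conj_map ` L"
  proof (intro set_eqI iffI)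
    fix y assume "y \<in> \<phi> ` (t ` V \<inter> U)"
    then obtain v where v: "v \<in> V" "t v \<in> U" "y = \<phi> (t v)" by auto
    have sv: "s (t v) = v" using t v(1) V by auto
    then have "v \<in> U0" using ts[OF v(2)] by simp
    then have "\<phi>0 v \<in> L" using U0(5) v(1) by blast
    then have "y \<in> conj_map ` L" using v(3) sv by (simp add: \<phi>_def)
    then show "y \<in> \<phi> ` U \<inter> conj_map ` L" using v(2,3) by blast
  next
    fix y assume y: "y \<in> \<phi> ` U \<inter> conj_map ` L"
    then obtain x where x: "x \<in> U" "y = \<phi> x" by blast
    have "conj_map y \<in> L" using y by auto
    then have "\<phi>0 (s x) \<in> \<phi>0 ` (V \<inter> U0)" unfolding U0(5) using x ts[OF x(1)] by (simp add: \<phi>_def)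
    then obtain v where v: "v \<in> V" "v \<in> U0" "\<phi>0 (s x) = \<phi>0 v" by auto
    then have "s x = v" using inj_onD[OF inj0 v(3)] ts[OF x(1)] by blast
    then have "x = t v" using s ts[OF x(1)] by auto
    then show "y \<in> \<phi> ` (t ` V \<inter> U)" using x v(1) by blast
  qed
  moreover have "t w \<in> U" "t w \<in> t ` V" using U0(1,2) V by (auto simp: U_def)
  ultimately show ?thesis unfolding complex_submanifold_at_def by blast
qed

section \<open>Antiholomorphic involutions of the torus\<close>

locale antiholomorphic_involution =
  fixes \<tau> :: "complex ^ 'm::finite \<Rightarrow> complex ^ 'm"
  assumes \<tau>_torus: "z \<in> torus \<Longrightarrow> \<tau> z \<in> torus"
    and \<tau>_involution: "z \<in> torus \<Longrightarrow> \<tau> (\<tau> z) = z"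
    and \<tau>_dset: "dset UNIV X \<Longrightarrow> dset UNIV {x. vec_nth (\<tau> (vec_lambda x)) \<in> X}"
    and \<tau>_derivative: "z \<in> torus \<Longrightarrow> antilinear_derivative \<tau> z"
begin

definition twist :: "complex ^ 'm \<Rightarrow> complex ^ 'm \<Rightarrow> complex ^ 'm" where
  "twist e z = (\<chi> i. e $ i * \<tau> z $ i)"

lemma translate_image: "translate e (\<tau> ` V) = twist e ` V"
  by (auto simp: translate_def twist_def image_image)

lemma twist_derivative:
  assumes "z \<in> torus" shows "antilinear_derivative (twist e) z"
proof -
  obtain D where D: "(\<tau> has_derivative D) (at z)" "\<And>c v. D (c *s v) = cnj c *s D v"
    using \<tau>_derivative[OF assms] unfolding antilinear_derivative_def by blast
  have "((\<lambda>z. \<chi> i. e $ i * \<tau> z $ i) has_derivative (\<lambda>v. \<chi> i. e $ i * D v $ i)) (at z)"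
    by (intro has_derivative_vec_lambda has_derivative_mult_right
        bounded_linear.has_derivative[OF bounded_linear_vec_nth] D)
  moreover have "(\<chi> i. e $ i * D (c *s v) $ i) = cnj c *s (\<chi> i. e $ i * D v $ i)" for c v
    by (simp add: D(2) vec_eq_iff)
  ultimately show ?thesis unfolding antilinear_derivative_def twist_def by blast
qed

lemma untwist_derivative:
  assumes "z \<in> torus" "e \<in> torus" shows "antilinear_derivative (\<lambda>z. \<tau> (cdiv z e)) z"
proof -
  have ct: "cdiv z e \<in> torus" using assms by (auto simp: torus_def cdiv_def)
  obtain D where D: "(\<tau> has_derivative D) (at (cdiv z e))" "\<And>c v. D (c *s v) = cnj c *s D v"
    using \<tau>_derivative[OF ct] unfolding antilinear_derivative_def by blast
  have "((\<lambda>z. \<chi> i. inverse (e $ i) * z $ i) has_derivative (\<lambda>v. \<chi> i. inverse (e $ i) * v $ i)) (at z)"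
    by (intro has_derivative_vec_lambda has_derivative_mult_right
        bounded_linear.has_derivative[OF bounded_linear_vec_nth] has_derivative_ident)
  then have 1: "((\<lambda>z. cdiv z e) has_derivative (\<lambda>v. cdiv v e)) (at z)"
    by (simp add: cdiv_def divide_inverse mult.commute)
  have "((\<lambda>z. \<tau> (cdiv z e)) has_derivative (\<lambda>v. D (cdiv v e))) (at z)"
    by (rule has_derivative_compose[OF 1 D(1)])
  moreover have "D (cdiv (c *s v) e) = cnj c *s D (cdiv v e)" for c v
  proof -
    have "cdiv (c *s v) e = c *s cdiv v e" by (simp add: cdiv_def vec_eq_iff)
    then show ?thesis by (simp add: D(2))
  qed
  ultimately show ?thesis unfolding antilinear_derivative_def by blast
qed

lemma translate_submanifold:
  assumes V: "V \<subseteq> torus" and e: "e \<in> torus" and sub: "complex_submanifold_at V d w"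
  shows "\<exists>d. complex_submanifold_at (translate e (\<tau> ` V)) d (twist e w)"
  unfolding translate_image
proof (rule antilinear_submanifold[OF V sub])
  fix z :: "complex ^ 'm" assume z: "z \<in> torus"
  have 1: "twist e z \<in> torus" using e \<tau>_torus[OF z] by (auto simp: twist_def torus_def)
  have "cdiv (twist e z) e = \<tau> z" using e by (auto simp: cdiv_def twist_def vec_eq_iff torus_def)
  then show "twist e z \<in> torus \<and> \<tau> (cdiv (twist e z) e) = z \<and> antilinear_derivative (twist e) z"
    using 1 \<tau>_involution[OF z] twist_derivative[OF z] by simp
  have c: "cdiv z e \<in> torus" using z e by (auto simp: cdiv_def torus_def)
  have "twist e (\<tau> (cdiv z e)) = z"
    unfolding twist_def \<tau>_involution[OF c] using e by (auto simp: cdiv_def vec_eq_iff torus_def)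
  then show "\<tau> (cdiv z e) \<in> torus \<and> twist e (\<tau> (cdiv z e)) = z \<and> antilinear_derivative (\<lambda>z. \<tau> (cdiv z e)) z"
    using \<tau>_torus[OF c] untwist_derivative[OF z e] by simp
qed

text \<open>An involution turns images into preimages, to which \<open>\<tau>_dset\<close> applies.
  The law holds on the torus only, hence the condition of nonzero coordinates.\<close>

lemma image_pts:
  assumes "V \<subseteq> torus" shows "pts (\<tau> ` V) = {x. (\<forall>i\<in>UNIV. x i \<noteq> 0)} \<inter> {x. vec_nth (\<tau> (vec_lambda x)) \<in> pts V}"
proof (intro set_eqI iffI)
  fix x assume "x \<in> pts (\<tau> ` V)"
  then obtain v where v: "v \<in> V" "vec_lambda x = \<tau> v" by (auto simp: pts_def)
  then have "v \<in> torus" using assms by auto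
  then have "vec_lambda x \<in> torus" and \<tau>: "\<tau> (vec_lambda x) = v" using \<tau>_torus \<tau>_involution v by auto
  then have "\<forall>i. x i \<noteq> 0" by (simp add: torus_def)
  then show "x \<in> {x. (\<forall>i\<in>UNIV. x i \<noteq> 0)} \<inter> {x. vec_nth (\<tau> (vec_lambda x)) \<in> pts V}"
    using v(1) by (simp add: \<tau>)
next
  fix x assume x: "x \<in> {x. (\<forall>i\<in>UNIV. x i \<noteq> 0)} \<inter> {x. vec_nth (\<tau> (vec_lambda x)) \<in> pts V}"
  then have "vec_lambda x \<in> torus" by (auto simp: torus_def)
  then have "vec_lambda x = \<tau> (\<tau> (vec_lambda x))" by (simp add: \<tau>_involution)
  moreover have "\<tau> (vec_lambda x) \<in> V" using x by simp
  ultimately have "vec_lambda x \<in> \<tau> ` V" by blast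
  then show "x \<in> pts (\<tau> ` V)" by (simp add: pts_def)
qed

lemma dset_image:
  assumes "V \<subseteq> torus" "dset UNIV (pts V)" shows "dset UNIV (pts (\<tau> ` V))"
  unfolding image_pts[OF assms(1)]
  by (intro dset_Int dset_ball finite dset_neq ratf_var UNIV_I \<tau>_dset assms(2))

lemma small_reflection:
  assumes "V \<subseteq> torus" "small V r" shows "small (\<tau> ` V) r"
proof (rule small_image[OF assms(2)])
  show "\<tau> differentiable_on V"
    unfolding differentiable_on_def differentiable_def
    using \<tau>_derivative assms(1) unfolding antilinear_derivative_def
    by (meson has_derivative_at_withinI subsetD)
qed

text \<open>For generic \<open>e\<close> no intersection point is exceptional for \<open>V\<close>
  or for the translate. Then \<open>spanning\<close> amounts to transversality, and the generic
  number of points is the intersection number.\<close>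

theorem generic_self_intersection:
  assumes V: "algebraic_variety V" "has_complex_dimension V n" and n: "n \<ge> 1" "CARD('m) = 2 * n"
  obtains Q a where "Q \<in> polyf UNIV" "Q a \<noteq> 0"
    "\<forall>e. Q (vec_nth e) \<noteq> 0 \<longrightarrow> e \<in> torus \<and> finite (V \<inter> translate e (\<tau> ` V)) \<and>
       card (V \<inter> translate e (\<tau> ` V)) = toric_intersection_number V (\<tau> ` V) \<and>
       (\<forall>z \<in> V \<inter> translate e (\<tau> ` V). (\<exists>J. card J = n \<and> etale_at V J z) \<and> spanning V (translate e (\<tau> ` V)) z)"
proof -
  have VT: "V \<subseteq> torus" using V(1) by (auto simp: algebraic_variety_def)
  have dV: "dset UNIV (pts V)" by (rule dset_variety[OF V(1)])
  obtain B where B: "dset UNIV B" "B \<subseteq> pts V" "small (vec_nth -` B) (2 * n - 2)" "small V (2 * n)"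
    "\<forall>z\<in>V. vec_nth z \<notin> B \<longrightarrow> (\<exists>J. card J = n \<and> etale_at V J z)"
    by (rule variety_structure[OF V])
  define B0 where "B0 = vec_nth -` B"
  have ptsB0: "pts B0 = B" by (auto simp: pts_def B0_def vec_lambda_inverse)
  have B0V: "B0 \<subseteq> V"
  proof
    fix z assume "z \<in> B0"
    then have "vec_nth z \<in> pts V" using B(2) by (auto simp: B0_def)
    then show "z \<in> V" by simp
  qed
  then have B0T: "B0 \<subseteq> torus" using VT by auto
  have smB: "small B0 (CARD('m) - 1)" unfolding B0_def by (rule small_mono[OF B(3)]) (use n in simp)
  have sm: "small V CARD('m)" using B(4) n(2) by simp
  have WT: "\<tau> ` V \<subseteq> torus" using VT \<tau>_torus by auto
  have dB': "dset UNIV (pts (\<tau> ` B0))" by (rule dset_image[OF B0T]) (simp add: ptsB0 B)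
  have subB': "pts (\<tau> ` B0) \<subseteq> pts (\<tau> ` V)" using B0V by (auto simp: pts_def)
  have smB': "small (vec_nth -` pts (\<tau> ` B0)) (CARD('m) - 1)" using small_reflection[OF B0T smB] by simp
  have smB1: "small (vec_nth -` B) (CARD('m) - 1)" using smB by (simp add: B0_def)
  obtain k Q a where Q: "Q \<in> polyf UNIV" "Q a \<noteq> 0"
    "\<forall>e. Q (vec_nth e) \<noteq> 0 \<longrightarrow> e \<in> torus \<and> finite (V \<inter> translate e (\<tau> ` V)) \<and> card (V \<inter> translate e (\<tau> ` V)) = k \<and>
       (\<forall>z \<in> V \<inter> translate e (\<tau> ` V). vec_nth z \<notin> B \<and> vec_nth (cdiv z e) \<notin> pts (\<tau> ` B0) \<and>
          spanning V (translate e (\<tau> ` V)) z)"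
    by (rule generic_intersection[OF VT WT sm small_reflection[OF VT sm] dV dset_image[OF VT dV]
          B(1,2) smB1 dB' subB' smB'])
  have etale_at: "\<exists>J. card J = n \<and> etale_at V J z" if "Q (vec_nth e) \<noteq> 0" "z \<in> V \<inter> translate e (\<tau> ` V)" for e z
    using Q(3) B(5) that by blast
  have trans: "transverse_at V (translate e (\<tau> ` V)) z"
    if Qe: "Q (vec_nth e) \<noteq> 0" and z: "z \<in> V \<inter> translate e (\<tau> ` V)" for e z
  proof -
    have eT: "e \<in> torus" using Q(3) Qe by blast
    obtain w where w: "w \<in> V" "z = twist e w" using z unfolding translate_image by auto
    have "cdiv z e = \<tau> w" using eT by (auto simp: w cdiv_def twist_def vec_eq_iff torus_def)
    moreover have "vec_nth (cdiv z e) \<notin> pts (\<tau> ` B0)" using Q(3) Qe z by blast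
    ultimately have "w \<notin> B0" by auto
    then have "\<exists>J. card J = n \<and> etale_at V J w" using B(5) w(1) by (simp add: B0_def)
    then have "\<exists>d. complex_submanifold_at V d w" using etale_at_complex_submanifold by blast
    then have 1: "\<exists>d. complex_submanifold_at (translate e (\<tau> ` V)) d z"
      using translate_submanifold[OF VT eT] w(2) by blast
    have 2: "\<exists>d. complex_submanifold_at V d z" using etale_at[OF Qe z] etale_at_complex_submanifold by blast
    have "spanning V (translate e (\<tau> ` V)) z" using Q(3) Qe z by blast
    with 1 2 show ?thesis unfolding transverse_at_def spanning_def by blast
  qed
  have "toric_intersection_number V (\<tau> ` V) = k"
  proof (rule toric_intersection_number_eqI)
    show "open {e. Q (vec_nth e) \<noteq> 0}" by (rule open_polyf_neq_0[OF Q(1)])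
    show "{e. Q (vec_nth e) \<noteq> 0} \<subseteq> torus" using Q(3) by blast
    show "torus \<subseteq> closure {e. Q (vec_nth e) \<noteq> 0}" using polyf_dense[OF Q(1,2)] by simp
    fix e assume "e \<in> {e. Q (vec_nth e) \<noteq> 0}"
    then have "Q (vec_nth e) \<noteq> 0" by simp
    then show "(\<forall>z \<in> V \<inter> translate e (\<tau> ` V). transverse_at V (translate e (\<tau> ` V)) z) \<and>
             finite (V \<inter> translate e (\<tau> ` V)) \<and> card (V \<inter> translate e (\<tau> ` V)) = k"
      using Q(3) trans by blast
  qed
  then show ?thesis by (intro that[OF Q(1,2)] allI impI) (use Q(3) etale_at in simp)
qed

end

interpretation conj: antiholomorphic_involution conj_map
proof
  fix z :: "complex ^ 'm" and X :: "('m \<Rightarrow> complex) set"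
  show "z \<in> torus \<Longrightarrow> conj_map z \<in> torus" by (auto simp: torus_def conj_map_def)
  show "conj_map (conj_map z) = z" by simp
  have "vec_nth (conj_map (vec_lambda x)) = (\<lambda>i. cnj (x i))" for x :: "'m \<Rightarrow> complex"
    by (simp add: conj_map_def vec_lambda_inverse)
  then show "dset UNIV {x. vec_nth (conj_map (vec_lambda x)) \<in> X}" if "dset UNIV X"
    using dset_conj_preimage[OF that] by simp
  show "antilinear_derivative conj_map z"
    unfolding antilinear_derivative_def using conj_map_has_derivative conj_map_scale by blast
qed

interpretation conj': antiholomorphic_involution conj'_map
proof
  fix z :: "complex ^ 'm" and X :: "('m \<Rightarrow> complex) set"
  show "z \<in> torus \<Longrightarrow> conj'_map z \<in> torus" by (auto simp: torus_def conj'_map_def)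
  show "z \<in> torus \<Longrightarrow> conj'_map (conj'_map z) = z" by (auto simp: torus_def conj'_map_def vec_eq_iff)
  have "vec_nth (conj'_map (vec_lambda x)) = (\<lambda>i. 1 / cnj (x i))" for x :: "'m \<Rightarrow> complex"
    by (simp add: conj'_map_def vec_lambda_inverse)
  moreover have "dset UNIV {x. (\<lambda>i. 1 / cnj (x i)) \<in> X}" if X: "dset UNIV X"
  proof -
    have "dset UNIV {x. (\<lambda>i. 1 / x i) \<in> X}"
      by (rule dset_subst[OF X]) (intro ratf_divide ratf_const ratf_var UNIV_I)
    from dset_conj_preimage[OF this] show ?thesis by simp
  qed
  ultimately show "dset UNIV {x. vec_nth (conj'_map (vec_lambda x)) \<in> X}" if "dset UNIV X"
    using that by simp
  show "antilinear_derivative conj'_map z" if z: "z \<in> torus"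
  proof -
    have "((\<lambda>z. \<chi> i. inverse (cnj (z $ i))) has_derivative
       (\<lambda>v. \<chi> i. - (inverse (cnj (z $ i)) * cnj (v $ i) * inverse (cnj (z $ i))))) (at z)"
    proof (rule has_derivative_vec_lambda)
      fix i
      have "((\<lambda>z. cnj (z $ i)) has_derivative (\<lambda>v. cnj (v $ i))) (at z)"
        by (rule bounded_linear.has_derivative[OF bounded_linear_cnj
              bounded_linear.has_derivative[OF bounded_linear_vec_nth has_derivative_ident]])
      moreover have "cnj (z $ i) \<noteq> 0" using z by (simp add: torus_def)
      ultimately show "((\<lambda>z. inverse (cnj (z $ i))) has_derivative
          (\<lambda>v. - (inverse (cnj (z $ i)) * cnj (v $ i) * inverse (cnj (z $ i))))) (at z)"
        by (intro Deriv.has_derivative_inverse)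
    qed
    moreover have "conj'_map = (\<lambda>z :: complex ^ 'm. \<chi> i. inverse (cnj (z $ i)))"
      by (simp add: conj'_map_def divide_inverse fun_eq_iff)
    moreover have "(\<chi> i. - (inverse (cnj (z $ i)) * cnj ((c *s v) $ i) * inverse (cnj (z $ i)))) =
        cnj c *s (\<chi> i. - (inverse (cnj (z $ i)) * cnj (v $ i) * inverse (cnj (z $ i))))" for c v
      by (simp add: vec_eq_iff)
    ultimately show ?thesis unfolding antilinear_derivative_def by auto
  qed
qed

section \<open>Coverings\<close>

text \<open>Integrate the indicator of \<open>A\<close>, at \<open>x\<close> moved by
  \<open>t\<close> times \<open>b\<close>, over \<open>x\<close> and \<open>t\<close>. Integrating
  over \<open>t\<close> first gives 0; over \<open>x\<close> first it gives the measure of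
  \<open>A\<close> for every \<open>t\<close>, by translation invariance.\<close>

lemma negligible_countable_lines:
  fixes A :: "'a::euclidean_space set" and b :: 'a
  assumes A: "A \<in> sets borel" and lines: "\<And>x. countable {t. x + t *\<^sub>R b \<in> A}"
  shows "negligible A"
proof -
  define f where "f x t = (indicator A (x + t *\<^sub>R b) :: ennreal)" for x :: 'a and t :: real
  have f: "case_prod f \<in> borel_measurable (lborel \<Otimes>\<^sub>M lborel)"
  proof -
    have "(\<lambda>p. fst p + snd p *\<^sub>R b) \<in> borel_measurable (borel :: ('a \<times> real) measure)"
      by (intro borel_measurable_continuous_onI continuous_intros)
    then have "(\<lambda>p. indicator A (fst p + snd p *\<^sub>R b) :: ennreal) \<in> borel_measurable (borel :: ('a \<times> real) measure)"
      using A by (intro measurable_compose[OF _ borel_measurable_indicator])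
    moreover have "case_prod f = (\<lambda>p. indicator A (fst p + snd p *\<^sub>R b))"
      by (auto simp: f_def fun_eq_iff)
    ultimately show ?thesis by (simp add: lborel_prod)
  qed
  have "(\<integral>\<^sup>+t. f x t \<partial>lborel) = 0" for x
  proof -
    have "{t. x + t *\<^sub>R b \<in> A} \<in> null_sets lborel" by (rule countable_imp_null_set_lborel[OF lines])
    then have "AE t in lborel. f x t = 0"
      by (rule AE_I') (auto simp: f_def indicator_def)
    then have "(\<integral>\<^sup>+t. f x t \<partial>lborel) = (\<integral>\<^sup>+t. 0 \<partial>(lborel :: real measure))" by (rule nn_integral_cong_AE)
    then show ?thesis by simp
  qed
  then have "(\<integral>\<^sup>+t. (\<integral>\<^sup>+x. f x t \<partial>lborel) \<partial>lborel) = 0"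
    using lborel_pair.Fubini'[OF f] by simp
  moreover have "(\<integral>\<^sup>+x. f x t \<partial>lborel) = emeasure lborel A" for t
  proof -
    have "(\<integral>\<^sup>+x. f x t \<partial>lborel) = (\<integral>\<^sup>+x. indicator A (t *\<^sub>R b + x) \<partial>lborel)"
      by (simp add: f_def add.commute)
    also have "\<dots> = (\<integral>\<^sup>+y. indicator A y \<partial>distr lborel borel ((+) (t *\<^sub>R b)))"
      by (subst nn_integral_distr) (use A in auto)
    also have "\<dots> = emeasure lborel A" by (simp add: lborel_distr_plus A)
    finally show ?thesis .
  qed
  \<comment> \<open>A constant whose integral over the whole line is 0 must be 0.\<close>
  ultimately have "emeasure lborel A = 0" by (simp add: ennreal_mult_eq_top_iff)
  then show ?thesis using A by (simp add: negligible_iff_null_sets null_sets_completionI null_sets_def)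
qed

text \<open>Induction on the variables of \<open>Q\<close>. Where some coefficient \<open>q\<close>
  with respect to \<open>v\<close> is nonzero, lines in direction \<open>v\<close> meet the zero set
  in countable sets; the zeros of \<open>q\<close> have one variable less. The curve
  \<open>c\<close> describes the real slice.\<close>

lemma polyf_real_zero_negligible:
  fixes c :: "real \<Rightarrow> complex" and Q :: "('m::finite \<Rightarrow> complex) \<Rightarrow> complex"
  assumes c: "continuous_on UNIV c" "\<And>a. countable {t. c t = a}"
    and Q: "Q \<in> polyf A" "Q a \<noteq> 0"
  shows "negligible {x :: real ^ 'm. Q (\<lambda>i. c (x $ i)) = 0}"
proof -
  have "finite A" by simp
  then show ?thesis using Q
  proof (induction A arbitrary: Q a rule: finite_induct)
    case empty
    have "Q (\<lambda>i. c (x $ i)) = Q a" for x :: "real ^ 'm" by (rule polyf_cong[OF empty(1)]) simp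
    then have "Q (\<lambda>i. c (x $ i)) \<noteq> 0" for x :: "real ^ 'm" using empty(2) by (simp only:) simp
    then show ?case by simp
  next
    case (insert v A)
    obtain p d where p: "\<And>i. (\<lambda>x. coeff (p x) i) \<in> polyf A" "\<And>x y. Q (x(v := y)) = poly (p x) y"
      using polyf_family[OF insert.prems(1) insert.hyps(2)] by metis
    have "p a \<noteq> 0" using p(2)[of a "a v"] insert.prems(2) by auto
    then obtain i where i: "coeff (p a) i \<noteq> 0" by (metis coeff_0 poly_eqI)
    define q where "q x = coeff (p x) i" for x
    have q: "q \<in> polyf A" "q a \<noteq> 0" unfolding q_def using p(1) i by auto
    define h :: "real ^ 'm \<Rightarrow> complex ^ 'm" where "h x = (\<chi> i. c (x $ i))" for x
    have hc: "continuous_on UNIV h" unfolding h_def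
      by (intro continuous_on_vec_lambda continuous_on_compose2[OF c(1)] continuous_intros) auto
    have vh: "vec_nth (h x) = (\<lambda>i. c (x $ i))" for x by (simp add: h_def vec_lambda_inverse)
    have cont: "continuous_on UNIV (\<lambda>x. f (\<lambda>i. c (x $ i)))" if "f \<in> polyf UNIV" for f :: "('m \<Rightarrow> complex) \<Rightarrow> complex"
      using continuous_on_compose2[OF polyf_continuous[OF that, of UNIV] hc] by (simp add: vh)
    have QU: "Q \<in> polyf UNIV" "q \<in> polyf UNIV" using insert.prems(1) q(1) polyf_mono by blast+
    let ?S = "{x :: real ^ 'm. Q (\<lambda>i. c (x $ i)) = 0} \<inter> {x. q (\<lambda>i. c (x $ i)) \<noteq> 0}"
    have "negligible ?S"
    proof (rule negligible_countable_lines[where b = "axis v 1"])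
      have "closed {x :: real ^ 'm. Q (\<lambda>i. c (x $ i)) = 0}"
        by (intro closed_Collect_eq cont QU continuous_on_const)
      moreover have "open {x :: real ^ 'm. q (\<lambda>i. c (x $ i)) \<noteq> 0}"
        by (intro open_Collect_neq cont QU continuous_on_const)
      ultimately show "?S \<in> sets borel" by (intro sets.Int borel_closed borel_open)
      fix x :: "real ^ 'm"
      define y where "y = (\<lambda>i. c (x $ i))"
      have upd: "(\<lambda>i. c ((x + t *\<^sub>R axis v 1) $ i)) = y(v := c (x $ v + t))" for t
        by (auto simp: y_def axis_def fun_eq_iff)
      have eq: "{t. x + t *\<^sub>R axis v 1 \<in> ?S} = {t. poly (p y) (c (x $ v + t)) = 0 \<and> q (y(v := c (x $ v + t))) \<noteq> 0}"
        by (simp only: mem_Collect_eq Int_iff upd p(2))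
      have qy: "q (y(v := s)) = q y" for s
        by (rule polyf_cong[OF q(1)]) (use insert.hyps(2) in auto)
      show "countable {t. x + t *\<^sub>R axis v 1 \<in> ?S}"
      proof (cases "q y = 0")
        case True
        then show ?thesis unfolding eq qy by simp
      next
        case False
        then have "p y \<noteq> 0" by (auto simp: q_def)
        then have fin: "finite {s. poly (p y) s = 0}" by (rule poly_roots_finite)
        have "countable {t. c (x $ v + t) = s}" for s
        proof -
          have "{t. c (x $ v + t) = s} = (\<lambda>t. t - x $ v) ` {t. c t = s}"
            by (auto simp: image_iff intro!: exI[of _ "x $ v + _"])
          then show ?thesis using c(2)[of s] by simp
        qed
        then have "countable (\<Union>s\<in>{s. poly (p y) s = 0}. {t. c (x $ v + t) = s})"
          using countable_finite[OF fin] by (intro countable_UN)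
        then show ?thesis unfolding eq by (rule countable_subset[rotated]) auto
      qed
    qed
    moreover have "negligible {x :: real ^ 'm. q (\<lambda>i. c (x $ i)) = 0}" by (rule insert.IH[OF q])
    ultimately have "negligible (?S \<union> {x :: real ^ 'm. q (\<lambda>i. c (x $ i)) = 0})" by (rule negligible_Un)
    then show ?case by (rule negligible_subset) auto
  qed
qed

lemma subspace_kernel:
  fixes L :: "'a::euclidean_space set"
  assumes "subspace L" obtains P :: "'a \<Rightarrow> 'a" where "linear P" "\<And>x. P x = 0 \<longleftrightarrow> x \<in> L"
proof -
  obtain g :: "'a \<Rightarrow> 'a" where g: "range g \<subseteq> L" "linear g" "\<forall>v\<in>L. g v = v"
    using linear_exists_left_inverse_on[OF linear_id assms] by auto
  have "linear (\<lambda>x. x - g x)" by (intro linear_compose_sub linear_ident g)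
  moreover have "x - g x = 0 \<longleftrightarrow> x \<in> L" for x
    using g(1,3) by (auto simp: image_subset_iff) (metis rangeI subsetD)
  ultimately show ?thesis by (rule that)
qed

lemma smooth_on_has_derivative:
  assumes "smooth_on U f" "x \<in> U" shows "f differentiable (at x)"
proof -
  have "Ck_on (Suc 0) U f" using assms(1) unfolding smooth_on_def by blast
  then show ?thesis using assms(2) by simp
qed

lemma smooth_on_continuous:
  assumes "smooth_on U f" shows "continuous_on U f"
proof -
  have "Ck_on 0 U f" using assms unfolding smooth_on_def by blast
  then show ?thesis by simp
qed

text \<open>A right inverse \<open>h\<close> of the differential in a chart of \<open>S\<close>
  yields a continuous map whose derivative at 0 is the identity. Sussmann's open mapping theorem
  asks for differentiability at this one point only.\<close>

lemma submanifold_locally_onto: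
  fixes S :: "'a::euclidean_space set" and g :: "'a \<Rightarrow> 'b::euclidean_space"
  assumes S: "smooth_submanifold S" and z: "z \<in> S" and N: "open N" "z \<in> N"
    and g: "continuous_on N g" "(g has_derivative D) (at z)" and onto: "D ` tangent_space S z = UNIV"
  obtains \<delta> where "\<delta> > 0" "\<And>y. y \<in> ball (g z) \<delta> \<Longrightarrow> \<exists>w\<in>S \<inter> N. g w = y"
proof -
  obtain U \<phi> L where U: "z \<in> U" "diffeomorphic_on U \<phi>" "subspace L" "\<phi> ` (S \<inter> U) = \<phi> ` U \<inter> L"
    using S z unfolding smooth_submanifold_def by blast
  note dif = U(2)[unfolded diffeomorphic_on_def]
  define \<psi> where "\<psi> = inv_into U \<phi>"
  have inj: "inj_on \<phi> U" using dif by blast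
  have \<psi>\<phi>: "\<psi> (\<phi> x) = x" if "x \<in> U" for x using inj that by (simp add: \<psi>_def)
  define y0 where "y0 = \<phi> z"
  have y0: "y0 \<in> \<phi> ` U" "\<psi> y0 = z" using U(1) \<psi>\<phi> by (auto simp: y0_def)
  have y0L: "y0 \<in> L" using U(1,4) z by (auto simp: y0_def)
  have c\<psi>: "continuous_on (\<phi> ` U) \<psi>" using dif unfolding \<psi>_def by (intro smooth_on_continuous) blast
  have c\<phi>: "continuous_on U \<phi>" using dif by (intro smooth_on_continuous) blast
  obtain D\<psi> where D\<psi>: "(\<psi> has_derivative D\<psi>) (at y0)"
    using smooth_on_has_derivative[of "\<phi> ` U" \<psi> y0] dif y0 unfolding \<psi>_def differentiable_def by blast
  obtain D\<phi> where D\<phi>: "(\<phi> has_derivative D\<phi>) (at z)"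
    using smooth_on_has_derivative[of U \<phi> z] dif U(1) unfolding differentiable_def by blast
  have D\<psi>\<phi>: "D\<psi> (D\<phi> v) = v" for v
  proof -
    have "((\<lambda>x. \<psi> (\<phi> x)) has_derivative (\<lambda>v. D\<psi> (D\<phi> v))) (at z)"
      by (rule has_derivative_compose[OF D\<phi>]) (use D\<psi> in \<open>simp add: y0_def\<close>)
    moreover have "((\<lambda>x. \<psi> (\<phi> x)) has_derivative (\<lambda>v. v)) (at z)"
      by (rule has_derivative_transform_within_open[OF has_derivative_ident, of U])
        (use dif U(1) \<psi>\<phi> in auto)
    ultimately show ?thesis using has_derivative_unique by metis
  qed
  obtain P :: "'a \<Rightarrow> 'a" where P: "linear P" "\<And>x. P x = 0 \<longleftrightarrow> x \<in> L" by (rule subspace_kernel[OF U(3)]) blast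
  \<comment> \<open>The chart takes curves in \<open>S\<close> into the subspace \<open>L\<close>,
    and their velocities stay there.\<close>
  have tang: "D\<phi> v \<in> L" if v: "v \<in> tangent_space S z" for v
  proof -
    obtain \<gamma> where \<gamma>: "\<gamma> 0 = z" "range \<gamma> \<subseteq> S" "(\<gamma> has_vector_derivative v) (at 0)"
      using v unfolding tangent_space_def by blast
    have "isCont \<gamma> 0" using \<gamma>(3) has_vector_derivative_continuous by blast
    then obtain T where T: "open T" "0 \<in> T" "\<forall>t\<in>T. \<gamma> t \<in> U"
      using dif U(1) \<gamma>(1) unfolding continuous_at_open by metis
    have "(\<gamma> has_derivative (\<lambda>t. t *\<^sub>R v)) (at 0)" using \<gamma>(3) by (simp add: has_vector_derivative_def)
    then have "((\<lambda>t. \<phi> (\<gamma> t)) has_derivative (\<lambda>t. D\<phi> (t *\<^sub>R v))) (at 0)"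
      by (rule has_derivative_compose) (use D\<phi> \<gamma>(1) in simp)
    then have "((\<lambda>t. P (\<phi> (\<gamma> t))) has_derivative (\<lambda>t. P (D\<phi> (t *\<^sub>R v)))) (at 0)"
      by (rule has_derivative_compose[OF _ linear_imp_has_derivative[OF P(1)]])
    moreover have "((\<lambda>t. P (\<phi> (\<gamma> t))) has_derivative (\<lambda>t. 0)) (at 0)"
    proof (rule has_derivative_transform_within_open[OF has_derivative_const T(1,2)])
      show "0 = P (\<phi> (\<gamma> t))" if "t \<in> T" for t
      proof -
        have "\<gamma> t \<in> S \<inter> U" using T(3) that \<gamma>(2) by auto
        then have "\<phi> (\<gamma> t) \<in> L" using U(4) by blast
        then show ?thesis using P(2) by simp
      qed
    qed
    ultimately have "(\<lambda>t. P (D\<phi> (t *\<^sub>R v))) = (\<lambda>t. 0)" by (rule has_derivative_unique)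
    then have "P (D\<phi> (1 *\<^sub>R v)) = 0" by meson
    then show ?thesis using P(2) by simp
  qed
  have lin: "linear (\<lambda>y. D (D\<psi> y))"
    using linear_compose[OF has_derivative_linear[OF D\<psi>] has_derivative_linear[OF g(2)]] by (simp add: o_def)
  have ontoL: "(\<lambda>y. D (D\<psi> y)) ` L = UNIV"
  proof (intro equalityI subset_UNIV subsetI)
    fix y
    have "y \<in> D ` tangent_space S z" using onto by simp
    then obtain v where "v \<in> tangent_space S z" "y = D v" by blast
    then show "y \<in> (\<lambda>y. D (D\<psi> y)) ` L" using tang D\<psi>\<phi> by (intro image_eqI[of _ _ "D\<phi> v"]) auto
  qed
  obtain h :: "'b \<Rightarrow> 'a" where h: "range h \<subseteq> L" "linear h" "\<forall>y\<in>(\<lambda>y. D (D\<psi> y)) ` L. D (D\<psi> (h y)) = y"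
    using linear_exists_right_inverse_on[OF lin U(3)] by blast
  have Dh: "D (D\<psi> (h y)) = y" for y using h(3) ontoL by auto
  define T where "T = {y. y0 + h y \<in> \<phi> ` U \<inter> \<psi> -` N}"
  have o: "open (\<phi> ` U \<inter> \<psi> -` N)" by (rule continuous_open_preimage[OF c\<psi> _ N(1)]) (use dif in blast)
  have ch: "continuous_on UNIV (\<lambda>y. y0 + h y)"
    by (intro continuous_intros linear_continuous_on) (use h(2) linear_conv_bounded_linear in blast)
  have "T = (\<lambda>y. y0 + h y) -` (\<phi> ` U \<inter> \<psi> -` N)" by (auto simp: T_def)
  then have oT: "open T" using open_vimage[OF o ch] by simp
  have T0: "0 \<in> T" using y0 N(2) linear_0[OF h(2)] by (simp add: T_def)
  have "continuous_on T (\<lambda>y. \<psi> (y0 + h y))"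
    by (rule continuous_on_compose2[OF c\<psi> continuous_on_subset[OF ch]]) (auto simp: T_def)
  then have cT: "continuous_on T (\<lambda>y. g (\<psi> (y0 + h y)))"
    by (rule continuous_on_compose2[OF g(1)]) (auto simp: T_def)
  have "((\<lambda>y. y0 + h y) has_derivative h) (at 0)"
    using has_derivative_add[OF has_derivative_const[of y0] linear_imp_has_derivative[OF h(2)]] by simp
  then have d1: "((\<lambda>y. \<psi> (y0 + h y)) has_derivative (\<lambda>y. D\<psi> (h y))) (at 0)"
    by (rule has_derivative_compose) (use D\<psi> linear_0[OF h(2)] in simp)
  have d2: "((\<lambda>y. g (\<psi> (y0 + h y))) has_derivative (\<lambda>y. D (D\<psi> (h y)))) (at 0)"
    by (rule has_derivative_compose[OF d1]) (use g(2) y0 linear_0[OF h(2)] in simp)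
  have "g (\<psi> (y0 + h 0)) \<in> interior ((\<lambda>y. g (\<psi> (y0 + h y))) ` T)"
    by (rule sussmann_open_mapping[OF oT cT T0 d2 bounded_linear_ident]) (use oT T0 Dh in \<open>auto simp: interior_open o_def\<close>)
  then have "g z \<in> interior ((\<lambda>y. g (\<psi> (y0 + h y))) ` T)" using y0(2) linear_0[OF h(2)] by simp
  then obtain \<delta> where \<delta>: "\<delta> > 0" "ball (g z) \<delta> \<subseteq> (\<lambda>y. g (\<psi> (y0 + h y))) ` T" by (auto simp: mem_interior)
  have "\<exists>w\<in>S \<inter> N. g w = y" if y: "y \<in> ball (g z) \<delta>" for y
  proof -
    obtain t where t: "t \<in> T" "y = g (\<psi> (y0 + h t))" using \<delta>(2) y by blast
    have "y0 + h t \<in> L" using subspace_add[OF U(3) y0L] h(1) by blast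
    then have "y0 + h t \<in> \<phi> ` (S \<inter> U)" using t(1) U(4) by (auto simp: T_def)
    then obtain w where w: "w \<in> S" "w \<in> U" "y0 + h t = \<phi> w" by blast
    then have "\<psi> (y0 + h t) = w" using \<psi>\<phi> by simp
    then show ?thesis using w(1) t by (auto simp: T_def)
  qed
  with \<delta>(1) that show ?thesis by blast
qed

lemma separating_neighbourhoods:
  fixes F :: "'a::metric_space set"
  assumes "finite F" obtains r where "r > 0" "\<And>x y. x \<in> F \<Longrightarrow> y \<in> F \<Longrightarrow> x \<noteq> y \<Longrightarrow> ball x r \<inter> ball y r = {}"
proof -
  \<comment> \<open>The element 1 keeps the set of distances nonempty when \<open>F\<close> has at
    most one point.\<close>
  let ?D = "insert 1 ((\<lambda>(x, y). dist x y) ` {p \<in> F \<times> F. fst p \<noteq> snd p})"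
  have fin: "finite ?D" using assms by auto
  define r where "r = Min ?D / 2"
  have "Min ?D > 0" using fin by (subst Min_gr_iff) auto
  then have "r > 0" by (simp add: r_def)
  moreover have "ball x r \<inter> ball y r = {}" if "x \<in> F" "y \<in> F" "x \<noteq> y" for x y
  proof -
    have "dist x y \<in> ?D" using that by force
    then have "Min ?D \<le> dist x y" using fin by (intro Min_le)
    then show ?thesis by (intro disjoint_ballI) (simp add: r_def)
  qed
  ultimately show ?thesis by (rule that)
qed

text \<open>Regular fibre points persist over all nearby values, in particular over generic ones.\<close>

lemma covering_bound:
  fixes q :: "real ^ 'm::finite \<Rightarrow> 'b" and f :: "complex ^ 'm \<Rightarrow> 'b"
  assumes S: "stratification \<S> V" and q: "surj q"
    and lift: "\<And>z \<theta>. z \<in> V \<Longrightarrow> f z = q \<theta> \<Longrightarrow> \<exists>g N D. g z = \<theta> \<and> (\<forall>w\<in>V. q (g w) = f w) \<and>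
       open N \<and> z \<in> N \<and> continuous_on N g \<and> (g has_derivative D) (at z)"
    and N0: "negligible N0" "\<And>\<theta>. \<theta> \<notin> N0 \<Longrightarrow> finite {z \<in> V. f z = q \<theta>} \<and> card {z \<in> V. f z = q \<theta>} \<le> b"
  shows "covers_at_most q \<S> V f b"
  unfolding covers_at_most_def
proof (intro allI impI)
  fix p assume p: "\<forall>S\<in>\<S>. \<not> critical_value q S f p"
  obtain \<theta>0 where \<theta>0: "p = q \<theta>0" using q by (metis surjD)
  \<comment> \<open>Bounding all finite parts of the fibre shows at the end that the fibre is
    finite.\<close>
  have bound: "card F \<le> b" if F: "finite F" "F \<subseteq> {z \<in> V. f z = p}" for F
  proof -
    obtain r where r: "r > 0" "\<And>x y. x \<in> F \<Longrightarrow> y \<in> F \<Longrightarrow> x \<noteq> y \<Longrightarrow> ball x r \<inter> ball y r = {}"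
      by (rule separating_neighbourhoods[OF F(1)]) blast
    have "\<exists>\<delta>>0. \<forall>\<theta>\<in>ball \<theta>0 \<delta>. \<exists>w\<in>V \<inter> ball z r. f w = q \<theta>" if z: "z \<in> F" for z
    proof -
      have zV: "z \<in> V" "f z = q \<theta>0" using z F(2) \<theta>0 by auto
      obtain g N D where g: "g z = \<theta>0" "\<forall>w\<in>V. q (g w) = f w" "open N" "z \<in> N"
        "continuous_on N g" "(g has_derivative D) (at z)" using lift[OF zV] by blast
      obtain X where X: "X \<in> \<S>" "z \<in> X" "X \<subseteq> V" "smooth_submanifold X"
        using S zV(1) unfolding stratification_def by blast
      have "differential_at q X f z D"
        unfolding differential_at_def using g X(3) has_derivative_at_withinI by blast
      moreover have "\<not> critical_value q X f p" using p X(1) by blast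
      ultimately have onto: "D ` tangent_space X z = UNIV"
        unfolding critical_value_def using X(2) zV(2) \<theta>0 by blast
      have N': "open (N \<inter> ball z r)" "z \<in> N \<inter> ball z r" using g r(1) by auto
      obtain \<delta> where \<delta>: "\<delta> > 0" "\<And>y. y \<in> ball (g z) \<delta> \<Longrightarrow> \<exists>w\<in>X \<inter> (N \<inter> ball z r). g w = y"
        by (rule submanifold_locally_onto[OF X(4,2) N' continuous_on_subset[OF g(5) Int_lower1] g(6) onto]) blast
      have "\<exists>w\<in>V \<inter> ball z r. f w = q \<theta>" if "\<theta> \<in> ball \<theta>0 \<delta>" for \<theta>
        using \<delta>(2)[of \<theta>] that g(1,2) X(3) by fastforce
      with \<delta>(1) show ?thesis by blast
    qed
    then obtain \<delta> where \<delta>: "\<And>z. z \<in> F \<Longrightarrow> \<delta> z > 0"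
      "\<And>z \<theta>. z \<in> F \<Longrightarrow> \<theta> \<in> ball \<theta>0 (\<delta> z) \<Longrightarrow> \<exists>w\<in>V \<inter> ball z r. f w = q \<theta>" by metis
    have "open (\<Inter>z\<in>F. ball \<theta>0 (\<delta> z))" using F(1) by (intro open_INT) auto
    moreover have "\<theta>0 \<in> (\<Inter>z\<in>F. ball \<theta>0 (\<delta> z))" using \<delta>(1) by simp
    \<comment> \<open>Every point of \<open>F\<close> persists over this neighbourhood, which is too
      large to consist of exceptional values only.\<close>
    ultimately have "\<not> negligible (\<Inter>z\<in>F. ball \<theta>0 (\<delta> z))" using open_not_negligible by blast
    then have "\<not> (\<Inter>z\<in>F. ball \<theta>0 (\<delta> z)) \<subseteq> N0" using N0(1) negligible_subset by blast
    then obtain \<theta> where \<theta>: "\<theta> \<in> (\<Inter>z\<in>F. ball \<theta>0 (\<delta> z))" "\<theta> \<notin> N0" by blast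
    then obtain w where w: "\<And>z. z \<in> F \<Longrightarrow> w z \<in> V \<and> w z \<in> ball z r \<and> f (w z) = q \<theta>"
      using \<delta>(2)[of _ \<theta>] by (metis INT_iff Int_iff)
    have "inj_on w F"
    proof (rule inj_onI, rule ccontr)
      fix x y assume "x \<in> F" "y \<in> F" "w x = w y" "x \<noteq> y"
      then show False using r(2)[of x y] w[of x] w[of y] by auto
    qed
    then have "card F = card (w ` F)" by (simp add: card_image)
    also have "\<dots> \<le> card {z \<in> V. f z = q \<theta>}"
      by (rule card_mono) (use N0(2)[OF \<theta>(2)] w in auto)
    also have "\<dots> \<le> b" using N0(2)[OF \<theta>(2)] by blast
    finally show ?thesis .
  qed
  have "finite {z \<in> V. f z = p}"
  proof (rule ccontr)
    assume "infinite {z \<in> V. f z = p}"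
    then obtain F where F: "F \<subseteq> {z \<in> V. f z = p}" "finite F" "card F = Suc b"
      using infinite_arbitrarily_large by blast
    with bound[OF F(2,1)] show False by simp
  qed
  then show "finite {z \<in> V. f z = p} \<and> card {z \<in> V. f z = p} \<le> b" using bound by blast
qed

section \<open>Jacobians and images\<close>

text \<open>A copy of a finite index type carrying a well-order, as demanded by the change of variables
  theorem in the library.\<close>

typedef 'a wo = "UNIV :: 'a set" by simp

instance wo :: (finite) finite
proof
  have "(UNIV :: 'a wo set) = range Abs_wo" by (metis Abs_wo_cases UNIV_I UNIV_eq_I rangeI)
  then show "finite (UNIV :: 'a wo set)" by (metis finite finite_imageI)
qed

instantiation wo :: (finite) wellorder
begin

definition wo_index :: "'a wo \<Rightarrow> nat" where "wo_index = (SOME f. inj f)"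

lemma inj_wo_index: "inj (wo_index :: 'a wo \<Rightarrow> nat)"
proof -
  have "\<exists>f :: 'a wo \<Rightarrow> nat. inj f" using finite_imp_inj_to_nat_seg[of "UNIV :: 'a wo set"] by auto
  then show ?thesis unfolding wo_index_def by (rule someI_ex)
qed

definition less_eq_wo :: "'a wo \<Rightarrow> 'a wo \<Rightarrow> bool" where "x \<le> y \<longleftrightarrow> wo_index x \<le> wo_index y"
definition less_wo :: "'a wo \<Rightarrow> 'a wo \<Rightarrow> bool" where "x < y \<longleftrightarrow> wo_index x < wo_index y"

instance
proof
  fix x y z :: "'a wo" and P :: "'a wo \<Rightarrow> bool"
  show "x < y \<longleftrightarrow> x \<le> y \<and> \<not> y \<le> x" by (auto simp: less_eq_wo_def less_wo_def)
  show "x \<le> x" by (simp add: less_eq_wo_def)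
  show "x \<le> y \<Longrightarrow> y \<le> z \<Longrightarrow> x \<le> z" by (simp add: less_eq_wo_def)
  show "x \<le> y \<Longrightarrow> y \<le> x \<Longrightarrow> x = y" using inj_wo_index by (auto simp: less_eq_wo_def inj_def)
  show "x \<le> y \<or> y \<le> x" by (auto simp: less_eq_wo_def)
  show "P z" if step: "\<And>x. (\<And>y. y < x \<Longrightarrow> P y) \<Longrightarrow> P x"
  proof (induction z rule: measure_induct_rule[of wo_index])
    case (less z)
    show ?case by (rule step, rule less.IH) (simp only: less_wo_def)
  qed
qed

end

definition to_wo :: "real ^ 'm::finite \<Rightarrow> real ^ 'm wo" where "to_wo x = (\<chi> i. x $ Rep_wo i)"
definition from_wo :: "real ^ 'm wo \<Rightarrow> real ^ 'm::finite" where "from_wo x = (\<chi> i. x $ Abs_wo i)"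

lemma from_to_wo [simp]: "from_wo (to_wo x) = x"
  by (simp add: from_wo_def to_wo_def vec_eq_iff Abs_wo_inverse)

lemma to_from_wo [simp]: "to_wo (from_wo x) = x"
  by (simp add: from_wo_def to_wo_def vec_eq_iff Rep_wo_inverse)

lemma linear_wo: "linear to_wo" "linear from_wo"
  by (auto intro!: linearI simp: to_wo_def from_wo_def vec_eq_iff)

lemma DIM_wo: "DIM(real ^ 'm::finite) = DIM(real ^ 'm wo)"
  using bij_betw_same_card[of Abs_wo "UNIV :: 'm set" UNIV] 
  by (simp add: bij_betw_def inj_def Abs_wo_inject surj_def) (metis Abs_wo_cases)

lemma continuous_on_wo: "continuous_on S to_wo" "continuous_on T from_wo"
  using linear_wo linear_continuous_on linear_conv_bounded_linear by blast+

lemma emeasure_to_wo_borel: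
  fixes X :: "(real ^ 'm::finite) set"
  assumes X: "X \<in> sets borel"
  shows "to_wo ` X \<in> sets borel" "emeasure lborel (to_wo ` X) = emeasure lborel X"
proof -
  have im: "to_wo ` X = from_wo -` X" by (force intro: image_eqI[of _ to_wo "from_wo _"])
  have bm: "from_wo \<in> borel_measurable (borel :: (real ^ 'm wo) measure)"
    by (rule borel_measurable_continuous_onI[OF continuous_on_wo(2)])
  show 1: "to_wo ` X \<in> sets borel"
    unfolding im using measurable_sets[OF bm X] by simp
  have "lborel = distr lborel borel (from_wo :: real ^ 'm wo \<Rightarrow> real ^ 'm)"
  proof (rule lborel_eqI)
    fix l u :: "real ^ 'm" assume lu: "\<And>b. b \<in> Basis \<Longrightarrow> l \<bullet> b \<le> u \<bullet> b"
    have le: "l $ i \<le> u $ i" for i using lu[of "axis i 1"] by (simp add: inner_axis)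
    have "(\<lambda>i. u $ Rep_wo i - l $ Rep_wo i) = (\<lambda>i. (u $ i - l $ i)) \<circ> Rep_wo" by auto
    have eq: "from_wo -` box l u = box (to_wo l) (to_wo u)"
    proof (intro set_eqI)
      fix x :: "real ^ 'm wo"
      have "x \<in> from_wo -` box l u \<longleftrightarrow> (\<forall>i. l $ i < x $ Abs_wo i \<and> x $ Abs_wo i < u $ i)"
        by (simp add: mem_box_cart from_wo_def)
      also have "\<dots> \<longleftrightarrow> (\<forall>j. l $ Rep_wo j < x $ j \<and> x $ j < u $ Rep_wo j)"
        by (metis Abs_wo_inverse Rep_wo_inverse UNIV_I)
      finally show "x \<in> from_wo -` box l u \<longleftrightarrow> x \<in> box (to_wo l) (to_wo u)"
        by (simp add: mem_box_cart to_wo_def)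
    qed
    have "emeasure (distr lborel borel from_wo) (box l u) = emeasure lborel (box (to_wo l) (to_wo u))"
      by (subst emeasure_distr) (use bm eq in auto)
    also have "\<dots> = (\<Prod>b\<in>Basis. (to_wo u - to_wo l) \<bullet> b)"
      by (rule emeasure_lborel_box) (use le in \<open>auto simp: Basis_vec_def to_wo_def inner_axis\<close>)
    also have "(\<Prod>b\<in>Basis. (to_wo u - to_wo l) \<bullet> b) = (\<Prod>i\<in>UNIV. u $ Rep_wo i - l $ Rep_wo i)"
      by (simp add: Basis_vec_def UNION_singleton_eq_range prod.reindex inj_on_def axis_eq_axis inner_axis to_wo_def)
    also have "\<dots> = (\<Prod>i\<in>UNIV. u $ i - l $ i)"
      by (rule prod.reindex_bij_betw[of Rep_wo UNIV UNIV "\<lambda>i. u $ i - l $ i"])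
        (auto simp: bij_betw_def inj_def Rep_wo_inject surj_def intro: exI[of _ "Abs_wo _"] simp: Abs_wo_inverse)
    also have "\<dots> = (\<Prod>b\<in>Basis. (u - l) \<bullet> b)"
      by (simp add: Basis_vec_def UNION_singleton_eq_range prod.reindex inj_on_def axis_eq_axis inner_axis)
    finally show "emeasure (distr lborel borel from_wo) (box l u) = (\<Prod>b\<in>Basis. (u - l) \<bullet> b)" .
  qed simp
  then have "emeasure lborel X = emeasure (distr lborel borel (from_wo :: real ^ 'm wo \<Rightarrow> real ^ 'm)) X" by simp
  also have "\<dots> = emeasure lborel (from_wo -` X)" by (subst emeasure_distr) (use bm X in auto)
  finally show "emeasure lborel (to_wo ` X) = emeasure lborel X" by (simp add: im)
qed

text \<open>A Lebesgue set is an F-sigma set, to which the Borel case applies, together with a null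
  set, and null sets are preserved by linear maps between spaces of equal dimension.\<close>

lemma emeasure_to_wo:
  fixes X :: "(real ^ 'm::finite) set"
  assumes X: "X \<in> sets lebesgue"
  shows "emeasure lebesgue (to_wo ` X) = emeasure lebesgue X"
proof -
  obtain C N where CN: "fsigma C" "N \<in> null_sets lebesgue" "C \<union> N = X" "disjnt C N"
    by (rule lebesgue_set_almost_fsigma[OF X])
  have C: "C \<in> sets borel"
  proof -
    obtain F :: "nat \<Rightarrow> (real ^ 'm) set" where F: "range F \<subseteq> Collect compact" "C = \<Union>(range F)"
      using CN(1) fsigma_Union_compact by metis
    then have "range F \<subseteq> sets borel" using borel_compact by auto
    then have "(\<Union>n\<in>UNIV. F n) \<in> sets borel" by (rule sets.countable_UN)
    then show ?thesis by (simp add: F(2))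
  qed
  have N: "negligible N" using CN(2) by (simp add: negligible_iff_null_sets)
  have "negligible (to_wo ` N)"
    by (rule negligible_differentiable_image_negligible[OF _ N linear_imp_differentiable_on[OF linear_wo(1)]])
      (rule eq_imp_le[OF DIM_wo])
  then have N': "to_wo ` N \<in> null_sets lebesgue" by (simp add: negligible_iff_null_sets)
  have "emeasure lebesgue (to_wo ` X) = emeasure lebesgue (to_wo ` C \<union> to_wo ` N)"
    unfolding CN(3)[symmetric] by (simp add: image_Un)
  also have "\<dots> = emeasure lebesgue (to_wo ` C)"
    by (rule emeasure_Un_null_set[OF _ N']) (use emeasure_to_wo_borel(1)[OF C] in simp)
  also have "\<dots> = emeasure lebesgue C" using emeasure_to_wo_borel[OF C] C by simp
  also have "\<dots> = emeasure lebesgue (C \<union> N)"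
    by (rule emeasure_Un_null_set[symmetric]) (use C CN in auto)
  finally show ?thesis unfolding CN(3) .
qed

text \<open>The map \<open>-I\<close> composed with itself is \<open>-1\<close>, so its determinant
  has absolute value 1 and the two Jacobians agree in absolute value. Each image has the integral of
  its Jacobian as measure.\<close>

lemma equal_measure_images_wo:
  fixes f g :: "real ^ 'm::{finite,wellorder} \<Rightarrow> real ^ 'm::_"
  assumes S: "S \<in> sets lebesgue" and inj: "inj_on f S" "inj_on g S"
    and df: "\<And>x. x \<in> S \<Longrightarrow> (f has_derivative A x) (at x within S)"
    and dg: "\<And>x. x \<in> S \<Longrightarrow> (g has_derivative B x) (at x within S)"
    and I: "linear I" "\<And>x. I (I x) = - x" and BA: "\<And>x u. x \<in> S \<Longrightarrow> B x u = - A x (I u)"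
    and bd: "bounded (f ` S)" "bounded (g ` S)"
  shows "emeasure lebesgue (f ` S) = emeasure lebesgue (g ` S)"
proof -
  have det: "\<bar>det (matrix (B x))\<bar> = \<bar>det (matrix (A x))\<bar>" if x: "x \<in> S" for x
  proof -
    have lA: "linear (A x)" using df[OF x] by (rule has_derivative_linear)
    have lI: "linear (\<lambda>u. - I u)" using I(1) by (rule linear_compose_neg)
    have "B x = A x \<circ> (\<lambda>u. - I u)" using BA[OF x] linear_neg[OF lA] by auto
    then have 1: "det (matrix (B x)) = det (matrix (A x)) * det (matrix (\<lambda>u. - I u))"
      using matrix_compose[OF lI lA] by (simp add: det_mul)
    have "(\<lambda>u. - I u) \<circ> (\<lambda>u. - I u) = (\<lambda>u. - u)" using I(2) linear_neg[OF I(1)] by auto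
    then have "det (matrix (\<lambda>u. - I u)) * det (matrix (\<lambda>u. - I u)) = det (matrix (\<lambda>u :: real ^ 'm::_. - u))"
      using matrix_compose[OF lI lI] by (simp add: det_mul)
    moreover have "\<bar>det (matrix (\<lambda>u :: real ^ 'm::_. - u))\<bar> = 1"
    proof -
      have l: "linear (\<lambda>u :: real ^ 'm::_. - u)" by (intro linear_compose_neg linear_ident)
      have "(\<lambda>u :: real ^ 'm::_. - u) \<circ> (\<lambda>u. - u) = id" by auto
      then have "det (matrix (\<lambda>u :: real ^ 'm::_. - u)) * det (matrix (\<lambda>u :: real ^ 'm::_. - u)) = 1"
        using matrix_compose[OF l l] by (metis det_I det_mul matrix_id_mat_1)
      then show ?thesis by (metis abs_1 abs_mult_self_eq abs_square_eq_1 power2_eq_square)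
    qed
    ultimately have "\<bar>det (matrix (\<lambda>u. - I u))\<bar> * \<bar>det (matrix (\<lambda>u. - I u))\<bar> = 1" by (metis abs_mult)
    then have "\<bar>det (matrix (\<lambda>u. - I u))\<bar> = 1"
      by (metis abs_mult_self_eq abs_square_eq_1 power2_eq_square)
    with 1 show ?thesis by (simp add: abs_mult)
  qed
  \<comment> \<open>Bounded images have finite measure, as the real-valued change of variables
    formula demands.\<close>
  have ms: "f ` S \<in> lmeasurable" "g ` S \<in> lmeasurable"
  proof -
    have "f differentiable_on S" "g differentiable_on S"
      unfolding differentiable_on_def differentiable_def using df dg by blast+
    then have "f ` S \<in> sets lebesgue" "g ` S \<in> sets lebesgue"
      using differentiable_image_in_sets_lebesgue[OF S order_refl] by blast+
    then show "f ` S \<in> lmeasurable" "g ` S \<in> lmeasurable"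
      using bd by (auto intro: bounded_set_imp_lmeasurable)
  qed
  have i: "(\<lambda>x. \<bar>det (matrix (A x))\<bar>) integrable_on S" "(\<lambda>x. \<bar>det (matrix (B x))\<bar>) integrable_on S"
    using measurable_differentiable_image_eq[OF S df inj(1)] measurable_differentiable_image_eq[OF S dg inj(2)] ms
    by auto
  have "measure lebesgue (f ` S) = integral S (\<lambda>x. \<bar>det (matrix (A x))\<bar>)"
    by (rule measure_differentiable_image_eq[OF S df inj(1) i(1)])
  also have "\<dots> = integral S (\<lambda>x. \<bar>det (matrix (B x))\<bar>)" by (rule integral_cong) (simp add: det)
  also have "\<dots> = measure lebesgue (g ` S)"
    by (rule measure_differentiable_image_eq[OF S dg inj(2) i(2), symmetric])
  finally show ?thesis using ms by (simp add: emeasure_eq_measure2)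
qed

text \<open>If the derivatives of two maps differ by a complex structure \<open>I\<close>, their Jacobians agree up to
  sign.\<close>

lemma equal_measure_images:
  fixes f g :: "real ^ 'm::finite \<Rightarrow> real ^ 'm"
  assumes S: "S \<in> sets borel" and inj: "inj_on f S" "inj_on g S"
    and df: "\<And>x. x \<in> S \<Longrightarrow> (f has_derivative A x) (at x)"
    and dg: "\<And>x. x \<in> S \<Longrightarrow> (g has_derivative B x) (at x)"
    and I: "linear I" "\<And>x. I (I x) = - x" and BA: "\<And>x u. x \<in> S \<Longrightarrow> B x u = - A x (I u)"
    and bd: "bounded (f ` S)" "bounded (g ` S)"
  shows "f ` S \<in> sets lebesgue \<and> g ` S \<in> sets lebesgue \<and>
     emeasure lebesgue (f ` S) = emeasure lebesgue (g ` S)"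
proof -
  have SL: "S \<in> sets lebesgue" using S by simp
  have m: "f ` S \<in> sets lebesgue" "g ` S \<in> sets lebesgue"
  proof -
    have "f differentiable_on S" "g differentiable_on S"
      unfolding differentiable_on_def differentiable_def using df dg has_derivative_at_withinI by blast+
    then show "f ` S \<in> sets lebesgue" "g ` S \<in> sets lebesgue"
      using differentiable_image_in_sets_lebesgue[OF SL order_refl] by blast+
  qed
  let ?c = "\<lambda>h x. to_wo (h (from_wo x))"
  have bl: "bounded_linear (to_wo :: real ^ 'm \<Rightarrow> real ^ 'm wo)" "bounded_linear (from_wo :: real ^ 'm wo \<Rightarrow> real ^ 'm)"
    using linear_wo linear_conv_bounded_linear by blast+
  have im: "?c h ` (to_wo ` S) = to_wo ` (h ` S)" for h by (auto simp: image_image)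
  have der: "(?c h has_derivative ?c (D (from_wo x))) (at x within to_wo ` S)"
    if "\<And>x. x \<in> S \<Longrightarrow> (h has_derivative D x) (at x)" "x \<in> to_wo ` S"
    for h :: "real ^ 'm \<Rightarrow> real ^ 'm" and D x
  proof -
    have "from_wo x \<in> S" using that(2) by auto
    then have "(h has_derivative D (from_wo x)) (at (from_wo x))" by (rule that(1))
    from has_derivative_compose[OF bounded_linear_imp_has_derivative[OF bl(2)] this]
    have "((\<lambda>x. h (from_wo x)) has_derivative (\<lambda>u. D (from_wo x) (from_wo u))) (at x within to_wo ` S)" .
    from has_derivative_compose[OF this bounded_linear_imp_has_derivative[OF bl(1)]] show ?thesis .
  qed
  have injc: "inj_on (?c h) (to_wo ` S)" if "inj_on h S" for h
  proof (rule inj_onI)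
    fix x y assume xy: "x \<in> to_wo ` S" "y \<in> to_wo ` S" "?c h x = ?c h y"
    then have "from_wo (?c h x) = from_wo (?c h y)" by simp
    then have "h (from_wo x) = h (from_wo y)" by simp
    then have "from_wo x = from_wo y" using inj_onD[OF that] xy by auto
    then have "to_wo (from_wo x) = to_wo (from_wo y)" by simp
    then show "x = y" by simp
  qed
  have "emeasure lebesgue (?c f ` (to_wo ` S)) = emeasure lebesgue (?c g ` (to_wo ` S))"
  proof (rule equal_measure_images_wo)
    show "to_wo ` S \<in> sets lebesgue" using emeasure_to_wo_borel(1)[OF S] by simp
    show "inj_on (?c f) (to_wo ` S)" "inj_on (?c g) (to_wo ` S)" by (rule injc[OF inj(1)], rule injc[OF inj(2)])
    show "x \<in> to_wo ` S \<Longrightarrow> (?c f has_derivative ?c (A (from_wo x))) (at x within to_wo ` S)" for x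
      by (rule der[OF df])
    show "x \<in> to_wo ` S \<Longrightarrow> (?c g has_derivative ?c (B (from_wo x))) (at x within to_wo ` S)" for x
      by (rule der[OF dg])
    show "linear (?c I)"
      using linear_compose[OF linear_compose[OF linear_wo(2) I(1)] linear_wo(1)] by (simp add: o_def)
    show "?c I (?c I x) = - x" for x by (simp add: I(2) linear_neg[OF linear_wo(1)])
    show "?c (B (from_wo x)) u = - ?c (A (from_wo x)) (?c I u)" if "x \<in> to_wo ` S" for x u
      using BA[of "from_wo x"] that by (auto simp: linear_neg[OF linear_wo(1)])
    show "bounded (?c f ` (to_wo ` S))" "bounded (?c g ` (to_wo ` S))"
      unfolding im by (intro bounded_linear_image bl bd)+
  qed
  then show ?thesis using m by (simp add: im emeasure_to_wo)
qed

text \<open>The target may have the larger dimension, as for the map \<open>G\<close> in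
  \<open>locally_injective_on_variety\<close>.\<close>

lemma locally_injective_C1:
  fixes f :: "'a::euclidean_space \<Rightarrow> 'b::euclidean_space"
  assumes S: "open S" "a \<in> S" and der: "\<And>x. x \<in> S \<Longrightarrow> (f has_derivative f' x) (at x)"
    and cont: "\<And>u. continuous_on S (\<lambda>x. f' x u)" and inj: "\<And>u. f' a u = 0 \<Longrightarrow> u = 0"
  obtains r where "r > 0" "ball a r \<subseteq> S" "inj_on f (ball a r)"
proof -
  define D where "D x = Blinfun (f' x)" for x
  have D: "blinfun_apply (D x) = f' x" if "x \<in> S" for x
    unfolding D_def using has_derivative_bounded_linear[OF der[OF that]] by (rule bounded_linear_Blinfun_apply)
  have "continuous_on S D"
  proof (rule continuous_on_blinfun_componentwise)
    show "continuous_on S (\<lambda>x. blinfun_apply (D x) u)" for u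
      using cont[of u] by (rule continuous_on_cong[THEN iffD1, rotated 2]) (auto simp: D)
  qed
  have lin: "linear (f' a)" by (rule has_derivative_linear[OF der[OF S(2)]])
  then have "inj (f' a)" using inj by (simp add: linear_injective_0)
  then obtain h where h: "linear h" "h \<circ> f' a = id" using linear_injective_left_inverse[OF lin] by blast
  obtain r0 where r0: "r0 > 0" "ball a r0 \<subseteq> S" using S by (meson openE)
  show ?thesis
  proof (rule has_derivative_locally_injective[OF S(2,1) _ h(2) der])
    show "bounded_linear h" using h(1) by (simp add: linear_conv_bounded_linear)
    fix e :: real assume "e > 0"
    then obtain d where d: "d > 0" "\<And>x. x \<in> S \<Longrightarrow> dist x a < d \<Longrightarrow> dist (D x) (D a) < e"
      using \<open>continuous_on S D\<close> S(2) unfolding continuous_on_iff by metis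
    have "onorm (\<lambda>v. f' x v - f' a v) < e" if "dist a x < min d r0" for x
    proof -
      have x: "x \<in> S" using r0(2) that by (auto simp: ball_def)
      have "norm (D x - D a) < e" using d(2)[OF x] that by (simp add: dist_norm norm_minus_commute)
      moreover have "norm (D x - D a) = onorm (\<lambda>v. f' x v - f' a v)"
        by (simp add: norm_blinfun.rep_eq minus_blinfun.rep_eq D x S(2))
      ultimately show ?thesis by simp
    qed
    then show "\<exists>d>0. \<forall>x. dist a x < d \<longrightarrow> onorm (\<lambda>v. f' x v - f' a v) < e"
      using d(1) r0(1) by (intro exI[of _ "min d r0"]) auto
  qed (auto intro: that)
qed

section \<open>Amoebas and rolled coamoebas\<close>

lemma arg_pi_eq_iff:
  assumes "w \<noteq> 0" shows "arg_pi w = abs_real_mod_pi x \<longleftrightarrow> Im (w * cis (- x)) = 0"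
proof -
  have "w * cis (- x) = of_real (cmod w) * (cis (Arg w) * cis (- x))"
    using cis_Arg[OF assms] assms by (simp add: sgn_div_norm scaleR_conv_of_real field_simps)
  also have "cis (Arg w) * cis (- x) = cis (Arg w - x)" by (simp add: cis_mult)
  finally have "Im (w * cis (- x)) = cmod w * sin (Arg w - x)" by simp
  then have "Im (w * cis (- x)) = 0 \<longleftrightarrow> sin (Arg w - x) = 0" using assms by simp
  also have "\<dots> \<longleftrightarrow> (\<exists>k::int. Arg w - x = of_int k * pi)" by (simp add: sin_zero_iff_int2)
  also have "\<dots> \<longleftrightarrow> arg_pi w = abs_real_mod_pi x" unfolding arg_pi_def by (rule real_mod_pi.abs_eq_iff[symmetric])
  finally show ?thesis by simp
qed

lemma Arg_pi_map_eq_iff: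
  assumes "w \<in> torus"
  shows "Arg_pi_map w = mod_pi \<theta> \<longleftrightarrow> (\<forall>i. Im (w $ i * cis (- (\<theta> $ i))) = 0)"
  using assms by (simp add: Arg_pi_map_def mod_pi_def vec_eq_iff torus_def arg_pi_eq_iff)

section \<open>Local branches of the logarithm and the argument\<close>

definition logs :: "complex ^ 'm::finite \<Rightarrow> complex ^ 'm \<Rightarrow> complex ^ 'm" where
  "logs z w = (\<chi> i. Ln (w $ i / z $ i))"

definition slit :: "complex ^ 'm::finite \<Rightarrow> (complex ^ 'm) set" where
  "slit z = {w. \<forall>i. w $ i / z $ i \<notin> \<real>\<^sub>\<le>\<^sub>0}"

text \<open>The branch of the argument on \<open>slit z\<close> that takes the value
  \<open>\<theta>\<close> at \<open>z\<close>, where the quotient is 1 and its logarithm 0.\<close>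

definition arg_lift :: "complex ^ 'm::finite \<Rightarrow> real ^ 'm \<Rightarrow> complex ^ 'm \<Rightarrow> real ^ 'm" where
  "arg_lift z \<theta> w = (\<chi> i. \<theta> $ i + Im (logs z w $ i))"

lemma slit_torus: "slit z \<subseteq> torus"
proof
  fix w assume w: "w \<in> slit z"
  have "w $ i \<noteq> 0" for i
  proof
    assume "w $ i = 0"
    moreover have "w $ i / z $ i \<notin> \<real>\<^sub>\<le>\<^sub>0" using w by (simp add: slit_def)
    ultimately show False by simp
  qed
  then show "w \<in> torus" by (simp add: torus_def)
qed

lemma slit_self: "z \<in> torus \<Longrightarrow> z \<in> slit z"
  by (simp add: slit_def torus_def)

lemma open_slit: "open (slit (z :: complex ^ 'm::finite))"
proof -
  have "slit z = (\<Inter>i. (\<lambda>w. w $ i / z $ i) -` (- \<real>\<^sub>\<le>\<^sub>0))" by (auto simp: slit_def)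
  moreover have "continuous_on UNIV (\<lambda>w. w $ i / z $ i)" for i
    unfolding divide_inverse by (intro continuous_intros)
  ultimately show ?thesis
    by (auto intro!: open_INT open_vimage open_Compl closed_nonpos_Reals_complex)
qed

lemma logs_has_derivative:
  assumes z: "z \<in> torus" and w: "w \<in> slit z"
  shows "(logs z has_derivative (\<lambda>u. \<chi> i. u $ i / w $ i)) (at w)"
  unfolding logs_def
proof (rule has_derivative_vec_lambda)
  fix i
  have nz: "z $ i \<noteq> 0" using z by (simp add: torus_def)
  have ws: "w $ i / z $ i \<notin> \<real>\<^sub>\<le>\<^sub>0" using w by (simp add: slit_def)
  have "((\<lambda>w. w $ i / z $ i) has_derivative (\<lambda>u. u $ i / z $ i)) (at w)"
    unfolding divide_inverse
    by (intro has_derivative_mult_left bounded_linear_imp_has_derivative bounded_linear_vec_nth)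
  from has_derivative_compose[OF this has_field_derivative_Ln[OF ws, unfolded has_field_derivative_def]]
  have "((\<lambda>w. Ln (w $ i / z $ i)) has_derivative (\<lambda>u. inverse (w $ i / z $ i) * (u $ i / z $ i))) (at w)" .
  then show "((\<lambda>w. Ln (w $ i / z $ i)) has_derivative (\<lambda>u. u $ i / w $ i)) (at w)"
    using nz by (simp add: field_simps)
qed

lemma Log_logs:
  assumes z: "z \<in> torus" and w: "w \<in> torus"
  shows "Log_map w = Log_map z + (\<chi> i. Re (logs z w $ i))"
  using z w by (simp add: Log_map_def logs_def vec_eq_iff torus_def norm_divide ln_div)

lemma Log_map_has_derivative:
  assumes w: "w \<in> torus"
  shows "(Log_map has_derivative (\<lambda>u. \<chi> i. Re (u $ i / w $ i))) (at w)"
proof -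
  have "((\<lambda>x. Log_map w + (\<chi> i. Re (logs w x $ i))) has_derivative (\<lambda>u. 0 + (\<chi> i. Re ((\<chi> i. u $ i / w $ i) $ i)))) (at w)"
    by (intro has_derivative_add has_derivative_const has_derivative_vec_lambda
        bounded_linear.has_derivative[OF bounded_linear_Re]
        bounded_linear.has_derivative[OF bounded_linear_vec_nth] logs_has_derivative w slit_self)
  then have 1: "((\<lambda>x. Log_map w + (\<chi> i. Re (logs w x $ i))) has_derivative (\<lambda>u. \<chi> i. Re (u $ i / w $ i))) (at w)"
    by simp
  show ?thesis
    by (rule has_derivative_transform_within_open[OF 1 open_slit slit_self[OF w]])
      (use Log_logs[OF w, symmetric] subsetD[OF slit_torus] in blast)
qed

lemma arg_lift_has_derivative:
  assumes z: "z \<in> torus" and w: "w \<in> slit z"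
  shows "(arg_lift z \<theta> has_derivative (\<lambda>u. \<chi> i. Im (u $ i / w $ i))) (at w)"
proof -
  have "((\<lambda>x. \<chi> i. \<theta> $ i + Im (logs z x $ i)) has_derivative (\<lambda>u. \<chi> i. 0 + Im ((\<chi> i. u $ i / w $ i) $ i))) (at w)"
    by (intro has_derivative_add has_derivative_const has_derivative_vec_lambda
        bounded_linear.has_derivative[OF bounded_linear_Im]
        bounded_linear.has_derivative[OF bounded_linear_vec_nth] logs_has_derivative z w)
  then show ?thesis by (simp add: arg_lift_def[abs_def])
qed

text \<open>The identity extends over the whole torus, since across the slit the principal logarithm
  jumps by full turns. \<open>covering_bound\<close> calls for a lift on all of
  \<open>V\<close>.\<close>

lemma arg_lift_mod_pi:
  assumes z: "z \<in> torus" "Arg_pi_map z = mod_pi \<theta>" and w: "w \<in> torus"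
  shows "mod_pi (arg_lift z \<theta> w) = Arg_pi_map w"
proof -
  have "Im (w $ i * cis (- (arg_lift z \<theta> w $ i))) = 0" for i
  proof -
    have nz: "z $ i \<noteq> 0" "w $ i \<noteq> 0" using z w by (auto simp: torus_def)
    define q where "q = w $ i / z $ i"
    have q: "q \<noteq> 0" using nz by (simp add: q_def)
    have "q * cis (- Im (Ln q)) = of_real (cmod q)"
    proof -
      have "q = of_real (cmod q) * cis (Im (Ln q))"
        using cis_Arg[OF q] q by (simp add: Arg_eq_Im_Ln sgn_div_norm scaleR_conv_of_real field_simps)
      then have "q * cis (- Im (Ln q)) = of_real (cmod q) * (cis (Im (Ln q)) * cis (- Im (Ln q)))"
        by (metis mult.assoc)
      then show ?thesis by (simp add: cis_mult)
    qed
    moreover have "w $ i * cis (- (arg_lift z \<theta> w $ i)) =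
        (q * cis (- Im (Ln q))) * (z $ i * cis (- (\<theta> $ i)))"
    proof -
      have "cis (- (arg_lift z \<theta> w $ i)) = cis (- Im (Ln q)) * cis (- (\<theta> $ i))"
        by (simp add: arg_lift_def logs_def q_def cis_mult add.commute)
      moreover have "w $ i = q * z $ i" using nz by (simp add: q_def)
      ultimately show ?thesis by (simp only: mult_ac)
    qed
    moreover have "Im (z $ i * cis (- (\<theta> $ i))) = 0" using z Arg_pi_map_eq_iff by blast
    ultimately show ?thesis by simp
  qed
  then show ?thesis using Arg_pi_map_eq_iff[OF w] by metis
qed

text \<open>The reflection \<open>z \<mapsto> \<epsilon> / cnj z\<close> fixes \<open>z\<close> when
  \<open>\<epsilon>\<close> is the square of \<open>cmod z\<close>; hence the factor 2.\<close>

definition radial :: "real ^ 'm::finite \<Rightarrow> complex ^ 'm" where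
  "radial p = (\<chi> i. of_real (exp (2 * p $ i)))"

text \<open>The parameter \<open>z / cnj z\<close> for which \<open>z\<close> is a fixed point of
  \<open>z \<mapsto> \<epsilon> * cnj z\<close>. Doubling the angle makes it well defined modulo
  \<open>pi\<close>.\<close>

definition angular :: "real ^ 'm::finite \<Rightarrow> complex ^ 'm" where
  "angular \<theta> = (\<chi> i. cis (2 * \<theta> $ i))"

lemma Log_fixed:
  assumes "z \<in> torus" shows "Log_map z = p \<longleftrightarrow> conj'.twist (radial p) z = z"
proof -
  have "ln (cmod (z $ i)) = p $ i \<longleftrightarrow> of_real (exp (2 * p $ i)) * (1 / cnj (z $ i)) = z $ i" for i
  proof -
    have nz: "z $ i \<noteq> 0" using assms by (simp add: torus_def)
    have "of_real (exp (2 * p $ i)) * (1 / cnj (z $ i)) = z $ i \<longleftrightarrow> of_real (exp (2 * p $ i)) = z $ i * cnj (z $ i)"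
      using nz by (auto simp: field_simps)
    also have "\<dots> \<longleftrightarrow> exp (2 * p $ i) = (cmod (z $ i))\<^sup>2"
      by (simp only: complex_norm_square[symmetric] of_real_eq_iff)
    also have "\<dots> \<longleftrightarrow> exp (p $ i) = cmod (z $ i)"
      by (simp add: exp_double power2_eq_iff_nonneg)
    also have "\<dots> \<longleftrightarrow> ln (cmod (z $ i)) = p $ i"
      using nz by (metis exp_ln ln_exp zero_less_norm_iff)
    finally show ?thesis by simp
  qed
  then show ?thesis by (simp add: Log_map_def conj'.twist_def conj'_map_def radial_def vec_eq_iff)
qed

lemma Arg_fixed:
  assumes "z \<in> torus" "Arg_pi_map z = mod_pi \<theta>" shows "conj.twist (angular \<theta>) z = z"
proof -
  have "cis (2 * \<theta> $ i) * cnj (z $ i) = z $ i" for i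
  proof -
    have "Im (z $ i * cis (- (\<theta> $ i))) = 0" using assms Arg_pi_map_eq_iff by blast
    then have "cnj (z $ i * cis (- (\<theta> $ i))) = z $ i * cis (- (\<theta> $ i))"
      by (simp add: complex_eq_iff)
    then have "cis (\<theta> $ i) * (cnj (z $ i) * cis (\<theta> $ i)) = cis (\<theta> $ i) * (z $ i * cis (- (\<theta> $ i)))"
      by (simp add: cis_cnj)
    moreover have "cis (\<theta> $ i) * (z $ i * cis (- (\<theta> $ i))) = z $ i * (cis (\<theta> $ i) * cis (- (\<theta> $ i)))"
      by (simp only: mult_ac)
    moreover have "cis (\<theta> $ i) * (cnj (z $ i) * cis (\<theta> $ i)) = cis (2 * \<theta> $ i) * cnj (z $ i)"
    proof -
      have "cis (2 * \<theta> $ i) = cis (\<theta> $ i) * cis (\<theta> $ i)" by (simp add: cis_mult)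
      then show ?thesis by (simp only: mult_ac)
    qed
    ultimately show ?thesis by (simp add: cis_mult)
  qed
  then show ?thesis by (simp add: conj.twist_def conj_map_def angular_def vec_eq_iff)
qed

lemma generic_radial_negligible:
  fixes Q :: "('m::finite \<Rightarrow> complex) \<Rightarrow> complex"
  assumes Q: "Q \<in> polyf UNIV" "Q a \<noteq> 0"
  shows "negligible {p :: real ^ 'm. Q (vec_nth (radial p)) = 0}"
proof -
  have "negligible {p :: real ^ 'm. Q (\<lambda>i. complex_of_real (exp (2 * p $ i))) = 0}"
  proof (rule polyf_real_zero_negligible[OF _ _ Q, where c = "\<lambda>t. complex_of_real (exp (2 * t))"])
    show "continuous_on UNIV (\<lambda>t. complex_of_real (exp (2 * t)))" by (intro continuous_intros)
    fix b
    have "{t. complex_of_real (exp (2 * t)) = b} \<subseteq> {ln (cmod b) / 2}" by auto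
    then show "countable {t. complex_of_real (exp (2 * t)) = b}" using countable_subset by blast
  qed
  then show ?thesis by (simp add: radial_def vec_lambda_inverse)
qed

lemma generic_angular_negligible:
  fixes Q :: "('m::finite \<Rightarrow> complex) \<Rightarrow> complex"
  assumes Q: "Q \<in> polyf UNIV" "Q a \<noteq> 0"
  shows "negligible {\<theta> :: real ^ 'm. Q (vec_nth (angular \<theta>)) = 0}"
proof -
  have "negligible {\<theta> :: real ^ 'm. Q (\<lambda>i. cis (2 * \<theta> $ i)) = 0}"
  proof (rule polyf_real_zero_negligible[OF _ _ Q, where c = "\<lambda>t. cis (2 * t)"])
    show "continuous_on UNIV (\<lambda>t. cis (2 * t))" unfolding cis_conv_exp by (intro continuous_intros)
    fix b
    show "countable {t. cis (2 * t) = b}"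
    proof (cases "\<exists>s. cis (2 * s) = b")
      case True
      then obtain s where s: "cis (2 * s) = b" ..
      have "{t. cis (2 * t) = b} \<subseteq> range (\<lambda>k::int. s + of_int k * pi)"
      proof
        fix t assume "t \<in> {t. cis (2 * t) = b}"
        then have "cis (2 * t) = cis (2 * s)" unfolding s by blast
        then have "cis (2 * t) * cis (- (2 * s)) = cis (2 * s) * cis (- (2 * s))" by (rule arg_cong)
        then have "cis (2 * t) * cis (- (2 * s)) = 1" unfolding cis_mult by simp
        then have "cis (2 * (t - s)) = 1" by (simp add: cis_mult right_diff_distrib)
        then have "sin (2 * (t - s)) = 0" "cos (2 * (t - s)) = 1" by (auto simp: complex_eq_iff)
        then have "(sin (t - s))\<^sup>2 = 0" using cos_double_sin[of "t - s"] by linarith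
        then have "sin (t - s) = 0" by simp
        then obtain k :: int where "t - s = of_int k * pi" by (auto simp: sin_zero_iff_int2)
        then have "t = s + of_int k * pi" by simp
        then show "t \<in> range (\<lambda>k::int. s + of_int k * pi)" by blast
      qed
      then show ?thesis by (rule countable_subset) simp
    qed auto
  qed
  then show ?thesis by (simp add: angular_def vec_lambda_inverse)
qed

text \<open>The tangent space at \<open>z\<close> is written as the set of \<open>u\<close> that the
  differential of the chart sends to \<open>Lsub J\<close>; on it the differential of
  \<open>Log_map\<close> is onto.\<close>

definition log_onto where
  "log_onto J F z \<longleftrightarrow> (\<forall>y :: real ^ 'm::finite. \<exists>u. dchart J F z u \<in> Lsub J \<and> (\<chi> i. Re (u $ i / z $ i)) = y)"

text \<open>When \<open>CARD('m) = 2 * n\<close>, surjectivity of the differential of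
  \<open>Log_map\<close> on the tangent space makes it an isomorphism.\<close>

definition immersed :: "(complex ^ 'm::finite) set \<Rightarrow> nat \<Rightarrow> complex ^ 'm \<Rightarrow> bool" where
  "immersed V n z \<longleftrightarrow> z \<in> V \<and> (\<exists>J F U. card J = n \<and> etale J F z \<and> open U \<and> z \<in> U \<and>
     V \<inter> U = {w \<in> U. \<forall>k. k \<notin> J \<longrightarrow> F k (vec_nth w) = 0} \<and> log_onto J F z)"

lemma tangent_dchart:
  assumes et: "etale J F z" and U: "open U" "z \<in> U" "V \<inter> U = {w \<in> U. \<forall>k. k \<notin> J \<longrightarrow> F k (vec_nth w) = 0}"
    and v: "v \<in> tangent_space V z"
  shows "dchart J F z v \<in> Lsub J"
proof -
  obtain \<gamma> where \<gamma>: "\<gamma> 0 = z" "range \<gamma> \<subseteq> V" "(\<gamma> has_vector_derivative v) (at 0)"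
    using v unfolding tangent_space_def by blast
  have F: "\<And>k. F k \<in> polyf UNIV" using et by (simp add: etale_def)
  have "isCont \<gamma> 0" using \<gamma>(3) has_vector_derivative_continuous by blast
  then obtain T where T: "open T" "0 \<in> T" "\<forall>t\<in>T. \<gamma> t \<in> U"
    using U \<gamma>(1) unfolding continuous_at_open by metis
  have "dchart J F z v $ k = 0" if k: "k \<notin> J" for k
  proof -
    have "(\<gamma> has_derivative (\<lambda>t. t *\<^sub>R v)) (at 0)" using \<gamma>(3) by (simp add: has_vector_derivative_def)
    then have "((\<lambda>t. F k (vec_nth (\<gamma> t))) has_derivative (\<lambda>t. \<Sum>i\<in>UNIV. pd (F k) i (vec_nth z) * (t *\<^sub>R v) $ i)) (at 0)"
      by (rule has_derivative_compose) (use polyf_has_derivative[OF F] \<gamma>(1) in simp)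
    moreover have "((\<lambda>t. F k (vec_nth (\<gamma> t))) has_derivative (\<lambda>t. 0)) (at 0)"
    proof (rule has_derivative_transform_within_open[OF has_derivative_const T(1,2)])
      show "0 = F k (vec_nth (\<gamma> t))" if "t \<in> T" for t
      proof -
        have "\<gamma> t \<in> V \<inter> U" using T(3) that \<gamma>(2) by auto
        then show ?thesis unfolding U(3) using k by simp
      qed
    qed
    ultimately have "(\<lambda>t. \<Sum>i\<in>UNIV. pd (F k) i (vec_nth z) * (t *\<^sub>R v) $ i) = (\<lambda>t. 0)"
      by (rule has_derivative_unique)
    then have "(\<Sum>i\<in>UNIV. pd (F k) i (vec_nth z) * (1 *\<^sub>R v) $ i) = 0" by meson
    then show ?thesis using k by (simp add: dchart_def)
  qed
  then show ?thesis by (simp add: Lsub_def)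
qed

text \<open>At a fixed point of the reflection \<open>z \<mapsto> \<epsilon> / cnj z\<close> the derivative of \<open>Log\<close> changes sign under
  the derivative of the reflection; so transversality makes it surjective on the tangent space.\<close>

lemma immersedI:
  fixes V :: "(complex ^ 'm::finite) set"
  assumes V: "V \<subseteq> torus" and etale_at: "etale_at V J z" "card J = n" and z: "Log_map z = p"
    and span: "spanning V (translate (radial p) (conj'_map ` V)) z"
  shows "immersed V n z"
proof -
  obtain F U where FU: "etale J F z" "open U" "z \<in> U" "z \<in> V"
    "V \<inter> U = {w \<in> U. \<forall>k. k \<notin> J \<longrightarrow> F k (vec_nth w) = 0}" using etale_at unfolding etale_at_def by blast
  have zT: "z \<in> torus" using FU V by auto
  have fixed: "conj'.twist (radial p) z = z" using Log_fixed[OF zT] z by blast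
  have rad: "radial p $ i = z $ i * cnj (z $ i)" for i
  proof -
    have "radial p $ i * (1 / cnj (z $ i)) = z $ i"
      using arg_cong[OF fixed, of "\<lambda>v. v $ i"] by (simp add: conj'.twist_def conj'_map_def)
    then show ?thesis using zT by (auto simp: torus_def field_simps)
  qed
  \<comment> \<open>The derivative of the reflection at its fixed point. In the logarithmic
    coordinates \<open>u / z\<close> it is minus conjugation.\<close>
  define R where "R u = (\<chi> i. - (z $ i * cnj (u $ i / z $ i)))" for u :: "complex ^ 'm"
  have dR: "(conj'.twist (radial p) has_derivative R) (at z)"
  proof -
    have eq: "conj'.twist (radial p) = (\<lambda>x. \<chi> i. radial p $ i * inverse (cnj (x $ i)))"
      by (simp add: conj'.twist_def conj'_map_def divide_inverse fun_eq_iff)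
    have "((\<lambda>x. \<chi> i. radial p $ i * inverse (cnj (x $ i))) has_derivative
        (\<lambda>u. \<chi> i. radial p $ i * - (inverse (cnj (z $ i)) * cnj (u $ i) * inverse (cnj (z $ i))))) (at z)"
    proof (rule has_derivative_vec_lambda)
      fix i
      have 1: "((\<lambda>x. cnj (x $ i)) has_derivative (\<lambda>u. cnj (u $ i))) (at z)"
        by (rule bounded_linear.has_derivative[OF bounded_linear_cnj
              bounded_linear.has_derivative[OF bounded_linear_vec_nth has_derivative_ident]])
      have 2: "cnj (z $ i) \<noteq> 0" using zT by (simp add: torus_def)
      show "((\<lambda>x. radial p $ i * inverse (cnj (x $ i))) has_derivative
          (\<lambda>u. radial p $ i * - (inverse (cnj (z $ i)) * cnj (u $ i) * inverse (cnj (z $ i))))) (at z)"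
        by (rule has_derivative_mult_right[OF Deriv.has_derivative_inverse[OF 2 1]])
    qed
    moreover have "(\<chi> i. radial p $ i * - (inverse (cnj (z $ i)) * cnj (u $ i) * inverse (cnj (z $ i)))) = R u" for u
      using zT by (simp add: R_def rad vec_eq_iff torus_def field_simps)
    ultimately show ?thesis by (simp add: eq)
  qed
  have invol: "conj'.twist (radial p) (conj'.twist (radial p) x) = x" if "x \<in> torus" for x
    using that by (simp add: conj'.twist_def conj'_map_def radial_def vec_eq_iff torus_def)
  have refl: "R w \<in> tangent_space V z" if w: "w \<in> tangent_space (translate (radial p) (conj'_map ` V)) z" for w
  proof -
    obtain \<gamma> where \<gamma>: "\<gamma> 0 = z" "range \<gamma> \<subseteq> translate (radial p) (conj'_map ` V)"
      "(\<gamma> has_vector_derivative w) (at 0)" using w unfolding tangent_space_def by blast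
    define \<gamma>' where "\<gamma>' t = conj'.twist (radial p) (\<gamma> t)" for t
    have "\<gamma>' t \<in> V" for t
    proof -
      have "\<gamma> t \<in> conj'.twist (radial p) ` V" using \<gamma>(2) unfolding conj'.translate_image by auto
      then obtain x where "x \<in> V" "\<gamma> t = conj'.twist (radial p) x" by blast
      then show ?thesis using invol[of x] V by (auto simp: \<gamma>'_def)
    qed
    moreover have "\<gamma>' 0 = z" by (simp add: \<gamma>'_def \<gamma>(1) fixed)
    moreover have "(\<gamma>' has_vector_derivative R w) (at 0)"
    proof -
      have "(\<gamma> has_derivative (\<lambda>t. t *\<^sub>R w)) (at 0)" using \<gamma>(3) by (simp add: has_vector_derivative_def)
      then have "(\<gamma>' has_derivative (\<lambda>t. R (t *\<^sub>R w))) (at 0)"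
        unfolding \<gamma>'_def by (rule has_derivative_compose) (use dR \<gamma>(1) in simp)
      moreover have "R (t *\<^sub>R w) = t *\<^sub>R R w" for t
        by (simp add: R_def vec_eq_iff scaleR_conv_of_real[where 'a = complex])
      ultimately show ?thesis by (simp add: has_vector_derivative_def)
    qed
    ultimately show ?thesis unfolding tangent_space_def by blast
  qed
  have "\<exists>u. dchart J F z u \<in> Lsub J \<and> (\<chi> i. Re (u $ i / z $ i)) = y" for y
  proof -
    define u where "u = (\<chi> i. z $ i * of_real (y $ i))"
    have "u \<in> {v + w | v w. v \<in> tangent_space V z \<and> w \<in> tangent_space (translate (radial p) (conj'_map ` V)) z}"
      using span unfolding spanning_def by simp
    then obtain v w where vw: "u = v + w" "v \<in> tangent_space V z"
      "w \<in> tangent_space (translate (radial p) (conj'_map ` V)) z" by blast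
    \<comment> \<open>The vector \<open>v - R w\<close> is tangent to \<open>V\<close>, and its
      logarithmic coordinates have the same real parts as those of \<open>v + w\<close>.\<close>
    have "dchart J F z (v - R w) = dchart J F z v - dchart J F z (R w)"
      by (rule linear_diff[OF dchart_linear])
    then have "dchart J F z (v - R w) \<in> Lsub J"
      using subspace_diff[OF subspace_Lsub tangent_dchart[OF FU(1-3,5) vw(2)] tangent_dchart[OF FU(1-3,5) refl[OF vw(3)]]]
      by simp
    moreover have "Re ((v - R w) $ i / z $ i) = y $ i" for i
    proof -
      have nz: "z $ i \<noteq> 0" using zT by (simp add: torus_def)
      have "(v - R w) $ i / z $ i = v $ i / z $ i + cnj (w $ i / z $ i)"
        using nz by (simp add: R_def diff_divide_distrib add_divide_distrib)
      then have "Re ((v - R w) $ i / z $ i) = Re (v $ i / z $ i) + Re (w $ i / z $ i)"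
        by (simp only: plus_complex.sel cnj.sel)
      also have "\<dots> = Re (u $ i / z $ i)" by (simp add: vw(1) add_divide_distrib)
      also have "\<dots> = y $ i" using nz by (simp add: u_def)
      finally show ?thesis .
    qed
    ultimately show ?thesis by (intro exI[of _ "v - R w"]) (simp add: vec_eq_iff)
  qed
  then have "log_onto J F z" unfolding log_onto_def by blast
  then show ?thesis unfolding immersed_def using FU etale_at(2) by blast
qed

text \<open>Joined with the equations of the variety, \<open>\<phi>\<close> becomes a map whose
  differential at \<open>z\<close> has no kernel. It is injective nearby, and on the variety the
  added components are 0.\<close>

lemma locally_injective_on_variety:
  fixes z :: "complex ^ 'm::finite" and \<phi> :: "complex ^ 'm \<Rightarrow> real ^ 'm"
  assumes F: "\<And>k. F k \<in> polyf UNIV" and S: "open S" "z \<in> S" "S \<subseteq> torus" and c: "bounded_linear c"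
    and der: "\<And>w. w \<in> S \<Longrightarrow> (\<phi> has_derivative (\<lambda>u. \<chi> i. c (u $ i / w $ i))) (at w)"
    and ker: "\<And>u. dchart J F z u \<in> Lsub J \<Longrightarrow> (\<chi> i. c (u $ i / z $ i)) = 0 \<Longrightarrow> u = 0"
  obtains r where "r > 0" "ball z r \<subseteq> S" "inj_on \<phi> (ball z r \<inter> {w. \<forall>k. k \<notin> J \<longrightarrow> F k (vec_nth w) = 0})"
proof -
  define \<rho> where "\<rho> y = (\<chi> k. if k \<in> J then 0 else y $ k)" for y :: "complex ^ 'm"
  have lin: "bounded_linear \<rho>" unfolding linear_conv_bounded_linear[symmetric]
    by (rule linearI) (auto simp: \<rho>_def vec_eq_iff)
  define G where "G w = (\<phi> w, \<rho> (chart J F w))" for w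
  obtain r where r: "r > 0" "ball z r \<subseteq> S" "inj_on G (ball z r)"
  proof (rule locally_injective_C1[OF S(1,2)])
    show "(G has_derivative (\<lambda>u. ((\<chi> i. c (u $ i / w $ i)), \<rho> (dchart J F w u)))) (at w)" if "w \<in> S" for w
      unfolding G_def
      by (intro has_derivative_Pair der that bounded_linear.has_derivative[OF lin] chart_has_derivative F)
    show "continuous_on S (\<lambda>w. ((\<chi> i. c (u $ i / w $ i)), \<rho> (dchart J F w u)))" for u
    proof (intro continuous_on_Pair continuous_on_vec_lambda)
      show "continuous_on S (\<lambda>w. \<rho> (dchart J F w u))"
        by (rule bounded_linear.continuous_on[OF lin dchart_continuous[OF F]])
      show "continuous_on S (\<lambda>w. c (u $ i / w $ i))" for i
        by (rule bounded_linear.continuous_on[OF c]) (use S(3) in \<open>auto intro!: continuous_intros simp: torus_def\<close>)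
    qed
    show "u = 0" if u: "((\<chi> i. c (u $ i / z $ i)), \<rho> (dchart J F z u)) = 0" for u
    proof (rule ker)
      show "(\<chi> i. c (u $ i / z $ i)) = 0" using u by (simp add: zero_prod_def)
      have \<rho>0: "\<rho> (dchart J F z u) $ k = 0" for k using u by (simp add: zero_prod_def)
      have "dchart J F z u $ k = 0" if "k \<notin> J" for k using \<rho>0[of k] that by (simp add: \<rho>_def)
      then show "dchart J F z u \<in> Lsub J" by (simp add: Lsub_def)
    qed
  qed
  have "inj_on \<phi> (ball z r \<inter> {w. \<forall>k. k \<notin> J \<longrightarrow> F k (vec_nth w) = 0})"
  proof (rule inj_onI)
    fix x y assume x: "x \<in> ball z r \<inter> {w. \<forall>k. k \<notin> J \<longrightarrow> F k (vec_nth w) = 0}"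
      and y: "y \<in> ball z r \<inter> {w. \<forall>k. k \<notin> J \<longrightarrow> F k (vec_nth w) = 0}" and eq: "\<phi> x = \<phi> y"
    have "\<rho> (chart J F w) = 0" if "\<forall>k. k \<notin> J \<longrightarrow> F k (vec_nth w) = 0" for w
      using that by (simp add: \<rho>_def chart_def vec_eq_iff)
    then have "G x = G y" using x y eq by (simp add: G_def)
    then show "x = y" using inj_onD[OF r(3)] x y by blast
  qed
  with r(1,2) show thesis by (rule that)
qed

text \<open>\<open>h\<close> inverts the differential of \<open>Log_map\<close> on the tangent
  space, whose real dimension is \<open>2 * card J\<close>. \<open>I\<close> is multiplication by
  \<open>\<i>\<close> read in the coordinates given by \<open>h\<close>.\<close>

lemma immersed_parametrization:
  fixes z :: "complex ^ 'm::finite"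
  assumes J: "CARD('m) = 2 * card J" and et: "etale J F z" and onto: "log_onto J F z"
  obtains h :: "real ^ 'm \<Rightarrow> complex ^ 'm" and I where "linear h" "linear I"
    "\<And>x. h (I x) = \<i> *s h x" "\<And>x. I (I x) = - x" "inj h" "range (\<lambda>x. dchart J F z (h x)) = Lsub J"
    "\<And>u. dchart J F z u \<in> Lsub J \<Longrightarrow> (\<chi> i. Re (u $ i / z $ i)) = 0 \<Longrightarrow> u = 0"
proof -
  define K where "K = {u. dchart J F z u \<in> Lsub J}"
  define A where "A u = (\<chi> i. Re (u $ i / z $ i))" for u :: "complex ^ 'm"
  have lA: "linear A"
  proof (rule linearI)
    have "r *\<^sub>R x / y = r *\<^sub>R (x / y)" for r and x y :: complex by (simp add: scaleR_conv_of_real)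
    then show "A (r *\<^sub>R u) = r *\<^sub>R A u" for r u by (simp add: A_def vec_eq_iff)
  qed (simp add: A_def vec_eq_iff add_divide_distrib)
  have K: "subspace K"
    using subspace_Lsub[of J] unfolding K_def subspace_def
    by (simp add: linear_0[OF dchart_linear] linear_add[OF dchart_linear] linear_cmul[OF dchart_linear])
  have "A ` K = UNIV"
  proof -
    have "y \<in> A ` K" for y
    proof -
      obtain u where "dchart J F z u \<in> Lsub J" "A u = y" using onto unfolding log_onto_def A_def by meson
      then show ?thesis by (intro image_eqI[of _ _ u]) (auto simp: K_def)
    qed
    then show ?thesis by blast
  qed
  then obtain h where h: "range h \<subseteq> K" "linear h" "\<And>y. A (h y) = y"
    using linear_exists_right_inverse_on[OF lA K] by auto
  have inj: "inj h" using h(3) by (metis injI)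
  have dinj: "inj (dchart J F z)" using et by (simp add: etale_def linear_injective_0[OF dchart_linear])
  have l: "linear (\<lambda>x. dchart J F z (h x))" using linear_compose[OF h(2) dchart_linear] by (simp add: o_def)
  have linj: "inj (\<lambda>x. dchart J F z (h x))" using inj dinj by (simp add: inj_def)
  have range: "range (\<lambda>x. dchart J F z (h x)) = Lsub J"
  proof (rule subspace_dim_equal)
    show "subspace (range (\<lambda>x. dchart J F z (h x)))" by (rule linear_subspace_image[OF l subspace_UNIV])
    show "range (\<lambda>x. dchart J F z (h x)) \<subseteq> Lsub J" using h(1) by (auto simp: K_def)
    have "dim (range (\<lambda>x. dchart J F z (h x))) = dim (UNIV :: (real ^ 'm) set)"
      by (rule dim_image_eq[OF l]) (use linj in simp)
    then show "dim (Lsub J) \<le> dim (range (\<lambda>x. dchart J F z (h x)))" using dim_Lsub[of J] J by simp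
  qed (rule subspace_Lsub)
  have hA: "h (A u) = u" if u: "u \<in> K" for u
  proof -
    have "dchart J F z u \<in> range (\<lambda>x. dchart J F z (h x))" using u unfolding range by (simp add: K_def)
    then obtain x where "dchart J F z u = dchart J F z (h x)" by blast
    then have "u = h x" by (rule injD[OF dinj])
    then show ?thesis by (simp add: h(3))
  qed
  have Ki: "\<i> *s u \<in> K" if "u \<in> K" for u
    using that by (simp add: K_def dchart_scale Lsub_def)
  define I where "I x = A (\<i> *s h x)" for x
  have hI: "h (I x) = \<i> *s h x" for x unfolding I_def by (rule hA, rule Ki) (use h(1) in blast)
  show thesis
  proof (rule that[OF h(2) _ hI _ inj range])
    have si: "\<i> *s (r *\<^sub>R u) = r *\<^sub>R (\<i> *s u)" for r and u :: "complex ^ 'm" by (simp add: vec_eq_iff)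
    show "linear I" unfolding I_def
      by (rule linearI) (simp_all add: linear_add[OF h(2)] linear_cmul[OF h(2)] vector_add_ldistrib
          linear_add[OF lA] linear_cmul[OF lA, symmetric] si)
    show "I (I x) = - x" for x
    proof -
      have "I (I x) = A (- h x)" unfolding I_def[of "I x"] hI by (simp add: vector_smult_assoc)
      then show ?thesis by (simp add: linear_neg[OF lA] h(3))
    qed
    show "u = 0" if "dchart J F z u \<in> Lsub J" "(\<chi> i. Re (u $ i / z $ i)) = 0" for u
      using hA[of u] that linear_0[OF h(2)] by (simp add: K_def A_def)
  qed
qed

text \<open>Near an immersed point \<open>Log\<close> and a branch of \<open>Arg\<close> are the real and imaginary parts of one
  holomorphic immersion, and so their Jacobians in a chart of \<open>V\<close> agree up to sign.\<close>

lemma log_arg_same_measure: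
  fixes V :: "(complex ^ 'm::finite) set"
  assumes V: "V \<subseteq> torus" and im: "immersed V n z" and n: "CARD('m) = 2 * n"
  shows "\<exists>U a. open U \<and> z \<in> U \<and> U \<subseteq> torus \<and> (\<forall>w\<in>U. mod_pi (a w) = Arg_pi_map w) \<and> continuous_on U a \<and>
    inj_on Log_map (V \<inter> U) \<and> inj_on a (V \<inter> U) \<and>
    (\<forall>P\<in>sets borel. P \<subseteq> V \<inter> U \<longrightarrow> Log_map ` P \<in> sets lebesgue \<and> a ` P \<in> sets lebesgue \<and>
       emeasure lebesgue (Log_map ` P) = emeasure lebesgue (a ` P))"
proof -
  obtain J F U0 where J: "card J = n" and et: "etale J F z" and U0: "open U0" "z \<in> U0"
    "V \<inter> U0 = {w \<in> U0. \<forall>k. k \<notin> J \<longrightarrow> F k (vec_nth w) = 0}" and onto: "log_onto J F z" and zV: "z \<in> V"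
    using im unfolding immersed_def by blast
  have F: "\<And>k. F k \<in> polyf UNIV" using et by (simp add: etale_def)
  have zT: "z \<in> torus" using zV V by blast
  have n': "CARD('m) = 2 * card J" using n J by simp
  obtain h :: "real ^ 'm \<Rightarrow> complex ^ 'm" and I where h: "linear h" and I: "linear I"
    and hI: "\<And>x. h (I x) = \<i> *s h x" and II: "\<And>x. I (I x) = - x" and hinj: "inj h"
    and range: "range (\<lambda>x. dchart J F z (h x)) = Lsub J"
    and ker: "\<And>u. dchart J F z u \<in> Lsub J \<Longrightarrow> (\<chi> i. Re (u $ i / z $ i)) = 0 \<Longrightarrow> u = 0"
    by (rule immersed_parametrization[OF n' et onto]) (rule that)
  define \<theta> where "\<theta> = (\<chi> i. Arg (z $ i))"
  have \<theta>: "Arg_pi_map z = mod_pi \<theta>" by (simp add: \<theta>_def Arg_pi_map_def mod_pi_def arg_pi_def)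
  define a where "a = arg_lift z \<theta>"
  have da: "(a has_derivative (\<lambda>u. \<chi> i. Im (u $ i / w $ i))) (at w)" if "w \<in> slit z" for w
    unfolding a_def by (rule arg_lift_has_derivative[OF zT that])
  have dL: "(Log_map has_derivative (\<lambda>u. \<chi> i. Re (u $ i / w $ i))) (at w)" if "w \<in> slit z" for w
    by (rule Log_map_has_derivative) (use that slit_torus in blast)
  have zs: "z \<in> slit z" by (rule slit_self[OF zT])
  obtain r1 where r1: "r1 > 0" "ball z r1 \<subseteq> slit z"
    "inj_on Log_map (ball z r1 \<inter> {w. \<forall>k. k \<notin> J \<longrightarrow> F k (vec_nth w) = 0})"
    by (rule locally_injective_on_variety[OF F open_slit zs slit_torus bounded_linear_Re dL ker])
  \<comment> \<open>Multiplication by \<open>\<i>\<close> preserves the tangent space and reduces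
    imaginary parts to real parts.\<close>
  have ker': "u = 0" if u: "dchart J F z u \<in> Lsub J" "(\<chi> i. Im (u $ i / z $ i)) = 0" for u
  proof -
    have "dchart J F z (\<i> *s u) \<in> Lsub J" using u(1) by (simp add: dchart_scale Lsub_def)
    moreover have "(\<chi> i. Re ((\<i> *s u) $ i / z $ i)) = 0"
      using u(2) by (simp add: vec_eq_iff flip: times_divide_eq_right)
    ultimately have "\<i> *s u = 0" by (rule ker)
    then show ?thesis by (simp add: vec_eq_iff)
  qed
  obtain r2 where r2: "r2 > 0" "ball z r2 \<subseteq> slit z"
    "inj_on a (ball z r2 \<inter> {w. \<forall>k. k \<notin> J \<longrightarrow> F k (vec_nth w) = 0})"
    by (rule locally_injective_on_variety[OF F open_slit zs slit_torus bounded_linear_Im da ker'])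
  have ca: "continuous_on (slit z) a" and cL: "continuous_on (slit z) Log_map"
    using has_derivative_continuous_on[OF has_derivative_at_withinI[OF da]]
      has_derivative_continuous_on[OF has_derivative_at_withinI[OF dL]] by blast+
  \<comment> \<open>The unit balls keep the images under \<open>Log_map\<close> and \<open>a\<close>
    bounded, as \<open>equal_measure_images\<close> requires.\<close>
  define N where "N = U0 \<inter> ball z r1 \<inter> ball z r2 \<inter> (slit z \<inter> a -` ball (a z) 1) \<inter> (slit z \<inter> Log_map -` ball (Log_map z) 1)"
  have N: "open N" "z \<in> N"
  proof -
    have o: "open (slit z \<inter> a -` ball (a z) 1)" "open (slit z \<inter> Log_map -` ball (Log_map z) 1)"
      by (intro continuous_open_preimage ca cL open_slit open_ball)+
    show "open N" unfolding N_def
      by (rule open_Int[OF open_Int[OF open_Int[OF open_Int[OF U0(1) open_ball] open_ball] o(1)] o(2)])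
    show "z \<in> N" unfolding N_def using U0(2) r1(1) r2(1) zs by simp
  qed
  obtain U W \<Psi> \<Psi>' where loc: "local_inverse J F U W \<Psi> \<Psi>'" and U: "z \<in> U" "U \<subseteq> N"
    by (rule etale_chart[OF et N])
  note L = local_inverseD[OF loc]
  have Us: "U \<subseteq> slit z" using U(2) by (auto simp: N_def)
  define \<l> where "\<l> x = dchart J F z (h x)" for x
  have l: "linear \<l>" unfolding \<l>_def using linear_compose[OF h dchart_linear] by (simp add: o_def)
  have bl: "bounded_linear \<l>" using l by (simp add: linear_conv_bounded_linear)
  have "inj (dchart J F z)" using et by (simp add: etale_def linear_injective_0[OF dchart_linear])
  then have linj: "inj \<l>" unfolding \<l>_def using hinj by (simp add: inj_def)
  have lI: "\<l> (I x) = \<i> *s \<l> x" for x by (simp add: \<l>_def hI dchart_scale)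
  define c where "c = chart J F z"
  have cL: "c \<in> Lsub J" unfolding c_def chart_in_Lsub using et by (simp add: etale_def)
  define T where "T = (\<lambda>y. c + \<l> y) -` W"
  define \<psi> where "\<psi> y = \<Psi> (c + \<l> y)" for y
  have T: "open T" unfolding T_def
    by (rule open_vimage[OF L(2)]) (intro continuous_intros bounded_linear.continuous_on[OF bl])
  define M where "M y x = \<Psi>' (c + \<l> y) (\<l> x)" for y x
  have d\<psi>: "(\<psi> has_derivative M y) (at y)" if y: "y \<in> T" for y
  proof -
    have "((\<lambda>y. c + \<l> y) has_derivative (\<lambda>x. 0 + \<l> x)) (at y)"
      by (intro has_derivative_add has_derivative_const bounded_linear_imp_has_derivative bl)
    from has_derivative_compose[OF this L(6)] y show ?thesis unfolding \<psi>_def M_def T_def by simp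
  qed
  \<comment> \<open>\<open>\<Psi>'\<close> inverts the complex linear map \<open>dchart\<close>, so
    it commutes with multiplication by \<open>\<i>\<close>.\<close>
  have MI: "M y (I x) = \<i> *s M y x" if y: "y \<in> T" for y x
  proof -
    have y: "c + \<l> y \<in> W" using y by (simp add: T_def)
    have "\<i> *s \<l> x = dchart J F (\<Psi> (c + \<l> y)) (\<i> *s M y x)"
      unfolding M_def dchart_scale L(7)[OF y] ..
    then show ?thesis unfolding M_def lI by (simp add: L(8)[OF y])
  qed
  have \<psi>U: "\<psi> y \<in> V \<inter> U" if y: "y \<in> T" for y
  proof -
    have y: "c + \<l> y \<in> W" using y by (simp add: T_def)
    have 1: "\<psi> y \<in> U" unfolding \<psi>_def using L(5)[OF y] by blast
    have "\<l> y \<in> Lsub J" using range unfolding \<l>_def by blast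
    then have "c + \<l> y \<in> Lsub J" using subspace_add[OF subspace_Lsub cL] by blast
    then have "chart J F (\<psi> y) \<in> Lsub J" unfolding \<psi>_def using L(5)[OF y] by simp
    then have "\<forall>k. k \<notin> J \<longrightarrow> F k (vec_nth (\<psi> y)) = 0" unfolding chart_in_Lsub .
    moreover have "\<psi> y \<in> U0" using 1 U(2) by (auto simp: N_def)
    ultimately have "\<psi> y \<in> V \<inter> U0" unfolding U0(3) by blast
    then show ?thesis using 1 by blast
  qed
  have onT: "\<exists>y\<in>T. \<psi> y = w" if w: "w \<in> V \<inter> U" for w
  proof -
    have "w \<in> V \<inter> U0" using w U(2) by (auto simp: N_def)
    then have "chart J F w \<in> Lsub J" unfolding U0(3) chart_in_Lsub by blast
    then have "chart J F w - c \<in> range \<l>" using subspace_diff[OF subspace_Lsub _ cL] range unfolding \<l>_def by blast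
    then obtain y where "chart J F w - c = \<l> y" by blast
    then have y: "chart J F w = c + \<l> y" by (simp add: algebra_simps)
    have "c + \<l> y \<in> W" unfolding y[symmetric] using w L(3) by blast
    moreover have "\<psi> y = w" unfolding \<psi>_def y[symmetric] using L(4) w by blast
    ultimately show ?thesis unfolding T_def by blast
  qed
  have \<psi>inj: "inj_on \<psi> T"
  proof (rule inj_onI)
    fix x y assume xy: "x \<in> T" "y \<in> T" "\<psi> x = \<psi> y"
    have "chart J F (\<psi> x) = c + \<l> x" "chart J F (\<psi> y) = c + \<l> y"
      using xy(1,2) L(5) by (simp_all add: \<psi>_def T_def)
    then have "\<l> x = \<l> y" using xy(3) by simp
    then show "x = y" by (rule injD[OF linj])
  qed
  have V0: "V \<inter> U \<subseteq> ball z r1 \<inter> {w. \<forall>k. k \<notin> J \<longrightarrow> F k (vec_nth w) = 0}"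
    "V \<inter> U \<subseteq> ball z r2 \<inter> {w. \<forall>k. k \<notin> J \<longrightarrow> F k (vec_nth w) = 0}"
  proof -
    have "V \<inter> U \<subseteq> V \<inter> U0" using U(2) by (auto simp: N_def)
    then have "V \<inter> U \<subseteq> {w. \<forall>k. k \<notin> J \<longrightarrow> F k (vec_nth w) = 0}" unfolding U0(3) by blast
    moreover have "U \<subseteq> ball z r1 \<inter> ball z r2" using U(2) by (auto simp: N_def)
    ultimately show "V \<inter> U \<subseteq> ball z r1 \<inter> {w. \<forall>k. k \<notin> J \<longrightarrow> F k (vec_nth w) = 0}"
      "V \<inter> U \<subseteq> ball z r2 \<inter> {w. \<forall>k. k \<notin> J \<longrightarrow> F k (vec_nth w) = 0}" by blast+
  qed
  have iL: "inj_on Log_map (V \<inter> U)" by (rule inj_on_subset[OF r1(3) V0(1)])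
  have ia: "inj_on a (V \<inter> U)" by (rule inj_on_subset[OF r2(3) V0(2)])
  have same: "Log_map ` P \<in> sets lebesgue \<and> a ` P \<in> sets lebesgue \<and>
       emeasure lebesgue (Log_map ` P) = emeasure lebesgue (a ` P)" if P: "P \<in> sets borel" "P \<subseteq> V \<inter> U" for P
  proof -
    define S where "S = \<psi> -` P \<inter> T"
    have cont: "continuous_on T \<psi>" using has_derivative_continuous_on[OF has_derivative_at_withinI[OF d\<psi>]] .
    have SB: "S \<in> sets borel"
    proof -
      have "S \<in> sets (restrict_space borel T)"
        using measurable_sets[OF borel_measurable_continuous_on_restrict[OF cont] P(1)]
        by (simp add: S_def space_restrict_space)
      then show ?thesis using T by (simp add: sets_restrict_space_iff)
    qed
    have ST: "S \<subseteq> T" by (auto simp: S_def)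
    have \<psi>S: "\<psi> ` S = P"
    proof
      show "\<psi> ` S \<subseteq> P" by (auto simp: S_def)
      show "P \<subseteq> \<psi> ` S"
      proof
        fix w assume w: "w \<in> P"
        then obtain y where "y \<in> T" "\<psi> y = w" using onT P(2) by blast
        then show "w \<in> \<psi> ` S" using w by (intro image_eqI[of _ _ y]) (auto simp: S_def)
      qed
    qed
    have im: "(\<lambda>y. Log_map (\<psi> y)) ` S = Log_map ` P" "(\<lambda>y. a (\<psi> y)) ` S = a ` P"
      unfolding \<psi>S[symmetric] by (simp_all add: image_image)
    have sl: "\<psi> y \<in> slit z" if "y \<in> S" for y using \<psi>U[of y] that ST Us by blast
    have "(\<lambda>y. Log_map (\<psi> y)) ` S \<in> sets lebesgue \<and> (\<lambda>y. a (\<psi> y)) ` S \<in> sets lebesgue \<and>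
      emeasure lebesgue ((\<lambda>y. Log_map (\<psi> y)) ` S) = emeasure lebesgue ((\<lambda>y. a (\<psi> y)) ` S)"
    proof (rule equal_measure_images[OF SB _ _ _ _ I II])
      have i: "inj_on \<psi> S" by (rule inj_on_subset[OF \<psi>inj ST])
      have sub: "\<psi> ` S \<subseteq> V \<inter> U" using \<psi>U ST by blast
      show "inj_on (\<lambda>y. Log_map (\<psi> y)) S" "inj_on (\<lambda>y. a (\<psi> y)) S"
        using comp_inj_on[OF i inj_on_subset[OF iL sub]] comp_inj_on[OF i inj_on_subset[OF ia sub]]
        by (simp_all add: o_def)
      show "((\<lambda>y. Log_map (\<psi> y)) has_derivative (\<lambda>x. \<chi> i. Re (M y x $ i / \<psi> y $ i))) (at y)" if "y \<in> S" for y
        by (rule has_derivative_compose[OF d\<psi> dL[OF sl[OF that]]]) (use that ST in blast)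
      show "((\<lambda>y. a (\<psi> y)) has_derivative (\<lambda>x. \<chi> i. Im (M y x $ i / \<psi> y $ i))) (at y)" if "y \<in> S" for y
        by (rule has_derivative_compose[OF d\<psi> da[OF sl[OF that]]]) (use that ST in blast)
      \<comment> \<open>The imaginary part of a number is minus the real part of its product with
        \<open>\<i>\<close>.\<close>
      show "(\<chi> i. Im (M y x $ i / \<psi> y $ i)) = - (\<chi> i. Re (M y (I x) $ i / \<psi> y $ i))" if "y \<in> S" for y x
        using MI[OF subsetD[OF ST that]] by (simp add: vec_eq_iff flip: times_divide_eq_right)
      have b: "Log_map ` P \<subseteq> ball (Log_map z) 1" "a ` P \<subseteq> ball (a z) 1"
        using P(2) U(2) by (auto simp: N_def)
      show "bounded ((\<lambda>y. Log_map (\<psi> y)) ` S)" "bounded ((\<lambda>y. a (\<psi> y)) ` S)"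
        unfolding im using bounded_subset[OF bounded_ball b(1)] bounded_subset[OF bounded_ball b(2)] by blast+
    qed
    then show ?thesis unfolding im .
  qed
  show ?thesis
  proof (intro exI conjI ballI impI)
    show "open U" "z \<in> U" by (fact L(1), fact U(1))
    show "U \<subseteq> torus" using Us slit_torus by blast
    show "mod_pi (a w) = Arg_pi_map w" if "w \<in> U" for w
      unfolding a_def by (rule arg_lift_mod_pi[OF zT \<theta>]) (use that Us slit_torus in blast)
    show "continuous_on U a" by (rule continuous_on_subset[OF ca Us])
    show "inj_on Log_map (V \<inter> U)" "inj_on a (V \<inter> U)" by (fact iL, fact ia)
    fix P assume P: "P \<in> sets borel" "P \<subseteq> V \<inter> U"
    show "Log_map ` P \<in> sets lebesgue" "a ` P \<in> sets lebesgue"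
      "emeasure lebesgue (Log_map ` P) = emeasure lebesgue (a ` P)" using same[OF P] by blast+
  qed
qed

text \<open>The points not fixed by \<open>t\<close> come in pairs.\<close>

lemma card_involution_parity:
  assumes X: "finite X" and t: "\<And>x. x \<in> X \<Longrightarrow> t x \<in> X" "\<And>x. x \<in> X \<Longrightarrow> t (t x) = x"
  shows "even (card X) \<longleftrightarrow> even (card {x \<in> X. t x = x})"
proof -
  define Y where "Y = {x \<in> X. t x \<noteq> x}"
  define C where "C = (\<lambda>x. {x, t x}) ` Y"
  have Y: "finite Y" "\<And>x. x \<in> Y \<Longrightarrow> t x \<in> Y" using X t by (auto simp: Y_def)
  have UC: "\<Union>C = Y" using Y(2) by (auto simp: C_def)
  have "2 * card C = card (\<Union>C)"
  proof (rule card_partition)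
    show "finite C" "finite (\<Union>C)" unfolding UC using Y(1) by (auto simp: C_def)
    show "card c = 2" if "c \<in> C" for c using that by (auto simp: C_def Y_def card_2_iff)
    show "c1 \<inter> c2 = {}" if c: "c1 \<in> C" "c2 \<in> C" "c1 \<noteq> c2" for c1 c2
    proof -
      obtain x y where xy: "x \<in> Y" "c1 = {x, t x}" "y \<in> Y" "c2 = {y, t y}" using c unfolding C_def by blast
      have tt: "t (t x) = x" "t (t y) = y" using xy t(2) by (auto simp: Y_def)
      have orbit: "{a, t a} = {s, t s}" if "s \<in> {a, t a}" "t (t a) = a" for a s
        using that by (elim insertE emptyE) (simp_all add: insert_commute)
      have "c1 = c2" if "s \<in> c1" "s \<in> c2" for s
        using orbit[of s x] orbit[of s y] that tt unfolding xy by simp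
      then show ?thesis using c(3) by blast
    qed
  qed
  then have "even (card Y)" unfolding UC by (metis dvd_triv_left)
  moreover have "card X = card Y + card {x \<in> X. t x = x}"
  proof -
    have "X = Y \<union> {x \<in> X. t x = x}" by (auto simp: Y_def)
    then have "card X = card (Y \<union> {x \<in> X. t x = x})" by simp
    also have "\<dots> = card Y + card {x \<in> X. t x = x}" by (rule card_Un_disjoint) (use X in \<open>auto simp: Y_def\<close>)
    finally show ?thesis .
  qed
  ultimately show ?thesis by simp
qed

section \<open>Generic fibres and the covering bounds\<close>

lemma generic_Log_fibre:
  fixes V :: "(complex ^ 'm::finite) set"
  assumes V: "algebraic_variety V" "has_complex_dimension V n" and n: "n \<ge> 1" "CARD('m) = 2 * n"
  obtains N where "negligible N" "\<And>p. p \<notin> N \<Longrightarrow> finite {z \<in> V. Log_map z = p} \<and>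
      card {z \<in> V. Log_map z = p} \<le> conj'_degree V \<and>
      (even (card {z \<in> V. Log_map z = p}) \<longleftrightarrow> even (conj'_degree V)) \<and>
      (\<forall>z\<in>V. Log_map z = p \<longrightarrow> immersed V n z)"
proof -
  have VT: "V \<subseteq> torus" using V(1) by (auto simp: algebraic_variety_def)
  obtain Q a where Q: "Q \<in> polyf UNIV" "Q a \<noteq> 0"
    "\<forall>e. Q (vec_nth e) \<noteq> 0 \<longrightarrow> e \<in> torus \<and> finite (V \<inter> translate e (conj'_map ` V)) \<and>
       card (V \<inter> translate e (conj'_map ` V)) = toric_intersection_number V (conj'_map ` V) \<and>
       (\<forall>z \<in> V \<inter> translate e (conj'_map ` V). (\<exists>J. card J = n \<and> etale_at V J z) \<and>
          spanning V (translate e (conj'_map ` V)) z)"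
    by (rule conj'.generic_self_intersection[OF V n])
  show thesis
  proof (rule that[of "{p :: real ^ 'm. Q (vec_nth (radial p)) = 0}"])
    show "negligible {p :: real ^ 'm. Q (vec_nth (radial p)) = 0}" by (rule generic_radial_negligible[OF Q(1,2)])
    fix p :: "real ^ 'm" assume "p \<notin> {p. Q (vec_nth (radial p)) = 0}"
    then have p: "Q (vec_nth (radial p)) \<noteq> 0" by simp
    define X where "X = V \<inter> translate (radial p) (conj'_map ` V)"
    define t where "t = conj'.twist (radial p)"
    have X: "finite X" "card X = conj'_degree V"
      and span: "\<And>z. z \<in> X \<Longrightarrow> (\<exists>J. card J = n \<and> etale_at V J z) \<and> spanning V (translate (radial p) (conj'_map ` V)) z"
      using Q(3)[rule_format, OF p] unfolding X_def conj'_degree_def by blast+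
    have tr: "translate (radial p) (conj'_map ` V) = t ` V" unfolding t_def by (rule conj'.translate_image)
    have tt: "t (t z) = z" if "z \<in> V" for z
      using subsetD[OF VT that]
      by (simp add: t_def conj'.twist_def conj'_map_def radial_def vec_eq_iff torus_def)
    have fib: "Log_map z = p \<longleftrightarrow> t z = z" if "z \<in> V" for z
      unfolding t_def by (rule Log_fixed[OF subsetD[OF VT that]])
    have FX: "{z \<in> V. Log_map z = p} = {z \<in> X. t z = z}"
    proof (intro set_eqI iffI)
      fix z assume z: "z \<in> {z \<in> V. Log_map z = p}"
      then have tz: "t z = z" using fib by blast
      moreover have "z \<in> V" using z by blast
      ultimately have "z \<in> t ` V" by (rule image_eqI[OF sym])
      then show "z \<in> {z \<in> X. t z = z}" using z tz by (simp add: X_def tr)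
    qed (use fib in \<open>auto simp: X_def\<close>)
    have par: "even (card X) \<longleftrightarrow> even (card {z \<in> X. t z = z})"
    proof (rule card_involution_parity[OF X(1)])
      fix z assume z: "z \<in> X"
      then obtain x where x: "x \<in> V" "z = t x" unfolding X_def tr by blast
      have "x = t z" "z \<in> V" using z x tt[OF x(1)] by (simp_all add: X_def)
      then have "x \<in> t ` V" by (rule image_eqI)
      then show "t z \<in> X" using x tt[OF x(1)] by (simp add: X_def tr)
      show "t (t z) = z" using z tt by (simp add: X_def)
    qed
    have im: "immersed V n z" if "z \<in> V" "Log_map z = p" for z
    proof -
      have z: "z \<in> X" using FX that by blast
      then obtain J where "etale_at V J z" "card J = n" using span by blast
      then show ?thesis using span[OF z] immersedI[OF VT _ _ that(2)] by blast
    qed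
    have le: "card {z \<in> V. Log_map z = p} \<le> conj'_degree V"
      unfolding FX X(2)[symmetric] by (rule card_mono[OF X(1)]) auto
    have fin: "finite {z \<in> V. Log_map z = p}" unfolding FX using X(1) by simp
    show "finite {z \<in> V. Log_map z = p} \<and> card {z \<in> V. Log_map z = p} \<le> conj'_degree V \<and>
      (even (card {z \<in> V. Log_map z = p}) \<longleftrightarrow> even (conj'_degree V)) \<and>
      (\<forall>z\<in>V. Log_map z = p \<longrightarrow> immersed V n z)"
      using le fin im par unfolding FX X(2) by blast
  qed
qed

lemma generic_Arg_fibre:
  fixes V :: "(complex ^ 'm::finite) set"
  assumes V: "algebraic_variety V" "has_complex_dimension V n" and n: "n \<ge> 1" "CARD('m) = 2 * n"
  obtains N :: "(real ^ 'm) set" where "negligible N" "\<And>\<theta>. \<theta> \<notin> N \<Longrightarrow> finite {z \<in> V. Arg_pi_map z = mod_pi \<theta>} \<and>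
      card {z \<in> V. Arg_pi_map z = mod_pi \<theta>} \<le> conj_degree V"
proof -
  have VT: "V \<subseteq> torus" using V(1) by (auto simp: algebraic_variety_def)
  obtain Q a where Q: "Q \<in> polyf UNIV" "Q a \<noteq> 0"
    "\<forall>e. Q (vec_nth e) \<noteq> 0 \<longrightarrow> e \<in> torus \<and> finite (V \<inter> translate e (conj_map ` V)) \<and>
       card (V \<inter> translate e (conj_map ` V)) = toric_intersection_number V (conj_map ` V) \<and>
       (\<forall>z \<in> V \<inter> translate e (conj_map ` V). (\<exists>J. card J = n \<and> etale_at V J z) \<and>
          spanning V (translate e (conj_map ` V)) z)"
    by (rule conj.generic_self_intersection[OF V n])
  show thesis
  proof (rule that[of "{\<theta> :: real ^ 'm. Q (vec_nth (angular \<theta>)) = 0}"])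
    show "negligible {\<theta> :: real ^ 'm. Q (vec_nth (angular \<theta>)) = 0}" by (rule generic_angular_negligible[OF Q(1,2)])
    fix \<theta> :: "real ^ 'm" assume "\<theta> \<notin> {\<theta>. Q (vec_nth (angular \<theta>)) = 0}"
    then have \<theta>: "Q (vec_nth (angular \<theta>)) \<noteq> 0" by simp
    define X where "X = V \<inter> translate (angular \<theta>) (conj_map ` V)"
    have X: "finite X" "card X = conj_degree V"
      using Q(3)[rule_format, OF \<theta>] unfolding X_def conj_degree_def by blast+
    have "{z \<in> V. Arg_pi_map z = mod_pi \<theta>} \<subseteq> X"
    proof
      fix z assume z: "z \<in> {z \<in> V. Arg_pi_map z = mod_pi \<theta>}"
      then have "conj.twist (angular \<theta>) z = z" using Arg_fixed VT by blast
      moreover have "z \<in> V" using z by blast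
      ultimately have "z \<in> conj.twist (angular \<theta>) ` V" by (rule image_eqI[OF sym])
      then show "z \<in> X" using z by (simp add: X_def conj.translate_image)
    qed
    from finite_subset[OF this X(1)] card_mono[OF X(1) this]
    show "finite {z \<in> V. Arg_pi_map z = mod_pi \<theta>} \<and> card {z \<in> V. Arg_pi_map z = mod_pi \<theta>} \<le> conj_degree V"
      unfolding X(2) by (rule conjI)
  qed
qed

lemma surj_mod_pi: "surj (mod_pi :: real ^ 'm \<Rightarrow> real_mod_pi ^ 'm)"
proof (rule surjI)
  fix y :: "real_mod_pi ^ 'm"
  show "mod_pi (\<chi> i. rep_real_mod_pi (y $ i)) = y"
    by (simp add: mod_pi_def vec_eq_iff Quotient_abs_rep[OF Quotient_real_mod_pi])
qed

lemma Log_covers: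
  fixes V :: "(complex ^ 'm::finite) set"
  assumes V: "algebraic_variety V" "has_complex_dimension V n" and n: "n \<ge> 1" "CARD('m) = 2 * n"
    and S: "stratification \<S> V"
  shows "covers_at_most (id :: real ^ 'm \<Rightarrow> real ^ 'm) \<S> V Log_map (conj'_degree V)"
proof -
  have VT: "V \<subseteq> torus" using V(1) by (auto simp: algebraic_variety_def)
  obtain N :: "(real ^ 'm) set" where N: "negligible N" "\<And>p. p \<notin> N \<Longrightarrow> finite {z \<in> V. Log_map z = p} \<and>
      card {z \<in> V. Log_map z = p} \<le> conj'_degree V \<and>
      (even (card {z \<in> V. Log_map z = p}) \<longleftrightarrow> even (conj'_degree V)) \<and>
      (\<forall>z\<in>V. Log_map z = p \<longrightarrow> immersed V n z)"
    by (rule generic_Log_fibre[OF V n]) (rule that)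
  show ?thesis
  proof (rule covering_bound[OF S surj_id _ N(1)])
    fix z \<theta> assume z: "z \<in> V" "Log_map z = id \<theta>"
    show "\<exists>g N D. g z = \<theta> \<and> (\<forall>w\<in>V. id (g w) = Log_map w) \<and>
       open N \<and> z \<in> N \<and> continuous_on N g \<and> (g has_derivative D) (at z)"
    proof (intro exI conjI)
      show "Log_map z = \<theta>" "\<forall>w\<in>V. id (Log_map w) = Log_map w" using z by simp_all
      show "open (torus :: (complex ^ 'm) set)" by (rule open_torus)
      show zT: "z \<in> torus" using z VT by blast
      show "continuous_on (torus :: (complex ^ 'm) set) Log_map"
        by (rule has_derivative_continuous_on[OF has_derivative_at_withinI[OF Log_map_has_derivative]])
      show "(Log_map has_derivative (\<lambda>u. \<chi> i. Re (u $ i / z $ i))) (at z)" by (rule Log_map_has_derivative[OF zT])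
    qed
  next
    fix p assume "p \<notin> N"
    from N(2)[OF this] show "finite {z \<in> V. Log_map z = id p} \<and> card {z \<in> V. Log_map z = id p} \<le> conj'_degree V"
      by simp
  qed
qed

lemma Arg_covers:
  fixes V :: "(complex ^ 'm::finite) set"
  assumes V: "algebraic_variety V" "has_complex_dimension V n" and n: "n \<ge> 1" "CARD('m) = 2 * n"
    and S: "stratification \<S> V"
  shows "covers_at_most (mod_pi :: real ^ 'm \<Rightarrow> real_mod_pi ^ 'm) \<S> V Arg_pi_map (conj_degree V)"
proof -
  have VT: "V \<subseteq> torus" using V(1) by (auto simp: algebraic_variety_def)
  obtain N :: "(real ^ 'm) set" where N: "negligible N" "\<And>\<theta>. \<theta> \<notin> N \<Longrightarrow> finite {z \<in> V. Arg_pi_map z = mod_pi \<theta>} \<and>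
      card {z \<in> V. Arg_pi_map z = mod_pi \<theta>} \<le> conj_degree V"
    by (rule generic_Arg_fibre[OF V n]) (rule that)
  show ?thesis
  proof (rule covering_bound[OF S surj_mod_pi _ N])
    fix z \<theta> assume z: "z \<in> V" "Arg_pi_map z = mod_pi \<theta>"
    have zT: "z \<in> torus" using z VT by blast
    show "\<exists>g N D. g z = \<theta> \<and> (\<forall>w\<in>V. mod_pi (g w) = Arg_pi_map w) \<and>
       open N \<and> z \<in> N \<and> continuous_on N g \<and> (g has_derivative D) (at z)"
    proof (rule exI[of _ "arg_lift z \<theta>"], rule exI[of _ "slit z"], rule exI, intro conjI)
      show "arg_lift z \<theta> z = \<theta>" using zT by (simp add: arg_lift_def logs_def torus_def vec_eq_iff)
      show "\<forall>w\<in>V. mod_pi (arg_lift z \<theta> w) = Arg_pi_map w" using arg_lift_mod_pi[OF zT z(2)] VT by blast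
      show "open (slit z)" by (rule open_slit)
      show zs: "z \<in> slit z" by (rule slit_self[OF zT])
      show "continuous_on (slit z) (arg_lift z \<theta>)"
        by (rule has_derivative_continuous_on[OF has_derivative_at_withinI[OF arg_lift_has_derivative[OF zT]]])
      show "(arg_lift z \<theta> has_derivative (\<lambda>u. \<chi> i. Im (u $ i / z $ i))) (at z)"
        by (rule arg_lift_has_derivative[OF zT zs])
    qed
  qed
qed

section \<open>Volume of the amoeba\<close>

text \<open>Makes \<open>V\<close> and its amoeba sigma-compact, hence Borel.\<close>

lemma variety_compacts:
  fixes V :: "(complex ^ 'm::finite) set"
  assumes "algebraic_variety V"
  obtains C :: "nat \<Rightarrow> (complex ^ 'm) set" where "\<And>r. compact (C r)" "V = (\<Union>r. C r)"
proof -
  obtain \<P> where \<P>': "finite \<P> \<and> (\<forall>f\<in>\<P>. laurent_polynomial f) \<and> V = {z \<in> torus. \<forall>f\<in>\<P>. f z = 0}"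
    using assms unfolding algebraic_variety_def ..
  note \<P> = \<P>'[THEN conjunct1] \<P>'[THEN conjunct2, THEN conjunct1]
    and V = \<P>'[THEN conjunct2, THEN conjunct2]
  \<comment> \<open>The lower bound on the moduli keeps \<open>K r\<close> inside the torus; both
    bounds relax as \<open>r\<close> grows and exhaust the torus.\<close>
  define K where "K r = cball 0 (real r) \<inter> {z :: complex ^ 'm. \<forall>i. 1 / (real r + 1) \<le> cmod (z $ i)}" for r
  have K: "compact (K r)" for r
    unfolding K_def by (intro compact_Int_closed compact_cball closed_Collect_all closed_Collect_le continuous_intros)
  have KT: "K r \<subseteq> torus" for r
  proof
    fix z assume "z \<in> K r"
    then have "1 / (real r + 1) \<le> cmod (z $ i)" for i by (simp add: K_def)
    moreover have "0 < 1 / (real r + 1)" by simp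
    ultimately have "0 < cmod (z $ i)" for i by (meson less_le_trans)
    then show "z \<in> torus" by (simp add: torus_def)
  qed
  have TK: "\<exists>r. z \<in> K r" if z: "z \<in> torus" for z
  proof -
    obtain r :: nat where r: "norm z + (\<Sum>i\<in>UNIV. 1 / cmod (z $ i)) \<le> real r" using real_arch_simple by blast
    have s: "1 / cmod (z $ i) \<le> (\<Sum>i\<in>UNIV. 1 / cmod (z $ i))" for i
      by (rule member_le_sum) auto
    have "0 \<le> (\<Sum>i\<in>UNIV. 1 / cmod (z $ i))" by (intro sum_nonneg) simp
    then have 1: "norm z \<le> real r" using r by linarith
    have "1 / (real r + 1) \<le> cmod (z $ i)" for i
    proof -
      have "1 / cmod (z $ i) \<le> real r + 1" using s[of i] r norm_ge_zero[of z] by linarith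
      moreover have "0 < cmod (z $ i)" using z by (simp add: torus_def)
      ultimately show ?thesis by (simp add: field_simps)
    qed
    with 1 show ?thesis by (auto simp: K_def)
  qed
  have cont: "continuous_on torus f" if f: "f \<in> \<P>" for f
  proof -
    obtain E :: "('m \<Rightarrow> int) set" and c where "f = (\<lambda>z. \<Sum>e\<in>E. c e * (\<Prod>i\<in>UNIV. z $ i powi e i))"
      using \<P>(2) f unfolding laurent_polynomial_def by blast
    moreover have "continuous_on torus (\<lambda>z :: complex ^ 'm. \<Sum>e\<in>E. c e * (\<Prod>i\<in>UNIV. z $ i powi e i))"
      by (intro continuous_intros) (auto simp: torus_def)
    ultimately show ?thesis by simp
  qed
  show thesis
  proof (rule that)
    show "compact (V \<inter> K r)" for r
    proof -
      have "closed (K r \<inter> f -` {0})" if "f \<in> \<P>" for f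
        by (rule continuous_closed_preimage[OF continuous_on_subset[OF cont[OF that] KT] compact_imp_closed[OF K] closed_singleton])
      then have "compact (K r \<inter> (\<Inter>f\<in>\<P>. K r \<inter> f -` {0}))"
        by (intro compact_Int_closed[OF K] closed_INT ballI)
      moreover have "V \<inter> K r = K r \<inter> (\<Inter>f\<in>\<P>. K r \<inter> f -` {0})" using KT[of r] by (auto simp: V)
      ultimately show ?thesis by simp
    qed
    show "V = (\<Union>r. V \<inter> K r)" using TK by (auto simp: V)
  qed
qed

definition log_arg_patch :: "(complex ^ 'm::finite) set \<Rightarrow> (complex ^ 'm) set \<Rightarrow> (complex ^ 'm \<Rightarrow> real ^ 'm) \<Rightarrow> bool" where
  "log_arg_patch V U a \<longleftrightarrow> open U \<and> (\<forall>w\<in>U. mod_pi (a w) = Arg_pi_map w) \<and> continuous_on U a \<and>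
    inj_on Log_map (V \<inter> U) \<and>
    (\<forall>P\<in>sets borel. P \<subseteq> V \<inter> U \<longrightarrow> Log_map ` P \<in> sets lebesgue \<and> a ` P \<in> sets lebesgue \<and>
       emeasure lebesgue (Log_map ` P) = emeasure lebesgue (a ` P))"

text \<open>By Lindelof's theorem countably many patches suffice; the empty patch serves if there
  are no immersed points.\<close>

lemma log_arg_patches:
  fixes V :: "(complex ^ 'm::finite) set"
  assumes V: "V \<subseteq> torus" and n: "CARD('m) = 2 * n"
  obtains U and a :: "nat \<Rightarrow> complex ^ 'm \<Rightarrow> real ^ 'm" where "\<And>j. log_arg_patch V (U j) (a j)"
    "{z. immersed V n z} \<subseteq> (\<Union>j. U j)"
proof (cases "{z. immersed V n z} = {}")
  case True
  have "log_arg_patch V {} (\<lambda>_. 0)" by (auto simp: log_arg_patch_def)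
  then show thesis by (rule that[of "\<lambda>_. {}" "\<lambda>_ _. 0"]) (simp add: True)
next
  case False
  have "\<forall>z. immersed V n z \<longrightarrow> (\<exists>U a. z \<in> U \<and> log_arg_patch V U a)"
    unfolding log_arg_patch_def using log_arg_same_measure[OF V _ n] by meson
  then obtain U a where Ua: "\<And>z. immersed V n z \<Longrightarrow> z \<in> U z \<and> log_arg_patch V (U z) (a z)" by metis
  have op: "\<And>S. S \<in> U ` {z. immersed V n z} \<Longrightarrow> open S" using Ua by (auto simp: log_arg_patch_def)
  obtain \<F> where \<F>: "\<F> \<subseteq> U ` {z. immersed V n z}" "countable \<F>" "\<Union>\<F> = \<Union>(U ` {z. immersed V n z})"
    by (rule Lindelof[OF op])
  obtain D where D: "countable D" "D \<subseteq> {z. immersed V n z}" "\<F> = U ` D"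
    using \<F>(1,2) by (meson countable_subset_image)
  have cov: "{z. immersed V n z} \<subseteq> (\<Union>z\<in>D. U z)"
  proof -
    have "{z. immersed V n z} \<subseteq> \<Union>(U ` {z. immersed V n z})" using Ua by blast
    then show ?thesis unfolding \<F>(3)[symmetric] D(3) .
  qed
  then have D0: "D \<noteq> {}" using False by auto
  show thesis
  proof (rule that)
    have "from_nat_into D j \<in> D" for j by (rule from_nat_into[OF D0])
    then show "log_arg_patch V (U (from_nat_into D j)) (a (from_nat_into D j))" for j using Ua D(2) by blast
    show "{z. immersed V n z} \<subseteq> (\<Union>j. U (from_nat_into D j))"
      using cov range_from_nat_into[OF D0 D(1)] by (metis SUP_image image_comp image_image)
  qed
qed

section \<open>The period lattice and its fundamental cube\<close>

definition period_cell :: "real ^ 'm::finite \<Rightarrow> int ^ 'm" where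
  "period_cell x = (\<chi> i. \<lfloor>x $ i / pi\<rfloor>)"

definition period :: "int ^ 'm::finite \<Rightarrow> real ^ 'm" where
  "period k = (\<chi> i. of_int (k $ i) * pi)"

lemma period_cell_borel: "{x. period_cell x = k} \<in> sets borel"
proof -
  have "{x. period_cell x = k} = (\<Inter>i. {x. of_int (k $ i) \<le> x $ i / pi} \<inter> {x. x $ i / pi < of_int (k $ i) + 1})"
    by (auto simp: period_cell_def vec_eq_iff floor_eq_iff)
  also have "\<dots> \<in> sets borel"
  proof (intro sets.countable_INT'' sets.Int)
    show "{x :: real ^ 'a. of_int (k $ i) \<le> x $ i / pi} \<in> sets borel" for i
      by (intro borel_closed closed_Collect_le continuous_intros) auto
    show "{x :: real ^ 'a. x $ i / pi < of_int (k $ i) + 1} \<in> sets borel" for i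
      by (intro borel_open open_Collect_less continuous_intros) auto
  qed auto
  finally show ?thesis .
qed

lemma mod_pi_minus_period: "mod_pi (x - period k) = mod_pi x"
  unfolding mod_pi_def period_def vec_eq_iff
proof (simp, intro allI)
  fix i
  show "abs_real_mod_pi (x $ i - real_of_int (k $ i) * pi) = abs_real_mod_pi (x $ i)"
    by (subst real_mod_pi.abs_eq_iff) (rule exI[of _ "- (k $ i)"], simp)
qed

lemma minus_period_cell: "x - period (period_cell x) \<in> cbox 0 (\<chi> i. pi)"
proof -
  have "of_int \<lfloor>x $ i / pi\<rfloor> * pi \<le> x $ i" "x $ i \<le> of_int \<lfloor>x $ i / pi\<rfloor> * pi + pi" for i
  proof -
    have 1: "of_int \<lfloor>x $ i / pi\<rfloor> \<le> x $ i / pi" "x $ i / pi \<le> of_int \<lfloor>x $ i / pi\<rfloor> + 1" by linarith+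
    show "of_int \<lfloor>x $ i / pi\<rfloor> * pi \<le> x $ i" using 1(1) by (simp only: pos_le_divide_eq[OF pi_gt_zero])
    have "x $ i \<le> (of_int \<lfloor>x $ i / pi\<rfloor> + 1) * pi" using 1(2) by (simp only: pos_divide_le_eq[OF pi_gt_zero])
    then show "x $ i \<le> of_int \<lfloor>x $ i / pi\<rfloor> * pi + pi" by (simp add: ring_distribs)
  qed
  then show ?thesis by (simp add: mem_box_cart period_def period_cell_def algebra_simps)
qed

lemma lebesgue_minus:
  fixes S :: "'a::euclidean_space set"
  assumes "S \<in> sets lebesgue"
  shows "(\<lambda>x. x - c) ` S \<in> sets lebesgue" "emeasure lebesgue ((\<lambda>x. x - c) ` S) = emeasure lebesgue S"
proof -
  have im: "(\<lambda>x. x - c) ` S = (\<lambda>x. - c + x) ` S" by simp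
  show "(\<lambda>x. x - c) ` S \<in> sets lebesgue" unfolding im by (rule lebesgue_sets_translation[OF assms])
  show "emeasure lebesgue ((\<lambda>x. x - c) ` S) = emeasure lebesgue S"
    using emeasure_lebesgue_affine[of 1 "- c" S] by simp
qed

text \<open>Assign each point to the first patch containing it and sort by the period cell of its
  argument. Subtracting the period moves the branch into the fundamental cube without changing any
  measure.\<close>

lemma log_arg_pieces:
  fixes V :: "(complex ^ 'm::finite) set"
  assumes V: "V \<subseteq> torus" "V \<in> sets borel" and n: "CARD('m) = 2 * n"
  obtains P :: "nat \<times> (int ^ 'm) \<Rightarrow> (complex ^ 'm) set" and b where
    "\<And>i. P i \<subseteq> V" "\<And>i j. i \<noteq> j \<Longrightarrow> P i \<inter> P j = {}" "{z. immersed V n z} \<subseteq> (\<Union>i. P i)"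
    "\<And>i. inj_on Log_map (P i)" "\<And>i. Log_map ` P i \<in> sets lebesgue" "\<And>i. b i ` P i \<in> sets lebesgue"
    "\<And>i. emeasure lebesgue (Log_map ` P i) = emeasure lebesgue (b i ` P i)"
    "\<And>i z. z \<in> P i \<Longrightarrow> mod_pi (b i z) = Arg_pi_map z" "\<And>i. b i ` P i \<subseteq> cbox 0 (\<chi> i. pi)"
proof -
  obtain U and a :: "nat \<Rightarrow> complex ^ 'm \<Rightarrow> real ^ 'm"
    where patch: "\<And>j. log_arg_patch V (U j) (a j)" and cov: "{z. immersed V n z} \<subseteq> (\<Union>j. U j)"
    by (rule log_arg_patches[OF V(1) n]) (rule that)
  have U: "open (U j)" "continuous_on (U j) (a j)" "inj_on Log_map (V \<inter> U j)"
    "\<And>w. w \<in> U j \<Longrightarrow> mod_pi (a j w) = Arg_pi_map w" for j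
    using patch[of j] by (simp_all add: log_arg_patch_def)
  have same: "Log_map ` P \<in> sets lebesgue" "a j ` P \<in> sets lebesgue"
       "emeasure lebesgue (Log_map ` P) = emeasure lebesgue (a j ` P)"
    if "P \<in> sets borel" "P \<subseteq> V \<inter> U j" for P j
    using patch[of j] that unfolding log_arg_patch_def by blast+
  define P where "P = (\<lambda>(j, k). (V - (\<Union>l<j. U l)) \<inter> (a j -` {x. period_cell x = k} \<inter> U j))"
  define b where "b = (\<lambda>(j, k) z. a j z - period k)"
  have PB: "P (j, k) \<in> sets borel" for j k
  proof -
    have "a j -` {x. period_cell x = k} \<inter> U j \<in> sets (restrict_space borel (U j))"
      using measurable_sets[OF borel_measurable_continuous_on_restrict[OF U(2)] period_cell_borel]
      by (simp add: space_restrict_space)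
    then have "a j -` {x. period_cell x = k} \<inter> U j \<in> sets borel"
      using U(1) by (simp add: sets_restrict_space_iff)
    moreover have "(\<Union>l<j. U l) \<in> sets borel" using U(1) by (intro borel_open open_UN) auto
    ultimately show ?thesis unfolding P_def using V(2) by auto
  qed
  have PU: "P (j, k) \<subseteq> V \<inter> U j" for j k by (auto simp: P_def)
  have im: "b (j, k) ` P (j, k) = (\<lambda>x. x - period k) ` (a j ` P (j, k))" for j k
    by (simp add: b_def image_image)
  show thesis
  proof (rule that[of P b])
    show "P i \<subseteq> V" for i using PU by (cases i) blast
    show "P i \<inter> P j = {}" if "i \<noteq> j" for i j
    proof -
      obtain i1 i2 j1 j2 where ij: "i = (i1, i2)" "j = (j1, j2)" by (meson surj_pair)
      show ?thesis
      proof (cases "i1 = j1")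
        case True
        then show ?thesis using that by (auto simp: ij P_def)
      next
        case False
        then show ?thesis by (cases "i1 < j1") (auto simp: ij P_def)
      qed
    qed
    show "{z. immersed V n z} \<subseteq> (\<Union>i. P i)"
    proof
      fix z assume z: "z \<in> {z. immersed V n z}"
      then obtain j where j: "z \<in> U j" "\<forall>l<j. z \<notin> U l"
        using cov exists_least_iff[of "\<lambda>j. z \<in> U j"] by blast
      have "z \<in> V" using z by (simp add: immersed_def)
      then have "z \<in> P (j, period_cell (a j z))" using j by (simp add: P_def)
      then show "z \<in> (\<Union>i. P i)" by blast
    qed
    show "inj_on Log_map (P i)" for i by (cases i) (metis inj_on_subset[OF U(3) PU])
    show "Log_map ` P i \<in> sets lebesgue" for i by (cases i) (metis same(1)[OF PB PU])
    show "b i ` P i \<in> sets lebesgue" for i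
      by (cases i) (metis im lebesgue_minus(1)[OF same(2)[OF PB PU]])
    show "emeasure lebesgue (Log_map ` P i) = emeasure lebesgue (b i ` P i)" for i
      by (cases i) (metis im lebesgue_minus(2)[OF same(2)[OF PB PU]] same(3)[OF PB PU])
    show "mod_pi (b i z) = Arg_pi_map z" if "z \<in> P i" for i z
    proof (cases i)
      case (Pair j k)
      then show ?thesis using U(4)[of z j] that PU[of j k] by (simp add: b_def mod_pi_minus_period subset_iff)
    qed
    show "b i ` P i \<subseteq> cbox 0 (\<chi> i. pi)" for i
    proof (cases i)
      case (Pair j k)
      have "b i z \<in> cbox 0 (\<chi> i. pi)" if "z \<in> P i" for z
      proof -
        have "period_cell (a j z) = k" using that by (simp add: Pair P_def)
        then show ?thesis using minus_period_cell[of "a j z"] by (simp add: Pair b_def)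
      qed
      then show ?thesis by blast
    qed
  qed
qed

lemma nn_integral_count_indicator:
  "(\<integral>\<^sup>+i. indicator (A i) x \<partial>count_space UNIV) = emeasure (count_space UNIV) {i. x \<in> A i}"
proof -
  have "(\<lambda>i. indicator (A i) x :: ennreal) = indicator {i. x \<in> A i}" by (auto simp: indicator_def)
  then show ?thesis by simp
qed

lemma emeasure_cube: "emeasure lebesgue (cbox 0 (\<chi> i. pi) :: (real ^ 'm::finite) set) = ennreal (pi ^ CARD('m))"
proof -
  have "emeasure lborel (cbox 0 (\<chi> i. pi) :: (real ^ 'm) set) = (\<Prod>b\<in>Basis. ((\<chi> i. pi) - 0 :: real ^ 'm) \<bullet> b)"
    by (rule emeasure_lborel_cbox) (auto simp: Basis_vec_def inner_axis)
  also have "(\<Prod>b\<in>Basis. ((\<chi> i. pi) - 0 :: real ^ 'm) \<bullet> b) = (\<Prod>b\<in>(Basis :: (real ^ 'm) set). pi)"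
    by (rule prod.cong) (auto simp: Basis_vec_def inner_axis)
  finally show ?thesis by simp
qed

text \<open>Double counting: almost every point of the amoeba lies in the \<open>Log_map\<close>
  images of at least \<open>c\<close> pieces, and almost every point of the cube in the argument
  images of at most \<open>conj_degree V\<close> pieces. The constant \<open>c\<close> is first 1,
  to obtain finite volume, and then 2.\<close>

lemma Log_volume:
  fixes V :: "(complex ^ 'm::finite) set"
  assumes V: "algebraic_variety V" "has_complex_dimension V n" and n: "n \<ge> 1" "CARD('m) = 2 * n"
    and N: "negligible N" and imm: "\<And>z. z \<in> V \<Longrightarrow> Log_map z \<notin> N \<Longrightarrow> immersed V n z"
    and c: "\<And>p. p \<in> Log_map ` V \<Longrightarrow> p \<notin> N \<Longrightarrow> finite {z \<in> V. Log_map z = p} \<and> c \<le> card {z \<in> V. Log_map z = p}"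
  shows "Log_map ` V \<in> sets lebesgue \<and>
    of_nat c * emeasure lebesgue (Log_map ` V) \<le> of_nat (conj_degree V) * ennreal (pi ^ (2 * n))"
proof -
  have VT: "V \<subseteq> torus" using V(1) by (auto simp: algebraic_variety_def)
  obtain C :: "nat \<Rightarrow> (complex ^ 'm) set" where C: "\<And>r. compact (C r)" "V = (\<Union>r. C r)"
    by (rule variety_compacts[OF V(1)]) (rule that)
  have VB: "V \<in> sets borel" unfolding C(2) using borel_compact[OF C(1)] by blast
  have cL: "continuous_on torus (Log_map :: complex ^ 'm \<Rightarrow> real ^ 'm)"
    by (rule has_derivative_continuous_on[OF has_derivative_at_withinI[OF Log_map_has_derivative]])
  have LB: "Log_map ` V \<in> sets borel"
  proof -
    have "C r \<subseteq> torus" for r using VT C(2) by blast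
    then have "compact (Log_map ` C r)" for r
      by (intro compact_continuous_image C(1) continuous_on_subset[OF cL])
    then have "(\<Union>r. Log_map ` C r) \<in> sets borel" using borel_compact by blast
    then show ?thesis unfolding C(2) by (simp add: image_UN)
  qed
  obtain P :: "nat \<times> (int ^ 'm) \<Rightarrow> (complex ^ 'm) set" and b where P:
    "\<And>i. P i \<subseteq> V" "\<And>i j. i \<noteq> j \<Longrightarrow> P i \<inter> P j = {}" "{z. immersed V n z} \<subseteq> (\<Union>i. P i)"
    "\<And>i. inj_on Log_map (P i)" "\<And>i. Log_map ` P i \<in> sets lebesgue" "\<And>i. b i ` P i \<in> sets lebesgue"
    "\<And>i. emeasure lebesgue (Log_map ` P i) = emeasure lebesgue (b i ` P i)"
    "\<And>i z. z \<in> P i \<Longrightarrow> mod_pi (b i z) = Arg_pi_map z" "\<And>i. b i ` P i \<subseteq> cbox 0 (\<chi> i. pi)"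
    by (rule log_arg_pieces[OF VT VB n(2)]) (rule that)
  obtain N1 :: "(real ^ 'm) set" where N1: "negligible N1" "\<And>\<theta>. \<theta> \<notin> N1 \<Longrightarrow> finite {z \<in> V. Arg_pi_map z = mod_pi \<theta>} \<and>
      card {z \<in> V. Arg_pi_map z = mod_pi \<theta>} \<le> conj_degree V"
    by (rule generic_Arg_fibre[OF V n]) (rule that)
  have null: "N \<in> null_sets lebesgue" "N1 \<in> null_sets lebesgue" using N N1(1) by (simp_all add: negligible_iff_null_sets)
  let ?A = "\<lambda>i. Log_map ` P i" and ?B = "\<lambda>i. b i ` P i"
  have lower: "of_nat c * indicator (Log_map ` V) p \<le> (\<integral>\<^sup>+i. indicator (?A i) p \<partial>count_space UNIV)"
    if p: "p \<notin> N" for p :: "real ^ 'm"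
  proof (cases "p \<in> Log_map ` V")
    case True
    define F where "F = {z \<in> V. Log_map z = p}"
    have F: "finite F" "c \<le> card F" using c[OF True p] by (simp_all add: F_def)
    have "\<exists>i. z \<in> P i" if "z \<in> F" for z using imm[of z] p that P(3) unfolding F_def by blast
    then obtain s where s: "\<And>z. z \<in> F \<Longrightarrow> z \<in> P (s z)" by metis
    have inj: "inj_on s F"
    proof (rule inj_onI)
      fix x y assume xy: "x \<in> F" "y \<in> F" "s x = s y"
      then have "x \<in> P (s x)" "y \<in> P (s x)" "Log_map x = Log_map y" using s[of x] s[of y] by (simp_all add: F_def)
      then show "x = y" using inj_onD[OF P(4)] by blast
    qed
    have sub: "s ` F \<subseteq> {i. p \<in> ?A i}" using s by (auto simp: F_def)
    have "of_nat c \<le> emeasure (count_space UNIV) {i. p \<in> ?A i}"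
    proof (cases "finite {i. p \<in> ?A i}")
      case True
      have "c \<le> card {i. p \<in> ?A i}" using card_mono[OF True sub] card_image[OF inj] F(2) by simp
      then show ?thesis using True by simp
    qed simp
    then show ?thesis unfolding nn_integral_count_indicator using True by simp
  qed simp
  have upper: "(\<integral>\<^sup>+i. indicator (?B i) \<theta> \<partial>count_space UNIV) \<le> of_nat (conj_degree V) * indicator (cbox 0 (\<chi> i. pi)) \<theta>"
    if \<theta>: "\<theta> \<notin> N1" for \<theta> :: "real ^ 'm"
  proof (cases "\<theta> \<in> cbox 0 (\<chi> i. pi)")
    case True
    define F where "F = {z \<in> V. Arg_pi_map z = mod_pi \<theta>}"
    have F: "finite F" "card F \<le> conj_degree V" using N1(2)[OF \<theta>] by (simp_all add: F_def)
    have "\<exists>z. z \<in> P i \<and> b i z = \<theta>" if "i \<in> {i. \<theta> \<in> ?B i}" for i using that by blast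
    then obtain s where s: "\<And>i. i \<in> {i. \<theta> \<in> ?B i} \<Longrightarrow> s i \<in> P i \<and> b i (s i) = \<theta>" by metis
    have inj: "inj_on s {i. \<theta> \<in> ?B i}"
    proof (rule inj_onI)
      fix i j assume ij: "i \<in> {i. \<theta> \<in> ?B i}" "j \<in> {i. \<theta> \<in> ?B i}" "s i = s j"
      then have "s i \<in> P i \<inter> P j" using s[OF ij(1)] s[OF ij(2)] by simp
      then show "i = j" using P(2)[of i j] by blast
    qed
    have sub: "s ` {i. \<theta> \<in> ?B i} \<subseteq> F"
    proof
      fix z assume "z \<in> s ` {i. \<theta> \<in> ?B i}"
      then obtain i where i: "z = s i" "s i \<in> P i" "b i (s i) = \<theta>" using s by blast
      then show "z \<in> F" using P(1)[of i] P(8)[OF i(2)] by (auto simp: F_def)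
    qed
    have fin: "finite {i. \<theta> \<in> ?B i}" by (rule inj_on_finite[OF inj sub F(1)])
    have "card {i. \<theta> \<in> ?B i} \<le> conj_degree V" using card_inj_on_le[OF inj sub F(1)] F(2) by linarith
    then show ?thesis unfolding nn_integral_count_indicator using fin True by simp
  next
    case False
    then have e: "{i. \<theta> \<in> ?B i} = {}" using P(9) by blast
    show ?thesis unfolding nn_integral_count_indicator e by simp
  qed
  have cnt: "countable (UNIV :: (nat \<times> (int ^ 'm)) set)" by simp
  have LL: "Log_map ` V \<in> sets lebesgue" using LB by simp
  have "of_nat c * emeasure lebesgue (Log_map ` V) = (\<integral>\<^sup>+p. of_nat c * indicator (Log_map ` V) p \<partial>lebesgue)"
    using LL by (simp add: nn_integral_cmult_indicator)
  also have "\<dots> \<le> (\<integral>\<^sup>+p. (\<integral>\<^sup>+i. indicator (?A i) p \<partial>count_space UNIV) \<partial>lebesgue)"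
    by (rule nn_integral_mono_AE) (use lower in \<open>auto intro!: AE_I'[OF null(1)]\<close>)
  also have "\<dots> = (\<integral>\<^sup>+i. (\<integral>\<^sup>+p. indicator (?A i) p \<partial>lebesgue) \<partial>count_space UNIV)"
    by (rule nn_integral_count_space_nn_integral[OF cnt]) (use P(5) in simp)
  \<comment> \<open>Piece by piece, volume in the amoeba is exchanged for volume in the fundamental
    cube.\<close>
  also have "\<dots> = (\<integral>\<^sup>+i. (\<integral>\<^sup>+p. indicator (?B i) p \<partial>lebesgue) \<partial>count_space UNIV)"
    by (simp add: P(5,6,7))
  also have "\<dots> = (\<integral>\<^sup>+\<theta>. (\<integral>\<^sup>+i. indicator (?B i) \<theta> \<partial>count_space UNIV) \<partial>lebesgue)"
    by (rule nn_integral_count_space_nn_integral[OF cnt, symmetric]) (use P(6) in simp)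
  also have "\<dots> \<le> (\<integral>\<^sup>+\<theta>. of_nat (conj_degree V) * indicator (cbox 0 (\<chi> i. pi) :: (real ^ 'm) set) \<theta> \<partial>lebesgue)"
    by (rule nn_integral_mono_AE) (use upper in \<open>auto intro!: AE_I'[OF null(2)]\<close>)
  also have "\<dots> = of_nat (conj_degree V) * ennreal (pi ^ (2 * n))"
    by (subst nn_integral_cmult_indicator) (use n(2) emeasure_cube[where 'm = 'm] in simp_all)
  finally show ?thesis using LL by blast
qed

theorem theorem1:
  fixes V :: "(complex ^ 'm::finite) set" and n :: nat
  assumes "n \<ge> 1" and "CARD('m) = 2 * n"
    and "algebraic_variety V" and "has_complex_dimension V n"
  shows "(\<forall>\<S>. stratification \<S> V \<longrightarrow>
            covers_at_most (id :: real ^ 'm \<Rightarrow> real ^ 'm) \<S> V Log_map (conj'_degree V) \<and>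
            covers_at_most (mod_pi :: real ^ 'm \<Rightarrow> real_mod_pi ^ 'm) \<S> V Arg_pi_map (conj_degree V))
         \<and> Log_map ` V \<in> lmeasurable
         \<and> measure lebesgue (Log_map ` V) \<le> pi ^ (2 * n) / 2 * real (conj_degree V)"
proof -
  note V = assms(3,4) and n = assms(1,2)
  obtain N :: "(real ^ 'm) set" where N: "negligible N" "\<And>p. p \<notin> N \<Longrightarrow> finite {z \<in> V. Log_map z = p} \<and>
      card {z \<in> V. Log_map z = p} \<le> conj'_degree V \<and>
      (even (card {z \<in> V. Log_map z = p}) \<longleftrightarrow> even (conj'_degree V)) \<and>
      (\<forall>z\<in>V. Log_map z = p \<longrightarrow> immersed V n z)"
    by (rule generic_Log_fibre[OF V n]) (rule that)
  have imm: "immersed V n z" if "z \<in> V" "Log_map z \<notin> N" for z using N(2)[OF that(2)] that(1) by blast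
  let ?M = "of_nat (conj_degree V) * ennreal (pi ^ (2 * n))"
  have ne: "0 < card {z \<in> V. Log_map z = p}" if "p \<in> Log_map ` V" "p \<notin> N" for p
    using N(2)[OF that(2)] that(1) by (auto simp: card_gt_0_iff)
  have meas: "Log_map ` V \<in> sets lebesgue" and vol: "of_nat 1 * emeasure lebesgue (Log_map ` V) \<le> ?M"
    using Log_volume[OF V n N(1) imm, of 1] ne N(2) by (auto simp: Suc_le_eq)
  have M: "?M = ennreal (real (conj_degree V) * pi ^ (2 * n))"
    by (simp add: ennreal_mult ennreal_of_nat_eq_real_of_nat)
  have fin: "emeasure lebesgue (Log_map ` V) < \<infinity>"
  proof -
    have "emeasure lebesgue (Log_map ` V) \<le> ?M" using vol by simp
    also have "?M < \<infinity>" unfolding M by simp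
    finally show ?thesis .
  qed
  have even: "even (conj'_degree V)"
  proof (rule ccontr)
    assume odd: "odd (conj'_degree V)"
    \<comment> \<open>Odd numbers are nonzero, so the amoeba would be of full measure.\<close>
    have "- N \<subseteq> Log_map ` V"
    proof
      fix p assume "p \<in> - N"
      then have "odd (card {z \<in> V. Log_map z = p})" using N(2)[of p] odd by blast
      then have "{z \<in> V. Log_map z = p} \<noteq> {}" by (metis card.empty even_zero)
      then show "p \<in> Log_map ` V" by blast
    qed
    have Nn: "N \<in> null_sets lebesgue" using N(1) by (simp add: negligible_iff_null_sets)
    have "emeasure lebesgue (UNIV - N) = emeasure lebesgue (UNIV :: (real ^ 'm) set)"
      by (rule emeasure_Diff_null_set[OF Nn]) simp
    also have "\<dots> = \<infinity>" by simp
    finally have "\<infinity> \<le> emeasure lebesgue (Log_map ` V)"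
      using emeasure_mono[of "UNIV - N" "Log_map ` V" lebesgue] \<open>- N \<subseteq> Log_map ` V\<close> meas by (simp add: Compl_eq_Diff_UNIV)
    then show False using fin by simp
  qed
  have two: "2 \<le> card {z \<in> V. Log_map z = p}" if "p \<in> Log_map ` V" "p \<notin> N" for p
    using ne[OF that] N(2)[OF that(2)] even by (metis One_nat_def Suc_leI dvd_imp_le numeral_2_eq_2)
  have vol2: "of_nat 2 * emeasure lebesgue (Log_map ` V) \<le> ?M"
    using Log_volume[OF V n N(1) imm, of 2] two N(2) by blast
  have lm: "Log_map ` V \<in> lmeasurable" by (rule fmeasurableI[OF meas fin])
  have "ennreal (2 * measure lebesgue (Log_map ` V)) \<le> ennreal (real (conj_degree V) * pi ^ (2 * n))"
    using vol2 emeasure_eq_measure2[OF lm] unfolding M by (simp add: ennreal_mult)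
  then have "2 * measure lebesgue (Log_map ` V) \<le> real (conj_degree V) * pi ^ (2 * n)"
    by (simp add: ennreal_le_iff)
  then have "measure lebesgue (Log_map ` V) \<le> pi ^ (2 * n) / 2 * real (conj_degree V)" by (simp add: field_simps)
  then show ?thesis using lm Log_covers[OF V n] Arg_covers[OF V n] by blast
qed

end
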